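(* Let $d\ge1$ and suppose that $S:\mathbb{Z}^d\to[0,\infty)$ satisfies Assumption 1 and Assumption 2 (stated in the context), the latter with functions $J,h$ and constants $M,K_{\mathrm{IR}},\zeta>0$. For nonzero $x\in\mathbb{Z}^d$, let $\mu_{\hat x},\eta_{\hat x},\Lambda_{\hat x}$ and $|x|_S$ be as defined in the context. Then as $|x|\to\infty$, we have $$S(x)=\frac{1}{(2\pi)^{(d-1)/2}\sqrt{\det\Lambda_{\hat x}}}\,\frac{1}{(\hat x\cdot\Lambda_{\hat x}^{-1}\hat x)^{1/2}}\,\frac{\|\eta_{\hat x}\|_2^{(d-3)/2}}{\|x\|_2^{(d-1)/2}}\,e^{-m_S|x|_S}\,[\hat h^{(\mu_{\hat x})}(0)+o(1)],$$ with the $o(1)$ depending only on $d,M,K_{\mathrm{IR}},\zeta,m_S$.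
   Context: Notation. $|x|=\|x\|_2$ is the Euclidean norm on $\mathbb{R}^d$; $\hat x=x/|x|$ for $x\ne0$; $a\wedge b=\min\{a,b\}$; $e_1,\dots,e_d$ is the standard basis; $\mathbb{T}^d$ is the $d$-dimensional torus of period $2\pi$. For $f,g:\mathbb{Z}^d\to\mathbb{R}$: $\hat f(k)=\sum_{x}f(x)e^{-ik\cdot x}$, $(f*g)(x)=\sum_{y}f(x-y)g(y)$, and $\|f(y)\|_p$ is the $\ell^p(\mathbb{Z}^d)$ norm. $f$ is $\mathbb{Z}^d$-symmetric if $f(x)$ is unchanged when a component of $x$ is multiplied by $-1$ or the components of $x$ are permuted. The exponential tilt of $f$ by $\mu\in\mathbb{R}^d$ is $f^{(\mu)}(x)=f(x)e^{\mu\cdot x}$. Class $\mathcal{Q}_{M,K_{\mathrm{IR}},\zeta}$ (for $d\ge1$, $M,K_{\mathrm{IR}},\zeta>0$): the set of pairs $(Q,g)$ of functions $\mathbb{Z}^d\to\mathbb{R}$ such that (a) $\|Q(y)\|_1\le M$ and $\||y|^{2+\zeta}Q(y)\|_1\le M$; (b) $\mathrm{Re}[\hat Q(0)-\hat Q(k)]\ge K_{\mathrm{IR}}|k|^2$ for $k\in\mathbb{T}^d$ (represented in $[-\pi,\pi]^d$); (c) $\|g(y)\|_1\le M$, $\||y|^{\zeta}g(y)\|_1\le M$, $\||y|^2g(y)\|_{p_d\wedge2}\le M$, where $p_d=2$ for $d=1$ and $p_d=\frac{d}{d-2+(\zeta\wedge2)}$ for $d\ge2$; (d) if $d\ge4$,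 additionally $\||y|^{d-1}Q(y)\|_{\frac d3\wedge2}\le M$ and $\||y|^{d-1}g(y)\|_2\le M$. For $S:\mathbb{Z}^d\to[0,\infty)$ let $\chi^{(\mu)}=\sum_{x}S^{(\mu)}(x)$, $\Omega=\{\mu\in\mathbb{R}^d:\chi^{(\mu)}<\infty\}$, with closure $\overline\Omega$ and boundary $\partial\Omega$, and $m_S=\sup\{t\ge0:\chi^{(te_1)}<\infty\}$ (which lies in $(0,\infty)$ under Assumption 1). Assumption 1: $S$ is $\mathbb{Z}^d$-symmetric, $\Omega$ is an open set containing $0$, and $\mu_1e_1\notin\Omega$ for some $\mu_1>0$. Assumption 2 (with constants $M,K_{\mathrm{IR}},\zeta>0$): $S=h+J*S$ with $\mathbb{Z}^d$-symmetric $J,h\in\ell^1(\mathbb{Z}^d)$, and for every $\mu\in\overline\Omega$ (with the same constants for all $\mu$) $(J^{(\mu)},h^{(\mu)})\in\mathcal{Q}_{M,K_{\mathrm{IR}},\zeta}$ and $\hat h^{(\mu)}(0)>0$. Under Assumptions 1 and 2, for each nonzero $x\in\mathbb{R}^d$ the maximum $\max_{\mu\in\overline\Omega}\mu\cdot x$ is attained at a unique point $\mu_{\hat x}\in\partial\Omega$, depending only on $\hat x$. Define $\eta_{\hat x}\in\mathbb{R}^d$ and $\Lambda_{\hat x}\in\mathbb{R}^{d\times d}$ by $\eta_{\hat x,j}=\sum_y y_jJ^{(\mu_{\hat x})}(y)$, $\Lambda_{\hat x,jl}=\sum_y y_jy_lJ^{(\mu_{\hat x})}(y)$ (the matrix is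 positive-definite and $\eta_{\hat x}\neq0$), and the norm $|x|_S=\mu_{\hat x}\cdot x/m_S$, $|0|_S=0$. *)

theory Defs
  imports "HOL-Analysis.Analysis"
begin

text \<open>The lattice is \<open>int ^ 'd\<close> with \<open>d = CARD('d)\<close>; \<open>rvec\<close> is its inclusion into \<open>real ^ 'd\<close>.\<close>

definition rvec :: "int ^ 'd \<Rightarrow> real ^ 'd" where
  "rvec x = (\<chi> i. real_of_int (x $ i))"

definition fourier :: "(int ^ 'd::finite \<Rightarrow> real) \<Rightarrow> real ^ 'd \<Rightarrow> complex" where
  "fourier f k = (\<Sum>\<^sub>\<infinity>x. complex_of_real (f x) * exp (- \<i> * complex_of_real (k \<bullet> rvec x)))"

definition conv :: "(int ^ 'd::finite \<Rightarrow> real) \<Rightarrow> (int ^ 'd \<Rightarrow> real) \<Rightarrow> int ^ 'd \<Rightarrow> real" where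
  "conv f g x = (\<Sum>\<^sub>\<infinity>y. f (x - y) * g y)"

definition in_lp :: "real \<Rightarrow> (int ^ 'd::finite \<Rightarrow> real) \<Rightarrow> bool" where
  "in_lp p f \<longleftrightarrow> (\<lambda>x. \<bar>f x\<bar> powr p) summable_on UNIV"

definition lp_norm :: "real \<Rightarrow> (int ^ 'd::finite \<Rightarrow> real) \<Rightarrow> real" where
  "lp_norm p f = (\<Sum>\<^sub>\<infinity>x. \<bar>f x\<bar> powr p) powr (1 / p)"

text \<open>Since \<open>infsum\<close> of a non-summable family is \<open>0\<close>, a bound on the norm of \<open>f\<close> must
  also assert that this norm is finite.\<close>

definition lp_bounded :: "real \<Rightarrow> (int ^ 'd::finite \<Rightarrow> real) \<Rightarrow> real \<Rightarrow> bool" where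
  "lp_bounded p f M \<longleftrightarrow> in_lp p f \<and> lp_norm p f \<le> M"

definition Zd_symmetric :: "(int ^ 'd::finite \<Rightarrow> real) \<Rightarrow> bool" where
  "Zd_symmetric f \<longleftrightarrow>
     (\<forall>x i. f (\<chi> j. if j = i then - (x $ j) else x $ j) = f x) \<and>
     (\<forall>x p. bij p \<longrightarrow> f (\<chi> j. x $ p j) = f x)"

definition tilt :: "real ^ 'd::finite \<Rightarrow> (int ^ 'd \<Rightarrow> real) \<Rightarrow> int ^ 'd \<Rightarrow> real" where
  "tilt \<mu> f x = f x * exp (\<mu> \<bullet> rvec x)"

definition p_exp :: "nat \<Rightarrow> real \<Rightarrow> real" where
  "p_exp d \<zeta> = (if d = 1 then 2 else real d / (real d - 2 + min \<zeta> 2))"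

text \<open>In \<open>Q_class\<close> the torus is represented by \<open>[-\<pi>,\<pi>]\<^sup>d\<close>. All exponents \<open>p\<close> that occur lie in
  \<open>[1,2]\<close>.\<close>

definition Q_class :: "real \<Rightarrow> real \<Rightarrow> real \<Rightarrow>
    ((int ^ 'd::finite \<Rightarrow> real) \<times> (int ^ 'd \<Rightarrow> real)) set" where
  "Q_class M K \<zeta> = {(Q, g).
     lp_bounded 1 Q M \<and>
     lp_bounded 1 (\<lambda>y. norm (rvec y) powr (2 + \<zeta>) * Q y) M \<and>
     (\<forall>k. (\<forall>i. \<bar>k $ i\<bar> \<le> pi) \<longrightarrow> Re (fourier Q 0 - fourier Q k) \<ge> K * (norm k)\<^sup>2) \<and>
     lp_bounded 1 g M \<and>
     lp_bounded 1 (\<lambda>y. norm (rvec y) powr \<zeta> * g y) M \<and>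
     lp_bounded (min (p_exp CARD('d) \<zeta>) 2) (\<lambda>y. (norm (rvec y))\<^sup>2 * g y) M \<and>
     (CARD('d) \<ge> 4 \<longrightarrow>
        lp_bounded (min (real CARD('d) / 3) 2) (\<lambda>y. norm (rvec y) ^ (CARD('d) - 1) * Q y) M \<and>
        lp_bounded 2 (\<lambda>y. norm (rvec y) ^ (CARD('d) - 1) * g y) M)}"

definition susc :: "(int ^ 'd::finite \<Rightarrow> real) \<Rightarrow> real ^ 'd \<Rightarrow> ennreal" where
  "susc S \<mu> = (\<Sum>\<^sub>\<infinity>x. ennreal (tilt \<mu> S x))"

definition Omega :: "(int ^ 'd::finite \<Rightarrow> real) \<Rightarrow> (real ^ 'd) set" where
  "Omega S = {\<mu>. susc S \<mu> < \<infinity>}"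

text \<open>A finite index type has no distinguished first element. The index \<open>i1\<close> plays the role of
  the first coordinate, so that \<open>axis i1 1\<close> is the vector \<open>e\<^sub>1\<close>.\<close>

definition mass :: "'d \<Rightarrow> (int ^ 'd::finite \<Rightarrow> real) \<Rightarrow> real" where
  "mass i1 S = Sup {t. 0 \<le> t \<and> susc S (t *\<^sub>R axis i1 1) < \<infinity>}"

definition assumption1 :: "'d \<Rightarrow> (int ^ 'd::finite \<Rightarrow> real) \<Rightarrow> bool" where
  "assumption1 i1 S \<longleftrightarrow>
     Zd_symmetric S \<and> open (Omega S) \<and> 0 \<in> Omega S \<and>
     (\<exists>\<mu>1>0. \<mu>1 *\<^sub>R axis i1 1 \<notin> Omega S)"

text \<open>\<open>h\<close> is real-valued, so its transform at \<open>0\<close> is real and equals its real part.\<close>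

definition assumption2 :: "real \<Rightarrow> real \<Rightarrow> real \<Rightarrow> (int ^ 'd::finite \<Rightarrow> real) \<Rightarrow>
    (int ^ 'd \<Rightarrow> real) \<Rightarrow> (int ^ 'd \<Rightarrow> real) \<Rightarrow> bool" where
  "assumption2 M K \<zeta> S J h \<longleftrightarrow>
     Zd_symmetric J \<and> Zd_symmetric h \<and> in_lp 1 J \<and> in_lp 1 h \<and>
     (\<forall>x. S x = h x + conv J S x) \<and>
     (\<forall>\<mu>\<in>closure (Omega S).
        (tilt \<mu> J, tilt \<mu> h) \<in> Q_class M K \<zeta> \<and> Re (fourier (tilt \<mu> h) 0) > 0)"

text \<open>Under both assumptions and for \<open>v \<noteq> 0\<close> the maximiser exists, is unique, lies on the
  boundary of \<open>Omega S\<close>, and depends only on the direction of \<open>v\<close>.\<close>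

definition mu_max :: "(int ^ 'd::finite \<Rightarrow> real) \<Rightarrow> real ^ 'd \<Rightarrow> real ^ 'd" where
  "mu_max S v = (THE \<mu>. is_arg_max (\<lambda>\<nu>. \<nu> \<bullet> v) (\<lambda>\<nu>. \<nu> \<in> closure (Omega S)) \<mu>)"

definition eta :: "(int ^ 'd::finite \<Rightarrow> real) \<Rightarrow> (int ^ 'd \<Rightarrow> real) \<Rightarrow> real ^ 'd \<Rightarrow> real ^ 'd" where
  "eta S J v = (\<chi> j. \<Sum>\<^sub>\<infinity>y. real_of_int (y $ j) * tilt (mu_max S v) J y)"

definition Lambda :: "(int ^ 'd::finite \<Rightarrow> real) \<Rightarrow> (int ^ 'd \<Rightarrow> real) \<Rightarrow> real ^ 'd \<Rightarrow> real ^ 'd ^ 'd" where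
  "Lambda S J v = (\<chi> j l. \<Sum>\<^sub>\<infinity>y.
     real_of_int (y $ j) * real_of_int (y $ l) * tilt (mu_max S v) J y)"

definition S_norm :: "'d \<Rightarrow> (int ^ 'd::finite \<Rightarrow> real) \<Rightarrow> real ^ 'd \<Rightarrow> real" where
  "S_norm i1 S x = (if x = 0 then 0 else (mu_max S (sgn x) \<bullet> x) / mass i1 S)"

end

theory Submission
  imports Defs "HOL-Probability.Probability"
begin

text \<open>
  Let \<open>\<phi> \<mu>\<close> be the total mass of \<open>J\<^sup>(\<^sup>\<mu>\<^sup>)\<close>. Summing the renewal equation gives
  \<open>(1 - \<phi> \<mu>) \<chi>\<^sup>(\<^sup>\<mu>\<^sup>) = h\<^sup>(\<^sup>\<mu>\<^sup>)(0) > 0\<close> (transform at \<open>0\<close>), so \<open>\<phi> < 1\<close> on \<open>\<Omega>\<close> and \<open>\<phi> = 1\<close> on the rest of its closure, where \<open>\<chi>\<close> blows up.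
  The infrared bound makes \<open>\<phi>\<close> strongly convex, which yields uniqueness of the maximiser \<open>\<mu>\<close> in the direction \<open>u\<close>,
  a lower bound on \<open>\<bar>\<eta>\<bar>\<close>, and, since \<open>\<eta>\<close> is the gradient of \<open>\<phi>\<close> at \<open>\<mu>\<close>, that \<open>\<eta>\<close> is a positive multiple of \<open>u\<close>.

  Write \<open>1 / (1 - J(k))\<close> as \<open>\<integral>\<^sub>0\<^sup>\<infinity> exp (- t (1 - J(k))) dt\<close>. Before integrating over \<open>t\<close>, the exponential tilt
  is a harmless contour shift even at the boundary point \<open>\<mu>\<close>, where \<open>1 - J\<^sup>(\<^sup>\<mu>\<^sup>)(k)\<close> vanishes at \<open>k = 0\<close>: this avoids the
  singular integral \<open>\<integral> exp (ikx) h\<^sup>(\<^sup>\<mu>\<^sup>)(k) / (1 - J\<^sup>(\<^sup>\<mu>\<^sup>)(k)) dk\<close>. For fixed \<open>t\<close> the integral over the torus is the position at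
  time \<open>t\<close> of a (signed) continuous-time random walk with drift \<open>\<eta>\<close>. It is Gaussian up to a relative error \<open>t\<close> to a negative power
  for \<open>t\<close> in a window around \<open>t0 = \<bar>x\<bar> / \<bar>\<eta>\<bar>\<close>, and a truncation argument with the moment bounds of the class makes the
  times outside the window negligible. Integrating the Gaussian over \<open>t\<close> gives the prefactor.
\<close>

section \<open>Fourier analysis on the lattice\<close>

text \<open>Every error must be uniform in \<open>J\<close> and \<open>h\<close>, so each estimate
  is proved for an arbitrary kernel obeying the moment bounds, with constants quantified before the
  kernel; \<open>m\<close> enters them through the lower bound \<open>K * (m / d)\<close> on the
  length of the drift. At the maximiser the tilted kernel is only known to have 2 + \<zeta> moments
  and may change sign, so neither Chernoff bounds nor positivity are at hand. Truncating at a fixed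
  fraction of the distance \<open>s\<close> restores exponential moments, and the removed part is
  charged to the moment bounds. One large jump then costs about s^(-2-\<zeta>), which in high
  dimensions is too large at early times; there the weights of part (d) of the class enter. The
  window around \<open>t0\<close> has half-width t0^(1/2 + z/16): wide enough that its complement
  contributes a smaller power of \<open>t0\<close>, narrow enough that the local error integrated
  over it does too. The exponent \<zeta> is lowered to z = min \<zeta> 1, so that second-order
  Taylor expansions suffice throughout.\<close>

lemma infsum_comparison:
  fixes f :: "'a \<Rightarrow> 'b::banach"
  assumes "\<And>y. norm (f y) \<le> g y" "g summable_on UNIV"
  shows "f summable_on UNIV" "norm (infsum f UNIV) \<le> infsum g UNIV"
    "(\<lambda>y. norm (f y)) summable_on UNIV"
proof -
  show 1: "(\<lambda>y. norm (f y)) summable_on UNIV"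
    by (rule summable_on_comparison_test[OF assms(2)]) (use assms in auto)
  then show "f summable_on UNIV" by (rule abs_summable_summable)
  have "norm (infsum f UNIV) \<le> infsum (\<lambda>y. norm (f y)) UNIV"
    using norm_infsum_bound[OF 1] .
  also have "\<dots> \<le> infsum g UNIV"
    by (rule infsum_mono[OF 1 assms(2)]) (use assms in auto)
  finally show "norm (infsum f UNIV) \<le> infsum g UNIV" .
qed

lemma in_lp_1_iff: "in_lp 1 f \<longleftrightarrow> (\<lambda>x. \<bar>f x\<bar>) summable_on UNIV"
  unfolding in_lp_def by simp

definition l1_norm :: "(int ^ 'd::finite \<Rightarrow> real) \<Rightarrow> real" where
  "l1_norm f = (\<Sum>\<^sub>\<infinity>x. \<bar>f x\<bar>)"

lemma l1_norm_nonneg: "0 \<le> l1_norm f"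
  unfolding l1_norm_def by (rule infsum_nonneg) auto

definition phase :: "int ^ 'd::finite \<Rightarrow> real ^ 'd \<Rightarrow> complex" where
  "phase x k = exp (\<i> * complex_of_real (k \<bullet> rvec x))"

lemma norm_phase [simp]: "norm (phase x k) = 1"
  by (simp add: phase_def)

lemma rvec_add: "rvec (x + y) = rvec x + rvec y"
  and rvec_minus: "rvec (- x) = - rvec x"
  and rvec_diff: "rvec (x - y) = rvec x - rvec y"
  and rvec_0 [simp]: "rvec 0 = 0"
  by (simp_all add: rvec_def vec_eq_iff)

lemma phase_add: "phase (x + y) k = phase x k * phase y k"
  by (simp add: phase_def rvec_add inner_add_right exp_add algebra_simps)

lemma phase_minus: "phase (- x) k = cnj (phase x k)"
  by (simp add: phase_def rvec_minus exp_cnj)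

lemma phase_0 [simp]: "phase x 0 = 1"
  by (simp add: phase_def)

lemma continuous_on_phase [continuous_intros]: "continuous_on A (phase x)"
  unfolding phase_def by (intro continuous_intros)

lemma fourier_eq: "fourier f k = (\<Sum>\<^sub>\<infinity>x. complex_of_real (f x) * phase (- x) k)"
  unfolding fourier_def phase_def by (simp add: rvec_minus)

lemma fourier_summable:
  assumes "in_lp 1 f"
  shows "(\<lambda>x. complex_of_real (f x) * phase (- x) k) summable_on UNIV"
  by (rule infsum_comparison(1)[of _ "\<lambda>x. \<bar>f x\<bar>"])
     (use assms in \<open>auto simp: norm_mult in_lp_1_iff\<close>)

lemma norm_fourier_le:
  assumes "in_lp 1 f"
  shows "norm (fourier f k) \<le> l1_norm f"
  unfolding fourier_eq l1_norm_def
  by (rule infsum_comparison(2)) (use assms in \<open>auto simp: norm_mult in_lp_1_iff\<close>)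

lemma fourier_uniform_limit:
  assumes "in_lp 1 f"
  shows "uniform_limit A (\<lambda>X k. \<Sum>x\<in>X. complex_of_real (f x) * phase (- x) k) (fourier f)
    (finite_subsets_at_top UNIV)"
  using Weierstrass_m_test_general[of UNIV A
      "\<lambda>x k. complex_of_real (f x) * phase (- x) k" "\<lambda>x. \<bar>f x\<bar>"] assms
  by (simp add: norm_mult in_lp_1_iff fourier_eq[abs_def])

lemma continuous_on_fourier [continuous_intros]:
  assumes "in_lp 1 f"
  shows "continuous_on A (fourier f)"
  by (rule uniform_limit_theorem[OF _ fourier_uniform_limit[OF assms]])
     (auto intro!: always_eventually continuous_intros)

definition torus :: "(real ^ 'd::finite) set" where
  "torus = cbox (\<chi> i. - pi) (\<chi> i. pi)"

lemma torus_iff: "k \<in> torus \<longleftrightarrow> (\<forall>i. \<bar>k $ i\<bar> \<le> pi)"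
  by (auto simp: torus_def mem_box_cart abs_le_iff minus_le_iff)

text \<open>Absolute summability makes the Fourier series converge uniformly, so the integral over
  the compact torus passes to the limit along finite sets of lattice points. Inversion and Parseval
  are the cases where \<open>\<phi>\<close> is \<open>phase x\<close> and the conjugate
  transform.\<close>

lemma integral_fourier_swap:
  fixes \<phi> :: "real ^ 'd::finite \<Rightarrow> complex"
  assumes f: "in_lp 1 f" and \<phi>: "continuous_on torus \<phi>"
  shows "((\<lambda>x. complex_of_real (f x) * integral torus (\<lambda>k. \<phi> k * phase (- x) k)) has_sum
     integral torus (\<lambda>k. \<phi> k * fourier f k)) UNIV"
proof -
  have bnd: "bounded (\<phi> ` torus)"
    by (rule compact_imp_bounded, rule compact_continuous_image[OF \<phi>]) (simp add: torus_def)
  have bf: "bounded (fourier f ` torus)"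
    by (rule compact_imp_bounded, rule compact_continuous_image[OF continuous_on_fourier[OF f]])
       (simp add: torus_def)
  let ?G = "\<lambda>X k. \<phi> k * (\<Sum>x\<in>X. complex_of_real (f x) * phase (- x) k)"
  have ul: "uniform_limit torus ?G (\<lambda>k. \<phi> k * fourier f k) (finite_subsets_at_top UNIV)"
    by (rule uniform_lim_mult[OF uniform_limit_const fourier_uniform_limit[OF f] bnd bf])
  have c: "continuous_on torus (?G X)" for X
    by (intro continuous_intros \<phi>)
  obtain I J where I: "\<And>X. (?G X has_integral I X) torus"
    and J: "((\<lambda>k. \<phi> k * fourier f k) has_integral J) torus"
    and lim: "(I \<longlongrightarrow> J) (finite_subsets_at_top UNIV)"
    by (rule uniform_limit_integral_cbox[OF ul[unfolded torus_def] c[unfolded torus_def]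
          finite_subsets_at_top_neq_bot, folded torus_def]) (rule that)
  have int: "(\<lambda>k. \<phi> k * phase (- x) k) integrable_on torus" for x
    unfolding torus_def by (intro integrable_continuous continuous_intros \<phi>[unfolded torus_def])
  have "I X = (\<Sum>x\<in>X. complex_of_real (f x) * integral torus (\<lambda>k. \<phi> k * phase (- x) k))" if "finite X" for X
  proof -
    have "((\<lambda>k. \<Sum>x\<in>X. complex_of_real (f x) * (\<phi> k * phase (- x) k)) has_integral
       (\<Sum>x\<in>X. complex_of_real (f x) * integral torus (\<lambda>k. \<phi> k * phase (- x) k))) torus"
      by (intro has_integral_sum that has_integral_mult_right integrable_integral int)
    then have "(?G X has_integral
       (\<Sum>x\<in>X. complex_of_real (f x) * integral torus (\<lambda>k. \<phi> k * phase (- x) k))) torus"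
      by (simp add: sum_distrib_left mult_ac)
    with I show ?thesis using has_integral_unique by blast
  qed
  then have "\<forall>\<^sub>F X in finite_subsets_at_top UNIV.
    I X = (\<Sum>x\<in>X. complex_of_real (f x) * integral torus (\<lambda>k. \<phi> k * phase (- x) k))"
    by (auto intro: eventually_finite_subsets_at_top_weakI)
  with lim have "((\<lambda>X. \<Sum>x\<in>X. complex_of_real (f x) * integral torus (\<lambda>k. \<phi> k * phase (- x) k)) \<longlongrightarrow> J)
    (finite_subsets_at_top UNIV)"
    by (rule Lim_transform_eventually)
  moreover have "J = integral torus (\<lambda>k. \<phi> k * fourier f k)"
    using J by (simp add: integral_unique)
  ultimately show ?thesis by (simp add: has_sum_def)
qed

text \<open>Fubini over coordinates. Lebesgue measure on \<open>real ^ 'd\<close> is a product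
  indexed by \<open>Basis\<close>, while the factors are indexed by \<open>'d\<close>;
  \<open>ix\<close> translates between the two.\<close>

lemma lborel_prod_vec:
  fixes f :: "'d::finite \<Rightarrow> real \<Rightarrow> complex"
  assumes "\<And>i. integrable lborel (f i)"
  shows "integrable lborel (\<lambda>k :: real ^ 'd. \<Prod>i\<in>UNIV. f i (k $ i))"
    and "integral\<^sup>L lborel (\<lambda>k :: real ^ 'd. \<Prod>i\<in>UNIV. f i (k $ i)) = (\<Prod>i\<in>UNIV. integral\<^sup>L lborel (f i))"
proof -
  interpret product_sigma_finite "\<lambda>_ :: real ^ 'd. lborel :: real measure" by standard
  define ix :: "real ^ 'd \<Rightarrow> 'd" where "ix = axis_index"
  have ix: "ix (axis i 1) = i" for i by (simp add: ix_def)
  have B: "(Basis :: (real ^ 'd) set) = range (\<lambda>i. axis i 1)"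
    by (auto simp: Basis_vec_def)
  have inj: "inj (\<lambda>i::'d. axis i (1::real))" by (metis injI ix)
  have prodB: "(\<Prod>b\<in>Basis. g b) = (\<Prod>i\<in>UNIV. g (axis i 1))" for g :: "real ^ 'd \<Rightarrow> complex"
    unfolding B by (simp add: prod.reindex[OF inj])
  have meas[measurable]: "f i \<in> borel_measurable borel" for i using assms[of i] by auto
  let ?T = "\<lambda>h :: real ^ 'd \<Rightarrow> real. \<Sum>b\<in>Basis. h b *\<^sub>R b"
  have T: "?T h $ i = h (axis i 1)" for h i
  proof -
    have "?T h $ i = ?T h \<bullet> axis i 1" by (simp add: inner_axis)
    also have "\<dots> = h (axis i 1)"
      by (subst inner_sum_left_Basis) (auto simp: axis_in_Basis_iff)
    finally show ?thesis .
  qed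
  have Tm: "?T \<in> measurable (\<Pi>\<^sub>M b\<in>Basis. lborel) borel" by measurable
  have P: "integrable (\<Pi>\<^sub>M b\<in>(Basis :: (real ^ 'd) set). lborel) (\<lambda>h. \<Prod>b\<in>Basis. f (ix b) (h b))"
    by (rule product_integrable_prod) (use assms in auto)
  have eq: "(\<lambda>h. \<Prod>i\<in>UNIV. f i (?T h $ i)) = (\<lambda>h. \<Prod>b\<in>Basis. f (ix b) (h b))"
    by (rule ext) (simp only: prodB ix T)
  show "integrable lborel (\<lambda>k :: real ^ 'd. \<Prod>i\<in>UNIV. f i (k $ i))"
    unfolding lborel_eq[where 'a = "real ^ 'd"]
    by (subst integrable_distr_eq[OF Tm]) (simp, measurable, simp only: eq P)
  have "integral\<^sup>L lborel (\<lambda>k :: real ^ 'd. \<Prod>i\<in>UNIV. f i (k $ i))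
     = integral\<^sup>L (\<Pi>\<^sub>M b\<in>(Basis :: (real ^ 'd) set). lborel) (\<lambda>h. \<Prod>b\<in>Basis. f (ix b) (h b))"
    unfolding lborel_eq[where 'a = "real ^ 'd"] by (subst integral_distr[OF Tm]) (measurable, simp only: eq)
  also have "\<dots> = (\<Prod>b\<in>Basis. integral\<^sup>L lborel (f (ix b)))"
    by (rule product_integral_prod) (use assms in auto)
  also have "\<dots> = (\<Prod>i\<in>UNIV. integral\<^sup>L lborel (f i))"
    by (simp add: prodB ix)
  finally show "integral\<^sup>L lborel (\<lambda>k :: real ^ 'd. \<Prod>i\<in>UNIV. f i (k $ i)) = (\<Prod>i\<in>UNIV. integral\<^sup>L lborel (f i))" .
qed

lemma set_integral_torus:
  fixes f :: "real ^ 'd::finite \<Rightarrow> complex"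
  assumes "continuous_on torus f"
  shows "integral torus f = integral\<^sup>L lborel (\<lambda>k. indicator torus k *\<^sub>R f k)"
    and "integrable lborel (\<lambda>k. indicator torus k *\<^sub>R f k)"
proof -
  have i: "set_integrable lborel torus f"
    unfolding torus_def set_integrable_def
    by (rule borel_integrable_compact) (use assms in \<open>auto simp: torus_def\<close>)
  then show "integrable lborel (\<lambda>k. indicator torus k *\<^sub>R f k)"
    by (simp add: set_integrable_def)
  show "integral torus f = integral\<^sup>L lborel (\<lambda>k. indicator torus k *\<^sub>R f k)"
    using set_borel_integral_eq_integral(2)[OF i] by (simp add: set_lebesgue_integral_def)
qed

lemma indicator_torus: "indicator torus k = (\<Prod>i\<in>UNIV. indicator {-pi..pi} (k $ i) :: real)"
  by (auto simp: indicator_def torus_iff abs_le_iff minus_le_iff prod_zero_iff)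

lemma integral_exp_int:
  "integral\<^sup>L lborel (\<lambda>t. indicator {-pi..pi} t *\<^sub>R exp (\<i> * complex_of_real (t * real_of_int n)))
    = (if n = 0 then 2 * pi else 0)"
proof -
  let ?f = "\<lambda>t. exp (\<i> * complex_of_real (t * real_of_int n))"
  have i: "set_integrable lborel {-pi..pi} ?f"
    unfolding set_integrable_def by (rule borel_integrable_compact) (auto intro!: continuous_intros)
  have "integral\<^sup>L lborel (\<lambda>t. indicator {-pi..pi} t *\<^sub>R ?f t) = integral {-pi..pi} ?f"
    using set_borel_integral_eq_integral(2)[OF i] by (simp add: set_lebesgue_integral_def)
  also have "\<dots> = (if n = 0 then 2 * pi else 0)"
  proof (cases "n = 0")
    case False
    let ?F = "\<lambda>t. ?f t / (\<i> * of_int n)"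
    have "(?f has_integral (?F pi - ?F (-pi))) {-pi..pi}"
    proof (rule fundamental_theorem_of_calculus)
      fix x assume "x \<in> {-pi..pi}"
      show "(?F has_vector_derivative ?f x) (at x within {-pi..pi})"
        by (rule has_vector_derivative_at_within)
           (use False in \<open>auto intro!: derivative_eq_intros has_vector_derivative_real_field
             simp: has_vector_derivative_complex_iff\<close>)
    qed simp
    moreover have "?f pi = ?f (-pi)"
      by (simp add: exp_eq)
    ultimately show ?thesis using False by (simp add: integral_unique)
  qed (simp add: content_real scaleR_conv_of_real)
  finally show ?thesis .
qed

lemma integral_phase:
  "integral torus (phase (x :: int ^ 'd::finite)) = (if x = 0 then (2 * pi) ^ CARD('d) else 0)"
proof -
  let ?f = "\<lambda>(i::'d) t. indicator {-pi..pi} t *\<^sub>R exp (\<i> * complex_of_real (t * real_of_int (x $ i)))"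
  have int: "integrable lborel (?f i)" for i
    by (rule borel_integrable_compact) (auto intro!: continuous_intros)
  have eq: "indicator torus k *\<^sub>R phase x k = (\<Prod>i\<in>UNIV. ?f i (k $ i))" for k
    by (simp add: indicator_torus scaleR_conv_of_real prod.distrib phase_def inner_vec_def rvec_def
        sum_distrib_left flip: exp_sum)
  have "integral torus (phase x) = integral\<^sup>L lborel (\<lambda>k. indicator torus k *\<^sub>R phase x k)"
    by (rule set_integral_torus(1)) (rule continuous_on_phase)
  also have "\<dots> = (\<Prod>i\<in>UNIV. integral\<^sup>L lborel (?f i))"
    unfolding eq by (rule lborel_prod_vec(2)) (rule int)
  also have "\<dots> = (\<Prod>i\<in>(UNIV::'d set). complex_of_real (if x $ i = 0 then 2 * pi else 0))"
    by (subst integral_exp_int) simp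
  also have "\<dots> = (if x = 0 then (2 * pi) ^ CARD('d) else 0)"
    by (auto simp: vec_eq_iff)
  finally show ?thesis by simp
qed

lemma fourier_inversion:
  fixes f :: "int ^ 'd::finite \<Rightarrow> real"
  assumes "in_lp 1 f"
  shows "integral torus (\<lambda>k. phase x k * fourier f k) = (2 * pi) ^ CARD('d) * f x"
proof -
  have "((\<lambda>y. complex_of_real (f y) * integral torus (\<lambda>k. phase x k * phase (- y) k)) has_sum
     integral torus (\<lambda>k. phase x k * fourier f k)) UNIV"
    by (rule integral_fourier_swap[OF assms]) (rule continuous_on_phase)
  moreover have "(\<lambda>k. phase x k * phase (- y) k) = phase (x - y)" for y
    by (rule ext) (simp flip: phase_add)
  ultimately have 1: "((\<lambda>y. complex_of_real (f y) * (if x - y = 0 then (2 * pi) ^ CARD('d) else 0)) has_sum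
     integral torus (\<lambda>k. phase x k * fourier f k)) UNIV"
    by (simp add: integral_phase)
  have 2: "((\<lambda>y. complex_of_real (f y) * (if x - y = 0 then (2 * pi) ^ CARD('d) else 0)) has_sum
     (\<Sum>y\<in>{x}. complex_of_real (f y) * (if x - y = 0 then (2 * pi) ^ CARD('d) else 0))) UNIV"
    by (rule has_sum_finite_neutralI[of "{x}"]) auto
  show ?thesis using has_sum_unique[OF 1 2] by simp
qed

lemma fourier_parseval:
  fixes f :: "int ^ 'd::finite \<Rightarrow> real"
  assumes "in_lp 1 f"
  shows "((\<lambda>x. (2 * pi) ^ CARD('d) * (f x)\<^sup>2) has_sum
    integral torus (\<lambda>k. (norm (fourier f k))\<^sup>2)) UNIV"
proof -
  have c: "continuous_on torus (\<lambda>k. cnj (fourier f k))"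
    by (intro continuous_intros assms)
  have int: "(\<lambda>k. phase y k * fourier f k) integrable_on torus" for y
    unfolding torus_def by (intro integrable_continuous continuous_intros assms)
  have "integral torus (\<lambda>k. cnj (fourier f k) * phase (- y) k) = (2 * pi) ^ CARD('d) * f y" for y
  proof -
    have "integral torus (\<lambda>k. cnj (fourier f k) * phase (- y) k)
       = integral torus (\<lambda>k. cnj (phase y k * fourier f k))"
      by (simp add: phase_minus mult.commute)
    also have "\<dots> = cnj (integral torus (\<lambda>k. phase y k * fourier f k))"
      using integral_linear[OF int bounded_linear_cnj] by (simp add: o_def)
    finally show ?thesis by (simp add: fourier_inversion[OF assms])
  qed
  then have "((\<lambda>x. complex_of_real (f x) * ((2 * pi) ^ CARD('d) * f x)) has_sum
     integral torus (\<lambda>k. cnj (fourier f k) * fourier f k)) UNIV"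
    using integral_fourier_swap[OF assms c] by simp
  moreover have "integral torus (\<lambda>k. cnj (fourier f k) * fourier f k)
     = of_real (integral torus (\<lambda>k. (norm (fourier f k))\<^sup>2))"
  proof -
    have "(\<lambda>k. (norm (fourier f k))\<^sup>2) integrable_on torus"
      unfolding torus_def by (intro integrable_continuous continuous_intros assms)
    then have "integral torus (\<lambda>k. complex_of_real ((norm (fourier f k))\<^sup>2))
      = of_real (integral torus (\<lambda>k. (norm (fourier f k))\<^sup>2))"
      using integral_linear[of "\<lambda>k. (norm (fourier f k))\<^sup>2" torus complex_of_real] bounded_linear_of_real
      by (simp add: o_def)
    moreover have "cnj (fourier f k) * fourier f k = complex_of_real ((norm (fourier f k))\<^sup>2)" for k
      by (simp only: complex_norm_square mult.commute)
    ultimately show ?thesis by simp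
  qed
  ultimately have "((\<lambda>x. complex_of_real ((2 * pi) ^ CARD('d) * (f x)\<^sup>2)) has_sum
     of_real (integral torus (\<lambda>k. (norm (fourier f k))\<^sup>2))) UNIV"
    by (simp add: power2_eq_square mult_ac)
  then show ?thesis using has_sum_Re by fastforce
qed

text \<open>Both claims are Fubini for one absolutely summable double family, read through the shear
  that sends (x, y) to (x - y, y), a bijection of the pairs.\<close>

lemma conv_l1:
  fixes f g :: "int ^ 'd::finite \<Rightarrow> real"
  assumes f: "in_lp 1 f" and g: "in_lp 1 g"
  shows in_lp_conv: "in_lp 1 (conv f g)"
    and fourier_conv: "fourier (conv f g) k = fourier f k * fourier g k"
proof -
  have f': "(\<lambda>x. norm (f x)) summable_on UNIV" and g': "(\<lambda>x. norm (g x)) summable_on UNIV"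
    using f g by (simp_all add: in_lp_1_iff)
  have fg: "(\<lambda>(z, y). \<bar>f z\<bar> * \<bar>g y\<bar>) summable_on UNIV"
    using f' g' Infinite_Sum.abs_summable_on_Sigma_iff[where f = "\<lambda>(z, y). \<bar>f z\<bar> * \<bar>g y\<bar>" and A = UNIV and B = "\<lambda>_. UNIV"]
    by (simp add: case_prod_unfold abs_mult infsum_cmult_right' summable_on_cmult_right summable_on_cmult_left)
  have bij: "bij_betw (\<lambda>(x, y). (x - y, y)) (UNIV :: ((int ^ 'd) \<times> (int ^ 'd)) set) UNIV"
    by (rule bij_betw_byWitness[where f' = "\<lambda>(z, y). (z + y, y)"]) auto
  have fg2: "(\<lambda>(x, y). \<bar>f (x - y)\<bar> * \<bar>g y\<bar>) summable_on UNIV \<times> UNIV"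
    using summable_on_reindex_bij_betw[OF bij, of "\<lambda>(z, y). \<bar>f z\<bar> * \<bar>g y\<bar>"] fg
    by (simp add: case_prod_unfold)
  have fg3: "(\<lambda>p. norm (case p of (x, y) \<Rightarrow> f (x - y) * g y)) summable_on UNIV \<times> UNIV"
    using fg2 by (simp add: case_prod_unfold abs_mult)
  have inner: "(\<lambda>y. norm (f (x - y) * g y)) summable_on UNIV" for x
    using Infinite_Sum.abs_summable_on_Sigma_iff[where f = "\<lambda>(x, y). f (x - y) * g y" and A = UNIV and B = "\<lambda>_. UNIV"] fg3 by simp
  have outer: "(\<lambda>x. norm (\<Sum>\<^sub>\<infinity>y. norm (f (x - y) * g y))) summable_on UNIV"
    using Infinite_Sum.abs_summable_on_Sigma_iff[where f = "\<lambda>(x, y). f (x - y) * g y" and A = UNIV and B = "\<lambda>_. UNIV"] fg3 by simp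
  show "in_lp 1 (conv f g)"
    unfolding in_lp_1_iff
  proof (rule summable_on_comparison_test[OF outer])
    fix x
    show "\<bar>conv f g x\<bar> \<le> norm (\<Sum>\<^sub>\<infinity>y. norm (f (x - y) * g y))"
      unfolding conv_def using norm_infsum_bound[OF inner[of x]] by simp
  qed auto
  let ?F = "\<lambda>z y. (complex_of_real (f z) * phase (- z) k) * (complex_of_real (g y) * phase (- y) k)"
  have sF: "(\<lambda>p. norm (case p of (x, y) \<Rightarrow> ?F (x - y) y)) summable_on UNIV \<times> UNIV"
    using fg2 by (simp add: case_prod_unfold norm_mult)
  have sF': "(\<lambda>(x, y). ?F (x - y) y) summable_on UNIV \<times> UNIV"
    using abs_summable_summable[OF sF] .
  have sG: "(\<lambda>p. norm (case p of (x, y) \<Rightarrow> ?F x y)) summable_on UNIV \<times> UNIV"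
    using fg by (simp add: case_prod_unfold norm_mult)
  have "fourier (conv f g) k = (\<Sum>\<^sub>\<infinity>x. \<Sum>\<^sub>\<infinity>y. ?F (x - y) y)"
    unfolding fourier_eq
  proof (rule infsum_cong)
    fix x
    have "complex_of_real (conv f g x) = (\<Sum>\<^sub>\<infinity>y. complex_of_real (f (x - y) * g y))"
      unfolding conv_def
      by (rule infsumI[OF has_sum_bounded_linear[OF bounded_linear_of_real
            has_sum_infsum[OF abs_summable_summable[OF inner[of x]]]], symmetric])
    then have "complex_of_real (conv f g x) * phase (- x) k
       = (\<Sum>\<^sub>\<infinity>y. complex_of_real (f (x - y) * g y) * phase (- x) k)"
      by (simp add: infsum_cmult_left')
    also have "\<dots> = (\<Sum>\<^sub>\<infinity>y. ?F (x - y) y)"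
    proof (rule infsum_cong)
      fix y
      have "phase (- x) k = phase (- (x - y)) k * phase (- y) k"
        by (simp flip: phase_add)
      then show "complex_of_real (f (x - y) * g y) * phase (- x) k = ?F (x - y) y"
        by simp
    qed
    finally show "complex_of_real (conv f g x) * phase (- x) k = (\<Sum>\<^sub>\<infinity>y. ?F (x - y) y)" .
  qed
  also have "\<dots> = infsum (\<lambda>(x, y). ?F (x - y) y) (UNIV \<times> UNIV)"
    using infsum_Sigma'_banach[OF sF'] by simp
  also have "\<dots> = infsum (\<lambda>(z, y). ?F z y) UNIV"
    using infsum_reindex_bij_betw[OF bij, of "\<lambda>(z, y). ?F z y"] by (simp add: case_prod_unfold)
  also have "\<dots> = (\<Sum>\<^sub>\<infinity>z. \<Sum>\<^sub>\<infinity>y. ?F z y)"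
    using infsum_Sigma'_banach[OF abs_summable_summable[OF sG]] by simp
  also have "\<dots> = fourier f k * fourier g k"
    by (simp add: fourier_eq infsum_cmult_right' infsum_cmult_left')
  finally show "fourier (conv f g) k = fourier f k * fourier g k" .
qed

lemma tilt_conv: "tilt \<nu> (conv f g) = conv (tilt \<nu> f) (tilt \<nu> g)"
proof
  fix x
  have "conv (tilt \<nu> f) (tilt \<nu> g) x = (\<Sum>\<^sub>\<infinity>y. f (x - y) * g y * exp (\<nu> \<bullet> rvec x))"
    unfolding conv_def tilt_def
    by (rule infsum_cong) (simp add: rvec_diff inner_diff_right exp_diff)
  then show "tilt \<nu> (conv f g) x = conv (tilt \<nu> f) (tilt \<nu> g) x"
    by (simp add: conv_def tilt_def infsum_cmult_left')
qed

lemma tilt_0 [simp]: "tilt 0 f = f"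
  by (auto simp: tilt_def)

text \<open>In the power series of the exponential each term is the transform of an n-fold
  convolution applied to \<open>g\<close>, and inversion evaluates it; the l1 norms provide the
  M-test.\<close>

lemma integral_exp_fourier_sums:
  fixes f g :: "int ^ 'd::finite \<Rightarrow> real"
  assumes f: "in_lp 1 f" and g: "in_lp 1 g"
  shows "(\<lambda>n. of_real (t ^ n / fact n) * complex_of_real ((2 * pi) ^ CARD('d) * (conv f ^^ n) g x)) sums
    integral torus (\<lambda>k. phase x k * fourier g k * exp (of_real t * fourier f k))"
proof -
  have l1: "in_lp 1 ((conv f ^^ n) g)" for n
    by (induction n) (auto intro: in_lp_conv f g)
  have four: "fourier ((conv f ^^ n) g) k = fourier f k ^ n * fourier g k" for n k
    by (induction n) (simp_all add: fourier_conv f l1)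
  let ?h = "\<lambda>n k. phase x k * fourier g k * ((of_real t * fourier f k) ^ n /\<^sub>R fact n)"
  have c: "continuous_on torus (\<lambda>k. \<Sum>n<N. ?h n k)" for N
    by (intro continuous_intros f g)
  have "uniform_limit torus (\<lambda>N k. \<Sum>n<N. ?h n k) (\<lambda>k. \<Sum>n. ?h n k) sequentially"
  proof (rule Weierstrass_m_test)
    fix n k
    have "norm (?h n k) = norm (fourier g k) * (\<bar>t\<bar> * norm (fourier f k)) ^ n / fact n"
      by (simp add: norm_mult norm_power divide_inverse mult_ac)
    also have "\<dots> \<le> l1_norm g * (\<bar>t\<bar> * l1_norm f) ^ n / fact n"
      by (intro divide_right_mono mult_mono power_mono norm_fourier_le f g) 
         (auto intro!: mult_nonneg_nonneg l1_norm_nonneg)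
    finally show "norm (?h n k) \<le> l1_norm g * ((\<bar>t\<bar> * l1_norm f) ^ n /\<^sub>R fact n)"
      by (simp add: field_simps)
  next
    show "summable (\<lambda>n. l1_norm g * ((\<bar>t\<bar> * l1_norm f) ^ n /\<^sub>R fact n))"
      by (intro summable_mult summable_exp_generic)
  qed
  moreover have "(\<Sum>n. ?h n k) = phase x k * fourier g k * exp (of_real t * fourier f k)" for k
    unfolding exp_def by (subst suminf_mult[symmetric]) (auto intro: summable_exp_generic)
  ultimately have ul: "uniform_limit torus (\<lambda>N k. \<Sum>n<N. ?h n k)
     (\<lambda>k. phase x k * fourier g k * exp (of_real t * fourier f k)) sequentially"
    by simp
  obtain I J where I: "\<And>N. ((\<lambda>k. \<Sum>n<N. ?h n k) has_integral I N) torus"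
    and J: "((\<lambda>k. phase x k * fourier g k * exp (of_real t * fourier f k)) has_integral J) torus"
    and lim: "I \<longlonglongrightarrow> J"
    by (rule uniform_limit_integral_cbox[OF ul[unfolded torus_def] c[unfolded torus_def]
          sequentially_bot, folded torus_def]) (rule that)
  have h: "(?h n has_integral of_real (t ^ n / fact n) * complex_of_real ((2 * pi) ^ CARD('d) * (conv f ^^ n) g x)) torus" for n
  proof -
    have "(\<lambda>k. phase x k * fourier ((conv f ^^ n) g) k) integrable_on torus"
      unfolding torus_def by (intro integrable_continuous continuous_intros l1)
    then have "((\<lambda>k. phase x k * fourier ((conv f ^^ n) g) k) has_integral
       complex_of_real ((2 * pi) ^ CARD('d) * (conv f ^^ n) g x)) torus"
      using fourier_inversion[OF l1[of n], of x] integrable_integral by fastforce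
    from has_integral_mult_right[OF this, of "of_real (t ^ n / fact n)"]
    show ?thesis
      by (simp add: four scaleR_conv_of_real power_mult_distrib field_simps)
  qed
  have "I = (\<lambda>N. \<Sum>n<N. of_real (t ^ n / fact n) * complex_of_real ((2 * pi) ^ CARD('d) * (conv f ^^ n) g x))"
    using has_integral_unique[OF I has_integral_sum[OF _ h]] by (intro ext) simp
  with lim show ?thesis
    unfolding sums_def integral_unique[OF J] by (simp only:)
qed

text \<open>The contour shift \<open>k \<mapsto> k + \<i>\<nu>\<close>, carried out on the coefficients of the exponential series.\<close>

lemma integral_exp_fourier_tilt:
  fixes f g :: "int ^ 'd::finite \<Rightarrow> real"
  assumes "in_lp 1 f" "in_lp 1 g" "in_lp 1 (tilt \<nu> f)" "in_lp 1 (tilt \<nu> g)"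
  shows "integral torus (\<lambda>k. phase x k * fourier (tilt \<nu> g) k * exp (of_real t * fourier (tilt \<nu> f) k))
    = of_real (exp (\<nu> \<bullet> rvec x)) *
      integral torus (\<lambda>k. phase x k * fourier g k * exp (of_real t * fourier f k))"
proof -
  have it: "(conv (tilt \<nu> f) ^^ n) (tilt \<nu> g) = tilt \<nu> ((conv f ^^ n) g)" for n
    by (induction n) (simp_all add: tilt_conv)
  note 1 = integral_exp_fourier_sums[OF assms(3,4), of t x, unfolded it]
  note 2 = sums_mult[OF integral_exp_fourier_sums[OF assms(1,2), of t x], of "of_real (exp (\<nu> \<bullet> rvec x))"]
  show ?thesis
    by (rule sums_unique2[OF 1]) (use 2 in \<open>simp add: tilt_def mult_ac\<close>)
qed

section \<open>Gaussian integrals\<close>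

text \<open>Conjugation by \<open>f\<close> matches the permutations of the two index types and
  preserves signs, so the two Leibniz sums agree term by term.\<close>

lemma det_relabel:
  fixes A :: "real ^ 'b::finite ^ 'b" and f :: "'a::finite \<Rightarrow> 'b"
  assumes f: "bij f"
  shows "det (\<chi> i j. A $ f i $ f j) = det A"
proof -
  let ?m = "map_permutation UNIV f" and ?w = "map_permutation UNIV (inv f)"
  have inj: "inj f" "inj (inv f)" and ff: "f (inv f x) = x" "inv f (f y) = y" for x y
    using f by (auto simp: bij_is_inj bij_imp_bij_inv bij_is_surj surj_f_inv_f)
  have m: "?m p = f \<circ> p \<circ> inv f" for p
    using f by (auto simp: map_permutation_def restrict_id_def fun_eq_iff bij_is_surj)
  have w: "?w p = inv f \<circ> p \<circ> f" for p
    using f by (auto simp: map_permutation_def restrict_id_def fun_eq_iff bij_is_surj bij_imp_bij_inv inv_inv_eq)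
  have pm: "?m p permutes UNIV" if "p permutes UNIV" for p
    by (rule map_permutation_permutes) (use that f in auto)
  have pw: "?w p permutes UNIV" if "p permutes UNIV" for p
    by (rule map_permutation_permutes) (use that f bij_imp_bij_inv in auto)
  show ?thesis
    unfolding det_def
  proof (rule sum.reindex_bij_witness[of _ ?w ?m])
    fix p :: "'a \<Rightarrow> 'a" assume p: "p \<in> {p. p permutes UNIV}"
    show "?w (?m p) = p" by (auto simp: m w ff)
    show "?m p \<in> {p. p permutes UNIV}" using pm p by simp
    have "sign (?m p) = sign p"
      by (rule sign_map_permutation) (use inj p in auto)
    moreover have "(\<Prod>i\<in>UNIV. A $ i $ ?m p i) = (\<Prod>i\<in>UNIV. A $ f i $ ?m p (f i))"
      by (rule prod.reindex_bij_betw[OF f, symmetric])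
    ultimately show "of_int (sign (?m p)) * (\<Prod>i\<in>UNIV. A $ i $ ?m p i)
      = of_int (sign p) * (\<Prod>i\<in>UNIV. (\<chi> i j. A $ f i $ f j) $ i $ p i)"
      by (simp add: m ff)
  next
    fix p :: "'b \<Rightarrow> 'b" assume p: "p \<in> {p. p permutes UNIV}"
    show "?m (?w p) = p" by (auto simp: m w ff)
    show "?w p \<in> {p. p permutes UNIV}" using pw p by simp
  qed
qed

text \<open>The library's change of variables requires a wellordered index type; a finite type gets a
  wellordered copy by choosing an enumeration.\<close>

typedef 'a ordcopy = "UNIV :: 'a set" ..

definition ord_index :: "'a::finite ordcopy \<Rightarrow> nat" where
  "ord_index = (SOME f. inj f)"

lemma bij_Rep_ordcopy: "bij Rep_ordcopy"
  by (rule o_bij[of Abs_ordcopy]) (auto simp: Abs_ordcopy_inverse Rep_ordcopy_inverse)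

instance ordcopy :: (finite) finite
proof
  show "finite (UNIV :: 'a ordcopy set)"
    using bij_betw_finite[OF bij_Rep_ordcopy[where 'a = 'a]] by simp
qed

lemma inj_ord_index: "inj (ord_index :: 'a::finite ordcopy \<Rightarrow> nat)"
proof -
  have "\<exists>f :: 'a ordcopy \<Rightarrow> nat. inj f"
    using finite_imp_inj_to_nat_seg[of "UNIV :: 'a ordcopy set"] by auto
  then show ?thesis unfolding ord_index_def by (rule someI_ex)
qed

instantiation ordcopy :: (finite) wellorder
begin
definition "less_eq_ordcopy (a :: 'a ordcopy) (b :: 'a ordcopy) \<longleftrightarrow> ord_index a \<le> ord_index b"
definition "less_ordcopy (a :: 'a ordcopy) (b :: 'a ordcopy) \<longleftrightarrow> ord_index a < ord_index b"
instance
proof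
  fix P :: "'a ordcopy \<Rightarrow> bool" and a :: "'a ordcopy"
  assume H: "\<And>x. (\<And>y. y < x \<Longrightarrow> P y) \<Longrightarrow> P x"
  have "ord_index x = n \<Longrightarrow> P x" for x n
    by (induction n arbitrary: x rule: less_induct) (use H in \<open>auto simp: less_ordcopy_def\<close>)
  then show "P a" by blast
qed (use inj_ord_index in \<open>auto simp: less_eq_ordcopy_def less_ordcopy_def inj_def\<close>)
end

definition relabel :: "real ^ 'd::finite \<Rightarrow> real ^ 'd ordcopy" where
  "relabel x = (\<chi> i. x $ Rep_ordcopy i)"

definition unlabel :: "real ^ 'd::finite ordcopy \<Rightarrow> real ^ 'd" where
  "unlabel x = (\<chi> i. x $ Abs_ordcopy i)"

lemma unlabel_relabel [simp]: "unlabel (relabel x) = x" "relabel (unlabel y) = y"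
  by (simp_all add: relabel_def unlabel_def vec_eq_iff Abs_ordcopy_inverse Rep_ordcopy_inverse)

lemma relabel_measurable [measurable]:
  "relabel \<in> borel_measurable borel" "unlabel \<in> borel_measurable borel"
  by (intro borel_measurable_continuous_onI,
      simp add: relabel_def unlabel_def, intro continuous_intros)+

lemma prod_Basis_vec: "(\<Prod>b\<in>Basis. (x :: real ^ 'd::finite) \<bullet> b) = (\<Prod>i\<in>UNIV. x $ i)"
proof -
  have B: "(Basis :: (real ^ 'd) set) = range (\<lambda>i. axis i 1)"
    by (auto simp: Basis_vec_def)
  show ?thesis
    unfolding B by (subst prod.reindex) (auto simp: inj_on_def axis_eq_axis inner_axis)
qed

text \<open>Renaming coordinates carries boxes to boxes with the same side lengths, and Lebesgue
  measure is determined by its values on boxes.\<close>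

lemma distr_unlabel: "distr lborel borel (unlabel :: real ^ 'd::finite ordcopy \<Rightarrow> real ^ 'd) = lborel"
proof (rule lborel_eqI[symmetric])
  fix l u :: "real ^ 'd"
  assume le: "\<And>b. b \<in> Basis \<Longrightarrow> l \<bullet> b \<le> u \<bullet> b"
  have le': "l $ i \<le> u $ i" for i using le[of "axis i 1"] by (simp add: inner_axis axis_in_Basis_iff)
  have vim: "unlabel -` box l u = box (relabel l) (relabel u)"
  proof (rule set_eqI)
    fix x
    have "(\<forall>i. l $ i < x $ Abs_ordcopy i \<and> x $ Abs_ordcopy i < u $ i) \<longleftrightarrow>
       (\<forall>i. l $ Rep_ordcopy i < x $ i \<and> x $ i < u $ Rep_ordcopy i)"
    proof safe
      fix i assume "\<forall>i. l $ i < x $ Abs_ordcopy i \<and> x $ Abs_ordcopy i < u $ i"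
      then show "l $ Rep_ordcopy i < x $ i" "x $ i < u $ Rep_ordcopy i"
        by (auto dest!: spec[of _ "Rep_ordcopy i"] simp: Rep_ordcopy_inverse)
    next
      fix i assume "\<forall>i. l $ Rep_ordcopy i < x $ i \<and> x $ i < u $ Rep_ordcopy i"
      then show "l $ i < x $ Abs_ordcopy i" "x $ Abs_ordcopy i < u $ i"
        by (auto dest!: spec[of _ "Abs_ordcopy i"] simp: Abs_ordcopy_inverse)
    qed
    then show "x \<in> unlabel -` box l u \<longleftrightarrow> x \<in> box (relabel l) (relabel u)"
      by (simp add: mem_box_cart relabel_def unlabel_def)
  qed
  have "emeasure (distr lborel borel unlabel) (box l u) = emeasure lborel (box (relabel l) (relabel u))"
    by (subst emeasure_distr) (auto simp: vim)
  also have "\<dots> = ennreal (\<Prod>b\<in>Basis. (relabel u - relabel l) \<bullet> b)"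
    by (rule emeasure_lborel_box) (use le' in \<open>auto simp: Basis_vec_def inner_axis relabel_def\<close>)
  also have "(\<Prod>b\<in>Basis. (relabel u - relabel l) \<bullet> b) = (\<Prod>i\<in>UNIV. (relabel u - relabel l) $ i)"
    by (rule prod_Basis_vec)
  also have "\<dots> = (\<Prod>i\<in>UNIV. (u - l) $ i)"
    using prod.reindex_bij_betw[OF bij_Rep_ordcopy, of "\<lambda>i. (u - l) $ i"] by (simp add: relabel_def)
  also have "\<dots> = (\<Prod>b\<in>Basis. (u - l) \<bullet> b)"
    by (rule prod_Basis_vec[symmetric])
  finally show "emeasure (distr lborel borel unlabel) (box l u) = ennreal (\<Prod>b\<in>Basis. (u - l) \<bullet> b)" .
qed simp

lemma lborel_integral_linear_wellorder:
  fixes f :: "real ^ 'm::{finite,wellorder} \<Rightarrow> real" and B :: "real ^ 'm::_ ^ 'm::_"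
  assumes f: "integrable lborel f" and B: "det B \<noteq> 0"
  shows "integrable lborel (\<lambda>p. f (B *v p))"
    and "integral\<^sup>L lborel f = \<bar>det B\<bar> * integral\<^sup>L lborel (\<lambda>p. f (B *v p))"
proof -
  \<comment> \<open>The linear change of variables concerns vector-valued integrands, so
    \<open>f\<close> is wrapped into dimension one and later unwrapped by the first
    component.\<close>
  define F :: "real ^ 'm::_ \<Rightarrow> real ^ 1" where "F x = vec (f x)" for x
  have surj: "range ((*v) B) = UNIV"
    using B invertible_det_nz[of B] matrix_right_invertible_surjective[of B] invertible_right_inverse[of B]
    by simp
  have fb[measurable]: "f \<in> borel_measurable borel" using f by auto
  have vb: "bounded_linear (vec :: real \<Rightarrow> real ^ 1)"
    by (intro linear_conv_bounded_linear[THEN iffD1] linearI) (simp_all add: vec_eq_iff)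
  have fa: "f absolutely_integrable_on UNIV"
    using f by (simp add: set_integrable_def integrable_completion)
  have Fa: "F absolutely_integrable_on UNIV"
    unfolding F_def using absolutely_integrable_linear[OF fa vb] by (simp add: o_def)
  have lin: "linear ((*v) B)" by simp
  have m: "matrix ((*v) B) = B" by (rule matrix_of_matrix_vector_mul)
  have Fg: "(F \<circ> (*v) B) absolutely_integrable_on UNIV"
    using absolutely_integrable_on_linear_image[OF lin, where f = F and S = UNIV] Fa B by (simp add: surj m)
  have I: "integral UNIV F = \<bar>det B\<bar> *\<^sub>R integral UNIV (F \<circ> (*v) B)"
    using integral_change_of_variables_linear[OF lin, where f = F and S = UNIV] Fa by (simp add: surj m)
  have nb: "bounded_linear (\<lambda>x :: real ^ 1. x $ 1)" by (rule bounded_linear_vec_nth)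
  have ga: "(\<lambda>p. f (B *v p)) absolutely_integrable_on UNIV"
    using absolutely_integrable_linear[OF Fg nb] by (simp add: o_def F_def)
  have Bm[measurable]: "(*v) B \<in> borel_measurable borel"
    by (intro borel_measurable_continuous_onI matrix_vector_mult_linear_continuous_on)
  have gm: "(\<lambda>p. f (B *v p)) \<in> borel_measurable lborel" by measurable
  show g: "integrable lborel (\<lambda>p. f (B *v p))"
    using ga integrable_completion[OF gm] by (simp add: set_integrable_def)
  have e1: "integral\<^sup>L lborel f = integral UNIV f"
    by (rule integral_lborel[OF f, symmetric])
  have e2: "integral\<^sup>L lborel (\<lambda>p. f (B *v p)) = integral UNIV (\<lambda>p. f (B *v p))"
    by (rule integral_lborel[OF g, symmetric])
  have "integral UNIV F $ 1 = integral UNIV f"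
    using integral_linear[OF set_lebesgue_integral_eq_integral(1)[OF Fa] nb] by (simp add: o_def F_def)
  moreover have "integral UNIV (F \<circ> (*v) B) $ 1 = integral UNIV (\<lambda>p. f (B *v p))"
    using integral_linear[OF set_lebesgue_integral_eq_integral(1)[OF Fg] nb] by (simp add: o_def F_def)
  ultimately show "integral\<^sup>L lborel f = \<bar>det B\<bar> * integral\<^sup>L lborel (\<lambda>p. f (B *v p))"
    using arg_cong[OF I, of "\<lambda>x. x $ 1"] by (simp add: e1 e2)
qed

lemma lborel_integral_linear_real:
  fixes f :: "real ^ 'd::finite \<Rightarrow> real" and B :: "real ^ 'd ^ 'd"
  assumes f: "integrable lborel f" and B: "det B \<noteq> 0"
  shows "integrable lborel (\<lambda>p. f (B *v p))"
    and "integral\<^sup>L lborel f = \<bar>det B\<bar> * integral\<^sup>L lborel (\<lambda>p. f (B *v p))"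
proof -
  define B' :: "real ^ 'd ordcopy ^ 'd ordcopy" where "B' = (\<chi> i j. B $ Rep_ordcopy i $ Rep_ordcopy j)"
  have det: "det B' = det B" unfolding B'_def by (rule det_relabel[OF bij_Rep_ordcopy])
  have mv: "unlabel (B' *v p) = B *v unlabel p" for p
  proof -
    have "(\<Sum>j\<in>UNIV. B $ i $ Rep_ordcopy j * p $ j) = (\<Sum>j\<in>UNIV. B $ i $ j * p $ Abs_ordcopy j)" for i
      using sum.reindex_bij_betw[OF bij_Rep_ordcopy, of "\<lambda>j. B $ i $ j * p $ Abs_ordcopy j"]
      by (simp add: Rep_ordcopy_inverse)
    then show ?thesis
      by (simp add: vec_eq_iff unlabel_def B'_def matrix_vector_mult_def Abs_ordcopy_inverse)
  qed
  have fb[measurable]: "f \<in> borel_measurable borel" using f by auto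
  have Bm[measurable]: "(*v) B \<in> borel_measurable borel"
    by (intro borel_measurable_continuous_onI matrix_vector_mult_linear_continuous_on)
  have f': "integrable lborel (\<lambda>p. f (unlabel p))"
    using f integrable_distr_eq[of unlabel lborel borel f] by (simp add: distr_unlabel)
  note L = lborel_integral_linear_wellorder[OF f' B[folded det], unfolded mv]
  show "integrable lborel (\<lambda>p. f (B *v p))"
    using L(1) integrable_distr_eq[of unlabel lborel borel "\<lambda>p. f (B *v p)"] by (simp add: distr_unlabel)
  have "integral\<^sup>L lborel f = integral\<^sup>L lborel (\<lambda>p. f (unlabel p))"
    using integral_distr[of unlabel lborel borel f] by (simp add: distr_unlabel)
  moreover have "integral\<^sup>L lborel (\<lambda>p. f (B *v p)) = integral\<^sup>L lborel (\<lambda>p. f (B *v unlabel p))"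
    using integral_distr[of unlabel lborel borel "\<lambda>p. f (B *v p)"] by (simp add: distr_unlabel)
  ultimately show "integral\<^sup>L lborel f = \<bar>det B\<bar> * integral\<^sup>L lborel (\<lambda>p. f (B *v p))"
    using L(2) det by simp
qed

lemma lborel_integral_linear:
  fixes f :: "real ^ 'd::finite \<Rightarrow> complex" and B :: "real ^ 'd ^ 'd"
  assumes f: "integrable lborel f" and B: "det B \<noteq> 0"
  shows "integral\<^sup>L lborel f = of_real \<bar>det B\<bar> * integral\<^sup>L lborel (\<lambda>p. f (B *v p))"
proof -
  have re: "integrable lborel (\<lambda>p. Re (f p))" and im: "integrable lborel (\<lambda>p. Im (f p))"
    using f by auto
  have g: "integrable lborel (\<lambda>p. f (B *v p))"
    using lborel_integral_linear_real(1)[OF re B] lborel_integral_linear_real(1)[OF im B]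
      Bochner_Integration.integrable_add[where M = lborel and f = "\<lambda>p. complex_of_real (Re (f (B *v p)))"
        and g = "\<lambda>p. \<i> * complex_of_real (Im (f (B *v p)))"]
    by (simp flip: complex_eq)
  show ?thesis
    using lborel_integral_linear_real(2)[OF re B] lborel_integral_linear_real(2)[OF im B] f g
    by (simp add: complex_eq_iff)
qed

text \<open>Gram-Schmidt for the inner product given by \<open>L\<close>. Keeping the span unchanged
  in the induction is what makes the next vector independent of the system built so far.\<close>

lemma gram_schmidt_form:
  fixes L :: "real ^ 'd::finite ^ 'd"
  assumes sym: "transpose L = L" and pos: "\<And>x. x \<noteq> 0 \<Longrightarrow> 0 < x \<bullet> (L *v x)"
    and fin: "finite X" and ind: "independent X"
  shows "\<exists>Y. finite Y \<and> card Y = card X \<and> span Y = span X \<and>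
    (\<forall>y\<in>Y. \<forall>y'\<in>Y. y \<bullet> (L *v y') = (if y = y' then 1 else 0))"
  using fin ind
proof (induction X rule: finite_induct)
  case empty
  then show ?case by (intro exI[of _ "{}"]) auto
next
  case (insert a X)
  have commute: "x \<bullet> (L *v y) = y \<bullet> (L *v x)" for x y
    using dot_lmul_matrix[of x L y] by (simp add: inner_commute sym flip: vector_transpose_matrix)
  from insert have aX: "a \<notin> span X" "independent X" by (auto simp: independent_insert)
  with insert obtain Y where Y: "finite Y" "card Y = card X" "span Y = span X"
    and on: "\<And>y y'. y \<in> Y \<Longrightarrow> y' \<in> Y \<Longrightarrow> y \<bullet> (L *v y') = (if y = y' then 1 else 0)" by metis
  \<comment> \<open>The \<open>L\<close>-orthogonal projection of \<open>a\<close> onto the span of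
    \<open>Y\<close>.\<close>
  define w where "w = (\<Sum>y\<in>Y. (y \<bullet> (L *v a)) *\<^sub>R y)"
  have w: "w \<in> span Y" unfolding w_def by (intro span_sum span_scale span_base)
  define v where "v = a - w"
  have v: "v \<notin> span Y" using aX(1) w Y(3) span_add[of v Y w] by (auto simp: v_def)
  have orth: "y \<bullet> (L *v v) = 0" if y: "y \<in> Y" for y
  proof -
    have "y \<bullet> (L *v w) = w \<bullet> (L *v y)" by (rule commute)
    also have "\<dots> = (\<Sum>y'\<in>Y. (y' \<bullet> (L *v a)) * (y' \<bullet> (L *v y)))"
      unfolding w_def by (simp add: inner_sum_left)
    also have "\<dots> = (\<Sum>y'\<in>Y. if y' = y then y \<bullet> (L *v a) else 0)"
      by (rule sum.cong) (use on y in auto)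
    also have "\<dots> = y \<bullet> (L *v a)" using Y(1) y by simp
    finally show ?thesis by (simp add: v_def matrix_vector_mult_diff_distrib inner_diff_right)
  qed
  have v0: "v \<noteq> 0" using v span_zero by metis
  define c where "c = sqrt (v \<bullet> (L *v v))"
  have c: "c > 0" "c\<^sup>2 = v \<bullet> (L *v v)" using pos[OF v0] by (auto simp: c_def)
  define u where "u = (1 / c) *\<^sub>R v"
  have Lu: "L *v u = (1 / c) *\<^sub>R (L *v v)" unfolding u_def by (rule matrix_vector_mult_scaleR)
  have uu: "u \<bullet> (L *v u) = 1" using c by (simp add: Lu) (simp add: u_def field_simps power2_eq_square)
  have yu: "y \<bullet> (L *v u) = 0" "u \<bullet> (L *v y) = 0" if "y \<in> Y" for y
    using orth[OF that] commute[of u y] by (auto simp: Lu)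
  have uY: "u \<notin> Y" using yu(1) uu by force
  have vs: "v = c *\<^sub>R u" using c by (simp add: u_def)
  have sp: "span (insert u Y) = span (insert a X)"
    unfolding span_eq
  proof
    show "insert u Y \<subseteq> span (insert a X)"
    proof -
      have 1: "Y \<subseteq> span (insert a X)"
        using Y(3) span_superset[of Y] span_mono[of X "insert a X"] by blast
      moreover have "w \<in> span (insert a X)" using w Y(3) span_mono[of X "insert a X"] by blast
      then have "v \<in> span (insert a X)" unfolding v_def by (intro span_diff) (auto intro: span_base)
      then have "u \<in> span (insert a X)" unfolding u_def by (rule span_scale)
      ultimately show ?thesis by auto
    qed
    show "insert a X \<subseteq> span (insert u Y)"
    proof -
      have "X \<subseteq> span (insert u Y)"
        using Y(3) span_superset[of X] span_mono[of Y "insert u Y"] by blast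
      moreover have "a = c *\<^sub>R u + w" using vs v_def by (metis diff_add_cancel)
      moreover have "w \<in> span (insert u Y)" using w span_mono[of Y "insert u Y"] by blast
      ultimately show ?thesis by (auto intro!: span_add span_scale intro: span_base)
    qed
  qed
  show ?case
    by (rule exI[of _ "insert u Y"]) (use Y uY insert sp uu yu on in auto)
qed

text \<open>The columns of \<open>B\<close> form an \<open>L\<close>-orthonormal basis, so
  \<open>transpose B ** L ** B\<close> is the identity. The determinant and the formula
  \<open>matrix_inv L = B ** transpose B\<close> both follow from this one equation.\<close>

lemma posdef_normal_form:
  fixes L :: "real ^ 'd::finite ^ 'd"
  assumes sym: "transpose L = L" and pos: "\<And>x. x \<noteq> 0 \<Longrightarrow> 0 < x \<bullet> (L *v x)"
  obtains B :: "real ^ 'd ^ 'd" where "det B \<noteq> 0" "\<bar>det B\<bar> = 1 / sqrt (det L)" "0 < det L"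
    "\<And>x. (B *v x) \<bullet> (L *v (B *v x)) = x \<bullet> x"
    "\<And>z. (transpose B *v z) \<bullet> (transpose B *v z) = z \<bullet> (matrix_inv L *v z)"
    "L ** matrix_inv L = mat 1"
proof -
  obtain Y where Y: "finite Y" "card Y = card (Basis :: (real ^ 'd) set)"
    and on: "\<And>y y'. y \<in> Y \<Longrightarrow> y' \<in> Y \<Longrightarrow> y \<bullet> (L *v y') = (if y = y' then 1 else 0)"
    using gram_schmidt_form[OF sym pos finite_Basis independent_Basis] by metis
  have "card (UNIV :: 'd set) = card Y" using Y(2) by (simp add: DIM_cart)
  then obtain b where b: "bij_betw b (UNIV :: 'd set) Y"
    using finite_same_card_bij[OF finite Y(1)] by blast
  define B :: "real ^ 'd ^ 'd" where "B = (\<chi> i j. b j $ i)"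
  have cols: "B *v axis j 1 = b j" for j
    by (simp add: vec_eq_iff B_def matrix_vector_mult_def axis_def if_distrib cong: if_cong)
  have "(transpose B ** L ** B) $ j $ l = b j \<bullet> (L *v b l)" for j l
  proof -
    have "(transpose B ** L ** B) $ j $ l = axis j 1 \<bullet> ((transpose B ** L ** B) *v axis l 1)"
      by (simp add: inner_axis' matrix_vector_mul_component inner_axis)
    also have "\<dots> = axis j 1 \<bullet> (transpose B *v (L *v b l))"
      by (simp only: matrix_vector_mul_assoc[symmetric] cols)
    also have "\<dots> = (B *v axis j 1) \<bullet> (L *v b l)"
      by (metis dot_lmul_matrix inner_commute transpose_transpose vector_transpose_matrix)
    finally show ?thesis by (simp only: cols)
  qed
  moreover have "b j \<bullet> (L *v b l) = (if j = l then 1 else 0)" for j l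
    using on[of "b j" "b l"] b by (auto simp: bij_betw_def inj_on_def)
  ultimately have BLB: "transpose B ** L ** B = mat 1"
    by (simp add: vec_eq_iff mat_def)
  have "det (transpose B ** L ** B) = 1" by (simp add: BLB)
  then have d: "(det B)\<^sup>2 * det L = 1"
    by (simp add: det_mul power2_eq_square mult_ac)
  have dB: "det B \<noteq> 0" using d by auto
  have dL: "det L > 0" using d by (metis zero_less_mult_pos zero_less_one zero_less_power2 dB)
  have "B ** (transpose B ** L) = mat 1"
    using BLB matrix_left_right_inverse by (metis)
  then have inv1: "(B ** transpose B) ** L = mat 1" by (simp add: matrix_mul_assoc)
  then have inv2: "L ** (B ** transpose B) = mat 1" using matrix_left_right_inverse by metis
  have "\<exists>A'. L ** A' = mat 1 \<and> A' ** L = mat 1" using inv1 inv2 by blast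
  then have mi: "L ** matrix_inv L = mat 1 \<and> matrix_inv L ** L = mat 1"
    unfolding matrix_inv_def by (rule someI_ex)
  have "matrix_inv L = (B ** transpose B) ** (L ** matrix_inv L)"
    by (simp only: matrix_mul_assoc inv1 matrix_mul_lid)
  then have miB: "matrix_inv L = B ** transpose B" using mi by simp
  show thesis
  proof (rule that[of B])
    have "sqrt ((det B)\<^sup>2 * det L) = 1" by (simp add: d)
    then show "\<bar>det B\<bar> = 1 / sqrt (det L)" using dL by (simp add: real_sqrt_mult field_simps)
    show "(B *v x) \<bullet> (L *v (B *v x)) = x \<bullet> x" for x
    proof -
      have "(B *v x) \<bullet> (L *v (B *v x)) = x \<bullet> (transpose B *v (L *v (B *v x)))"
        by (metis dot_lmul_matrix inner_commute transpose_transpose vector_transpose_matrix)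
      also have "\<dots> = x \<bullet> ((transpose B ** L ** B) *v x)" by (simp only: matrix_vector_mul_assoc matrix_mul_assoc)
      finally show ?thesis by (simp add: BLB)
    qed
    show "(transpose B *v z) \<bullet> (transpose B *v z) = z \<bullet> (matrix_inv L *v z)" for z
    proof -
      have "(transpose B *v z) \<bullet> (transpose B *v z) = z \<bullet> (B *v (transpose B *v z))"
        by (metis dot_lmul_matrix inner_commute transpose_transpose vector_transpose_matrix)
      then show ?thesis by (simp only: miB matrix_vector_mul_assoc)
    qed
  qed (use dB dL mi in auto)
qed

section \<open>Gaussian integrals and their Fourier transforms\<close>

lemma gaussian_real_fourier:
  "integrable lborel (\<lambda>t. exp (\<i> * complex_of_real (w * t)) * complex_of_real (exp (- t\<^sup>2 / 2)))"
  "integral\<^sup>L lborel (\<lambda>t. exp (\<i> * complex_of_real (w * t)) * complex_of_real (exp (- t\<^sup>2 / 2)))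
    = complex_of_real (sqrt (2 * pi) * exp (- w\<^sup>2 / 2))"
proof -
  let ?f = "\<lambda>t. exp (\<i> * complex_of_real (w * t)) * complex_of_real (exp (- t\<^sup>2 / 2))"
  have eq: "?f t = complex_of_real (sqrt (2 * pi)) * (std_normal_density t *\<^sub>R exp (\<i> * complex_of_real (w * t)))" for t
    by (simp add: std_normal_density_def scaleR_conv_of_real)
  have i: "integrable lborel (\<lambda>t. std_normal_density t *\<^sub>R exp (\<i> * complex_of_real (w * t)))"
  proof (rule Bochner_Integration.integrable_bound)
    show "integrable lborel std_normal_density" by (rule integrable_normal_density) simp
  qed (auto simp: normal_density_nonneg)
  then show "integrable lborel ?f" unfolding eq by (rule integrable_mult_right)
  have "char std_normal_distribution w = integral\<^sup>L lborel (\<lambda>t. std_normal_density t *\<^sub>R exp (\<i> * complex_of_real (w * t)))"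
    unfolding char_def by (subst integral_density) (auto simp: normal_density_nonneg)
  then have "integral\<^sup>L lborel (\<lambda>t. std_normal_density t *\<^sub>R exp (\<i> * complex_of_real (w * t))) = complex_of_real (exp (- w\<^sup>2 / 2))"
    by (simp add: char_std_normal_distribution)
  then show "integral\<^sup>L lborel ?f = complex_of_real (sqrt (2 * pi) * exp (- w\<^sup>2 / 2))"
    unfolding eq by (simp only: integral_mult_right_zero of_real_mult)
qed

lemma inner_vec_power2: "(x :: real ^ 'd::finite) \<bullet> x = (\<Sum>i\<in>UNIV. (x $ i)\<^sup>2)"
  by (simp add: inner_vec_def power2_eq_square)

lemma gaussian_std_fourier:
  fixes w :: "real ^ 'd::finite"
  shows "integrable lborel (\<lambda>p. exp (\<i> * complex_of_real (w \<bullet> p)) * complex_of_real (exp (- (p \<bullet> p) / 2)))"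
    and "integral\<^sup>L lborel (\<lambda>p. exp (\<i> * complex_of_real (w \<bullet> p)) * complex_of_real (exp (- (p \<bullet> p) / 2)))
    = complex_of_real (sqrt (2 * pi) ^ CARD('d) * exp (- (w \<bullet> w) / 2))"
proof -
  let ?f = "\<lambda>(i::'d) t. exp (\<i> * complex_of_real (w $ i * t)) * complex_of_real (exp (- t\<^sup>2 / 2))"
  have eq: "exp (\<i> * complex_of_real (w \<bullet> p)) * complex_of_real (exp (- (p \<bullet> p) / 2)) = (\<Prod>i\<in>UNIV. ?f i (p $ i))" for p
    unfolding prod.distrib of_real_prod[symmetric] exp_sum[symmetric, OF finite]
    by (simp add: inner_vec_power2 inner_vec_def sum_distrib_left sum_negf sum_divide_distrib)
  show "integrable lborel (\<lambda>p. exp (\<i> * complex_of_real (w \<bullet> p)) * complex_of_real (exp (- (p \<bullet> p) / 2)))"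
    unfolding eq by (rule lborel_prod_vec(1)) (rule gaussian_real_fourier)
  have "integral\<^sup>L lborel (\<lambda>p. exp (\<i> * complex_of_real (w \<bullet> p)) * complex_of_real (exp (- (p \<bullet> p) / 2)))
    = (\<Prod>i\<in>UNIV. complex_of_real (sqrt (2 * pi) * exp (- (w $ i)\<^sup>2 / 2)))"
    unfolding eq by (subst lborel_prod_vec(2)[OF gaussian_real_fourier(1)]) (simp only: gaussian_real_fourier(2))
  also have "\<dots> = complex_of_real (sqrt (2 * pi) ^ CARD('d) * exp (- (w \<bullet> w) / 2))"
    unfolding of_real_prod[symmetric] prod.distrib exp_sum[symmetric, OF finite]
    by (simp add: inner_vec_power2 sum_negf sum_divide_distrib)
  finally show "integral\<^sup>L lborel (\<lambda>p. exp (\<i> * complex_of_real (w \<bullet> p)) * complex_of_real (exp (- (p \<bullet> p) / 2)))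
    = complex_of_real (sqrt (2 * pi) ^ CARD('d) * exp (- (w \<bullet> w) / 2))" .
qed

lemma gaussian_isotropic:
  fixes a :: real
  assumes a: "a > 0"
  shows "integrable lborel (\<lambda>k :: real ^ 'd::finite. exp (- a * (norm k)\<^sup>2))"
    and "integral\<^sup>L lborel (\<lambda>k :: real ^ 'd::finite. exp (- a * (norm k)\<^sup>2)) = (pi / a) powr (CARD('d) / 2)"
proof -
  let ?f = "\<lambda>t. complex_of_real (exp (- a * t\<^sup>2))"
  define s where "s = 1 / sqrt (2 * a)"
  have s: "s > 0" "s\<^sup>2 = 1 / (2 * a)" using a by (auto simp: s_def power_divide)
  have eq1: "?f t = complex_of_real (sqrt (pi / a) * normal_density 0 s t)" for t
    using a by (simp add: normal_density_def s)
  have i: "integrable lborel ?f"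
    unfolding eq1 using integrable_normal_density[OF s(1)] by simp
  have I: "integral\<^sup>L lborel ?f = complex_of_real (sqrt (pi / a))"
    unfolding eq1 using integral_normal_density[OF s(1)] integrable_normal_density[OF s(1)] by simp
  have eq: "complex_of_real (exp (- a * (norm k)\<^sup>2)) = (\<Prod>i\<in>UNIV. ?f (k $ i))" for k :: "real ^ 'd"
    unfolding of_real_prod[symmetric] exp_sum[symmetric, OF finite]
    by (simp add: power2_norm_eq_inner inner_vec_power2 sum_distrib_left sum_negf)
  have ci: "integrable lborel (\<lambda>k :: real ^ 'd. complex_of_real (exp (- a * (norm k)\<^sup>2)))"
    unfolding eq by (rule lborel_prod_vec(1)) (rule i)
  then show ii: "integrable lborel (\<lambda>k :: real ^ 'd. exp (- a * (norm k)\<^sup>2))"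
    using complex_of_real_integrable_eq by blast
  have "complex_of_real (integral\<^sup>L lborel (\<lambda>k :: real ^ 'd. exp (- a * (norm k)\<^sup>2)))
     = (\<Prod>i\<in>(UNIV::'d set). complex_of_real (sqrt (pi / a)))"
    unfolding integral_complex_of_real[symmetric] eq by (subst lborel_prod_vec(2)[OF i]) (simp only: I)
  also have "\<dots> = complex_of_real (sqrt (pi / a) ^ CARD('d))" by simp
  finally have "integral\<^sup>L lborel (\<lambda>k :: real ^ 'd. exp (- a * (norm k)\<^sup>2)) = sqrt (pi / a) ^ CARD('d)"
    by (simp only: of_real_eq_iff)
  also have "\<dots> = (pi / a) powr (CARD('d) / 2)"
    using a by (simp add: powr_half_sqrt[symmetric] powr_powr flip: powr_realpow)
  finally show "integral\<^sup>L lborel (\<lambda>k :: real ^ 'd. exp (- a * (norm k)\<^sup>2)) = (pi / a) powr (CARD('d) / 2)" .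
qed

text \<open>The substitution by \<open>C\<close>, the normal form of \<open>L\<close> scaled by 1 /
  sqrt t, turns the quadratic form into the standard one; its determinant supplies the
  prefactor.\<close>

lemma gaussian_fourier:
  fixes L :: "real ^ 'd::finite ^ 'd" and z :: "real ^ 'd"
  assumes sym: "transpose L = L" and pos: "\<And>x. x \<noteq> 0 \<Longrightarrow> 0 < x \<bullet> (L *v x)" and t: "t > 0"
  shows "integrable lborel (\<lambda>k. exp (\<i> * complex_of_real (z \<bullet> k)) * complex_of_real (exp (- t * (k \<bullet> (L *v k)) / 2))) \<Longrightarrow>
    integral\<^sup>L lborel (\<lambda>k. exp (\<i> * complex_of_real (z \<bullet> k)) * complex_of_real (exp (- t * (k \<bullet> (L *v k)) / 2)))
    = complex_of_real ((2 * pi / t) powr (CARD('d) / 2) / sqrt (det L) * exp (- (z \<bullet> (matrix_inv L *v z)) / (2 * t)))"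
proof -
  let ?f = "\<lambda>k. exp (\<i> * complex_of_real (z \<bullet> k)) * complex_of_real (exp (- t * (k \<bullet> (L *v k)) / 2))"
  assume int: "integrable lborel ?f"
  obtain B :: "real ^ 'd ^ 'd" where B: "det B \<noteq> 0" "\<bar>det B\<bar> = 1 / sqrt (det L)" "0 < det L"
    "\<And>x. (B *v x) \<bullet> (L *v (B *v x)) = x \<bullet> x"
    "\<And>z. (transpose B *v z) \<bullet> (transpose B *v z) = z \<bullet> (matrix_inv L *v z)"
    using posdef_normal_form[OF sym pos] by metis
  define s where "s = 1 / sqrt t"
  have s: "s > 0" "s\<^sup>2 = 1 / t" using t by (auto simp: s_def power_divide)
  define C where "C = s *\<^sub>R B"
  have Cv: "C *v p = s *\<^sub>R (B *v p)" for p unfolding C_def by (simp add: scaleR_matrix_vector_assoc)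
  have dC: "det C = s ^ CARD('d) * det B" 
  proof -
    have "C = (\<chi> i. s *s B $ i)" by (simp add: C_def vec_eq_iff)
    then show ?thesis using det_rows_mul[of "\<lambda>_. s" "\<lambda>i. B $ i"] by simp
  qed
  have ac: "\<bar>det C\<bar> = s ^ CARD('d) / sqrt (det L)" using s B by (simp add: dC abs_mult)
  let ?w = "s *\<^sub>R (transpose B *v z)"
  have zB: "z \<bullet> (C *v p) = ?w \<bullet> p" for p
    by (simp add: Cv) (metis dot_lmul_matrix inner_commute transpose_transpose vector_transpose_matrix)
  have "L *v (C *v p) = s *\<^sub>R (L *v (B *v p))" for p by (simp add: Cv matrix_vector_mult_scaleR)
  then have q: "t * ((C *v p) \<bullet> (L *v (C *v p))) = p \<bullet> p" for p
    using s t by (simp add: Cv B(4) power2_eq_square[symmetric] flip: mult.assoc)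
  have "integral\<^sup>L lborel ?f = of_real \<bar>det C\<bar> * integral\<^sup>L lborel (\<lambda>p. ?f (C *v p))"
    by (rule lborel_integral_linear[OF int]) (use s B in \<open>simp add: dC\<close>)
  also have "(\<lambda>p. ?f (C *v p)) = (\<lambda>p. exp (\<i> * complex_of_real (?w \<bullet> p)) * complex_of_real (exp (- (p \<bullet> p) / 2)))"
    by (rule ext) (simp only: zB q minus_mult_left[symmetric] mult.assoc)
  also have "integral\<^sup>L lborel \<dots> = complex_of_real (sqrt (2 * pi) ^ CARD('d) * exp (- (?w \<bullet> ?w) / 2))"
    by (rule gaussian_std_fourier(2))
  also have "?w \<bullet> ?w = (z \<bullet> (matrix_inv L *v z)) / t"
  proof -
    have "?w \<bullet> ?w = s\<^sup>2 * ((transpose B *v z) \<bullet> (transpose B *v z))" by (simp add: power2_eq_square)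
    then show ?thesis by (simp only: B(5) s) simp
  qed
  also have "\<bar>det C\<bar> = s ^ CARD('d) / sqrt (det L)" by (rule ac)
  finally have int_eq: "integral\<^sup>L lborel ?f = complex_of_real (s ^ CARD('d) / sqrt (det L) * (sqrt (2 * pi) ^ CARD('d) *
     exp (- (z \<bullet> (matrix_inv L *v z) / t) / 2)))"
    by (simp only: of_real_mult)
  have pw: "s ^ CARD('d) * sqrt (2 * pi) ^ CARD('d) = (2 * pi / t) powr (CARD('d) / 2)"
  proof -
    have "s ^ CARD('d) * sqrt (2 * pi) ^ CARD('d) = sqrt (2 * pi / t) ^ CARD('d)"
      by (simp add: s_def power_mult_distrib[symmetric] real_sqrt_divide)
    also have "\<dots> = (2 * pi / t) powr (CARD('d) / 2)"
      using t by (simp add: powr_half_sqrt[symmetric] powr_powr flip: powr_realpow)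
    finally show ?thesis .
  qed
  show "integral\<^sup>L lborel ?f = complex_of_real ((2 * pi / t) powr (CARD('d) / 2) / sqrt (det L) *
     exp (- (z \<bullet> (matrix_inv L *v z)) / (2 * t)))"
    unfolding int_eq pw[symmetric]
    by (rule arg_cong[where f = complex_of_real]) (simp add: field_simps)
qed

section \<open>Kernels with moments and the tail estimate\<close>

text \<open>The gap of the lattice at 0: it lets higher moments dominate lower ones without any
  additional constant.\<close>

lemma norm_rvec_cases: "norm (rvec y) = 0 \<or> norm (rvec (y :: int ^ 'd::finite)) \<ge> 1"
proof (cases "y = 0")
  case False
  then obtain i where i: "y $ i \<noteq> 0" by (auto simp: vec_eq_iff)
  have "1 \<le> \<bar>rvec y $ i\<bar>" using i by (simp add: rvec_def)
  also have "\<dots> \<le> norm (rvec y)" by (rule component_le_norm_cart)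
  finally show ?thesis by simp
qed simp

lemma norm_rvec_powr_mono:
  assumes "0 < p" "p \<le> q"
  shows "norm (rvec (y :: int ^ 'd::finite)) powr p \<le> norm (rvec y) powr q"
  using norm_rvec_cases[of y] assms by (auto intro: powr_mono)

lemma norm_rvec_power_le:
  assumes "0 < n" "real n \<le> q"
  shows "norm (rvec (y :: int ^ 'd::finite)) ^ n \<le> norm (rvec y) powr q"
  using norm_rvec_cases[of y]
proof
  assume "norm (rvec y) \<ge> 1"
  then have "norm (rvec y) ^ n = norm (rvec y) powr real n"
    using powr_realpow[of "norm (rvec y)" n] by (metis less_le_trans zero_less_one)
  also have "\<dots> \<le> norm (rvec y) powr q"
    using \<open>norm (rvec y) \<ge> 1\<close> assms by (intro powr_mono) auto
  finally show ?thesis .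
qed (use assms in \<open>auto simp: zero_power\<close>)

definition trunc :: "real \<Rightarrow> (int ^ 'd::finite \<Rightarrow> real) \<Rightarrow> int ^ 'd \<Rightarrow> real" where
  "trunc R f y = (if norm (rvec y) \<le> R then f y else 0)"

definition cotrunc :: "real \<Rightarrow> (int ^ 'd::finite \<Rightarrow> real) \<Rightarrow> int ^ 'd \<Rightarrow> real" where
  "cotrunc R f y = (if norm (rvec y) \<le> R then 0 else f y)"

lemma in_lp_1_mono:
  assumes "in_lp 1 f" "\<And>y. \<bar>g y\<bar> \<le> c * \<bar>f y\<bar>"
  shows "in_lp 1 g"
  unfolding in_lp_1_iff
  by (rule summable_on_comparison_test[OF summable_on_cmult_right[of "\<lambda>x. \<bar>f x\<bar>" UNIV c]])
     (use assms in \<open>auto simp: in_lp_1_iff\<close>)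

lemma in_lp_trunc: "in_lp 1 f \<Longrightarrow> in_lp 1 (trunc R f)"
  and in_lp_cotrunc: "in_lp 1 f \<Longrightarrow> in_lp 1 (cotrunc R f)"
  by (rule in_lp_1_mono[where c = 1]; auto simp: trunc_def cotrunc_def)+

lemma fourier_trunc:
  assumes "in_lp 1 f"
  shows "fourier f k = fourier (trunc R f) k + fourier (cotrunc R f) k"
proof -
  have "fourier (trunc R f) k + fourier (cotrunc R f) k
    = (\<Sum>\<^sub>\<infinity>x. complex_of_real (trunc R f x) * phase (- x) k + complex_of_real (cotrunc R f x) * phase (- x) k)"
    unfolding fourier_eq
    by (rule infsum_add[symmetric]) (intro fourier_summable in_lp_trunc in_lp_cotrunc assms)+
  also have "\<dots> = fourier f k"
    unfolding fourier_eq by (rule infsum_cong) (simp add: trunc_def cotrunc_def)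
  finally show ?thesis by simp
qed

lemma tilt_trunc_bound:
  assumes "norm v \<le> 1" "0 \<le> \<beta>" "0 \<le> R"
  shows "\<bar>tilt (\<beta> *\<^sub>R v) (trunc R f) y\<bar> \<le> exp (\<beta> * R) * \<bar>f y\<bar>"
proof (cases "norm (rvec y) \<le> R")
  case True
  have "v \<bullet> rvec y \<le> norm v * norm (rvec y)" by (rule norm_cauchy_schwarz)
  also have "\<dots> \<le> 1 * R" using assms True by (intro mult_mono) auto
  finally have "\<beta> * (v \<bullet> rvec y) \<le> \<beta> * R" using assms by (intro mult_left_mono) auto
  then show ?thesis using True by (simp add: tilt_def trunc_def abs_mult mult.commute mult_left_mono)
qed (auto simp: tilt_def trunc_def)

lemma in_lp_tilt_trunc:
  assumes "norm v \<le> 1" "0 \<le> \<beta>" "0 \<le> R" "in_lp 1 f"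
  shows "in_lp 1 (tilt (\<beta> *\<^sub>R v) (trunc R f))"
    and "l1_norm (tilt (\<beta> *\<^sub>R v) (trunc R f)) \<le> exp (\<beta> * R) * l1_norm f"
proof -
  show i: "in_lp 1 (tilt (\<beta> *\<^sub>R v) (trunc R f))"
    by (rule in_lp_1_mono[where f = f and c = "exp (\<beta> * R)", OF assms(4) tilt_trunc_bound[OF assms(1-3), of f]])
  have "l1_norm (tilt (\<beta> *\<^sub>R v) (trunc R f)) \<le> (\<Sum>\<^sub>\<infinity>y. exp (\<beta> * R) * \<bar>f y\<bar>)"
    unfolding l1_norm_def
    by (rule infsum_mono) (use i assms(4) tilt_trunc_bound[OF assms(1-3), of f] in
        \<open>auto simp: in_lp_1_iff intro!: summable_on_cmult_right\<close>)
  then show "l1_norm (tilt (\<beta> *\<^sub>R v) (trunc R f)) \<le> exp (\<beta> * R) * l1_norm f"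
    by (simp add: l1_norm_def infsum_cmult_right')
qed

text \<open>The analogues of \<open>eta\<close> and \<open>Lambda\<close> for an arbitrary kernel,
  so that the analytic estimates can be stated without a maximiser.\<close>

definition drift :: "(int ^ 'd::finite \<Rightarrow> real) \<Rightarrow> real ^ 'd" where
  "drift Q = (\<chi> j. \<Sum>\<^sub>\<infinity>y. real_of_int (y $ j) * Q y)"

definition covar :: "(int ^ 'd::finite \<Rightarrow> real) \<Rightarrow> real ^ 'd ^ 'd" where
  "covar Q = (\<chi> j l. \<Sum>\<^sub>\<infinity>y. real_of_int (y $ j) * real_of_int (y $ l) * Q y)"

text \<open>The mean value inequality on a half plane. The bound keeps the full decay that the two
  exponentials share, which later is the Gaussian weight.\<close>

lemma exp_diff_bound:
  fixes a b :: complex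
  assumes "Re a \<le> c" "Re b \<le> c"
  shows "norm (exp a - exp b) \<le> norm (a - b) * exp c"
proof -
  have "norm (exp a - exp b) \<le> exp c * norm (a - b)"
  proof (rule field_differentiable_bound[where S = "{z. Re z \<le> c}" and f' = exp])
    show "convex {z. Re z \<le> c}" by (rule convex_halfspace_Re_le)
    show "(exp has_field_derivative exp z) (at z within {z. Re z \<le> c})" for z
      by (rule DERIV_subset[OF DERIV_exp]) auto
  qed (use assms in auto)
  then show ?thesis by (simp add: mult.commute)
qed

lemma abs_exp_minus_linear: "\<bar>exp a - 1 - a\<bar> \<le> a\<^sup>2 / 2 * exp \<bar>a\<bar>" for a :: real
proof -
  obtain t where t: "\<bar>t\<bar> \<le> \<bar>a\<bar>" "exp a = (\<Sum>m<2. a ^ m / fact m) + exp t / fact 2 * a ^ 2"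
    using Maclaurin_exp_le[of a 2] by auto
  have eq: "exp a - 1 - a = a\<^sup>2 / 2 * exp t" using t(2) by (simp add: numeral_2_eq_2)
  have "\<bar>exp a - 1 - a\<bar> = a\<^sup>2 / 2 * exp t" unfolding eq by simp
  moreover have "exp t \<le> exp \<bar>a\<bar>" using t(1) by simp
  ultimately show ?thesis using mult_left_mono[of "exp t" "exp \<bar>a\<bar>" "a\<^sup>2 / 2"] by simp
qed

lemma Re_phase_minus: "Re (phase (- y) k) = cos (k \<bullet> rvec y)"
  by (simp add: phase_def rvec_minus Re_exp)

lemma has_sum_finite_sum:
  fixes f :: "'i \<Rightarrow> 'a \<Rightarrow> 'b::real_normed_vector"
  assumes "finite I" "\<And>i. i \<in> I \<Longrightarrow> (f i has_sum s i) A"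
  shows "((\<lambda>x. \<Sum>i\<in>I. f i x) has_sum (\<Sum>i\<in>I. s i)) A"
  using assms by (induction I rule: finite_induct) (auto intro!: has_sum_add)

lemma has_sum_diff:
  fixes f g :: "'a \<Rightarrow> 'b::real_normed_vector"
  assumes "(f has_sum s) A" "(g has_sum t) A"
  shows "((\<lambda>x. f x - g x) has_sum (s - t)) A"
  using has_sum_add[OF assms(1), of "\<lambda>x. - g x" "- t"] assms(2) by (simp add: has_sum_uminus)

lemma fourier_0: "fourier f 0 = complex_of_real (\<Sum>\<^sub>\<infinity>x. f x)"
proof -
  have "(\<Sum>\<^sub>\<infinity>x. complex_of_real (f x)) = complex_of_real (\<Sum>\<^sub>\<infinity>x. f x)"
    by (rule infsum_bounded_linear_strong[OF summable_on_bounded_linear_iff[OF bounded_linear_of_real bounded_linear_Re]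
          bounded_linear_of_real]) simp
  then show ?thesis by (simp add: fourier_eq)
qed

text \<open>The properties that hold for every tilt in the closure of the domain. The unit mass,
  available only at its boundary, is added in \<open>walk_kernel\<close>; the convexity argument
  needs the drift and covariance of all tilts.\<close>

locale kernel_moments =
  fixes M K z :: real and Q :: "int ^ 'd::finite \<Rightarrow> real"
  assumes M: "0 < M" and K: "0 < K" and z: "0 < z" "z \<le> 1"
    and Q_l1: "in_lp 1 Q" and Q_norm: "l1_norm Q \<le> M"
    and Q_mom: "(\<lambda>y. norm (rvec y) powr (2 + z) * \<bar>Q y\<bar>) summable_on UNIV"
      "(\<Sum>\<^sub>\<infinity>y. norm (rvec y) powr (2 + z) * \<bar>Q y\<bar>) \<le> M"
    and infrared: "\<And>k. k \<in> torus \<Longrightarrow> K * (norm k)\<^sup>2 \<le> Re (fourier Q 0 - fourier Q k)"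
begin

lemma moment_sum:
  fixes F :: "int ^ 'd \<Rightarrow> 'b::banach"
  assumes "\<And>y. norm (F y) \<le> c * (norm (rvec y) powr (2 + z) * \<bar>Q y\<bar>)" "0 \<le> c"
  shows "F summable_on UNIV" "norm (infsum F UNIV) \<le> c * M"
proof -
  have s: "(\<lambda>y. c * (norm (rvec y) powr (2 + z) * \<bar>Q y\<bar>)) summable_on UNIV"
    by (rule summable_on_cmult_right) (rule Q_mom)
  show "F summable_on UNIV" by (rule infsum_comparison(1)[OF assms(1) s])
  have "norm (infsum F UNIV) \<le> (\<Sum>\<^sub>\<infinity>y. c * (norm (rvec y) powr (2 + z) * \<bar>Q y\<bar>))"
    by (rule infsum_comparison(2)[OF assms(1) s])
  also have "\<dots> \<le> c * M" using Q_mom(2) assms(2) by (simp add: infsum_cmult_right' mult_left_mono)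
  finally show "norm (infsum F UNIV) \<le> c * M" .
qed

lemma moment_sum_power:
  fixes F :: "int ^ 'd \<Rightarrow> 'b::banach"
  assumes "\<And>y. norm (F y) \<le> c * (norm (rvec y) ^ n * \<bar>Q y\<bar>)" "0 \<le> c" "n = 1 \<or> n = 2"
  shows "F summable_on UNIV" "norm (infsum F UNIV) \<le> c * M"
proof -
  have "norm (F y) \<le> c * (norm (rvec y) powr (2 + z) * \<bar>Q y\<bar>)" for y
    by (rule order.trans[OF assms(1)], intro mult_left_mono mult_right_mono norm_rvec_power_le)
       (use assms z in auto)
  from moment_sum[OF this assms(2)] show "F summable_on UNIV" "norm (infsum F UNIV) \<le> c * M" by auto
qed

lemma Q_summable: "Q summable_on UNIV"
  by (rule infsum_comparison(1)[of _ "\<lambda>y. \<bar>Q y\<bar>"]) (use Q_l1 in \<open>auto simp: in_lp_1_iff\<close>)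

lemma inner_drift: "((\<lambda>y. (v \<bullet> rvec y) * Q y) has_sum (v \<bullet> drift Q)) UNIV"
proof -
  have "((\<lambda>y. \<Sum>j\<in>UNIV. v $ j * (real_of_int (y $ j) * Q y)) has_sum (\<Sum>j\<in>UNIV. v $ j * drift Q $ j)) UNIV"
  proof (rule has_sum_finite_sum)
    fix j :: 'd
    have "(\<lambda>y. real_of_int (y $ j) * Q y) summable_on UNIV"
    proof (rule moment_sum_power(1)[where c = 1 and n = 1])
      fix y :: "int ^ 'd"
      have "\<bar>rvec y $ j\<bar> \<le> norm (rvec y)" by (rule component_le_norm_cart)
      then show "norm (real_of_int (y $ j) * Q y) \<le> 1 * (norm (rvec y) ^ 1 * \<bar>Q y\<bar>)"
        by (simp add: abs_mult rvec_def mult_right_mono)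
    qed auto
    then show "((\<lambda>y. v $ j * (real_of_int (y $ j) * Q y)) has_sum v $ j * drift Q $ j) UNIV"
      unfolding drift_def by (auto intro!: has_sum_cmult_right)
  qed auto
  then show ?thesis by (simp add: inner_vec_def rvec_def sum_distrib_left mult_ac)
qed

lemma inner_covar: "((\<lambda>y. (v \<bullet> rvec y)\<^sup>2 * Q y) has_sum (v \<bullet> (covar Q *v v))) UNIV"
proof -
  have "((\<lambda>y. \<Sum>j\<in>UNIV. \<Sum>l\<in>UNIV. v $ j * v $ l * (real_of_int (y $ j) * real_of_int (y $ l) * Q y)) has_sum
     (\<Sum>j\<in>UNIV. \<Sum>l\<in>UNIV. v $ j * v $ l * covar Q $ j $ l)) UNIV"
  proof (intro has_sum_finite_sum)
    fix j l :: 'd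
    have "(\<lambda>y. real_of_int (y $ j) * real_of_int (y $ l) * Q y) summable_on UNIV"
    proof (rule moment_sum_power(1)[where c = 1 and n = 2])
      fix y :: "int ^ 'd"
      have "\<bar>rvec y $ j\<bar> * \<bar>rvec y $ l\<bar> \<le> norm (rvec y) * norm (rvec y)"
        by (intro mult_mono component_le_norm_cart) auto
      then show "norm (real_of_int (y $ j) * real_of_int (y $ l) * Q y) \<le> 1 * (norm (rvec y) ^ 2 * \<bar>Q y\<bar>)"
        by (simp add: abs_mult rvec_def mult_right_mono power2_eq_square)
    qed auto
    then show "((\<lambda>y. v $ j * v $ l * (real_of_int (y $ j) * real_of_int (y $ l) * Q y)) has_sum
        v $ j * v $ l * covar Q $ j $ l) UNIV"
      unfolding covar_def by (auto intro!: has_sum_cmult_right)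
  qed auto
  then show ?thesis
    by (simp add: inner_vec_def rvec_def sum_distrib_right sum_distrib_left mult_ac power2_eq_square matrix_vector_mult_def)
qed

text \<open>Markov's inequality for the moment of order 2 + z.\<close>

lemma l1_norm_cotrunc_Q:
  assumes "1 \<le> R"
  shows "l1_norm (cotrunc R Q) \<le> M * R powr (- 2 - z)"
proof -
  have le: "norm (\<bar>cotrunc R Q y\<bar>) \<le> R powr (- 2 - z) * (norm (rvec y) powr (2 + z) * \<bar>Q y\<bar>)" for y
  proof (cases "norm (rvec y) \<le> R")
    case False
    then have "R powr (2 + z) \<le> norm (rvec y) powr (2 + z)" using assms z by (intro powr_mono2) auto
    then have "R powr (- 2 - z) * R powr (2 + z) \<le> R powr (- 2 - z) * norm (rvec y) powr (2 + z)"
      by (intro mult_left_mono) auto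
    then have "1 \<le> R powr (- 2 - z) * norm (rvec y) powr (2 + z)"
      using assms by (simp flip: powr_add)
    then have "\<bar>Q y\<bar> * 1 \<le> \<bar>Q y\<bar> * (R powr (- 2 - z) * norm (rvec y) powr (2 + z))"
      by (intro mult_left_mono) auto
    then show ?thesis using False by (simp add: cotrunc_def mult_ac)
  qed (auto simp: cotrunc_def)
  have "norm (\<Sum>\<^sub>\<infinity>y. \<bar>cotrunc R Q y\<bar>) \<le> R powr (- 2 - z) * M"
    by (rule moment_sum(2)[OF le]) auto
  then show ?thesis using l1_norm_nonneg[of "cotrunc R Q"] by (simp add: l1_norm_def mult.commute)
qed

lemma Re_fourier: "((\<lambda>y. Q y * cos (k \<bullet> rvec y)) has_sum Re (fourier Q k)) UNIV"
proof -
  have "((\<lambda>y. complex_of_real (Q y) * phase (- y) k) has_sum fourier Q k) UNIV"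
    unfolding fourier_eq using fourier_summable[OF Q_l1] by (rule has_sum_infsum)
  from has_sum_Re[OF this] show ?thesis
    by (simp add: Re_phase_minus)
qed

end

text \<open>Weighted l2 bounds are the form that Parseval consumes. The exponent
  \<open>max 2 (CARD('d) - 1)\<close> merges the bound on \<open>g\<close> in part (c), used for d
  \<le> 3, with the one in part (d), used for d \<ge> 4.\<close>

locale walk_kernel = kernel_moments M K z Q
  for M K z and Q :: "int ^ 'd::finite \<Rightarrow> real" +
  fixes g :: "int ^ 'd \<Rightarrow> real"
  assumes Q_mass: "(\<Sum>\<^sub>\<infinity>y. Q y) = 1"
    and g_l1: "in_lp 1 g" and g_norm: "l1_norm g \<le> M"
    and g_mom: "(\<lambda>y. norm (rvec y) powr z * \<bar>g y\<bar>) summable_on UNIV"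
      "(\<Sum>\<^sub>\<infinity>y. norm (rvec y) powr z * \<bar>g y\<bar>) \<le> M"
    and g_l2: "(\<lambda>y. (norm (rvec y) ^ max 2 (CARD('d) - 1) * g y)\<^sup>2) summable_on UNIV"
      "(\<Sum>\<^sub>\<infinity>y. (norm (rvec y) ^ max 2 (CARD('d) - 1) * g y)\<^sup>2) \<le> M\<^sup>2"
    and Q_l2: "4 \<le> CARD('d) \<Longrightarrow> (\<lambda>y. (norm (rvec y) ^ (CARD('d) - 1) * Q y)\<^sup>2) summable_on UNIV"
      "4 \<le> CARD('d) \<Longrightarrow> (\<Sum>\<^sub>\<infinity>y. (norm (rvec y) ^ (CARD('d) - 1) * Q y)\<^sup>2) \<le> M\<^sup>2"
begin

lemma Q_infrared: "k \<in> torus \<Longrightarrow> K * (norm k)\<^sup>2 \<le> 1 - Re (fourier Q k)"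
  using infrared[of k] by (simp add: fourier_0 Q_mass)

text \<open>\<open>M\<^sup>2 / K\<close> is the price of absorbing the mixed term
  \<open>M * \<beta> * norm k\<close> into half of the infrared term; \<open>2 * M\<close> collects
  the remaining second-moment errors.\<close>

definition rate :: real where "rate = 2 * M + M\<^sup>2 / K"

text \<open>Only the second moment of \<open>Q\<close> is used, so the correction to \<open>1 + \<beta> v \<bullet> \<eta> - K \<bar>k\<bar>\<^sup>2\<close> is linear in
  \<open>\<bar>k\<bar>\<close>; it is absorbed into half of the quadratic term.\<close>

lemma Re_fourier_tilt_trunc:
  assumes v: "norm v \<le> 1" and l: "0 \<le> \<beta>" and R: "1 \<le> R" and k: "k \<in> torus"
  shows "Re (fourier (tilt (\<beta> *\<^sub>R v) (trunc R Q)) k)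
    \<le> 1 + \<beta> * (v \<bullet> drift Q) - K / 2 * (norm k)\<^sup>2 + rate * (\<beta>\<^sup>2 * exp (\<beta> * R) + 1 / R\<^sup>2)"
proof -
  let ?a = "\<lambda>y. \<beta> * (v \<bullet> rvec y)" and ?T = "tilt (\<beta> *\<^sub>R v) (trunc R Q)"
  \<comment> \<open>The first two summands are the errors inside the truncation radius: the Taylor
    remainder of the exponential, and the linear term multiplied by \<open>cos - 1\<close>. The last
    two bound, outside the radius, the missing mass and the missing linear term.\<close>
  let ?c = "\<beta>\<^sup>2 * exp (\<beta> * R) / 2 + \<beta> * norm k + 1 / R\<^sup>2 + \<beta> / R"
  have c0: "0 \<le> ?c" using l R by simp
  have T1: "in_lp 1 ?T" by (rule in_lp_tilt_trunc(1)) (use v l R Q_l1 in auto)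
  have "((\<lambda>y. complex_of_real (?T y) * phase (- y) k) has_sum fourier ?T k) UNIV"
    unfolding fourier_eq using fourier_summable[OF T1] by (rule has_sum_infsum)
  from has_sum_Re[OF this] have h1: "((\<lambda>y. ?T y * cos (k \<bullet> rvec y)) has_sum Re (fourier ?T k)) UNIV"
    by (simp add: Re_phase_minus)
  have h2: "((\<lambda>y. ?T y * cos (k \<bullet> rvec y) - Q y * cos (k \<bullet> rvec y) - \<beta> * ((v \<bullet> rvec y) * Q y)) has_sum
    (Re (fourier ?T k) - Re (fourier Q k) - \<beta> * (v \<bullet> drift Q))) UNIV"
    by (intro has_sum_diff h1 Re_fourier has_sum_cmult_right inner_drift)
  have ay: "\<bar>?a y\<bar> \<le> \<beta> * norm (rvec y)" for y
  proof -
    have "\<bar>v \<bullet> rvec y\<bar> \<le> norm v * norm (rvec y)" by (rule Cauchy_Schwarz_ineq2)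
    also have "\<dots> \<le> 1 * norm (rvec y)" using v by (intro mult_right_mono) auto
    finally show ?thesis using l by (simp add: abs_mult mult_left_mono)
  qed
  have cos1: "\<bar>cos b - 1\<bar> \<le> \<bar>b\<bar>" for b :: real
  proof -
    have "norm (iexp b - 1) \<le> \<bar>b\<bar>" using iexp_approx1[of b 0] by simp
    moreover have "Re (iexp b - 1) = cos b - 1" by (simp add: Re_exp)
    ultimately show ?thesis using abs_Re_le_cmod[of "iexp b - 1"] by linarith
  qed
  have le: "norm (?T y * cos (k \<bullet> rvec y) - Q y * cos (k \<bullet> rvec y) - \<beta> * ((v \<bullet> rvec y) * Q y))
     \<le> ?c * (norm (rvec y) ^ 2 * \<bar>Q y\<bar>)" for y
  proof (cases "norm (rvec y) \<le> R")
    case True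
    have "?T y * cos (k \<bullet> rvec y) - Q y * cos (k \<bullet> rvec y) - \<beta> * ((v \<bullet> rvec y) * Q y)
      = Q y * ((exp (?a y) - 1 - ?a y) * cos (k \<bullet> rvec y) + ?a y * (cos (k \<bullet> rvec y) - 1))"
      using True by (simp add: tilt_def trunc_def algebra_simps)
    also have "norm \<dots> \<le> \<bar>Q y\<bar> * (\<bar>exp (?a y) - 1 - ?a y\<bar> * 1 + \<bar>?a y\<bar> * \<bar>cos (k \<bullet> rvec y) - 1\<bar>)"
      unfolding real_norm_def abs_mult
      by (intro mult_left_mono abs_triangle_ineq[THEN order.trans] add_mono)
         (auto simp: abs_mult intro!: mult_left_le)
    also have "\<dots> \<le> \<bar>Q y\<bar> * ((\<beta> * norm (rvec y))\<^sup>2 / 2 * exp (\<beta> * R) + (\<beta> * norm (rvec y)) * (norm k * norm (rvec y)))"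
    proof (intro mult_left_mono add_mono)
      have "\<bar>exp (?a y) - 1 - ?a y\<bar> \<le> (?a y)\<^sup>2 / 2 * exp \<bar>?a y\<bar>" by (rule abs_exp_minus_linear)
      also have "\<dots> \<le> (\<beta> * norm (rvec y))\<^sup>2 / 2 * exp (\<beta> * R)"
      proof (intro mult_mono divide_right_mono)
        show "(?a y)\<^sup>2 \<le> (\<beta> * norm (rvec y))\<^sup>2" using ay[of y] power_mono[OF ay[of y], of 2] by simp
        have "\<beta> * norm (rvec y) \<le> \<beta> * R" using True l by (intro mult_left_mono)
        then show "exp \<bar>?a y\<bar> \<le> exp (\<beta> * R)" using ay[of y] by simp
      qed auto
      finally show "\<bar>exp (?a y) - 1 - ?a y\<bar> * 1 \<le> (\<beta> * norm (rvec y))\<^sup>2 / 2 * exp (\<beta> * R)" by simp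
      show "\<bar>?a y\<bar> * \<bar>cos (k \<bullet> rvec y) - 1\<bar> \<le> (\<beta> * norm (rvec y)) * (norm k * norm (rvec y))"
        by (intro mult_mono ay order.trans[OF cos1 Cauchy_Schwarz_ineq2]) (use l in auto)
    qed auto
    also have "\<dots> = (\<beta>\<^sup>2 * exp (\<beta> * R) / 2 + \<beta> * norm k) * (norm (rvec y) ^ 2 * \<bar>Q y\<bar>)"
      by (simp add: power2_eq_square field_simps)
    also have "\<dots> \<le> ?c * (norm (rvec y) ^ 2 * \<bar>Q y\<bar>)"
      using l R by (intro mult_right_mono) auto
    finally show ?thesis .
  next
    case False
    have "norm (?T y * cos (k \<bullet> rvec y) - Q y * cos (k \<bullet> rvec y) - \<beta> * ((v \<bullet> rvec y) * Q y))
      = \<bar>Q y\<bar> * \<bar>cos (k \<bullet> rvec y) + ?a y\<bar>"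
      using False by (simp add: tilt_def trunc_def flip: abs_mult) (simp add: abs_minus_commute algebra_simps)
    also have "\<dots> \<le> \<bar>Q y\<bar> * (1 + \<beta> * norm (rvec y))"
      by (intro mult_left_mono abs_triangle_ineq[THEN order.trans] add_mono ay) auto
    also have "\<dots> \<le> \<bar>Q y\<bar> * ((norm (rvec y))\<^sup>2 * (1 / R\<^sup>2) + \<beta> * (norm (rvec y) * (norm (rvec y) / R)))"
    proof (intro mult_left_mono add_mono)
      have "R\<^sup>2 \<le> (norm (rvec y))\<^sup>2" using False R by (intro power_mono) auto
      then show "1 \<le> (norm (rvec y))\<^sup>2 * (1 / R\<^sup>2)" using R by (simp add: field_simps)
      have "1 \<le> norm (rvec y) / R" using False R by simp
      then show "norm (rvec y) \<le> norm (rvec y) * (norm (rvec y) / R)"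
        using mult_left_mono[of 1 "norm (rvec y) / R" "norm (rvec y)"] by simp
    qed (use l in auto)
    also have "\<dots> = (1 / R\<^sup>2 + \<beta> / R) * (norm (rvec y) ^ 2 * \<bar>Q y\<bar>)"
      by (simp add: power2_eq_square field_simps)
    also have "\<dots> \<le> ?c * (norm (rvec y) ^ 2 * \<bar>Q y\<bar>)"
      using l R by (intro mult_right_mono) auto
    finally show ?thesis .
  qed
  have "norm (\<Sum>\<^sub>\<infinity>y. ?T y * cos (k \<bullet> rvec y) - Q y * cos (k \<bullet> rvec y) - \<beta> * ((v \<bullet> rvec y) * Q y)) \<le> ?c * M"
    by (rule moment_sum_power(2)[OF le c0]) simp
  then have A: "Re (fourier ?T k) \<le> Re (fourier Q k) + \<beta> * (v \<bullet> drift Q) + ?c * M"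
    by (simp add: infsumI[OF h2])
  \<comment> \<open>Completing the square in \<open>K * norm k - M * \<beta>\<close>.\<close>
  have B: "M * \<beta> * norm k \<le> K / 2 * (norm k)\<^sup>2 + M\<^sup>2 / K * \<beta>\<^sup>2"
  proof -
    have "0 \<le> (K * norm k - M * \<beta>)\<^sup>2 / (2 * K) + M\<^sup>2 * \<beta>\<^sup>2 / (2 * K)" using K by simp
    also have "\<dots> = K / 2 * (norm k)\<^sup>2 - M * \<beta> * norm k + M\<^sup>2 / K * \<beta>\<^sup>2"
      using K by (simp add: field_simps power2_eq_square)
    finally show ?thesis by simp
  qed
  have C: "\<beta> / R \<le> \<beta>\<^sup>2 / 2 + 1 / R\<^sup>2 / 2"
    using zero_le_power2[of "\<beta> - 1 / R"] by (simp add: power2_diff power_divide)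
  have D: "\<beta>\<^sup>2 \<le> \<beta>\<^sup>2 * exp (\<beta> * R)" using l R mult_left_mono[of 1 "exp (\<beta> * R)" "\<beta>\<^sup>2"] by simp
  have E: "M * (\<beta> / R) \<le> M * (\<beta>\<^sup>2 * exp (\<beta> * R) / 2 + 1 / R\<^sup>2 / 2)"
    using C D M by (intro mult_left_mono) auto
  have F: "M\<^sup>2 / K * \<beta>\<^sup>2 \<le> M\<^sup>2 / K * (\<beta>\<^sup>2 * exp (\<beta> * R))" using D K by (intro mult_left_mono) auto
  have G: "0 \<le> M * (\<beta>\<^sup>2 * exp (\<beta> * R))" "0 \<le> M * (1 / R\<^sup>2)" "0 \<le> M\<^sup>2 / K * (1 / R\<^sup>2)" using M K by auto
  have "?c * M = M * (\<beta>\<^sup>2 * exp (\<beta> * R)) / 2 + M * \<beta> * norm k + M * (1 / R\<^sup>2) + M * (\<beta> / R)"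
    by (simp add: algebra_simps)
  moreover have "rate * (\<beta>\<^sup>2 * exp (\<beta> * R) + 1 / R\<^sup>2) = 2 * (M * (\<beta>\<^sup>2 * exp (\<beta> * R))) + 2 * (M * (1 / R\<^sup>2))
     + M\<^sup>2 / K * (\<beta>\<^sup>2 * exp (\<beta> * R)) + M\<^sup>2 / K * (1 / R\<^sup>2)"
    by (simp add: rate_def algebra_simps)
  moreover have "M * (\<beta>\<^sup>2 * exp (\<beta> * R) / 2 + 1 / R\<^sup>2 / 2) = M * (\<beta>\<^sup>2 * exp (\<beta> * R)) / 2 + M * (1 / R\<^sup>2) / 2"
    by (simp add: algebra_simps)
  \<comment> \<open>The final bookkeeping is stated over real variables, so that the nonlinear
    expressions act as atoms of a linear inequality.\<close>
  moreover have "lhs \<le> 1 + p - K / 2 * (norm k)\<^sup>2 + (2 * X + 2 * Y + W + V)"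
    if "lhs \<le> q + p + (X / 2 + U + Y + T)" "U \<le> P / 2 + b" "T \<le> X / 2 + Y / 2" "b \<le> W"
      "0 \<le> X" "0 \<le> Y" "0 \<le> V" "P \<le> 1 - q" "P = K * (norm k)\<^sup>2" for lhs p q X Y W V U T P b :: real
    using that by simp
  ultimately show ?thesis using A B E F G Q_infrared[OF k]
    by (metis (no_types, lifting) times_divide_eq_left)
qed

section \<open>Decay of the inverse transform away from the drift line\<close>

lemma integral_torus_mono:
  fixes f :: "real ^ 'd \<Rightarrow> complex"
  assumes "continuous_on torus f" "continuous_on torus h" "\<And>k. k \<in> torus \<Longrightarrow> norm (f k) \<le> h k"
  shows "norm (integral torus f) \<le> integral torus h"
  using assms unfolding torus_def by (intro integral_norm_bound_integral integrable_continuous)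

text \<open>The factor \<open>M\<close> bounds the transform of \<open>g\<close> in two of the three
  pieces below, \<open>1\<close> belongs to the piece carrying the tail of \<open>g\<close>. In the
  exponent, 5 = 4 + 1 comes from \<open>tb\<close> and \<open>tR\<close>, and the summand
  \<open>M\<close> from \<open>Q2\<close>.\<close>

definition tail_const :: "nat \<Rightarrow> real" where
  "tail_const N = (M + 1) * exp ((5 * rate + M) * (real N)\<^sup>2)"

text \<open>Truncate \<open>Q\<close> and \<open>g\<close> at radius \<open>R = s / N\<close>. The truncated part is estimated by the contour shift
  \<open>\<beta> v\<close> with \<open>\<beta> R = ln \<rho>\<close>, for which \<open>t \<beta>\<^sup>2 exp (\<beta> R)\<close> stays bounded while \<open>exp (- \<beta> s) = \<rho>\<^sup>-\<^sup>N\<close>.\<close>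

lemma tail_estimate:
  fixes t s :: real and N :: nat
  defines "\<rho> \<equiv> s / sqrt t" and "R \<equiv> s / real N"
  assumes t: "0 < t" and v: "norm v \<le> 1" and s: "s = v \<bullet> (rvec x - t *\<^sub>R drift Q)"
    and N: "0 < N" and R: "1 \<le> R" and \<rho>: "1 \<le> \<rho>"
  shows "norm (integral torus (\<lambda>k. phase x k * fourier g k * exp (of_real t * (fourier Q k - 1))))
    \<le> tail_const N * (\<rho> / \<rho> ^ N * integral torus (\<lambda>k :: real ^ 'd. exp (- (t * (K / 2) * (norm k)\<^sup>2)))
        + integral torus (\<lambda>k. (t * norm (fourier (cotrunc R Q) k) + norm (fourier (cotrunc R g) k))
            * exp (- (t * K * (norm k)\<^sup>2))))"
proof -
  let ?n = "real N"
  define \<beta> where "\<beta> = ln \<rho> / R"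
  define c where "c = (5 * rate + M) * ?n\<^sup>2"
  let ?E = "\<lambda>k :: real ^ 'd. exp (- (t * K * (norm k)\<^sup>2))"
  let ?Q1 = "trunc R Q" and ?Q2 = "cotrunc R Q" and ?g1 = "trunc R g" and ?g2 = "cotrunc R g"
  have s0: "0 < s" using R N t by (simp add: R_def field_simps)
  have b0: "0 \<le> \<beta>" using \<rho> R by (simp add: \<beta>_def)
  have bR: "exp (\<beta> * R) = \<rho>" using \<rho> R by (simp add: \<beta>_def)
  have rate0: "0 \<le> rate" using M K by (simp add: rate_def)
  have tR: "t / R\<^sup>2 \<le> ?n\<^sup>2"
  proof -
    have "t / R\<^sup>2 = ?n\<^sup>2 / \<rho>\<^sup>2" using t s0 N by (simp add: R_def \<rho>_def power_divide field_simps)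
    also have "\<dots> \<le> ?n\<^sup>2 / 1" using \<rho> by (intro divide_left_mono) auto
    finally show ?thesis by simp
  qed
  \<comment> \<open>By ln \<rho> \<le> 2 sqrt \<rho> the product (ln \<rho>)^2 \<rho> is at most 4
    \<rho>^2, which cancels the \<rho>^2 in \<open>t / R\<^sup>2\<close>. This is why a shift of
    only logarithmic size in \<rho> is chosen.\<close>
  have tb: "t * (\<beta>\<^sup>2 * exp (\<beta> * R)) \<le> 4 * ?n\<^sup>2"
  proof -
    have "ln \<rho> = 2 * ln (sqrt \<rho>)" using \<rho> by (simp add: ln_sqrt)
    also have "\<dots> \<le> 2 * sqrt \<rho>" using \<rho> ln_le_minus_one[of "sqrt \<rho>"] by simp
    finally have "(ln \<rho>)\<^sup>2 \<le> (2 * sqrt \<rho>)\<^sup>2" using \<rho> by (intro power_mono) auto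
    then have l: "(ln \<rho>)\<^sup>2 \<le> 4 * \<rho>" using \<rho> by (simp add: power_mult_distrib)
    have "t * (\<beta>\<^sup>2 * exp (\<beta> * R)) = (t / R\<^sup>2) * ((ln \<rho>)\<^sup>2 * \<rho>)"
      unfolding bR by (simp add: \<beta>_def power_divide)
    also have "t / R\<^sup>2 = ?n\<^sup>2 / \<rho>\<^sup>2" using t s0 N by (simp add: R_def \<rho>_def power_divide field_simps)
    also have "?n\<^sup>2 / \<rho>\<^sup>2 * ((ln \<rho>)\<^sup>2 * \<rho>) \<le> ?n\<^sup>2 / \<rho>\<^sup>2 * ((4 * \<rho>) * \<rho>)"
      using l \<rho> by (intro mult_left_mono mult_right_mono) auto
    also have "\<dots> = 4 * ?n\<^sup>2" using \<rho> by (simp add: power2_eq_square)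
    finally show ?thesis .
  qed
  have Q2: "t * l1_norm ?Q2 \<le> M * ?n\<^sup>2"
  proof -
    have "l1_norm ?Q2 \<le> M * R powr (- 2 - z)" by (rule l1_norm_cotrunc_Q[OF R])
    also have "\<dots> \<le> M * R powr (- 2)" using R z M by (intro mult_left_mono powr_mono) auto
    also have "\<dots> = M / R\<^sup>2" using R by (simp add: powr_minus divide_inverse powr_numeral)
    finally have "l1_norm ?Q2 \<le> M / R\<^sup>2" .
    then have "t * l1_norm ?Q2 \<le> t * (M / R\<^sup>2)" using t by (intro mult_left_mono) auto
    then have "t * l1_norm ?Q2 \<le> M * (t / R\<^sup>2)" by (simp add: mult.commute)
    also have "M * (t / R\<^sup>2) \<le> M * ?n\<^sup>2" using tR M by (intro mult_left_mono) auto
    finally show ?thesis .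
  qed
  have c1: "M * ?n\<^sup>2 \<le> c" using rate0 by (simp add: c_def algebra_simps)
  have ReQ: "Re (of_real t * (fourier Q k - 1)) \<le> M * ?n\<^sup>2 - t * K * (norm k)\<^sup>2" if "k \<in> torus" for k
  proof -
    have "t * (Re (fourier Q k) - 1) \<le> t * (- K * (norm k)\<^sup>2)"
      using Q_infrared[OF that] t by (intro mult_left_mono) auto
    moreover have "0 \<le> M * ?n\<^sup>2" using M by simp
    ultimately show ?thesis by (simp add: mult.assoc)
  qed
  have ReQ1: "Re (of_real t * (fourier ?Q1 k - 1)) \<le> M * ?n\<^sup>2 - t * K * (norm k)\<^sup>2" if "k \<in> torus" for k
  proof -
    have "Re (fourier ?Q1 k) = Re (fourier Q k) - Re (fourier ?Q2 k)"
      using fourier_trunc[OF Q_l1, of k R] by simp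
    moreover have "- Re (fourier ?Q2 k) \<le> l1_norm ?Q2"
      using norm_fourier_le[OF in_lp_cotrunc[OF Q_l1], of R k] abs_Re_le_cmod[of "fourier ?Q2 k"] by linarith
    ultimately have "Re (fourier ?Q1 k) - 1 \<le> l1_norm ?Q2 - K * (norm k)\<^sup>2"
      using Q_infrared[OF that] by linarith
    then have "t * (Re (fourier ?Q1 k) - 1) \<le> t * (l1_norm ?Q2 - K * (norm k)\<^sup>2)"
      using t by (intro mult_left_mono) auto
    then show ?thesis using Q2 by (simp add: algebra_simps)
  qed
  have bound_exp: "exp (M * ?n\<^sup>2 - t * K * (norm k)\<^sup>2) \<le> exp c * ?E k" for k :: "real ^ 'd"
    using c1 by (simp add: mult.assoc flip: exp_add)
  note cont = continuous_intros Q_l1 g_l1 in_lp_trunc in_lp_cotrunc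
  let ?I1 = "\<lambda>k. phase x k * fourier ?g1 k * exp (of_real t * (fourier ?Q1 k - 1))"
  let ?I2 = "\<lambda>k. phase x k * fourier ?g2 k * exp (of_real t * (fourier ?Q1 k - 1))"
  let ?I3 = "\<lambda>k. phase x k * fourier g k * (exp (of_real t * (fourier Q k - 1)) - exp (of_real t * (fourier ?Q1 k - 1)))"
  have split: "phase x k * fourier g k * exp (of_real t * (fourier Q k - 1)) = ?I1 k + ?I2 k + ?I3 k" for k
    by (simp add: fourier_trunc[OF g_l1, of k R] algebra_simps)
  have "integral torus (\<lambda>k. phase x k * fourier g k * exp (of_real t * (fourier Q k - 1)))
    = integral torus ?I1 + integral torus ?I2 + integral torus ?I3"
    unfolding split torus_def
    by (simp add: integral_add integrable_add integrable_continuous cont)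
  then have "norm (integral torus (\<lambda>k. phase x k * fourier g k * exp (of_real t * (fourier Q k - 1))))
    \<le> norm (integral torus ?I1) + norm (integral torus ?I2) + norm (integral torus ?I3)"
    using norm_triangle_ineq[of "integral torus ?I1 + integral torus ?I2" "integral torus ?I3"]
      norm_triangle_ineq[of "integral torus ?I1" "integral torus ?I2"] by simp
  moreover have "norm (integral torus ?I1) \<le> tail_const N * (\<rho> / \<rho> ^ N * integral torus (\<lambda>k :: real ^ 'd. exp (- (t * (K / 2) * (norm k)\<^sup>2))))"
  proof -
    let ?tQ = "tilt (\<beta> *\<^sub>R v) ?Q1" and ?tg = "tilt (\<beta> *\<^sub>R v) ?g1"
    have l: "in_lp 1 ?tQ" "in_lp 1 ?tg" by (rule in_lp_tilt_trunc(1); use v b0 R Q_l1 g_l1 in auto)+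
    define \<sigma> where "\<sigma> = \<beta> * (v \<bullet> drift Q)"
    have e1: "integral torus ?I1 = of_real (exp (- t)) * integral torus (\<lambda>k. phase x k * fourier ?g1 k * exp (of_real t * fourier ?Q1 k))"
      by (subst integral_mult_right[symmetric]) 
         (simp_all add: exp_diff exp_minus right_diff_distrib divide_inverse mult_ac exp_of_real flip: of_real_inverse)
    have e2: "integral torus (\<lambda>k. phase x k * fourier ?tg k * exp (of_real t * fourier ?tQ k))
      = of_real (exp (\<beta> * (v \<bullet> rvec x))) * integral torus (\<lambda>k. phase x k * fourier ?g1 k * exp (of_real t * fourier ?Q1 k))"
      using integral_exp_fourier_tilt[OF in_lp_trunc[OF Q_l1] in_lp_trunc[OF g_l1] l, of x t] by simp
    have "integral torus ?I1 = of_real (exp (- t - \<beta> * (v \<bullet> rvec x))) *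
       integral torus (\<lambda>k. phase x k * fourier ?tg k * exp (of_real t * fourier ?tQ k))"
      unfolding e1 e2 by (simp add: exp_diff exp_minus divide_inverse flip: of_real_mult of_real_inverse)
    then have "norm (integral torus ?I1) = exp (- t - \<beta> * (v \<bullet> rvec x)) *
       norm (integral torus (\<lambda>k. phase x k * fourier ?tg k * exp (of_real t * fourier ?tQ k)))"
      by (simp add: norm_mult)
    also have "\<dots> \<le> exp (- t - \<beta> * (v \<bullet> rvec x)) *
       integral torus (\<lambda>k :: real ^ 'd. (\<rho> * M * exp (t + t * \<sigma> + c)) * exp (- (t * (K / 2) * (norm k)\<^sup>2)))"
    proof (intro mult_left_mono integral_torus_mono)
      fix k :: "real ^ 'd" assume k: "k \<in> torus"
      have "norm (fourier ?tg k) \<le> exp (\<beta> * R) * l1_norm g"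
        using norm_fourier_le[OF l(2), of k] in_lp_tilt_trunc(2)[OF v b0 _ g_l1, of R] R by linarith
      also have "\<dots> \<le> \<rho> * M" unfolding bR using g_norm \<rho> by (intro mult_left_mono) auto
      finally have G: "norm (fourier ?tg k) \<le> \<rho> * M" .
      have "t * Re (fourier ?tQ k) \<le> t * (1 + \<sigma> - K / 2 * (norm k)\<^sup>2 + rate * (\<beta>\<^sup>2 * exp (\<beta> * R) + 1 / R\<^sup>2))"
        using Re_fourier_tilt_trunc[OF v b0 R k] t unfolding \<sigma>_def by (intro mult_left_mono) auto
      also have "\<dots> = t + t * \<sigma> - t * (K / 2) * (norm k)\<^sup>2 + rate * (t * (\<beta>\<^sup>2 * exp (\<beta> * R)) + t / R\<^sup>2)"
        by (simp add: algebra_simps)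
      also have "\<dots> \<le> t + t * \<sigma> - t * (K / 2) * (norm k)\<^sup>2 + c"
      proof -
        have "rate * (t * (\<beta>\<^sup>2 * exp (\<beta> * R)) + t / R\<^sup>2) \<le> rate * (4 * ?n\<^sup>2 + ?n\<^sup>2)"
          by (intro mult_left_mono add_mono tb tR rate0)
        also have "\<dots> \<le> c" using M by (simp add: c_def algebra_simps)
        finally show ?thesis by simp
      qed
      finally have "norm (exp (of_real t * fourier ?tQ k)) \<le> exp (t + t * \<sigma> + c) * exp (- (t * (K / 2) * (norm k)\<^sup>2))"
        by (simp add: norm_exp_eq_Re flip: exp_add)
      then have "norm (fourier ?tg k) * norm (exp (of_real t * fourier ?tQ k))
        \<le> (\<rho> * M) * (exp (t + t * \<sigma> + c) * exp (- (t * (K / 2) * (norm k)\<^sup>2)))"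
        using \<rho> M by (intro mult_mono G) auto
      then show "norm (phase x k * fourier ?tg k * exp (of_real t * fourier ?tQ k))
        \<le> (\<rho> * M * exp (t + t * \<sigma> + c)) * exp (- (t * (K / 2) * (norm k)\<^sup>2))"
        by (simp add: norm_mult mult_ac)
    qed (auto intro!: cont l)
    also have "\<dots> = (exp (- t - \<beta> * (v \<bullet> rvec x)) * exp (t + t * \<sigma> + c)) * M * \<rho> *
       integral torus (\<lambda>k :: real ^ 'd. exp (- (t * (K / 2) * (norm k)\<^sup>2)))"
      by simp
    \<comment> \<open>The drift part of the tilted walk turns \<open>v \<bullet> rvec x\<close> into
      \<open>s\<close>, and exp (- \<beta> s) is \<rho>^(-N). The remaining factor
      \<open>\<rho>\<close> is the cost exp (\<beta> R) of tilting the truncated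
      \<open>g\<close>.\<close>
    also have "exp (- t - \<beta> * (v \<bullet> rvec x)) * exp (t + t * \<sigma> + c) = exp c / \<rho> ^ N"
    proof -
      have "\<beta> * s = ?n * ln \<rho>" using s0 N by (simp add: \<beta>_def R_def)
      then have "exp (- (\<beta> * s)) = 1 / \<rho> ^ N"
        using \<rho> by (simp add: exp_minus exp_of_nat_mult divide_inverse)
      moreover have "- t - \<beta> * (v \<bullet> rvec x) + (t + t * \<sigma> + c) = - (\<beta> * s) + c"
        by (simp add: s \<sigma>_def inner_diff_right algebra_simps)
      ultimately have "exp (- t - \<beta> * (v \<bullet> rvec x) + (t + t * \<sigma> + c)) = exp c / \<rho> ^ N"
        by (simp only: exp_add) simp
      then show ?thesis by (simp only: exp_add)
    qed
    also have "exp c / \<rho> ^ N * M * \<rho> * integral torus (\<lambda>k :: real ^ 'd. exp (- (t * (K / 2) * (norm k)\<^sup>2)))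
      = (M * exp c) * (\<rho> / \<rho> ^ N * integral torus (\<lambda>k :: real ^ 'd. exp (- (t * (K / 2) * (norm k)\<^sup>2))))"
      by simp
    also have "\<dots> \<le> tail_const N * (\<rho> / \<rho> ^ N * integral torus (\<lambda>k :: real ^ 'd. exp (- (t * (K / 2) * (norm k)\<^sup>2))))"
      unfolding tail_const_def c_def using \<rho> 
      by (intro mult_right_mono mult_nonneg_nonneg integral_nonneg) (auto simp: torus_def intro!: integrable_continuous continuous_intros)
    finally show ?thesis .
  qed
  moreover have "norm (integral torus ?I2) + norm (integral torus ?I3) \<le> tail_const N *
     integral torus (\<lambda>k. (t * norm (fourier ?Q2 k) + norm (fourier ?g2 k)) * ?E k)"
  proof -
    have "norm (integral torus ?I2) \<le> integral torus (\<lambda>k. exp c * (norm (fourier ?g2 k) * ?E k))"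
    proof (rule integral_torus_mono)
      fix k :: "real ^ 'd" assume k: "k \<in> torus"
      have "norm (exp (of_real t * (fourier ?Q1 k - 1))) \<le> exp c * ?E k"
        unfolding norm_exp_eq_Re using ReQ1[OF k] bound_exp[of k]
        by (meson exp_le_cancel_iff order.trans)
      then show "norm (?I2 k) \<le> exp c * (norm (fourier ?g2 k) * ?E k)"
        using mult_left_mono[of "norm (exp (of_real t * (fourier ?Q1 k - 1)))" "exp c * ?E k" "norm (fourier ?g2 k)"]
        by (simp add: norm_mult mult_ac)
    qed (auto intro!: cont)
    moreover have "norm (integral torus ?I3) \<le> integral torus (\<lambda>k. M * exp c * (t * norm (fourier ?Q2 k) * ?E k))"
    proof (rule integral_torus_mono)
      fix k :: "real ^ 'd" assume k: "k \<in> torus"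
      have G: "norm (fourier g k) \<le> M" using norm_fourier_le[OF g_l1, of k] g_norm by linarith
      have "norm (exp (of_real t * (fourier Q k - 1)) - exp (of_real t * (fourier ?Q1 k - 1)))
        \<le> norm (of_real t * (fourier Q k - 1) - of_real t * (fourier ?Q1 k - 1)) * exp (M * ?n\<^sup>2 - t * K * (norm k)\<^sup>2)"
        by (rule exp_diff_bound[OF ReQ[OF k] ReQ1[OF k]])
      also have "of_real t * (fourier Q k - 1) - of_real t * (fourier ?Q1 k - 1) = of_real t * fourier ?Q2 k"
        by (simp add: fourier_trunc[OF Q_l1, of k R] algebra_simps)
      also have "norm (of_real t * fourier ?Q2 k) * exp (M * ?n\<^sup>2 - t * K * (norm k)\<^sup>2) \<le>
        t * norm (fourier ?Q2 k) * (exp c * ?E k)"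
        using t by (simp add: norm_mult) (intro mult_left_mono bound_exp, auto)
      finally have D: "norm (exp (of_real t * (fourier Q k - 1)) - exp (of_real t * (fourier ?Q1 k - 1)))
        \<le> t * norm (fourier ?Q2 k) * (exp c * ?E k)" .
      have "norm (?I3 k) = norm (fourier g k) * norm (exp (of_real t * (fourier Q k - 1)) - exp (of_real t * (fourier ?Q1 k - 1)))"
        by (simp add: norm_mult)
      also have "\<dots> \<le> M * (t * norm (fourier ?Q2 k) * (exp c * ?E k))"
        using M by (intro mult_mono G D) auto
      finally show "norm (?I3 k) \<le> M * exp c * (t * norm (fourier ?Q2 k) * ?E k)" by (simp add: mult_ac)
    qed (auto intro!: cont)
    ultimately have "norm (integral torus ?I2) + norm (integral torus ?I3) \<le>
      integral torus (\<lambda>k. exp c * (norm (fourier ?g2 k) * ?E k)) + integral torus (\<lambda>k. M * exp c * (t * norm (fourier ?Q2 k) * ?E k))"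
      by simp
    also have "\<dots> = integral torus (\<lambda>k. exp c * (norm (fourier ?g2 k) * ?E k) + M * exp c * (t * norm (fourier ?Q2 k) * ?E k))"
      unfolding torus_def by (rule integral_add[symmetric]) (auto intro!: integrable_continuous cont)
    also have "\<dots> \<le> integral torus (\<lambda>k. tail_const N * ((t * norm (fourier ?Q2 k) + norm (fourier ?g2 k)) * ?E k))"
    proof (rule integral_le)
      fix k :: "real ^ 'd"
      have "0 \<le> t * norm (fourier ?Q2 k) * ?E k" "0 \<le> norm (fourier ?g2 k) * ?E k" using t by auto
      then have "0 \<le> exp c * (t * norm (fourier ?Q2 k) * ?E k)" "0 \<le> M * exp c * (norm (fourier ?g2 k) * ?E k)"
        using M by auto
      then show "exp c * (norm (fourier ?g2 k) * ?E k) + M * exp c * (t * norm (fourier ?Q2 k) * ?E k)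
        \<le> tail_const N * ((t * norm (fourier ?Q2 k) + norm (fourier ?g2 k)) * ?E k)"
        by (simp add: tail_const_def c_def algebra_simps)
    qed (auto simp: torus_def intro!: integrable_continuous cont)
    finally show ?thesis by simp
  qed
  ultimately show ?thesis by (simp add: distrib_left)
qed

end

section \<open>Taylor expansion of the kernels\<close>

text \<open>Interpolation between the cubic remainder, better for \<bar>b\<bar> \<le> 1, and the
  quadratic one, better for \<bar>b\<bar> > 1. It matches a kernel that has just 2 + z
  moments.\<close>

lemma norm_iexp_quadratic:
  fixes b z :: real
  assumes "0 \<le> z" "z \<le> 1"
  shows "norm (exp (- \<i> * complex_of_real b) - 1 + \<i> * complex_of_real b + complex_of_real (b\<^sup>2 / 2)) \<le> \<bar>b\<bar> powr (2 + z)"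
proof -
  let ?w = "exp (- \<i> * complex_of_real b) - 1 + \<i> * complex_of_real b + complex_of_real (b\<^sup>2 / 2)"
  have eq: "iexp (- b) - (\<Sum>k\<le>2. (\<i> * complex_of_real (- b)) ^ k / fact k) = ?w"
    by (simp add: numeral_2_eq_2 power2_eq_square field_simps)
  have 1: "norm ?w \<le> \<bar>b\<bar> ^ 3"
  proof -
    have "norm ?w \<le> \<bar>- b\<bar> ^ Suc 2 / fact (Suc 2)" using iexp_approx1[of "- b" 2] unfolding eq .
    also have "\<dots> \<le> \<bar>b\<bar> ^ 3" 
      using zero_le_power[OF abs_ge_zero[of b], of 3] by (simp add: eval_nat_numeral field_simps)
    finally show ?thesis .
  qed
  have 2: "norm ?w \<le> \<bar>b\<bar> ^ 2"
    using iexp_approx2[of "- b" 2] unfolding eq by simp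
  consider "b = 0" | "0 < \<bar>b\<bar>" "\<bar>b\<bar> \<le> 1" | "1 < \<bar>b\<bar>" by linarith
  then show ?thesis
  proof cases
    case 2
    have "\<bar>b\<bar> ^ 3 = \<bar>b\<bar> powr 3" using 2 by (simp add: powr_numeral)
    also have "\<dots> \<le> \<bar>b\<bar> powr (2 + z)" using 2 assms by (intro powr_mono') auto
    finally show ?thesis using 1 by linarith
  next
    case 3
    have "\<bar>b\<bar> ^ 2 = \<bar>b\<bar> powr 2" using 3 by (simp add: powr_numeral)
    also have "\<dots> \<le> \<bar>b\<bar> powr (2 + z)" using 3 assms by (intro powr_mono) auto
    finally show ?thesis using 2 by linarith
  qed (use assms in auto)
qed

lemma norm_iexp_minus_one:
  fixes b z :: real
  assumes "0 \<le> z" "z \<le> 1"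
  shows "norm (exp (- \<i> * complex_of_real b) - 1) \<le> 2 * \<bar>b\<bar> powr z"
proof -
  have eq: "iexp (- b) - (\<Sum>k\<le>0. (\<i> * complex_of_real (- b)) ^ k / fact k) = exp (- \<i> * complex_of_real b) - 1"
    by simp
  have 1: "norm (exp (- \<i> * complex_of_real b) - 1) \<le> \<bar>b\<bar>"
    using iexp_approx1[of "- b" 0] unfolding eq by simp
  have 2: "norm (exp (- \<i> * complex_of_real b) - 1) \<le> 2"
    using iexp_approx2[of "- b" 0] unfolding eq by simp
  consider "b = 0" | "0 < \<bar>b\<bar>" "\<bar>b\<bar> \<le> 1" | "1 < \<bar>b\<bar>" by linarith
  then show ?thesis
  proof cases
    case 2
    have "\<bar>b\<bar> = \<bar>b\<bar> powr 1" using 2 by simp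
    also have "\<dots> \<le> \<bar>b\<bar> powr z" using 2 assms by (intro powr_mono') auto
    finally show ?thesis using 1 powr_ge_zero[of "\<bar>b\<bar>" z] by linarith
  next
    case 3
    have "1 \<le> \<bar>b\<bar> powr z" using 3 assms by (intro ge_one_powr_ge_zero) auto
    then show ?thesis using 2 by linarith
  qed (use assms in auto)
qed

context kernel_moments
begin

lemma fourier_taylor:
  "norm (fourier Q k - fourier Q 0 + \<i> * complex_of_real (k \<bullet> drift Q) + complex_of_real (k \<bullet> (covar Q *v k) / 2))
    \<le> M * norm k powr (2 + z)"
proof -
  let ?b = "\<lambda>y. k \<bullet> rvec y"
  have h0: "((\<lambda>y. complex_of_real (Q y) * phase (- y) k) has_sum fourier Q k) UNIV"
    unfolding fourier_eq using fourier_summable[OF Q_l1] by (rule has_sum_infsum)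
  have h1: "((\<lambda>y. complex_of_real (Q y)) has_sum fourier Q 0) UNIV"
    unfolding fourier_0 by (intro has_sum_bounded_linear[OF bounded_linear_of_real] has_sum_infsum Q_summable)
  have h2: "((\<lambda>y. \<i> * complex_of_real (?b y * Q y)) has_sum \<i> * complex_of_real (k \<bullet> drift Q)) UNIV"
    by (intro has_sum_cmult_right has_sum_bounded_linear[OF bounded_linear_of_real] inner_drift)
  have h3: "((\<lambda>y. complex_of_real (1 / 2 * ((?b y)\<^sup>2 * Q y))) has_sum complex_of_real (1 / 2 * (k \<bullet> (covar Q *v k)))) UNIV"
    by (intro has_sum_bounded_linear[OF bounded_linear_of_real] has_sum_cmult_right inner_covar)
  have "((\<lambda>y. complex_of_real (Q y) * phase (- y) k - complex_of_real (Q y) + \<i> * complex_of_real (?b y * Q y)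
      + complex_of_real (1 / 2 * ((?b y)\<^sup>2 * Q y))) has_sum
     (fourier Q k - fourier Q 0 + \<i> * complex_of_real (k \<bullet> drift Q) + complex_of_real (1 / 2 * (k \<bullet> (covar Q *v k))))) UNIV"
    by (intro has_sum_add has_sum_diff h0 h1 h2 h3)
  moreover have "complex_of_real (Q y) * phase (- y) k - complex_of_real (Q y) + \<i> * complex_of_real (?b y * Q y)
      + complex_of_real (1 / 2 * ((?b y)\<^sup>2 * Q y))
    = complex_of_real (Q y) * (exp (- \<i> * complex_of_real (?b y)) - 1 + \<i> * complex_of_real (?b y) + complex_of_real ((?b y)\<^sup>2 / 2))" for y
    by (simp add: phase_def rvec_minus algebra_simps)
  ultimately have h: "((\<lambda>y. complex_of_real (Q y) * (exp (- \<i> * complex_of_real (?b y)) - 1 + \<i> * complex_of_real (?b y) + complex_of_real ((?b y)\<^sup>2 / 2))) has_sum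
     (fourier Q k - fourier Q 0 + \<i> * complex_of_real (k \<bullet> drift Q) + complex_of_real (k \<bullet> (covar Q *v k) / 2))) UNIV"
    by simp
  have "norm (complex_of_real (Q y) * (exp (- \<i> * complex_of_real (?b y)) - 1 + \<i> * complex_of_real (?b y) + complex_of_real ((?b y)\<^sup>2 / 2)))
    \<le> norm k powr (2 + z) * (norm (rvec y) powr (2 + z) * \<bar>Q y\<bar>)" for y
  proof -
    have "\<bar>?b y\<bar> powr (2 + z) \<le> (norm k * norm (rvec y)) powr (2 + z)"
      using z by (intro powr_mono2 Cauchy_Schwarz_ineq2) auto
    also have "\<dots> = norm k powr (2 + z) * norm (rvec y) powr (2 + z)" by (simp add: powr_mult)
    finally have A: "norm (exp (- \<i> * complex_of_real (?b y)) - 1 + \<i> * complex_of_real (?b y) + complex_of_real ((?b y)\<^sup>2 / 2))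
      \<le> norm k powr (2 + z) * norm (rvec y) powr (2 + z)"
      using norm_iexp_quadratic[of z "?b y"] z by linarith
    show ?thesis
      unfolding norm_mult using mult_left_mono[OF A, of "\<bar>Q y\<bar>"] by (simp only: norm_of_real mult_ac abs_ge_zero)
  qed
  from moment_sum(2)[OF this powr_ge_zero, unfolded infsumI[OF h]] show ?thesis
    by (simp only: mult.commute)
qed

text \<open>Testing the drift against itself bounds its square by \<open>norm (drift Q) * M\<close>,
  without a dimensional loss from summing coordinates.\<close>

lemma norm_drift: "norm (drift Q) \<le> M"
proof -
  have "norm (\<Sum>\<^sub>\<infinity>y. (drift Q \<bullet> rvec y) * Q y) \<le> norm (drift Q) * M"
  proof (rule moment_sum_power(2)[where n = 1])
    fix y :: "int ^ 'd"
    show "norm ((drift Q \<bullet> rvec y) * Q y) \<le> norm (drift Q) * (norm (rvec y) ^ 1 * \<bar>Q y\<bar>)"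
      using mult_right_mono[OF Cauchy_Schwarz_ineq2[of "drift Q" "rvec y"], of "\<bar>Q y\<bar>"] by (simp add: abs_mult mult_ac)
  qed auto
  then have "norm (drift Q) * norm (drift Q) \<le> norm (drift Q) * M"
    by (simp add: infsumI[OF inner_drift] flip: power2_norm_eq_inner power2_eq_square)
  then show ?thesis using M by (cases "drift Q = 0") auto
qed

lemma covar_symmetric: "transpose (covar Q) = covar Q"
  by (simp add: covar_def transpose_def vec_eq_iff mult_ac)

lemma covar_upper: "v \<bullet> (covar Q *v v) \<le> M * (norm v)\<^sup>2"
proof -
  have "norm (\<Sum>\<^sub>\<infinity>y. (v \<bullet> rvec y)\<^sup>2 * Q y) \<le> (norm v)\<^sup>2 * M"
  proof (rule moment_sum_power(2)[where n = 2])
    fix y :: "int ^ 'd"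
    have "(v \<bullet> rvec y)\<^sup>2 \<le> (norm v)\<^sup>2 * (norm (rvec y))\<^sup>2"
      using power_mono[OF Cauchy_Schwarz_ineq2[of v "rvec y"], of 2] by (simp add: power_mult_distrib)
    from mult_right_mono[OF this, of "\<bar>Q y\<bar>"]
    show "norm ((v \<bullet> rvec y)\<^sup>2 * Q y) \<le> (norm v)\<^sup>2 * (norm (rvec y) ^ 2 * \<bar>Q y\<bar>)"
      by (simp add: abs_mult mult_ac)
  qed auto
  from this[unfolded infsumI[OF inner_covar]] show ?thesis by (simp add: mult.commute)
qed

text \<open>Insert \<open>k = e v\<close> into the infrared bound and into the Taylor expansion,
  divide by e^2 and let \<open>e\<close> decrease to 0. The factor 2 undoes the 1/2 of the quadratic
  term.\<close>

lemma covar_lower: "2 * K * (norm v)\<^sup>2 \<le> v \<bullet> (covar Q *v v)"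
proof (cases "v = 0")
  case False
  have ev: "\<forall>\<^sub>F e in at_right (0::real). 2 * K * (norm v)\<^sup>2 \<le> v \<bullet> (covar Q *v v) + 2 * M * norm v powr (2 + z) * e powr z"
  proof -
    have "\<forall>\<^sub>F e in at_right (0::real). e < pi / norm v"
      unfolding eventually_at_right_field using False by (intro exI[of _ "pi / norm v"]) auto
    moreover have "\<forall>\<^sub>F e in at_right (0::real). 0 < e" by (rule eventually_at_right_less)
    ultimately show ?thesis
    proof eventually_elim
      case (elim e)
      have nv: "norm v > 0" using False by simp
      have "e *\<^sub>R v \<in> torus"
        unfolding torus_iff
      proof
        fix i
        have "\<bar>(e *\<^sub>R v) $ i\<bar> \<le> norm (e *\<^sub>R v)" by (rule component_le_norm_cart)
        also have "\<dots> \<le> pi" using elim nv by (simp add: field_simps)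
        finally show "\<bar>(e *\<^sub>R v) $ i\<bar> \<le> pi" .
      qed
      then have 1: "K * (norm (e *\<^sub>R v))\<^sup>2 \<le> Re (fourier Q 0 - fourier Q (e *\<^sub>R v))" by (rule infrared)
      have "\<bar>Re (fourier Q (e *\<^sub>R v) - fourier Q 0 + \<i> * complex_of_real ((e *\<^sub>R v) \<bullet> drift Q) + complex_of_real ((e *\<^sub>R v) \<bullet> (covar Q *v (e *\<^sub>R v)) / 2))\<bar>
        \<le> M * norm (e *\<^sub>R v) powr (2 + z)"
        by (rule order.trans[OF abs_Re_le_cmod fourier_taylor])
      then have 2: "Re (fourier Q 0 - fourier Q (e *\<^sub>R v)) \<le> e\<^sup>2 * (v \<bullet> (covar Q *v v)) / 2 + M * norm (e *\<^sub>R v) powr (2 + z)"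
        by (simp add: matrix_vector_mult_scaleR power2_eq_square)
      have "norm (e *\<^sub>R v) powr (2 + z) = e\<^sup>2 * (norm v powr (2 + z) * e powr z)"
        using elim by (simp add: powr_mult powr_add powr_numeral)
      with 1 2 have "e\<^sup>2 * (K * (norm v)\<^sup>2) \<le> e\<^sup>2 * ((v \<bullet> (covar Q *v v)) / 2 + M * (norm v powr (2 + z) * e powr z))"
        using elim by (simp add: power_mult_distrib algebra_simps)
      then have "K * (norm v)\<^sup>2 \<le> (v \<bullet> (covar Q *v v)) / 2 + M * (norm v powr (2 + z) * e powr z)"
        using elim by (simp add: mult_le_cancel_left_pos)
      then show ?case by (simp add: mult.assoc)
    qed
  qed
  have "((\<lambda>e :: real. e powr z) \<longlongrightarrow> 0 powr z) (at_right 0)"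
    by (rule tendsto_powr') (use z in \<open>auto intro!: tendsto_intros simp: eventually_at_right_less eventually_mono[OF eventually_at_right_less less_imp_le]\<close>)
  then have e0: "((\<lambda>e :: real. e powr z) \<longlongrightarrow> 0) (at_right 0)" using z by simp
  have "((\<lambda>e. v \<bullet> (covar Q *v v) + 2 * M * norm v powr (2 + z) * e powr z) \<longlongrightarrow> v \<bullet> (covar Q *v v) + 2 * M * norm v powr (2 + z) * 0) (at_right 0)"
    by (intro tendsto_add tendsto_mult tendsto_const e0)
  then show ?thesis
    using tendsto_lowerbound[OF _ ev] by simp
qed simp

lemma covar_posdef: "v \<noteq> 0 \<Longrightarrow> 0 < v \<bullet> (covar Q *v v)"
  using covar_lower[of v] K by (smt (verit) mult_pos_pos zero_less_norm_iff zero_less_power)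

end

context walk_kernel
begin

lemma fourier_Q_taylor:
  "norm (fourier Q k - 1 + \<i> * complex_of_real (k \<bullet> drift Q) + complex_of_real (k \<bullet> (covar Q *v k) / 2))
    \<le> M * norm k powr (2 + z)"
  using fourier_taylor[of k] by (simp add: fourier_0 Q_mass)

lemma fourier_g_holder:
  "norm (fourier g k - fourier g 0) \<le> 2 * M * norm k powr z"
proof -
  let ?b = "\<lambda>y. k \<bullet> rvec y"
  have h0: "((\<lambda>y. complex_of_real (g y) * phase (- y) l) has_sum fourier g l) UNIV" for l
    unfolding fourier_eq using fourier_summable[OF g_l1] by (rule has_sum_infsum)
  have "((\<lambda>y. complex_of_real (g y) * phase (- y) k - complex_of_real (g y) * phase (- y) 0) has_sum (fourier g k - fourier g 0)) UNIV"
    by (intro has_sum_diff h0)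
  then have h: "((\<lambda>y. complex_of_real (g y) * (exp (- \<i> * complex_of_real (?b y)) - 1)) has_sum (fourier g k - fourier g 0)) UNIV"
    by (simp add: phase_def rvec_minus algebra_simps)
  have le: "norm (complex_of_real (g y) * (exp (- \<i> * complex_of_real (?b y)) - 1)) \<le> (2 * norm k powr z) * (norm (rvec y) powr z * \<bar>g y\<bar>)" for y
  proof -
    have "\<bar>?b y\<bar> powr z \<le> (norm k * norm (rvec y)) powr z"
      using z by (intro powr_mono2 Cauchy_Schwarz_ineq2) auto
    also have "\<dots> = norm k powr z * norm (rvec y) powr z" by (simp add: powr_mult)
    finally have A: "norm (exp (- \<i> * complex_of_real (?b y)) - 1) \<le> 2 * (norm k powr z * norm (rvec y) powr z)"
      using norm_iexp_minus_one[of z "?b y"] z by linarith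
    show ?thesis
      unfolding norm_mult using mult_left_mono[OF A, of "\<bar>g y\<bar>"] by (simp only: norm_of_real mult_ac abs_ge_zero)
  qed
  have s: "(\<lambda>y. (2 * norm k powr z) * (norm (rvec y) powr z * \<bar>g y\<bar>)) summable_on UNIV"
    by (rule summable_on_cmult_right) (rule g_mom)
  have "norm (fourier g k - fourier g 0) \<le> (\<Sum>\<^sub>\<infinity>y. (2 * norm k powr z) * (norm (rvec y) powr z * \<bar>g y\<bar>))"
    using infsum_comparison(2)[OF le s] unfolding infsumI[OF h] .
  also have "\<dots> \<le> (2 * norm k powr z) * M"
    using g_mom(2) by (simp add: infsum_cmult_right' mult_left_mono)
  finally show ?thesis by (simp add: mult_ac)
qed

lemma norm_fourier_g: "norm (fourier g k) \<le> M"
  using norm_fourier_le[OF g_l1, of k] g_norm by linarith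

end

section \<open>Gaussian weights on the torus and pointwise bounds on the flow\<close>

definition gauss_const :: "nat \<Rightarrow> real" where
  "gauss_const d = (2 * pi) ^ d + pi powr (real d / 2)"

lemma integral_torus_real:
  fixes f :: "real ^ 'd::finite \<Rightarrow> real"
  assumes "continuous_on torus f"
  shows "integral torus f = integral\<^sup>L lborel (\<lambda>k. indicator torus k * f k)"
    and "integrable lborel (\<lambda>k. indicator torus k * f k)"
proof -
  have i: "set_integrable lborel torus f"
    unfolding torus_def set_integrable_def
    by (rule borel_integrable_compact) (use assms in \<open>auto simp: torus_def\<close>)
  then show "integrable lborel (\<lambda>k. indicator torus k * f k)"
    by (simp add: set_integrable_def)
  show "integral torus f = integral\<^sup>L lborel (\<lambda>k. indicator torus k * f k)"
    using set_borel_integral_eq_integral(2)[OF i] by (simp add: set_lebesgue_integral_def)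
qed

text \<open>For \<open>a \<le> 1\<close> the volume of the torus is the better bound, otherwise the
  full Gaussian integral; together they allow every exponent up to d/2. This freedom is spent
  differently at early and at late times.\<close>

lemma integral_torus_gauss_le:
  assumes a: "0 < a" and th: "0 \<le> \<theta>" "\<theta> \<le> real CARD('d) / 2"
  shows "integral torus (\<lambda>k :: real ^ 'd::finite. exp (- (a * (norm k)\<^sup>2))) \<le> gauss_const CARD('d) * a powr (- \<theta>)"
proof -
  let ?I = "integral torus (\<lambda>k :: real ^ 'd. exp (- (a * (norm k)\<^sup>2)))"
  have c: "continuous_on torus (\<lambda>k :: real ^ 'd. exp (- (a * (norm k)\<^sup>2)))" by (intro continuous_intros)
  have c1: "continuous_on torus (\<lambda>k :: real ^ 'd. 1 :: real)" by (intro continuous_intros)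
  have i: "integrable lborel (\<lambda>k :: real ^ 'd. exp (- (a * (norm k)\<^sup>2)))"
    using gaussian_isotropic(1)[OF a] by simp
  have 1: "?I \<le> pi powr (real CARD('d) / 2) * a powr (- (real CARD('d) / 2))"
  proof -
    have "?I \<le> integral\<^sup>L lborel (\<lambda>k :: real ^ 'd. exp (- (a * (norm k)\<^sup>2)))"
      unfolding integral_torus_real(1)[OF c]
      by (rule integral_mono[OF integral_torus_real(2)[OF c] i]) (auto simp: indicator_def)
    also have "\<dots> = (pi / a) powr (CARD('d) / 2)" using gaussian_isotropic(2)[OF a] by simp
    also have "\<dots> = pi powr (real CARD('d) / 2) * a powr (- (real CARD('d) / 2))"
      using a by (simp add: powr_divide powr_minus_divide)
    finally show ?thesis .
  qed
  have 2: "?I \<le> (2 * pi) ^ CARD('d)"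
  proof -
    have "?I \<le> integral torus (\<lambda>k :: real ^ 'd. 1 :: real)"
      by (rule integral_le) (use a in \<open>auto simp: torus_def intro!: integrable_continuous continuous_intros\<close>)
    also have "\<dots> = (2 * pi) ^ CARD('d)"
      by (simp add: torus_def content_cbox_cart interval_ne_empty_cart prod_constant)
    finally show ?thesis .
  qed
  show ?thesis
  proof (cases "a \<le> 1")
    case True
    have "1 \<le> a powr (- \<theta>)" using True a th powr_mono'[of "- \<theta>" 0 a] by simp
    then have "(2 * pi) ^ CARD('d) * 1 \<le> gauss_const CARD('d) * a powr (- \<theta>)"
      unfolding gauss_const_def by (intro mult_mono) auto
    then show ?thesis using 2 by linarith
  next
    case False
    have "a powr (- (real CARD('d) / 2)) \<le> a powr (- \<theta>)" using False th by (intro powr_mono) auto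
    then have "pi powr (real CARD('d) / 2) * a powr (- (real CARD('d) / 2)) \<le> gauss_const CARD('d) * a powr (- \<theta>)"
      unfolding gauss_const_def by (intro mult_mono) auto
    then show ?thesis using 1 by linarith
  qed
qed

text \<open>Young's inequality with the weights Y/X and X/Y, so that bounds on the two norms enter
  directly.\<close>

lemma integral_torus_cauchy_schwarz:
  fixes f h :: "real ^ 'd::finite \<Rightarrow> real"
  assumes f: "continuous_on torus f" and h: "continuous_on torus h"
    and F: "integral torus (\<lambda>k. (f k)\<^sup>2) \<le> X\<^sup>2" and H: "integral torus (\<lambda>k. (h k)\<^sup>2) \<le> Y\<^sup>2"
    and X: "0 < X" and Y: "0 < Y"
  shows "integral torus (\<lambda>k. f k * h k) \<le> X * Y"
proof -
  note int = integrable_continuous[folded torus_def]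
  have "integral torus (\<lambda>k. f k * h k) \<le> integral torus (\<lambda>k. Y / (2 * X) * (f k)\<^sup>2 + X / (2 * Y) * (h k)\<^sup>2)"
  proof (rule integral_le)
    show "(\<lambda>k. f k * h k) integrable_on torus" "(\<lambda>k. Y / (2 * X) * (f k)\<^sup>2 + X / (2 * Y) * (h k)\<^sup>2) integrable_on torus"
      unfolding torus_def by (intro integrable_continuous continuous_intros f[unfolded torus_def] h[unfolded torus_def])+
    fix k
    have "0 \<le> (Y * f k - X * h k)\<^sup>2 / (2 * X * Y)" using X Y by simp
    also have "\<dots> = Y / (2 * X) * (f k)\<^sup>2 + X / (2 * Y) * (h k)\<^sup>2 - f k * h k"
      using X Y by (simp add: field_simps power2_eq_square)
    finally show "f k * h k \<le> Y / (2 * X) * (f k)\<^sup>2 + X / (2 * Y) * (h k)\<^sup>2" by simp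
  qed
  also have "\<dots> = Y / (2 * X) * integral torus (\<lambda>k. (f k)\<^sup>2) + X / (2 * Y) * integral torus (\<lambda>k. (h k)\<^sup>2)"
  proof -
    have "(\<lambda>k. (f k)\<^sup>2) integrable_on torus" "(\<lambda>k. (h k)\<^sup>2) integrable_on torus"
      unfolding torus_def by (intro integrable_continuous continuous_intros f[unfolded torus_def] h[unfolded torus_def])+
    then show ?thesis
      by (intro integral_unique has_integral_add has_integral_mult_right integrable_integral)
  qed
  also have "\<dots> \<le> Y / (2 * X) * X\<^sup>2 + X / (2 * Y) * Y\<^sup>2"
    using F H X Y by (intro add_mono mult_left_mono) auto
  also have "\<dots> = X * Y" using X Y by (simp add: power2_eq_square field_simps)
  finally show ?thesis .
qed

lemma gauss_const_pos: "0 < gauss_const d"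
  unfolding gauss_const_def by (intro add_pos_pos) auto

text \<open>Parseval turns the weighted l2 bound into smallness of the transform of the removed
  part. Cauchy-Schwarz against the Gaussian then costs half of its exponent, whence the limit d/4
  instead of d/2.\<close>

lemma cotrunc_l2_gauss_le:
  fixes f :: "int ^ 'd::finite \<Rightarrow> real"
  assumes f: "in_lp 1 f" and M: "0 < M" and R: "1 \<le> R"
    and s: "(\<lambda>y. (norm (rvec y) ^ n * f y)\<^sup>2) summable_on UNIV" "(\<Sum>\<^sub>\<infinity>y. (norm (rvec y) ^ n * f y)\<^sup>2) \<le> M\<^sup>2"
    and a: "0 < a" and th: "0 \<le> \<theta>" "\<theta> \<le> real CARD('d) / 4"
  shows "integral torus (\<lambda>k. norm (fourier (cotrunc R f) k) * exp (- (a * (norm k)\<^sup>2)))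
    \<le> gauss_const CARD('d) * M * R powr (- real n) * a powr (- \<theta>)"
proof -
  let ?G = "gauss_const CARD('d)"
  have fc: "in_lp 1 (cotrunc R f)" by (rule in_lp_cotrunc[OF f])
  have P: "integral torus (\<lambda>k. (norm (fourier (cotrunc R f) k))\<^sup>2) \<le> (2 * pi) ^ CARD('d) * (M * R powr (- real n))\<^sup>2"
  proof -
    have Rn: "R powr (- real n) = 1 / R ^ n" using R by (simp add: powr_minus_divide powr_realpow)
    have "integral torus (\<lambda>k. (norm (fourier (cotrunc R f) k))\<^sup>2) \<le> (2 * pi) ^ CARD('d) * (R powr (- real n))\<^sup>2 * M\<^sup>2"
    proof (rule order.trans[OF has_sum_mono[OF fourier_parseval[OF fc]
            has_sum_cmult_right[OF has_sum_infsum[OF s(1)], of "(2 * pi) ^ CARD('d) * (R powr (- real n))\<^sup>2"]]])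
      fix y
      show "(2 * pi) ^ CARD('d) * (cotrunc R f y)\<^sup>2 \<le> (2 * pi) ^ CARD('d) * (R powr (- real n))\<^sup>2 * (norm (rvec y) ^ n * f y)\<^sup>2"
      proof (cases "norm (rvec y) \<le> R")
        case False
        have "R ^ n \<le> norm (rvec y) ^ n" using False R by (intro power_mono) auto
        then have "1 \<le> R powr (- real n) * norm (rvec y) ^ n" using R by (simp add: Rn field_simps)
        then have "1\<^sup>2 \<le> (R powr (- real n) * norm (rvec y) ^ n)\<^sup>2" by (intro power_mono) auto
        then have "(f y)\<^sup>2 * 1 \<le> (f y)\<^sup>2 * (R powr (- real n) * norm (rvec y) ^ n)\<^sup>2" by (intro mult_left_mono) auto
        then have "(f y)\<^sup>2 \<le> (R powr (- real n))\<^sup>2 * (norm (rvec y) ^ n * f y)\<^sup>2" by (simp add: power_mult_distrib mult_ac)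
        then have "(2 * pi) ^ CARD('d) * (f y)\<^sup>2 \<le> (2 * pi) ^ CARD('d) * ((R powr (- real n))\<^sup>2 * (norm (rvec y) ^ n * f y)\<^sup>2)"
          by (intro mult_left_mono) auto
        then show ?thesis using False by (simp add: cotrunc_def mult.assoc)
      qed (simp add: cotrunc_def)
    qed (use s(2) in \<open>auto intro!: mult_left_mono\<close>)
    then show ?thesis by (simp add: power_mult_distrib mult_ac)
  qed
  define X where "X = sqrt ((2 * pi) ^ CARD('d)) * (M * R powr (- real n))"
  define Y where "Y = sqrt ?G * a powr (- \<theta>)"
  have X: "0 < X" unfolding X_def using M R by simp
  have Y: "0 < Y" unfolding Y_def using a gauss_const_pos by simp
  have H: "integral torus (\<lambda>k :: real ^ 'd. (exp (- (a * (norm k)\<^sup>2)))\<^sup>2) \<le> Y\<^sup>2"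
  proof -
    have "integral torus (\<lambda>k :: real ^ 'd. (exp (- (a * (norm k)\<^sup>2)))\<^sup>2) = integral torus (\<lambda>k :: real ^ 'd. exp (- (2 * a * (norm k)\<^sup>2)))"
    proof -
      have "(exp (- (a * (norm k)\<^sup>2)))\<^sup>2 = exp (- (2 * a * (norm k)\<^sup>2))" for k :: "real ^ 'd"
        by (simp add: power2_eq_square flip: exp_add)
      then show ?thesis by (simp only:)
    qed
    also have "\<dots> \<le> ?G * (2 * a) powr (- (2 * \<theta>))"
      by (rule integral_torus_gauss_le) (use a th in auto)
    also have "\<dots> \<le> ?G * a powr (- (2 * \<theta>))"
      using a th gauss_const_pos[of "CARD('d)"] by (intro mult_left_mono powr_mono2') auto
    also have "a powr (- (2 * \<theta>)) = (a powr (- \<theta>))\<^sup>2"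
      by (simp add: power2_eq_square flip: powr_add)
    also have "?G * \<dots> = Y\<^sup>2" using gauss_const_pos[of "CARD('d)"]
      by (simp add: Y_def power_mult_distrib)
    finally show ?thesis .
  qed
  have "integral torus (\<lambda>k. norm (fourier (cotrunc R f) k) * exp (- (a * (norm k)\<^sup>2))) \<le> X * Y"
    by (rule integral_torus_cauchy_schwarz[OF _ _ _ H X Y])
       (use P in \<open>auto intro!: continuous_intros fc simp: X_def power_mult_distrib\<close>)
  also have "X * Y = (sqrt ((2 * pi) ^ CARD('d)) * sqrt ?G) * (M * R powr (- real n) * a powr (- \<theta>))"
    by (simp add: X_def Y_def)
  also have "\<dots> \<le> (sqrt ?G * sqrt ?G) * (M * R powr (- real n) * a powr (- \<theta>))"
    using M by (intro mult_right_mono real_sqrt_le_mono) (auto simp: gauss_const_def)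
  also have "\<dots> = ?G * M * R powr (- real n) * a powr (- \<theta>)"
    using gauss_const_pos[of "CARD('d)"] by simp
  finally show ?thesis .
qed

text \<open>Up to the factor (2 pi)^d this is \<open>g\<close> convolved with the law at time
  \<open>t\<close> of the compound Poisson walk with jump kernel \<open>Q\<close> (signed in
  general).\<close>

definition flow :: "(int ^ 'd::finite \<Rightarrow> real) \<Rightarrow> (int ^ 'd \<Rightarrow> real) \<Rightarrow> real \<Rightarrow> int ^ 'd \<Rightarrow> complex" where
  "flow Q g t x = integral torus (\<lambda>k. phase x k * fourier g k * exp (of_real t * (fourier Q k - 1)))"

text \<open>The three summands are the shifted main part, one large jump of the walk, and a large
  displacement by \<open>g\<close>. The exponents \<theta> stay free because no single choice serves
  all times; the second alternative measures the large jump by the l2 weight of part (d).\<close>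

lemma flow_tail:
  fixes M K z \<theta>\<^sub>1 \<theta>\<^sub>2 \<theta>\<^sub>3 \<theta>\<^sub>4 :: real
  defines "d \<equiv> CARD('d::finite)"
  assumes M: "0 < M" and K: "0 < K"
    and th: "0 \<le> \<theta>\<^sub>1" "\<theta>\<^sub>1 \<le> d / 2" "0 \<le> \<theta>\<^sub>2" "\<theta>\<^sub>2 \<le> d / 2" "0 \<le> \<theta>\<^sub>3" "\<theta>\<^sub>3 \<le> d / 4"
      "0 \<le> \<theta>\<^sub>4" "\<theta>\<^sub>4 \<le> d / 4"
  shows "\<exists>C>0. \<forall>(Q :: int ^ 'd \<Rightarrow> real) g t x v s. walk_kernel M K z Q g \<and> 0 < t \<and> norm v \<le> 1 \<and>
     s = v \<bullet> (rvec x - t *\<^sub>R drift Q) \<and> real (d + 5) \<le> s \<and> sqrt t \<le> s \<longrightarrow>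
     norm (flow Q g t x) \<le> C * ((sqrt t / s) ^ (d + 4) * t powr (- \<theta>\<^sub>1) + t * (s powr (- 2 - z) * t powr (- \<theta>\<^sub>2))
        + s powr (- real (max 2 (d - 1))) * t powr (- \<theta>\<^sub>3)) \<and>
     (4 \<le> d \<longrightarrow> norm (flow Q g t x) \<le> C * ((sqrt t / s) ^ (d + 4) * t powr (- \<theta>\<^sub>1) + t * (s powr (- real (d - 1)) * t powr (- \<theta>\<^sub>4))
        + s powr (- real (max 2 (d - 1))) * t powr (- \<theta>\<^sub>3)))"
proof -
  \<comment> \<open>One power of s / sqrt t is lost to the tilt of \<open>g\<close>, which leaves
    the power d + 4.\<close>
  define N where "N = d + 5"
  define G where "G = gauss_const d"
  define tc where "tc = (M + 1) * exp ((5 * (2 * M + M\<^sup>2 / K) + M) * (real N)\<^sup>2)"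
  define n where "n = max 2 (d - 1)"
  \<comment> \<open>The powers of \<open>real N\<close> undo the radius \<open>s / N\<close>, those
    of \<open>K\<close> the rate \<open>t * K\<close> of the Gaussian weight.\<close>
  define c1 where "c1 = G * (K / 2) powr (- \<theta>\<^sub>1)"
  define c2 where "c2 = M * G * K powr (- \<theta>\<^sub>2) * real N powr (2 + z)"
  define c3 where "c3 = G * M * K powr (- \<theta>\<^sub>3) * real N powr real n"
  define c4 where "c4 = G * M * K powr (- \<theta>\<^sub>4) * real N powr real (d - 1)"
  have N: "0 < N" by (simp add: N_def)
  have G: "0 < G" unfolding G_def by (rule gauss_const_pos)
  have cpos: "0 < c1" "0 < c2" "0 < c3" "0 < c4"
    using G M K N by (simp_all add: c1_def c2_def c3_def c4_def)
  have tc: "0 < tc" using M by (simp add: tc_def)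
  define C where "C = tc * (c1 + c2 + c3 + c4)"
  have C: "C > 0" unfolding C_def using tc cpos by simp
  have main: "norm (flow Q g t x) \<le> C * ((sqrt t / s) ^ (d + 4) * t powr (- \<theta>\<^sub>1) + t * (s powr (- 2 - z) * t powr (- \<theta>\<^sub>2))
        + s powr (- real n) * t powr (- \<theta>\<^sub>3))" (is ?A)
     "4 \<le> d \<longrightarrow> norm (flow Q g t x) \<le> C * ((sqrt t / s) ^ (d + 4) * t powr (- \<theta>\<^sub>1) + t * (s powr (- real (d - 1)) * t powr (- \<theta>\<^sub>4))
        + s powr (- real n) * t powr (- \<theta>\<^sub>3))" (is ?B)
    if wk: "walk_kernel M K z Q g" and t: "0 < t" and v: "norm v \<le> 1" and s: "s = v \<bullet> (rvec x - t *\<^sub>R drift Q)"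
      and sN: "real N \<le> s" and st: "sqrt t \<le> s"
    for Q g :: "int ^ 'd \<Rightarrow> real" and t x v s
  proof -
    interpret walk_kernel M K z Q g by (rule wk)
    let ?R = "s / real N"
    let ?E = "\<lambda>k :: real ^ 'd. exp (- (t * K * (norm k)\<^sup>2))"
    have R: "1 \<le> ?R" using sN N by simp
    have s0: "0 < s" using sN N by simp
    have tK: "0 < t * K" "0 < t * (K / 2)" using t K by auto
    have tc_eq: "tail_const N = tc" by (simp add: tail_const_def rate_def tc_def)
    have Rp: "?R powr (- p) = real N powr p * s powr (- p)" for p
      using s0 N by (simp add: powr_divide powr_minus_divide)
    have base: "norm (flow Q g t x) \<le> tc * ((s / sqrt t) / (s / sqrt t) ^ N * integral torus (\<lambda>k :: real ^ 'd. exp (- (t * (K / 2) * (norm k)\<^sup>2)))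
        + integral torus (\<lambda>k. (t * norm (fourier (cotrunc ?R Q) k) + norm (fourier (cotrunc ?R g) k)) * ?E k))"
      unfolding flow_def tc_eq[symmetric]
      by (rule tail_estimate[OF t v s N R]) (use st t in simp)
    have r: "(s / sqrt t) / (s / sqrt t) ^ N = (sqrt t / s) ^ (d + 4)"
      using s0 t by (simp add: N_def power_divide field_simps power_add eval_nat_numeral)
    have W: "integral torus (\<lambda>k :: real ^ 'd. exp (- (t * (K / 2) * (norm k)\<^sup>2))) \<le> c1 * t powr (- \<theta>\<^sub>1)"
    proof -
      have "(t * (K / 2)) powr (- \<theta>\<^sub>1) = t powr (- \<theta>\<^sub>1) * (K / 2) powr (- \<theta>\<^sub>1)" by (rule powr_mult)
      then have eq: "c1 * t powr (- \<theta>\<^sub>1) = G * (t * (K / 2)) powr (- \<theta>\<^sub>1)" by (simp add: c1_def)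
      show ?thesis
        unfolding eq unfolding G_def d_def by (rule integral_torus_gauss_le[OF tK(2) th(1) th(2)[unfolded d_def]])
    qed
    have l1: "in_lp 1 (cotrunc ?R Q)" "in_lp 1 (cotrunc ?R g)" by (auto intro: in_lp_cotrunc Q_l1 g_l1)
    have split: "integral torus (\<lambda>k. (t * norm (fourier (cotrunc ?R Q) k) + norm (fourier (cotrunc ?R g) k)) * ?E k)
      = t * integral torus (\<lambda>k. norm (fourier (cotrunc ?R Q) k) * ?E k) + integral torus (\<lambda>k. norm (fourier (cotrunc ?R g) k) * ?E k)"
    proof -
      have i: "(\<lambda>k. norm (fourier (cotrunc ?R Q) k) * ?E k) integrable_on torus"
        "(\<lambda>k. norm (fourier (cotrunc ?R g) k) * ?E k) integrable_on torus"
        unfolding torus_def by (intro integrable_continuous continuous_intros l1)+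
      have "((\<lambda>k. t * (norm (fourier (cotrunc ?R Q) k) * ?E k) + norm (fourier (cotrunc ?R g) k) * ?E k) has_integral
        t * integral torus (\<lambda>k. norm (fourier (cotrunc ?R Q) k) * ?E k) + integral torus (\<lambda>k. norm (fourier (cotrunc ?R g) k) * ?E k)) torus"
        by (intro has_integral_add has_integral_mult_right integrable_integral i)
      then show ?thesis by (simp add: integral_unique distrib_right mult.assoc)
    qed
    have Qa: "integral torus (\<lambda>k. norm (fourier (cotrunc ?R Q) k) * ?E k) \<le> c2 * (s powr (- 2 - z) * t powr (- \<theta>\<^sub>2))"
    proof -
      have "integral torus (\<lambda>k. norm (fourier (cotrunc ?R Q) k) * ?E k) \<le> integral torus (\<lambda>k. (M * ?R powr (- 2 - z)) * ?E k)"
      proof (rule integral_le)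
        show "(\<lambda>k. norm (fourier (cotrunc ?R Q) k) * ?E k) integrable_on torus" "(\<lambda>k. (M * ?R powr (- 2 - z)) * ?E k) integrable_on torus"
          unfolding torus_def by (intro integrable_continuous continuous_intros l1)+
        show "norm (fourier (cotrunc ?R Q) k) * ?E k \<le> (M * ?R powr (- 2 - z)) * ?E k" for k
          by (intro mult_right_mono order.trans[OF norm_fourier_le[OF l1(1)] l1_norm_cotrunc_Q[OF R]]) auto
      qed
      also have "\<dots> = (M * ?R powr (- 2 - z)) * integral torus ?E" by simp
      also have "\<dots> \<le> (M * ?R powr (- 2 - z)) * (G * (t * K) powr (- \<theta>\<^sub>2))"
        using integral_torus_gauss_le[OF tK(1), of \<theta>\<^sub>2, where 'd = 'd] th M
        by (intro mult_left_mono) (auto simp: d_def G_def)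
      also have "\<dots> = c2 * (s powr (- 2 - z) * t powr (- \<theta>\<^sub>2))"
        using Rp[of "2 + z"] t K by (simp add: c2_def powr_mult mult_ac)
      finally show ?thesis .
    qed
    have Ga: "integral torus (\<lambda>k. norm (fourier (cotrunc ?R g) k) * ?E k) \<le> c3 * (s powr (- real n) * t powr (- \<theta>\<^sub>3))"
    proof -
      have "integral torus (\<lambda>k. norm (fourier (cotrunc ?R g) k) * ?E k) \<le> G * M * ?R powr (- real n) * (t * K) powr (- \<theta>\<^sub>3)"
        unfolding G_def d_def by (rule cotrunc_l2_gauss_le[OF g_l1 M R _ _ tK(1)])
          (use g_l2 th in \<open>simp_all add: n_def d_def\<close>)
      also have "\<dots> = c3 * (s powr (- real n) * t powr (- \<theta>\<^sub>3))"
        using Rp[of "real n"] t K by (simp add: c3_def powr_mult mult_ac)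
      finally show ?thesis .
    qed
    have Qb: "integral torus (\<lambda>k. norm (fourier (cotrunc ?R Q) k) * ?E k) \<le> c4 * (s powr (- real (d - 1)) * t powr (- \<theta>\<^sub>4))" if d4: "4 \<le> d"
    proof -
      have "integral torus (\<lambda>k. norm (fourier (cotrunc ?R Q) k) * ?E k) \<le> G * M * ?R powr (- real (d - 1)) * (t * K) powr (- \<theta>\<^sub>4)"
        unfolding G_def d_def by (rule cotrunc_l2_gauss_le[OF Q_l1 M R _ _ tK(1)])
          (use Q_l2 d4 th in \<open>simp_all add: d_def\<close>)
      also have "\<dots> = c4 * (s powr (- real (d - 1)) * t powr (- \<theta>\<^sub>4))"
        using Rp[of "real (d - 1)"] t K by (simp add: c4_def powr_mult mult_ac)
      finally show ?thesis .
    qed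
    have combine: "norm (flow Q g t x) \<le> C * ((sqrt t / s) ^ (d + 4) * t powr (- \<theta>\<^sub>1) + t * m + s powr (- real n) * t powr (- \<theta>\<^sub>3))"
      if m: "integral torus (\<lambda>k. norm (fourier (cotrunc ?R Q) k) * ?E k) \<le> c * m" and c: "0 \<le> c" "c \<le> c2 + c4" and m0: "0 \<le> m" for c m
    proof -
      have a: "0 \<le> (sqrt t / s) ^ (d + 4) * t powr (- \<theta>\<^sub>1)" "0 \<le> t * m" "0 \<le> s powr (- real n) * t powr (- \<theta>\<^sub>3)"
        using s0 t m0 by auto
      have "norm (flow Q g t x) \<le> tc * ((sqrt t / s) ^ (d + 4) * (c1 * t powr (- \<theta>\<^sub>1)) + (t * (c * m) + c3 * (s powr (- real n) * t powr (- \<theta>\<^sub>3))))"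
        by (rule order.trans[OF base], unfold r split, intro mult_left_mono add_mono W m Ga) (use tc s0 t in auto)
      also have "\<dots> = tc * (c1 * ((sqrt t / s) ^ (d + 4) * t powr (- \<theta>\<^sub>1)) + c * (t * m) + c3 * (s powr (- real n) * t powr (- \<theta>\<^sub>3)))"
        by (simp add: algebra_simps)
      also have "\<dots> \<le> tc * ((c1 + c2 + c3 + c4) * ((sqrt t / s) ^ (d + 4) * t powr (- \<theta>\<^sub>1)) + (c1 + c2 + c3 + c4) * (t * m)
         + (c1 + c2 + c3 + c4) * (s powr (- real n) * t powr (- \<theta>\<^sub>3)))"
        using tc cpos c by (intro mult_left_mono add_mono mult_right_mono a) auto
      also have "\<dots> = C * ((sqrt t / s) ^ (d + 4) * t powr (- \<theta>\<^sub>1) + t * m + s powr (- real n) * t powr (- \<theta>\<^sub>3))"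
        by (simp add: C_def algebra_simps)
      finally show ?thesis .
    qed
    show ?A by (rule combine[OF Qa]) (use cpos in auto)
    show ?B by (intro impI combine[OF Qb]) (use cpos in auto)
  qed
  show ?thesis
  proof (rule exI[of _ C], intro conjI allI C impI, goal_cases)
    case (1 Q g t x v s)
    then show ?case using main(1)[of Q g t v s x] by (auto simp: N_def n_def)
  next
    case (2 Q g t x v s)
    then show ?case using main(2)[of Q g t v s x] by (auto simp: N_def n_def)
  qed
qed

text \<open>Excess powers of \<open>t\<close> are traded for powers of \<open>t0\<close>. The part
  t^(-1/2) is kept because it is integrable at 0 and its integral up to \<open>t0\<close> has order
  t0^(1/2).\<close>

lemma early_power_bound:
  fixes t t0 s c :: real
  assumes "0 < t" "t \<le> t0" "1 \<le> t0" "0 < c" "c * t0 \<le> s" "0 \<le> \<beta>"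
    and "0 \<le> \<alpha> + 1 / 2" "\<alpha> + 1 / 2 - \<beta> \<le> E"
  shows "t powr \<alpha> * s powr (- \<beta>) \<le> c powr (- \<beta>) * (t0 powr E * t powr (- 1 / 2))"
proof -
  have "t powr \<alpha> = t powr (\<alpha> + 1 / 2) * t powr (- 1 / 2)" using assms by (simp flip: powr_add)
  also have "\<dots> \<le> t0 powr (\<alpha> + 1 / 2) * t powr (- 1 / 2)" using assms by (intro mult_right_mono powr_mono2) auto
  finally have 1: "t powr \<alpha> \<le> t0 powr (\<alpha> + 1 / 2) * t powr (- 1 / 2)" .
  have "s powr (- \<beta>) \<le> (c * t0) powr (- \<beta>)" using assms by (intro powr_mono2') auto
  also have "\<dots> = c powr (- \<beta>) * t0 powr (- \<beta>)" using assms by (simp add: powr_mult)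
  finally have 2: "s powr (- \<beta>) \<le> c powr (- \<beta>) * t0 powr (- \<beta>)" .
  have "t powr \<alpha> * s powr (- \<beta>) \<le> (t0 powr (\<alpha> + 1 / 2) * t powr (- 1 / 2)) * (c powr (- \<beta>) * t0 powr (- \<beta>))"
    by (intro mult_mono 1 2) auto
  also have "\<dots> = c powr (- \<beta>) * (t0 powr (\<alpha> + 1 / 2 - \<beta>) * t powr (- 1 / 2))"
    using assms by (simp add: powr_diff powr_minus_divide)
  also have "\<dots> \<le> c powr (- \<beta>) * (t0 powr E * t powr (- 1 / 2))"
    using assms by (intro mult_left_mono mult_right_mono powr_mono) auto
  finally show ?thesis .
qed

lemma sqrt_over_power: "0 < t \<Longrightarrow> 0 < s \<Longrightarrow> (sqrt t / s) ^ n = t powr (real n / 2) * s powr (- real n)"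
  by (simp add: power_divide powr_half_sqrt[symmetric] powr_powr powr_minus_divide flip: powr_realpow)

text \<open>Up to half of the typical time the walk still lacks a distance proportional to
  \<open>t0\<close>, so \<open>s\<close> can be replaced by \<open>c * t0\<close> in every tail
  term.\<close>

lemma flow_early:
  fixes M K z e0 :: real
  defines "d \<equiv> CARD('d::finite)"
  assumes M: "0 < M" and K: "0 < K" and z: "0 < z" "z \<le> 1" and e0: "0 < e0"
  shows "\<exists>C>0. \<exists>T0. \<forall>(Q :: int ^ 'd \<Rightarrow> real) g t x t0. walk_kernel M K z Q g \<and> e0 \<le> norm (drift Q) \<and>
     rvec x = t0 *\<^sub>R drift Q \<and> T0 \<le> t0 \<and> 0 < t \<and> t \<le> t0 / 2 \<longrightarrow>
     norm (flow Q g t x) \<le> C * (t0 powr (- real d / 2 - z / 2) * t powr (- 1 / 2))"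
proof -
  \<comment> \<open>Each exponent is chosen so that its term reaches the power of \<open>t0\<close>
    required in its dimension without becoming worse than t^(-1/2) near 0. Hence
    \<open>\<theta>\<^sub>3\<close> is at most 1/2, and \<open>\<theta>\<^sub>4 = 1\<close> cancels
    the factor \<open>t\<close> in front when d \<ge> 4.\<close>
  define \<theta>\<^sub>2 :: real where "\<theta>\<^sub>2 = (if d = 1 then 0 else 1)"
  define \<theta>\<^sub>3 :: real where "\<theta>\<^sub>3 = (if d = 1 then 0 else 1 / 2)"
  define \<theta>\<^sub>4 :: real where "\<theta>\<^sub>4 = (if d < 4 then 0 else 1)"
  have d1: "1 \<le> d" by (simp add: d_def Suc_le_eq)
  have d2: "CARD('d) \<noteq> Suc 0 \<Longrightarrow> 2 \<le> CARD('d)" using d1 unfolding d_def by linarith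
  have "\<exists>C>0. \<forall>(Q :: int ^ 'd \<Rightarrow> real) g t x v s. walk_kernel M K z Q g \<and> 0 < t \<and> norm v \<le> 1 \<and>
     s = v \<bullet> (rvec x - t *\<^sub>R drift Q) \<and> real (d + 5) \<le> s \<and> sqrt t \<le> s \<longrightarrow>
     norm (flow Q g t x) \<le> C * ((sqrt t / s) ^ (d + 4) * t powr (- 0) + t * (s powr (- 2 - z) * t powr (- \<theta>\<^sub>2))
        + s powr (- real (max 2 (d - 1))) * t powr (- \<theta>\<^sub>3)) \<and>
     (4 \<le> d \<longrightarrow> norm (flow Q g t x) \<le> C * ((sqrt t / s) ^ (d + 4) * t powr (- 0) + t * (s powr (- real (d - 1)) * t powr (- \<theta>\<^sub>4))
        + s powr (- real (max 2 (d - 1))) * t powr (- \<theta>\<^sub>3)))"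
    unfolding d_def by (rule flow_tail[OF M K]) (use d2 in \<open>auto simp: \<theta>\<^sub>2_def \<theta>\<^sub>3_def \<theta>\<^sub>4_def d_def\<close>)
  then obtain C0 where C0: "0 < C0" and tail: "\<forall>(Q :: int ^ 'd \<Rightarrow> real) g t x v s. walk_kernel M K z Q g \<and> 0 < t \<and> norm v \<le> 1 \<and>
     s = v \<bullet> (rvec x - t *\<^sub>R drift Q) \<and> real (d + 5) \<le> s \<and> sqrt t \<le> s \<longrightarrow>
     norm (flow Q g t x) \<le> C0 * ((sqrt t / s) ^ (d + 4) * t powr (- 0) + t * (s powr (- 2 - z) * t powr (- \<theta>\<^sub>2))
        + s powr (- real (max 2 (d - 1))) * t powr (- \<theta>\<^sub>3)) \<and>
     (4 \<le> d \<longrightarrow> norm (flow Q g t x) \<le> C0 * ((sqrt t / s) ^ (d + 4) * t powr (- 0) + t * (s powr (- real (d - 1)) * t powr (- \<theta>\<^sub>4))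
        + s powr (- real (max 2 (d - 1))) * t powr (- \<theta>\<^sub>3)))"
    by (elim exE conjE)
  define c where "c = e0 / 2"
  have c: "0 < c" using e0 by (simp add: c_def)
  define E where "E = - real d / 2 - z / 2"
  define n where "n = max 2 (d - 1)"
  define D where "D = c powr (- real (d + 4)) + (c powr (- 2 - z) + c powr (- real (d - 1))) + c powr (- real n)"
  \<comment> \<open>The three thresholds give \<open>1 \<le> t0\<close>,
    \<open>d + 5 \<le> s\<close> and \<open>sqrt t \<le> s\<close>, in this order.\<close>
  define T0 where "T0 = max 1 (max (real (d + 5) / c) (1 / c\<^sup>2))"
  have D: "0 < D" unfolding D_def using c by (intro add_pos_pos) auto
  have main: "norm (flow Q g t x) \<le> C0 * D * (t0 powr E * t powr (- 1 / 2))"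
    if wk: "walk_kernel M K z Q g" and e: "e0 \<le> norm (drift Q)" and x: "rvec x = t0 *\<^sub>R drift Q"
      and T: "T0 \<le> t0" and t: "0 < t" "t \<le> t0 / 2" for Q g :: "int ^ 'd \<Rightarrow> real" and t x t0
  proof -
    define v where "v = sgn (drift Q)"
    define s where "s = v \<bullet> (rvec x - t *\<^sub>R drift Q)"
    have t0: "1 \<le> t0" "real (d + 5) / c \<le> t0" "1 / c\<^sup>2 \<le> t0" using T by (auto simp: T0_def)
    have dr: "drift Q \<noteq> 0" using e e0 by auto
    have v: "norm v \<le> 1" by (simp add: v_def norm_sgn)
    have "v \<bullet> drift Q = norm (drift Q)"
      using dr by (simp add: v_def sgn_div_norm power2_norm_eq_inner[symmetric] power2_eq_square)
    then have s_eq: "s = norm (drift Q) * (t0 - t)"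
      by (simp add: s_def x inner_diff_right algebra_simps)
    have "e0 * (t0 / 2) \<le> norm (drift Q) * (t0 - t)" using e e0 t t0 by (intro mult_mono) auto
    then have cs: "c * t0 \<le> s" by (simp add: s_eq c_def)
    have sN: "real (d + 5) \<le> s" using cs t0(2) c by (simp add: field_simps)
    have s0: "0 < s" using sN by simp
    have "sqrt t \<le> sqrt ((c * t0)\<^sup>2)"
    proof (rule real_sqrt_le_mono)
      have "t \<le> t0 * 1" using t t0 by simp
      also have "\<dots> \<le> t0 * (c\<^sup>2 * t0)" using t0 c by (intro mult_left_mono) (auto simp: field_simps)
      finally show "t \<le> (c * t0)\<^sup>2" by (simp add: power2_eq_square mult_ac)
    qed
    then have st: "sqrt t \<le> s" using cs c t0 by simp
    note step = early_power_bound[OF t(1) _ t0(1) c cs]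
    have tt0: "t \<le> t0" using t t0 by simp
    let ?P = "t0 powr E * t powr (- 1 / 2)"
    have "(sqrt t / s) ^ (d + 4) * t powr (- 0) = t powr (real (d + 4) / 2) * s powr (- real (d + 4))"
      using sqrt_over_power[OF t(1) s0] t by simp
    also have "\<dots> \<le> c powr (- real (d + 4)) * ?P"
      by (rule step[OF tt0]) (use z in \<open>auto simp: E_def field_simps\<close>)
    finally have 1: "(sqrt t / s) ^ (d + 4) * t powr (- 0) \<le> c powr (- real (d + 4)) * ?P" .
    have "s powr (- real n) * t powr (- \<theta>\<^sub>3) = t powr (- \<theta>\<^sub>3) * s powr (- real n)" by simp
    also have "\<dots> \<le> c powr (- real n) * ?P"
    proof (rule step[OF tt0])
      show "- \<theta>\<^sub>3 + 1 / 2 - real n \<le> E"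
      proof (cases "d \<le> 3")
        case True
        then consider "d = 1" | "d = 2" | "d = 3" using d1 by linarith
        then show ?thesis using z by cases (auto simp: E_def \<theta>\<^sub>3_def n_def)
      next
        case False
        then have "real n = real d - 1" by (auto simp: n_def)
        then show ?thesis using False z by (auto simp: E_def \<theta>\<^sub>3_def field_simps)
      qed
    qed (auto simp: \<theta>\<^sub>3_def)
    finally have 3: "s powr (- real n) * t powr (- \<theta>\<^sub>3) \<le> c powr (- real n) * ?P" .
    have t1: "t * (a * t powr b) = t powr (1 + b) * a" for a b using t by (simp add: powr_add)
    have P0: "0 \<le> ?P" by simp
    show ?thesis
    proof (cases "4 \<le> d")
      case True
      have "t * (s powr (- real (d - 1)) * t powr (- \<theta>\<^sub>4)) = t powr (1 + - \<theta>\<^sub>4) * s powr (- real (d - 1))" by (rule t1)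
      also have "\<dots> \<le> c powr (- real (d - 1)) * ?P"
        by (rule step[OF tt0]) (use True z in \<open>auto simp: \<theta>\<^sub>4_def E_def field_simps of_nat_diff\<close>)
      also have "\<dots> \<le> (c powr (- 2 - z) + c powr (- real (d - 1))) * ?P" by (intro mult_right_mono P0) auto
      finally have 2: "t * (s powr (- real (d - 1)) * t powr (- \<theta>\<^sub>4)) \<le> (c powr (- 2 - z) + c powr (- real (d - 1))) * ?P" .
      have "norm (flow Q g t x) \<le> C0 * ((sqrt t / s) ^ (d + 4) * t powr (- 0) + t * (s powr (- real (d - 1)) * t powr (- \<theta>\<^sub>4))
        + s powr (- real n) * t powr (- \<theta>\<^sub>3))"
        using tail[rule_format, OF conjI[OF wk conjI[OF t(1) conjI[OF v conjI[OF s_def conjI[OF sN st]]]]]] True unfolding n_def by blast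
      also have "\<dots> \<le> C0 * (c powr (- real (d + 4)) * ?P + (c powr (- 2 - z) + c powr (- real (d - 1))) * ?P + c powr (- real n) * ?P)"
        using C0 by (intro mult_left_mono add_mono 1 2 3) auto
      also have "\<dots> = C0 * D * ?P" by (simp add: D_def algebra_simps)
      finally show ?thesis .
    next
      case False
      then consider "d = 1" | "d = 2" | "d = 3" using d1 by linarith
      then have th: "0 \<le> 1 + - \<theta>\<^sub>2 + 1 / 2" "1 + - \<theta>\<^sub>2 + 1 / 2 - (2 + z) \<le> E" using z by (cases; auto simp: E_def \<theta>\<^sub>2_def)+
      have "t * (s powr (- 2 - z) * t powr (- \<theta>\<^sub>2)) = t powr (1 + - \<theta>\<^sub>2) * s powr (- (2 + z))"
        using t1[of "s powr (- 2 - z)" "- \<theta>\<^sub>2"] by simp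
      also have "\<dots> \<le> c powr (- (2 + z)) * ?P"
        by (rule step[OF tt0]) (use th z in auto)
      also have "\<dots> \<le> (c powr (- 2 - z) + c powr (- real (d - 1))) * ?P" by (intro mult_right_mono P0) auto
      finally have 2: "t * (s powr (- 2 - z) * t powr (- \<theta>\<^sub>2)) \<le> (c powr (- 2 - z) + c powr (- real (d - 1))) * ?P" .
      have "norm (flow Q g t x) \<le> C0 * ((sqrt t / s) ^ (d + 4) * t powr (- 0) + t * (s powr (- 2 - z) * t powr (- \<theta>\<^sub>2))
        + s powr (- real n) * t powr (- \<theta>\<^sub>3))"
        using tail[rule_format, OF conjI[OF wk conjI[OF t(1) conjI[OF v conjI[OF s_def conjI[OF sN st]]]]]] unfolding n_def by blast
      also have "\<dots> \<le> C0 * (c powr (- real (d + 4)) * ?P + (c powr (- 2 - z) + c powr (- real (d - 1))) * ?P + c powr (- real n) * ?P)"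
        using C0 by (intro mult_left_mono add_mono 1 2 3) auto
      also have "\<dots> = C0 * D * ?P" by (simp add: D_def algebra_simps)
      finally show ?thesis .
    qed
  qed
  show ?thesis
    using main C0 D unfolding E_def by (intro exI[of _ "C0 * D"] conjI exI[of _ T0]) auto
qed

text \<open>Since \<open>t\<close> may be much larger than \<open>t0\<close>, a nonnegative power
  \<open>\<kappa>\<close> of it is bounded by those of \<open>t0\<close> and of the distance
  \<open>u\<close>, and both cases are treated. The factor u^(-3/2) is kept for the time integral,
  as it is integrable at infinity; the other powers of \<open>u\<close> become powers of
  \<open>t0\<close>.\<close>

lemma far_power_bound:
  fixes t t0 u \<alpha> \<beta> \<kappa> \<delta> F :: real
  assumes t0: "1 \<le> t0" and t: "t0 / 2 \<le> t" "t \<le> t0 + u" and u: "t0 powr (1 / 2 + \<delta>) \<le> u" and \<delta>: "0 \<le> \<delta>"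
    and \<kappa>: "0 \<le> \<kappa>" "\<kappa> + 3 / 2 \<le> \<beta>" "\<alpha> \<le> \<kappa>"
    and F: "\<kappa> - (\<beta> - 3 / 2) * (1 / 2 + \<delta>) \<le> F" "- (\<beta> - \<kappa> - 3 / 2) * (1 / 2 + \<delta>) \<le> F"
  shows "t powr \<alpha> * u powr (- \<beta>) \<le> 2 powr (2 * \<kappa> - \<alpha> + 1) * (t0 powr (\<alpha> - \<kappa> + F) * u powr (- 3 / 2))"
proof -
  have u0: "0 < u" using u t0 by (smt (verit) powr_gt_zero)
  have t': "0 < t" using t t0 by simp
  have upow: "u powr (- p) \<le> t0 powr (- p * (1 / 2 + \<delta>))" if "0 \<le> p" for p
  proof -
    have "u powr (- p) \<le> (t0 powr (1 / 2 + \<delta>)) powr (- p)" using u t0 that by (intro powr_mono2') auto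
    then show ?thesis by (simp add: powr_powr mult.commute)
  qed
  have a: "t powr \<alpha> = t powr \<kappa> * t powr (\<alpha> - \<kappa>)" using t' by (simp flip: powr_add)
  have b: "t powr (\<alpha> - \<kappa>) \<le> 2 powr (\<kappa> - \<alpha>) * t0 powr (\<alpha> - \<kappa>)"
  proof -
    have "t powr (\<alpha> - \<kappa>) \<le> (t0 / 2) powr (\<alpha> - \<kappa>)" using t t0 \<kappa> by (intro powr_mono2') auto
    also have "\<dots> = 2 powr (\<kappa> - \<alpha>) * t0 powr (\<alpha> - \<kappa>)"
      using t0 powr_minus_divide[of 2 "\<alpha> - \<kappa>"] by (simp add: powr_divide)
    finally show ?thesis .
  qed
  have c: "t powr \<kappa> \<le> 2 powr \<kappa> * (t0 powr \<kappa> + u powr \<kappa>)"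
  proof -
    have "t powr \<kappa> \<le> (2 * max t0 u) powr \<kappa>" using t t' \<kappa> by (intro powr_mono2) auto
    also have "\<dots> = 2 powr \<kappa> * (max t0 u) powr \<kappa>" using t0 by (simp add: powr_mult)
    also have "\<dots> \<le> 2 powr \<kappa> * (t0 powr \<kappa> + u powr \<kappa>)" by (intro mult_left_mono) (auto simp: max_def)
    finally show ?thesis .
  qed
  have d: "(t0 powr \<kappa> + u powr \<kappa>) * u powr (- \<beta>) \<le> 2 * (t0 powr F * u powr (- 3 / 2))"
  proof -
    have "u powr (- \<beta>) = u powr (- (\<beta> - 3 / 2)) * u powr (- 3 / 2)" using u0 by (simp flip: powr_add)
    also have "\<dots> \<le> t0 powr (- (\<beta> - 3 / 2) * (1 / 2 + \<delta>)) * u powr (- 3 / 2)"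
      using \<kappa> by (intro mult_right_mono upow) auto
    finally have "t0 powr \<kappa> * u powr (- \<beta>) \<le> t0 powr \<kappa> * (t0 powr (- (\<beta> - 3 / 2) * (1 / 2 + \<delta>)) * u powr (- 3 / 2))"
      by (intro mult_left_mono) auto
    also have "\<dots> = t0 powr (\<kappa> + - (\<beta> - 3 / 2) * (1 / 2 + \<delta>)) * u powr (- 3 / 2)" by (simp only: powr_add mult.assoc)
    also have "\<dots> \<le> t0 powr F * u powr (- 3 / 2)"
    proof -
      have "\<kappa> + - (\<beta> - 3 / 2) * (1 / 2 + \<delta>) = \<kappa> - (\<beta> - 3 / 2) * (1 / 2 + \<delta>)"
        by (simp only: minus_mult_left[symmetric] diff_conv_add_uminus)
      with F(1) have "\<kappa> + - (\<beta> - 3 / 2) * (1 / 2 + \<delta>) \<le> F" by (simp only:)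
      then show ?thesis using t0 by (intro mult_right_mono powr_mono powr_ge_zero)
    qed
    finally have 1: "t0 powr \<kappa> * u powr (- \<beta>) \<le> t0 powr F * u powr (- 3 / 2)" .
    have "u powr \<kappa> * u powr (- \<beta>) = u powr (- (\<beta> - \<kappa> - 3 / 2)) * u powr (- 3 / 2)" using u0 by (simp flip: powr_add)
    also have "\<dots> \<le> t0 powr (- (\<beta> - \<kappa> - 3 / 2) * (1 / 2 + \<delta>)) * u powr (- 3 / 2)"
      using \<kappa> by (intro mult_right_mono upow) auto
    also have "\<dots> \<le> t0 powr F * u powr (- 3 / 2)" using F t0 by (intro mult_right_mono powr_mono) auto
    finally have 2: "u powr \<kappa> * u powr (- \<beta>) \<le> t0 powr F * u powr (- 3 / 2)" .
    from 1 2 show ?thesis by (simp add: distrib_right)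
  qed
  have "t powr \<alpha> * u powr (- \<beta>) \<le> (2 powr \<kappa> * (t0 powr \<kappa> + u powr \<kappa>)) * (2 powr (\<kappa> - \<alpha>) * t0 powr (\<alpha> - \<kappa>)) * u powr (- \<beta>)"
    unfolding a by (intro mult_right_mono mult_mono b c) auto
  also have "\<dots> = (2 powr \<kappa> * 2 powr (\<kappa> - \<alpha>) * t0 powr (\<alpha> - \<kappa>)) * ((t0 powr \<kappa> + u powr \<kappa>) * u powr (- \<beta>))"
    by (simp only: mult_ac)
  also have "\<dots> \<le> (2 powr \<kappa> * 2 powr (\<kappa> - \<alpha>) * t0 powr (\<alpha> - \<kappa>)) * (2 * (t0 powr F * u powr (- 3 / 2)))"
    by (intro mult_left_mono d) auto
  also have "\<dots> = 2 powr (2 * \<kappa> - \<alpha> + 1) * (t0 powr (\<alpha> - \<kappa> + F) * u powr (- 3 / 2))"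
  proof -
    have "2 powr (2 * \<kappa> - \<alpha> + 1) = 2 powr \<kappa> * 2 powr (\<kappa> - \<alpha>) * (2 :: real)"
    proof -
      have "2 * \<kappa> - \<alpha> + 1 = \<kappa> + (\<kappa> - \<alpha>) + 1" by simp
      then show ?thesis by (simp only: powr_add) simp
    qed
    then show ?thesis by (simp add: powr_add)
  qed
  finally show ?thesis .
qed

text \<open>After time t0 / 2 the Gaussian factor t^(-d/2) already carries the dimension, so the
  moment of order 2 + z controls the large jump in every dimension. The power 3/4 of
  \<open>t0\<close> becomes 1/2 in the end, because integrating u^(-3/2) outside the window gains
  t0^(-1/4).\<close>

lemma flow_far:
  fixes M K z e0 :: real
  defines "d \<equiv> CARD('d::finite)" and "\<delta> \<equiv> z / 16"
  assumes M: "0 < M" and K: "0 < K" and z: "0 < z" "z \<le> 1" and e0: "0 < e0"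
  shows "\<exists>C>0. \<exists>T0. \<forall>(Q :: int ^ 'd \<Rightarrow> real) g t x t0. walk_kernel M K z Q g \<and> e0 \<le> norm (drift Q) \<and>
     rvec x = t0 *\<^sub>R drift Q \<and> T0 \<le> t0 \<and> t0 / 2 \<le> t \<and> t0 powr (1 / 2 + \<delta>) \<le> \<bar>t - t0\<bar> \<longrightarrow>
     norm (flow Q g t x) \<le> C * (t0 powr (3 / 4 - real d / 2 - \<delta>) * \<bar>t - t0\<bar> powr (- 3 / 2))"
proof -
  have \<delta>: "0 < \<delta>" "\<delta> \<le> 1 / 16" using z by (auto simp: \<delta>_def)
  have d1: "1 \<le> d" by (simp add: d_def Suc_le_eq)
  define n where "n = max 2 (d - 1)"
  have "\<exists>C>0. \<forall>(Q :: int ^ 'd \<Rightarrow> real) g t x v s. walk_kernel M K z Q g \<and> 0 < t \<and> norm v \<le> 1 \<and>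
     s = v \<bullet> (rvec x - t *\<^sub>R drift Q) \<and> real (d + 5) \<le> s \<and> sqrt t \<le> s \<longrightarrow>
     norm (flow Q g t x) \<le> C * ((sqrt t / s) ^ (d + 4) * t powr (- (d / 2)) + t * (s powr (- 2 - z) * t powr (- (d / 2)))
        + s powr (- real (max 2 (d - 1))) * t powr (- (d / 4))) \<and>
     (4 \<le> d \<longrightarrow> norm (flow Q g t x) \<le> C * ((sqrt t / s) ^ (d + 4) * t powr (- (d / 2)) + t * (s powr (- real (d - 1)) * t powr (- 0))
        + s powr (- real (max 2 (d - 1))) * t powr (- (d / 4))))"
    unfolding d_def by (rule flow_tail[OF M K]) auto
  then obtain C0 where C0: "0 < C0" and tail: "\<forall>(Q :: int ^ 'd \<Rightarrow> real) g t x v s. walk_kernel M K z Q g \<and> 0 < t \<and> norm v \<le> 1 \<and>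
     s = v \<bullet> (rvec x - t *\<^sub>R drift Q) \<and> real (d + 5) \<le> s \<and> sqrt t \<le> s \<longrightarrow>
     norm (flow Q g t x) \<le> C0 * ((sqrt t / s) ^ (d + 4) * t powr (- (d / 2)) + t * (s powr (- 2 - z) * t powr (- (d / 2)))
        + s powr (- real (max 2 (d - 1))) * t powr (- (d / 4))) \<and>
     (4 \<le> d \<longrightarrow> norm (flow Q g t x) \<le> C0 * ((sqrt t / s) ^ (d + 4) * t powr (- (d / 2)) + t * (s powr (- real (d - 1)) * t powr (- 0))
        + s powr (- real (max 2 (d - 1))) * t powr (- (d / 4))))"
    by (elim exE conjE)
  \<comment> \<open>With t0^\<delta> \<ge> b the distance \<open>u\<close> to \<open>t0\<close>
    exceeds both \<open>b\<close> and \<open>sqrt t0 * b\<close>; the three summands of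
    \<open>b\<close> then yield \<open>d + 5 \<le> s\<close>,
    \<open>t \<le> (e0 * u)\<^sup>2\<close> and \<open>1 \<le> b\<close>.\<close>
  define b where "b = real (d + 5) / e0 + 2 / e0\<^sup>2 + 1"
  have b: "1 \<le> b" "real (d + 5) \<le> e0 * b" "1 \<le> e0\<^sup>2 * b / 2"
    using e0 by (auto simp: b_def field_simps power2_eq_square)
  define T0 where "T0 = max 1 (b powr (1 / \<delta>))"
  \<comment> \<open>The constants of \<open>far_power_bound\<close>: the decay exponents in
    \<open>s\<close> are 4, 2 + z and n, and the parameter \<open>\<kappa>\<close> is 2, 1/2 and
    0.\<close>
  define D1 where "D1 = e0 powr (- 4) * 2 powr (2 * 2 - (2 - d / 2) + 1)"
  define D2 where "D2 = e0 powr (- (2 + z)) * 2 powr (2 * (1 / 2) - (1 - d / 2) + 1)"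
  define D3 where "D3 = e0 powr (- real n) * 2 powr (2 * 0 - (- (d / 4)) + 1)"
  define D where "D = D1 + D2 + D3"
  have D: "0 < D" unfolding D_def D1_def D2_def D3_def using e0 by (intro add_pos_pos) auto
  have main: "norm (flow Q g t x) \<le> C0 * D * (t0 powr (3 / 4 - real d / 2 - \<delta>) * \<bar>t - t0\<bar> powr (- 3 / 2))"
    if wk: "walk_kernel M K z Q g" and e: "e0 \<le> norm (drift Q)" and x: "rvec x = t0 *\<^sub>R drift Q"
      and T: "T0 \<le> t0" and t: "t0 / 2 \<le> t" and far: "t0 powr (1 / 2 + \<delta>) \<le> \<bar>t - t0\<bar>"
    for Q g :: "int ^ 'd \<Rightarrow> real" and t x t0
  proof -
    define u where "u = \<bar>t - t0\<bar>"
    have t0: "1 \<le> t0" "b powr (1 / \<delta>) \<le> t0" using T by (auto simp: T0_def)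
    have bt: "b \<le> t0 powr \<delta>"
    proof -
      have "(b powr (1 / \<delta>)) powr \<delta> \<le> t0 powr \<delta>" using t0 \<delta> by (intro powr_mono2) auto
      then show ?thesis using \<delta> b by (simp add: powr_powr)
    qed
    have sq: "sqrt t0 * b \<le> u"
    proof -
      have "sqrt t0 * b \<le> sqrt t0 * t0 powr \<delta>" using bt t0 by (intro mult_left_mono) auto
      also have "\<dots> = t0 powr (1 / 2 + \<delta>)" using t0 by (simp add: powr_add powr_half_sqrt)
      finally show ?thesis using far by (simp add: u_def)
    qed
    have sq1: "1 \<le> sqrt t0" using t0 by simp
    have "1 * b \<le> sqrt t0 * b" using sq1 b by (intro mult_right_mono) auto
    then have ub: "b \<le> u" using sq by simp
    have u0: "0 < u" using ub b by simp
    have t': "0 < t" using t t0 by simp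
    \<comment> \<open>Before \<open>t0\<close> the walk lags behind \<open>x\<close>, afterwards it
      has overshot. The sign makes \<open>s\<close> the distance to the mean position in both
      cases.\<close>
    define v where "v = sgn (t0 - t) *\<^sub>R sgn (drift Q)"
    define s where "s = v \<bullet> (rvec x - t *\<^sub>R drift Q)"
    have dr: "drift Q \<noteq> 0" using e e0 by auto
    have v: "norm v \<le> 1" by (simp add: v_def norm_sgn sgn_real_def)
    have vd: "v \<bullet> drift Q = sgn (t0 - t) * norm (drift Q)"
      using dr by (simp add: v_def sgn_div_norm power2_norm_eq_inner[symmetric] power2_eq_square)
    have s_eq: "s = norm (drift Q) * u"
    proof -
      have "s = (t0 - t) * (v \<bullet> drift Q)" by (simp add: s_def x inner_diff_right algebra_simps)
      also have "\<dots> = norm (drift Q) * \<bar>t0 - t\<bar>" unfolding vd by (simp add: sgn_if)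
      finally show ?thesis by (simp add: u_def abs_minus_commute)
    qed
    have es: "e0 * u \<le> s" unfolding s_eq using e u0 by (intro mult_right_mono) auto
    have sN: "real (d + 5) \<le> s" using b(2) mult_left_mono[OF ub, of e0] e0 es by linarith
    have s0: "0 < s" using sN by simp
    have tu: "t \<le> t0 + u" by (simp add: u_def)
    have "t \<le> (e0 * u)\<^sup>2"
    proof -
      have "e0\<^sup>2 * b / 2 * 1 \<le> e0\<^sup>2 * b / 2 * b" using b by (intro mult_left_mono) auto
      then have "1 \<le> e0\<^sup>2 * b\<^sup>2 / 2" using b(3) by (simp add: power2_eq_square mult.assoc)
      then have "t0 * 1 \<le> t0 * (e0\<^sup>2 * b\<^sup>2 / 2)" using t0 by (intro mult_left_mono) auto
      also have "\<dots> = e0\<^sup>2 / 2 * (sqrt t0 * b)\<^sup>2" using t0 by (simp add: power_mult_distrib)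
      also have "\<dots> \<le> e0\<^sup>2 / 2 * u\<^sup>2" using sq b t0 by (intro mult_left_mono power_mono) auto
      finally have 1: "t0 \<le> e0\<^sup>2 * u\<^sup>2 / 2" by simp
      have "e0\<^sup>2 / 2 * b \<le> e0\<^sup>2 / 2 * u" using ub by (intro mult_left_mono) auto
      then have "1 \<le> e0\<^sup>2 * u / 2" using b(3) by simp
      then have "u * 1 \<le> u * (e0\<^sup>2 * u / 2)" using u0 by (intro mult_left_mono) auto
      then have 2: "u \<le> e0\<^sup>2 * u\<^sup>2 / 2" by (simp add: power2_eq_square mult_ac)
      from 1 2 tu show ?thesis by (simp add: power_mult_distrib)
    qed
    then have "sqrt t \<le> e0 * u" using e0 u0 by (intro real_le_lsqrt) auto
    then have st: "sqrt t \<le> s" using es by simp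
    have spow: "s powr (- p) \<le> e0 powr (- p) * u powr (- p)" if "0 \<le> p" for p
    proof -
      have "s powr (- p) \<le> (e0 * u) powr (- p)" using es e0 u0 that by (intro powr_mono2') auto
      then show ?thesis using e0 u0 by (simp add: powr_mult)
    qed
    have step: "t powr \<alpha> * s powr (- \<beta>) \<le> e0 powr (- \<beta>) * 2 powr (2 * \<kappa> - \<alpha> + 1) * (t0 powr (3 / 4 - real d / 2 - \<delta>) * u powr (- 3 / 2))"
      if "0 \<le> \<kappa>" "\<kappa> + 3 / 2 \<le> \<beta>" "\<alpha> \<le> \<kappa>" "\<kappa> - (\<beta> - 3 / 2) * (1 / 2 + \<delta>) \<le> F" "- (\<beta> - \<kappa> - 3 / 2) * (1 / 2 + \<delta>) \<le> F"
        "\<alpha> - \<kappa> + F \<le> 3 / 4 - real d / 2 - \<delta>" for \<alpha> \<beta> \<kappa> F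
    proof -
      have "t powr \<alpha> * s powr (- \<beta>) \<le> t powr \<alpha> * (e0 powr (- \<beta>) * u powr (- \<beta>))"
        using that by (intro mult_left_mono spow) auto
      also have "\<dots> = e0 powr (- \<beta>) * (t powr \<alpha> * u powr (- \<beta>))" by simp
      also have "\<dots> \<le> e0 powr (- \<beta>) * (2 powr (2 * \<kappa> - \<alpha> + 1) * (t0 powr (\<alpha> - \<kappa> + F) * u powr (- 3 / 2)))"
        by (intro mult_left_mono far_power_bound[OF t0(1) t tu far[folded u_def]]) (use that \<delta> in auto)
      also have "\<dots> \<le> e0 powr (- \<beta>) * (2 powr (2 * \<kappa> - \<alpha> + 1) * (t0 powr (3 / 4 - real d / 2 - \<delta>) * u powr (- 3 / 2)))"
        using that t0 by (intro mult_left_mono mult_right_mono powr_mono) auto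
      finally show ?thesis by (simp add: mult.assoc)
    qed
    let ?P = "t0 powr (3 / 4 - real d / 2 - \<delta>) * u powr (- 3 / 2)"
    have 1: "(sqrt t / s) ^ (d + 4) * t powr (- (d / 2)) \<le> D1 * ?P"
    proof -
      \<comment> \<open>The base is at most 1, so four of the powers may be kept; the dimension is
        accounted for by t^(-d/2).\<close>
      have "(sqrt t / s) ^ (d + 4) \<le> (sqrt t / s) ^ 4" using st s0 t' by (intro power_decreasing) auto
      then have "(sqrt t / s) ^ (d + 4) * t powr (- (d / 2)) \<le> (sqrt t / s) ^ 4 * t powr (- (d / 2))" by (intro mult_right_mono) auto
      also have "\<dots> = t powr (2 - d / 2) * s powr (- 4)"
        using sqrt_over_power[OF t' s0, of 4] t' by (simp add: powr_diff powr_minus_divide)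
      also have "\<dots> \<le> D1 * ?P" unfolding D1_def
        by (rule step[where F = "3 / 4 - \<delta>"]) (use \<delta> in \<open>auto simp: field_simps\<close>)
      finally show ?thesis .
    qed
    have zd: "0 \<le> z * \<delta>" "\<delta> \<le> z" using z \<delta> by (auto simp: \<delta>_def)
    have "((2 + z) - 3 / 2) * (1 / 2 + \<delta>) = 1 / 4 + \<delta> / 2 + z / 2 + z * \<delta>" by (simp add: field_simps)
    then have Fa: "1 / 2 - ((2 + z) - 3 / 2) * (1 / 2 + \<delta>) \<le> 1 / 4 - \<delta>" using zd \<delta> by linarith
    have "- ((2 + z) - 1 / 2 - 3 / 2) * (1 / 2 + \<delta>) = - (z / 2) - z * \<delta>" by (simp add: field_simps)
    then have Fb: "- ((2 + z) - 1 / 2 - 3 / 2) * (1 / 2 + \<delta>) \<le> 1 / 4 - \<delta>" using zd z \<delta> by linarith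
    have 2: "t * (s powr (- 2 - z) * t powr (- (d / 2))) \<le> D2 * ?P"
    proof -
      have "t * (s powr (- 2 - z) * t powr (- (d / 2))) = t powr (1 - d / 2) * s powr (- (2 + z))"
        using t' by (simp add: powr_diff powr_minus_divide)
      also have "\<dots> \<le> D2 * ?P" unfolding D2_def
        by (rule step[OF _ _ _ Fa Fb]) (use z d1 in auto)
      finally show ?thesis .
    qed
    have 3: "s powr (- real n) * t powr (- (d / 4)) \<le> D3 * ?P"
    proof -
      have nd: "real d / 4 + \<delta> \<le> real n / 2"
        using \<delta> d1 by (cases "d \<le> 3") (auto simp: n_def max_def of_nat_diff field_simps)
      have n2: "2 \<le> real n" by (simp add: n_def)
      have n\<delta>: "\<delta> / 2 \<le> (real n - 3 / 2) * \<delta>" using n2 \<delta> mult_right_mono[of "1 / 2" "real n - 3 / 2" \<delta>] by simp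
      have "- (real n - 3 / 2) * (1 / 2 + \<delta>) = - real n / 2 + 3 / 4 - (real n - 3 / 2) * \<delta>" by (simp add: field_simps)
      also have "\<dots> \<le> 3 / 4 - real d / 4 - \<delta>" using nd n\<delta> \<delta> by linarith
      finally have F: "- (real n - 3 / 2) * (1 / 2 + \<delta>) \<le> 3 / 4 - real d / 4 - \<delta>" .
      have "s powr (- real n) * t powr (- (d / 4)) = t powr (- (d / 4)) * s powr (- real n)" by simp
      also have "\<dots> \<le> D3 * ?P" unfolding D3_def
        by (rule step[where F = "3 / 4 - real d / 4 - \<delta>"]) (use \<delta> n2 F in \<open>simp_all add: field_simps\<close>)
      finally show ?thesis .
    qed
    have "norm (flow Q g t x) \<le> C0 * ((sqrt t / s) ^ (d + 4) * t powr (- (d / 2)) + t * (s powr (- 2 - z) * t powr (- (d / 2)))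
        + s powr (- real n) * t powr (- (d / 4)))"
      using tail[rule_format, OF conjI[OF wk conjI[OF t' conjI[OF v conjI[OF s_def conjI[OF sN st]]]]]] unfolding n_def by blast
    also have "\<dots> \<le> C0 * (D1 * ?P + D2 * ?P + D3 * ?P)"
      using C0 by (intro mult_left_mono add_mono 1 2 3) auto
    also have "\<dots> = C0 * D * ?P" by (simp add: D_def algebra_simps)
    finally show ?thesis by (simp add: u_def)
  qed
  show ?thesis
    using main C0 D by (intro exI[of _ "C0 * D"] conjI exI[of _ T0]) auto
qed

section \<open>The local limit approximation near the typical time\<close>

lemma powr_gauss_le:
  fixes a p :: real
  assumes a: "0 < a" and p: "0 \<le> p" "p \<le> 4"
  shows "norm k powr p * exp (- (a * (norm k)\<^sup>2)) \<le> 8 * a powr (- p / 2) * exp (- (a / 2 * (norm k)\<^sup>2))"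
proof (cases "k = 0")
  case False
  define w where "w = a * (norm k)\<^sup>2"
  have w: "0 < w" using a False by (simp add: w_def)
  have "norm k powr p = (w / a) powr (p / 2)"
    using a False by (simp add: w_def powr_powr flip: powr_numeral)
  also have "\<dots> = a powr (- p / 2) * w powr (p / 2)" using a w by (simp add: powr_divide powr_minus_divide)
  \<comment> \<open>\<open>1 + w\<^sup>2\<close> covers all exponents between 0 and 2 at once, and 8
    is the factor that makes the quadratic Taylor bound of exp (w / 2) dominate it.\<close>
  also have "w powr (p / 2) \<le> 8 * exp (w / 2)"
  proof -
    have "w powr (p / 2) \<le> 1 + w\<^sup>2"
    proof (cases "w \<le> 1")
      case True
      then have "w powr (p / 2) \<le> 1" using w p powr_le1[of "p / 2" w] by simp
      then show ?thesis using zero_le_power2[of w] by linarith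
    next
      case False
      then have "w powr (p / 2) \<le> w powr 2" using p by (intro powr_mono) auto
      then show ?thesis using w by (simp add: powr_numeral)
    qed
    also have "\<dots> \<le> 8 * exp (w / 2)"
      using exp_lower_Taylor_quadratic[of "w / 2"] w by (simp add: power2_eq_square field_simps)
    finally show ?thesis .
  qed
  finally have "norm k powr p \<le> a powr (- p / 2) * (8 * exp (w / 2))" by (simp add: mult_left_mono)
  then have "norm k powr p * exp (- w) \<le> a powr (- p / 2) * (8 * exp (w / 2)) * exp (- w)" by (intro mult_right_mono) auto
  also have "\<dots> = 8 * a powr (- p / 2) * exp (- (w / 2))" by (simp flip: exp_add)
  finally show ?thesis by (simp add: w_def)
qed auto

context walk_kernel
begin

text \<open>Since \<open>rvec x\<close> is \<open>t0\<close> times the drift, the phase cancels the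
  linear Taylor term up to \<open>t - t0\<close>. The remaining errors are the Hoelder continuity of
  the transform of \<open>g\<close>, the Taylor remainder, and the replacement of \<open>t\<close>
  by \<open>t0\<close> in the covariance. This replacement makes the main term exactly Gaussian in
  \<open>t\<close>. The rate \<open>a\<close> is the infrared decay available for all t \<ge> t0 /
  2.\<close>

lemma flow_window_pointwise:
  fixes t t0 :: real
  defines "a \<equiv> K * t0 / 2"
  assumes x: "rvec x = t0 *\<^sub>R drift Q" and t0: "1 \<le> t0" and t: "\<bar>t - t0\<bar> \<le> t0 / 2"
  shows "norm (indicator torus k *\<^sub>R (phase x k * fourier g k * exp (of_real t * (fourier Q k - 1)))
      - fourier g 0 * (exp (\<i> * complex_of_real (- (t - t0) *\<^sub>R drift Q \<bullet> k)) * complex_of_real (exp (- t0 * (k \<bullet> (covar Q *v k)) / 2))))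
    \<le> 8 * (2 * M * a powr (- z / 2) + M\<^sup>2 * (2 * t0) * a powr (- (2 + z) / 2) + M\<^sup>2 * \<bar>t - t0\<bar> * a powr (- 1) + M * a powr (- 1))
      * exp (- (a / 2 * (norm k)\<^sup>2))"
proof -
  have a: "0 < a" using K t0 by (simp add: a_def)
  let ?E = "exp (- (a * (norm k)\<^sup>2))" and ?E2 = "exp (- (a / 2 * (norm k)\<^sup>2))"
  let ?c1 = "a powr (- z / 2)" and ?c2 = "a powr (- (2 + z) / 2)" and ?c3 = "a powr (- 1)"
  let ?C = "8 * (2 * M * ?c1 + M\<^sup>2 * (2 * t0) * ?c2 + M\<^sup>2 * \<bar>t - t0\<bar> * ?c3 + M * ?c3)"
  let ?D = "t - t0" and ?q = "k \<bullet> (covar Q *v k)"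
  let ?b = "\<i> * complex_of_real (- ?D *\<^sub>R drift Q \<bullet> k) + complex_of_real (- t0 * ?q / 2)"
  have tt: "t0 / 2 \<le> t" "t \<le> 2 * t0" using t t0 by linarith+
  have p2: "(norm k)\<^sup>2 * ?E \<le> 8 * ?c3 * ?E2"
    using powr_gauss_le[OF a, of 2 k] by (simp add: powr_numeral)
  have pz: "norm k powr z * ?E \<le> 8 * ?c1 * ?E2" using powr_gauss_le[OF a, of z k] z by simp
  have p2z: "norm k powr (2 + z) * ?E \<le> 8 * ?c2 * ?E2" using powr_gauss_le[OF a, of "2 + z" k] z by simp
  have q: "2 * K * (norm k)\<^sup>2 \<le> ?q" "0 \<le> ?q" "?q \<le> M * (norm k)\<^sup>2"
    using covar_lower[of k] covar_upper[of k] order.trans[OF mult_nonneg_nonneg covar_lower[of k]] K by simp_all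
  have qq: "t0 * (2 * K * (norm k)\<^sup>2) \<le> t0 * ?q" using q(1) t0 by (intro mult_left_mono) auto
  have Kk: "0 \<le> t0 * (K * (norm k)\<^sup>2)" using t0 K by auto
  have Reb: "Re ?b \<le> - (a * (norm k)\<^sup>2)"
    using qq Kk by (simp add: a_def algebra_simps)
  have eb: "exp (\<i> * complex_of_real (- ?D *\<^sub>R drift Q \<bullet> k)) * complex_of_real (exp (- t0 * ?q / 2)) = exp ?b"
    by (simp only: exp_add exp_of_real)
  have neb: "norm (exp ?b) \<le> ?E" using Reb by (simp add: norm_exp_eq_Re)
  show ?thesis
  proof (cases "k \<in> torus")
    case True
    let ?a1 = "\<i> * complex_of_real (t0 * (drift Q \<bullet> k)) + of_real t * (fourier Q k - 1)"
    have "t * (K * (norm k)\<^sup>2) \<le> t * (1 - Re (fourier Q k))"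
      using Q_infrared[OF True] tt t0 by (intro mult_left_mono) auto
    moreover have "t0 / 2 * (K * (norm k)\<^sup>2) \<le> t * (K * (norm k)\<^sup>2)" using tt K by (intro mult_right_mono) auto
    ultimately have Rea: "Re ?a1 \<le> - (a * (norm k)\<^sup>2)" by (simp add: a_def algebra_simps)
    have ea: "phase x k * exp (of_real t * (fourier Q k - 1)) = exp ?a1"
      by (simp add: phase_def x exp_add inner_commute)
    have nea: "norm (exp ?a1) \<le> ?E" using Rea by (simp add: norm_exp_eq_Re)
    have diff: "?a1 - ?b = of_real t * (fourier Q k - 1 + \<i> * complex_of_real (k \<bullet> drift Q) + complex_of_real (?q / 2)) - complex_of_real (?D * ?q / 2)"
      by (simp add: algebra_simps inner_commute add_divide_distrib diff_divide_distrib)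
    have N: "norm (?a1 - ?b) \<le> t * (M * norm k powr (2 + z)) + \<bar>?D\<bar> * (M * (norm k)\<^sup>2)"
    proof -
      have "norm (?a1 - ?b) \<le> norm (of_real t * (fourier Q k - 1 + \<i> * complex_of_real (k \<bullet> drift Q) + complex_of_real (?q / 2)))
        + norm (complex_of_real (?D * ?q / 2))" unfolding diff by (rule norm_triangle_ineq4)
      moreover have "norm (of_real t * (fourier Q k - 1 + \<i> * complex_of_real (k \<bullet> drift Q) + complex_of_real (?q / 2))) \<le> t * (M * norm k powr (2 + z))"
        unfolding norm_mult using fourier_Q_taylor[of k] tt t0 by (intro mult_mono) auto
      moreover have "norm (complex_of_real (?D * ?q / 2)) \<le> \<bar>?D\<bar> * (M * (norm k)\<^sup>2)"
      proof -
        have "norm (complex_of_real (?D * ?q / 2)) = \<bar>?D\<bar> * (?q / 2)" 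
          by (simp only: norm_of_real abs_mult abs_divide abs_of_nonneg[OF q(2)])
        also have "\<dots> \<le> \<bar>?D\<bar> * (M * (norm k)\<^sup>2)" using q by (intro mult_left_mono) auto
        finally show ?thesis .
      qed
      ultimately show ?thesis by linarith
    qed
    have "norm (exp ?a1 - exp ?b) \<le> (t * (M * norm k powr (2 + z)) + \<bar>?D\<bar> * (M * (norm k)\<^sup>2)) * ?E"
      by (rule order.trans[OF exp_diff_bound[OF Rea Reb] mult_right_mono[OF N exp_ge_zero]])
    also have "\<dots> = t * M * (norm k powr (2 + z) * ?E) + \<bar>?D\<bar> * M * ((norm k)\<^sup>2 * ?E)" by (simp add: algebra_simps)
    also have "\<dots> \<le> (2 * t0) * M * (8 * ?c2 * ?E2) + \<bar>?D\<bar> * M * (8 * ?c3 * ?E2)"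
      using tt t0 M by (intro add_mono mult_mono p2 p2z mult_right_mono) auto
    finally have X: "norm (exp ?a1 - exp ?b) \<le> (2 * t0) * M * (8 * ?c2 * ?E2) + \<bar>?D\<bar> * M * (8 * ?c3 * ?E2)" .
    have "norm (fourier g k - fourier g 0) * norm (exp ?a1) \<le> (2 * M * norm k powr z) * ?E"
      using M by (intro mult_mono fourier_g_holder nea) auto
    also have "\<dots> \<le> 2 * M * (8 * ?c1 * ?E2)" using pz M by (simp add: mult.assoc)
    finally have Y: "norm (fourier g k - fourier g 0) * norm (exp ?a1) \<le> 2 * M * (8 * ?c1 * ?E2)" .
    have "indicator torus k *\<^sub>R (phase x k * fourier g k * exp (of_real t * (fourier Q k - 1))) = fourier g k * exp ?a1"
      using True ea by (simp add: mult_ac)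
    then have "indicator torus k *\<^sub>R (phase x k * fourier g k * exp (of_real t * (fourier Q k - 1))) - fourier g 0 * exp ?b
      = (fourier g k - fourier g 0) * exp ?a1 + fourier g 0 * (exp ?a1 - exp ?b)"
      by (simp add: algebra_simps)
    note split = this
    have "norm (indicator torus k *\<^sub>R (phase x k * fourier g k * exp (of_real t * (fourier Q k - 1))) - fourier g 0 * exp ?b)
      \<le> norm (fourier g k - fourier g 0) * norm (exp ?a1) + norm (fourier g 0) * norm (exp ?a1 - exp ?b)"
      unfolding split by (rule norm_triangle_ineq[THEN order.trans]) (simp only: norm_mult order.refl)
    also have "\<dots> \<le> 2 * M * (8 * ?c1 * ?E2) + M * ((2 * t0) * M * (8 * ?c2 * ?E2) + \<bar>?D\<bar> * M * (8 * ?c3 * ?E2))"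
      using M by (intro add_mono Y mult_mono norm_fourier_g X) auto
    also have "\<dots> \<le> 2 * M * (8 * ?c1 * ?E2) + M * ((2 * t0) * M * (8 * ?c2 * ?E2) + \<bar>?D\<bar> * M * (8 * ?c3 * ?E2)) + M * (8 * ?c3 * ?E2)"
      using M by simp
    also have "\<dots> = ?C * ?E2" by (simp add: power2_eq_square algebra_simps)
    finally show ?thesis unfolding eb .
  next
    \<comment> \<open>Outside the torus only the Gaussian is present. There
      \<open>norm k \<ge> 1\<close>, so \<open>p2\<close> applies; this is the source of the last
      summand in the bound.\<close>
    case False
    then obtain i where "pi < \<bar>k $ i\<bar>" by (auto simp: torus_iff not_le)
    then have "1 \<le> norm k" using component_le_norm_cart[of k i] pi_gt3 by linarith
    then have "1 \<le> (norm k)\<^sup>2" by simp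
    then have "1 * ?E \<le> (norm k)\<^sup>2 * ?E" by (intro mult_right_mono) auto
    then have "norm (exp ?b) \<le> 8 * ?c3 * ?E2" using neb p2 by linarith
    then have "norm (fourier g 0) * norm (exp ?b) \<le> M * (8 * ?c3 * ?E2)"
      using M by (intro mult_mono norm_fourier_g) auto
    also have "\<dots> \<le> 2 * M * (8 * ?c1 * ?E2) + M * ((2 * t0) * M * (8 * ?c2 * ?E2) + \<bar>?D\<bar> * M * (8 * ?c3 * ?E2)) + M * (8 * ?c3 * ?E2)"
      using M t0 by simp
    also have "\<dots> = ?C * ?E2" by (simp add: power2_eq_square algebra_simps)
    finally show ?thesis using False unfolding eb by (simp add: norm_mult)
  qed
qed

lemma continuous_covar: "continuous_on A (\<lambda>k. k \<bullet> (covar Q *v k))"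
  by (intro continuous_intros matrix_vector_mult_linear_continuous_on)

lemma gauss_term_integrable:
  assumes t0: "0 < t0"
  shows "integrable lborel (\<lambda>k. exp (\<i> * complex_of_real (w \<bullet> k)) * complex_of_real (exp (- t0 * (k \<bullet> (covar Q *v k)) / 2)))"
proof (rule Bochner_Integration.integrable_bound)
  show "integrable lborel (\<lambda>k :: real ^ 'd. exp (- (K * t0) * (norm k)\<^sup>2))"
    using K t0 by (intro gaussian_isotropic(1)) auto
  show "(\<lambda>k. exp (\<i> * complex_of_real (w \<bullet> k)) * complex_of_real (exp (- t0 * (k \<bullet> (covar Q *v k)) / 2))) \<in> borel_measurable lborel"
    unfolding measurable_lborel2
    by (intro borel_measurable_continuous_onI continuous_intros continuous_covar) auto
  have "exp (- t0 * (k \<bullet> (covar Q *v k)) / 2) \<le> exp (- (K * t0) * (norm k)\<^sup>2)" for k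
    using mult_left_mono[OF covar_lower[of k], of t0] t0 by (simp add: mult_ac)
  then show "AE k in lborel. norm (exp (\<i> * complex_of_real (w \<bullet> k)) * complex_of_real (exp (- t0 * (k \<bullet> (covar Q *v k)) / 2)))
    \<le> norm (exp (- (K * t0) * (norm k)\<^sup>2))"
    by (auto simp: norm_mult)
qed

lemma flow_window:
  fixes t t0 :: real
  defines "a \<equiv> K * t0 / 2"
  assumes x: "rvec x = t0 *\<^sub>R drift Q" and t0: "1 \<le> t0" and t: "\<bar>t - t0\<bar> \<le> t0 / 2"
  shows "norm (flow Q g t x - fourier g 0 * complex_of_real ((2 * pi / t0) powr (CARD('d) / 2) / sqrt (det (covar Q))
      * exp (- ((t - t0)\<^sup>2 * (drift Q \<bullet> (matrix_inv (covar Q) *v drift Q))) / (2 * t0))))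
    \<le> 8 * (2 * M * a powr (- z / 2) + M\<^sup>2 * (2 * t0) * a powr (- (2 + z) / 2) + M\<^sup>2 * \<bar>t - t0\<bar> * a powr (- 1) + M * a powr (- 1))
      * (2 * pi / a) powr (CARD('d) / 2)"
proof -
  have a: "0 < a" "0 < a / 2" using K t0 by (auto simp: a_def)
  let ?C = "8 * (2 * M * a powr (- z / 2) + M\<^sup>2 * (2 * t0) * a powr (- (2 + z) / 2) + M\<^sup>2 * \<bar>t - t0\<bar> * a powr (- 1) + M * a powr (- 1))"
  let ?f = "\<lambda>k. phase x k * fourier g k * exp (of_real t * (fourier Q k - 1))"
  let ?w = "- (t - t0) *\<^sub>R drift Q"
  let ?h = "\<lambda>k. exp (\<i> * complex_of_real (?w \<bullet> k)) * complex_of_real (exp (- t0 * (k \<bullet> (covar Q *v k)) / 2))"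
  have cf: "continuous_on torus ?f" by (intro continuous_intros Q_l1 g_l1)
  have t0': "0 < t0" using t0 by simp
  have ih: "integrable lborel ?h" by (rule gauss_term_integrable[OF t0'])
  have Ih: "integral\<^sup>L lborel ?h = complex_of_real ((2 * pi / t0) powr (CARD('d) / 2) / sqrt (det (covar Q))
      * exp (- ((t - t0)\<^sup>2 * (drift Q \<bullet> (matrix_inv (covar Q) *v drift Q))) / (2 * t0)))"
  proof -
    have "?w \<bullet> (matrix_inv (covar Q) *v ?w) = (t - t0)\<^sup>2 * (drift Q \<bullet> (matrix_inv (covar Q) *v drift Q))"
      by (simp add: matrix_vector_mult_scaleR power2_eq_square algebra_simps)
    moreover have "integral\<^sup>L lborel ?h = complex_of_real ((2 * pi / t0) powr (CARD('d) / 2) / sqrt (det (covar Q))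
      * exp (- (?w \<bullet> (matrix_inv (covar Q) *v ?w)) / (2 * t0)))"
      by (rule gaussian_fourier[OF covar_symmetric covar_posdef t0' ih])
    ultimately show ?thesis by (simp only:)
  qed
  have iB: "integrable lborel (\<lambda>k :: real ^ 'd. ?C * exp (- (a / 2 * (norm k)\<^sup>2)))"
    using gaussian_isotropic(1)[OF a(2), where 'd = 'd] by (intro integrable_mult_right) simp
  have e1: "flow Q g t x = integral\<^sup>L lborel (\<lambda>k. indicator torus k *\<^sub>R ?f k)"
    unfolding flow_def by (rule set_integral_torus(1)[OF cf])
  have e2: "fourier g 0 * integral\<^sup>L lborel ?h = integral\<^sup>L lborel (\<lambda>k. fourier g 0 * ?h k)"
    by (rule integral_mult_right_zero[symmetric])
  have eq: "flow Q g t x - fourier g 0 * integral\<^sup>L lborel ?h = integral\<^sup>L lborel (\<lambda>k. indicator torus k *\<^sub>R ?f k - fourier g 0 * ?h k)"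
    unfolding e1 e2
    by (rule Bochner_Integration.integral_diff[symmetric]) (intro set_integral_torus(2)[OF cf] integrable_mult_right ih)+
  have "norm (flow Q g t x - fourier g 0 * integral\<^sup>L lborel ?h) \<le> integral\<^sup>L lborel (\<lambda>k. norm (indicator torus k *\<^sub>R ?f k - fourier g 0 * ?h k))"
    unfolding eq by (rule Bochner_Integration.integral_norm_bound)
  also have "\<dots> \<le> integral\<^sup>L lborel (\<lambda>k :: real ^ 'd. ?C * exp (- (a / 2 * (norm k)\<^sup>2)))"
  proof (rule Bochner_Integration.integral_mono)
    show "integrable lborel (\<lambda>k. norm (indicator torus k *\<^sub>R ?f k - fourier g 0 * ?h k))"
      by (intro integrable_norm Bochner_Integration.integrable_diff set_integral_torus(2)[OF cf] integrable_mult_right ih)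
    show "norm (indicator torus k *\<^sub>R ?f k - fourier g 0 * ?h k) \<le> ?C * exp (- (a / 2 * (norm k)\<^sup>2))" for k
      unfolding a_def by (rule flow_window_pointwise[OF x t0 t])
  qed (rule iB)
  also have "\<dots> = ?C * (pi / (a / 2)) powr (CARD('d) / 2)"
    using gaussian_isotropic(2)[OF a(2), where 'd = 'd] by simp
  also have "pi / (a / 2) = 2 * pi / a" by simp
  finally show ?thesis unfolding Ih .
qed

end

section \<open>The time integral\<close>

lemma gaussian_real:
  fixes a m :: real
  assumes a: "0 < a"
  shows "integrable lborel (\<lambda>t. exp (- (a * (t - m)\<^sup>2)))"
    and "integral\<^sup>L lborel (\<lambda>t. exp (- (a * (t - m)\<^sup>2))) = sqrt (pi / a)"
proof -
  define s where "s = 1 / sqrt (2 * a)"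
  have s: "s > 0" "s\<^sup>2 = 1 / (2 * a)" using a by (auto simp: s_def power_divide)
  have eq: "exp (- (a * (t - m)\<^sup>2)) = sqrt (pi / a) * normal_density m s t" for t
    using a by (simp add: normal_density_def s mult_ac)
  show "integrable lborel (\<lambda>t. exp (- (a * (t - m)\<^sup>2)))"
    unfolding eq using integrable_normal_density[OF s(1)] by simp
  show "integral\<^sup>L lborel (\<lambda>t. exp (- (a * (t - m)\<^sup>2))) = sqrt (pi / a)"
    unfolding eq using integral_normal_density[OF s(1)] integrable_normal_density[OF s(1)] by simp
qed

text \<open>Outside the window the Gaussian is split into two square roots: one is at most
  \<open>2 / (a * U\<^sup>2)\<close> there, the other is integrated over the whole line.\<close>

lemma gaussian_real_window:
  fixes a m U :: real
  assumes a: "0 < a" and U: "0 < U"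
  shows "\<bar>integral {m - U..m + U} (\<lambda>t. exp (- (a * (t - m)\<^sup>2))) - sqrt (pi / a)\<bar> \<le> 2 / (a * U\<^sup>2) * sqrt (2 * pi / a)"
proof -
  let ?f = "\<lambda>t. exp (- (a * (t - m)\<^sup>2))" and ?S = "{m - U..m + U}"
  note i = gaussian_real[OF a, of m]
  have a2: "0 < a / 2" using a by simp
  note i2 = gaussian_real[OF a2, of m]
  have s: "set_integrable lborel ?S ?f"
    unfolding set_integrable_def by (rule borel_integrable_compact) (auto intro!: continuous_intros)
  have I: "integral ?S ?f = integral\<^sup>L lborel (\<lambda>t. indicator ?S t * ?f t)"
    using set_borel_integral_eq_integral(2)[OF s] by (simp add: set_lebesgue_integral_def)
  have is': "integrable lborel (\<lambda>t. indicator ?S t * ?f t)" using s by (simp add: set_integrable_def)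
  have "sqrt (pi / a) - integral ?S ?f = integral\<^sup>L lborel (\<lambda>t. ?f t - indicator ?S t * ?f t)"
    unfolding I i(2)[symmetric] by (rule Bochner_Integration.integral_diff[symmetric]) (rule i is')+
  moreover have "0 \<le> integral\<^sup>L lborel (\<lambda>t. ?f t - indicator ?S t * ?f t)"
    by (rule Bochner_Integration.integral_nonneg) (auto simp: indicator_def)
  moreover have "integral\<^sup>L lborel (\<lambda>t. ?f t - indicator ?S t * ?f t) \<le> integral\<^sup>L lborel (\<lambda>t. 2 / (a * U\<^sup>2) * exp (- (a / 2 * (t - m)\<^sup>2)))"
  proof (rule Bochner_Integration.integral_mono)
    show "integrable lborel (\<lambda>t. ?f t - indicator ?S t * ?f t)" by (intro Bochner_Integration.integrable_diff i is')
    show "integrable lborel (\<lambda>t. 2 / (a * U\<^sup>2) * exp (- (a / 2 * (t - m)\<^sup>2)))" by (intro integrable_mult_right i2)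
    fix t
    show "?f t - indicator ?S t * ?f t \<le> 2 / (a * U\<^sup>2) * exp (- (a / 2 * (t - m)\<^sup>2))"
    proof (cases "t \<in> ?S")
      case True
      then show ?thesis using a by simp
    next
      case False
      then have "U \<le> \<bar>t - m\<bar>" by auto
      then have "U\<^sup>2 \<le> (t - m)\<^sup>2" using U power_mono[of U "\<bar>t - m\<bar>" 2] by simp
      then have "a / 2 * U\<^sup>2 \<le> a / 2 * (t - m)\<^sup>2" using a by (intro mult_left_mono) auto
      then have 1: "exp (- (a / 2 * (t - m)\<^sup>2)) \<le> exp (- (a / 2 * U\<^sup>2))" by simp
      have x: "0 < a / 2 * U\<^sup>2" using a U by simp
      have "a / 2 * U\<^sup>2 \<le> exp (a / 2 * U\<^sup>2)" using exp_ge_add_one_self[of "a / 2 * U\<^sup>2"] by linarith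
      then have "1 / exp (a / 2 * U\<^sup>2) \<le> 1 / (a / 2 * U\<^sup>2)"
        using x a U by (intro divide_left_mono mult_pos_pos) auto
      then have "exp (- (a / 2 * U\<^sup>2)) \<le> 1 / (a / 2 * U\<^sup>2)"
        by (simp add: exp_minus inverse_eq_divide)
      also have "\<dots> = 2 / (a * U\<^sup>2)" by simp
      finally have 2: "exp (- (a / 2 * (t - m)\<^sup>2)) \<le> 2 / (a * U\<^sup>2)" using 1 by linarith
      have "?f t = exp (- (a / 2 * (t - m)\<^sup>2)) * exp (- (a / 2 * (t - m)\<^sup>2))" by (simp flip: exp_add)
      also have "\<dots> \<le> 2 / (a * U\<^sup>2) * exp (- (a / 2 * (t - m)\<^sup>2))" using 2 by (intro mult_right_mono) auto
      finally show ?thesis using False by simp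
    qed
  qed
  moreover have "integral\<^sup>L lborel (\<lambda>t. 2 / (a * U\<^sup>2) * exp (- (a / 2 * (t - m)\<^sup>2))) = 2 / (a * U\<^sup>2) * sqrt (2 * pi / a)"
    using i2(2) by (simp add: mult.commute)
  ultimately show ?thesis by linarith
qed

context walk_kernel
begin

text \<open>The middle expression is the integral of exp (- q/2) for the covariance form
  \<open>q\<close>. Sandwiching \<open>q\<close> between isotropic forms bounds the determinant
  without eigenvalues.\<close>

lemma gauss_zero_bounds:
  "(2 * pi / M) powr (CARD('d) / 2) \<le> (2 * pi) powr (CARD('d) / 2) / sqrt (det (covar Q))"
  "(2 * pi) powr (CARD('d) / 2) / sqrt (det (covar Q)) \<le> (pi / K) powr (CARD('d) / 2)"
proof -
  let ?q = "\<lambda>k. k \<bullet> (covar Q *v k)"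
  have i: "integrable lborel (\<lambda>k. exp (\<i> * complex_of_real (0 \<bullet> k)) * complex_of_real (exp (- 1 * ?q k / 2)))"
    by (rule gauss_term_integrable) simp
  have G: "integral\<^sup>L lborel (\<lambda>k. exp (\<i> * complex_of_real (0 \<bullet> k)) * complex_of_real (exp (- 1 * ?q k / 2)))
    = complex_of_real ((2 * pi / 1) powr (CARD('d) / 2) / sqrt (det (covar Q)) * exp (- (0 \<bullet> (matrix_inv (covar Q) *v 0)) / (2 * 1)))"
    by (rule gaussian_fourier[OF covar_symmetric covar_posdef zero_less_one i])
  have ir: "integrable lborel (\<lambda>k. exp (- (?q k / 2)))"
    using i complex_of_real_integrable_eq[of lborel "\<lambda>k. exp (- (?q k / 2))"] by simp
  have "complex_of_real (integral\<^sup>L lborel (\<lambda>k. exp (- (?q k / 2)))) = complex_of_real ((2 * pi) powr (CARD('d) / 2) / sqrt (det (covar Q)))"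
    unfolding integral_complex_of_real[symmetric] using G by simp
  then have I: "integral\<^sup>L lborel (\<lambda>k. exp (- (?q k / 2))) = (2 * pi) powr (CARD('d) / 2) / sqrt (det (covar Q))"
    by (simp only: of_real_eq_iff)
  have M2: "0 < M / 2" using M by simp
  note i1 = gaussian_isotropic[OF M2, where 'd = 'd] and i2 = gaussian_isotropic[OF K, where 'd = 'd]
  have "integral\<^sup>L lborel (\<lambda>k :: real ^ 'd. exp (- (M / 2) * (norm k)\<^sup>2)) \<le> integral\<^sup>L lborel (\<lambda>k. exp (- (?q k / 2)))"
    by (rule Bochner_Integration.integral_mono[OF i1(1) ir]) (use covar_upper in \<open>simp add: field_simps\<close>)
  then show "(2 * pi / M) powr (CARD('d) / 2) \<le> (2 * pi) powr (CARD('d) / 2) / sqrt (det (covar Q))"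
    unfolding I i1(2) by (simp add: mult.commute)
  have "integral\<^sup>L lborel (\<lambda>k. exp (- (?q k / 2))) \<le> integral\<^sup>L lborel (\<lambda>k :: real ^ 'd. exp (- K * (norm k)\<^sup>2))"
    by (rule Bochner_Integration.integral_mono[OF ir i2(1)]) (use covar_lower in \<open>simp add: field_simps\<close>)
  then show "(2 * pi) powr (CARD('d) / 2) / sqrt (det (covar Q)) \<le> (pi / K) powr (CARD('d) / 2)"
    unfolding I i2(2) .
qed

lemma norm_covar: "norm (covar Q *v y) \<le> M * norm y"
proof -
  define v where "v = covar Q *v y"
  have comm: "a \<bullet> (covar Q *v b) = b \<bullet> (covar Q *v a)" for a b
    using dot_lmul_matrix[of a "covar Q" b] by (simp add: inner_commute covar_symmetric flip: vector_transpose_matrix)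
  text \<open>Cauchy--Schwarz for the positive form gives \<open>\<bar>\<Lambda>y\<bar>\<^sup>4 \<le> (v \<bullet> \<Lambda>v) (y \<bullet> \<Lambda>y)\<close> with \<open>v = \<Lambda>y\<close>.\<close>
  have pos: "0 \<le> a \<bullet> (covar Q *v a)" for a using covar_posdef[of a] by (cases "a = 0") auto
  let ?A = "v \<bullet> (covar Q *v v)" and ?B = "v \<bullet> v" and ?C = "y \<bullet> (covar Q *v y)"
  have "0 \<le> s\<^sup>2 * ?A - 2 * s * ?B + ?C" for s
  proof -
    have "0 \<le> (s *\<^sub>R v - y) \<bullet> (covar Q *v (s *\<^sub>R v - y))" by (rule pos)
    also have "\<dots> = s\<^sup>2 * ?A - 2 * s * ?B + ?C"
      using comm[of v y] by (simp add: matrix_vector_mult_diff_distrib matrix_vector_mult_scaleR inner_diff_left inner_diff_right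
          power2_eq_square algebra_simps v_def[symmetric] comm[of y v])
    finally show ?thesis .
  qed
  from this[of "1 / M"] have "0 \<le> (1 / M)\<^sup>2 * ?A - 2 * (1 / M) * ?B + ?C" .
  moreover have "(1 / M)\<^sup>2 * ?A \<le> (1 / M)\<^sup>2 * (M * (norm v)\<^sup>2)" by (intro mult_left_mono covar_upper) auto
  moreover have "?C \<le> M * (norm y)\<^sup>2" by (rule covar_upper)
  moreover have "(1 / M)\<^sup>2 * (M * (norm v)\<^sup>2) = (norm v)\<^sup>2 / M" "2 * (1 / M) * ?B = 2 * ((norm v)\<^sup>2 / M)"
    using M by (simp_all add: power2_norm_eq_inner) (simp add: power2_eq_square)
  ultimately have "(norm v)\<^sup>2 / M \<le> M * (norm y)\<^sup>2" by linarith
  then have "(norm v)\<^sup>2 \<le> (M * norm y)\<^sup>2" using M by (simp add: field_simps power2_eq_square)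
  then show ?thesis using M by (simp add: v_def power2_le_iff_abs_le)
qed

text \<open>With v = \<Lambda> y the inverse form at \<open>v\<close> is the form itself at
  \<open>y\<close>, so bounds for \<Lambda> become bounds for its inverse.\<close>

lemma inverse_covar_bounds:
  "2 * K * (norm v)\<^sup>2 / M\<^sup>2 \<le> v \<bullet> (matrix_inv (covar Q) *v v)"
  "v \<bullet> (matrix_inv (covar Q) *v v) \<le> (norm v)\<^sup>2 / (2 * K)"
proof -
  define y where "y = matrix_inv (covar Q) *v v"
  obtain B :: "real ^ 'd ^ 'd" where "covar Q ** matrix_inv (covar Q) = mat 1"
    using posdef_normal_form[OF covar_symmetric covar_posdef] by metis
  then have v: "v = covar Q *v y" by (simp add: y_def matrix_vector_mul_assoc)
  have vy: "v \<bullet> (matrix_inv (covar Q) *v v) = y \<bullet> (covar Q *v y)"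
    unfolding y_def[symmetric] by (subst v) (simp add: inner_commute)
  have "norm v \<le> M * norm y" unfolding v by (rule norm_covar)
  then have "(norm v)\<^sup>2 \<le> (M * norm y)\<^sup>2" by (intro power_mono) auto
  then have "(norm v)\<^sup>2 / M\<^sup>2 \<le> (norm y)\<^sup>2" using M by (simp add: power_mult_distrib field_simps)
  then have "2 * K * ((norm v)\<^sup>2 / M\<^sup>2) \<le> 2 * K * (norm y)\<^sup>2" using K by (intro mult_left_mono) auto
  then show "2 * K * (norm v)\<^sup>2 / M\<^sup>2 \<le> v \<bullet> (matrix_inv (covar Q) *v v)"
    unfolding vy using covar_lower[of y] by simp
  have "2 * K * (norm y)\<^sup>2 \<le> v \<bullet> y" using covar_lower[of y] vy by (simp add: y_def)
  also have "\<dots> \<le> norm v * norm y" by (rule norm_cauchy_schwarz)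
  finally have "2 * K * norm y * norm y \<le> norm v * norm y" by (simp add: power2_eq_square)
  then have "2 * K * norm y \<le> norm v" by (cases "y = 0") auto
  then have yv: "norm y \<le> norm v / (2 * K)" using K by (simp add: field_simps)
  have "v \<bullet> y \<le> norm v * norm y" by (rule norm_cauchy_schwarz)
  also have "\<dots> \<le> norm v * (norm v / (2 * K))" using yv by (intro mult_left_mono) auto
  finally show "v \<bullet> (matrix_inv (covar Q) *v v) \<le> (norm v)\<^sup>2 / (2 * K)"
    by (simp add: y_def power2_eq_square)
qed

lemma continuous_on_flow: "continuous_on A (\<lambda>t. flow Q g t x)"
proof -
  have "continuous_on (A \<times> torus) (\<lambda>(t, k). phase x k * fourier g k * exp (of_real t * (fourier Q k - 1)))"
  proof -
    have s: "continuous_on (A \<times> torus) (\<lambda>p. fourier f (snd p))" if "in_lp 1 f" for f :: "int ^ 'd \<Rightarrow> real"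
      by (rule continuous_on_compose2[OF continuous_on_fourier[OF that, of UNIV] continuous_on_snd]) (auto intro: continuous_intros)
    have p: "continuous_on (A \<times> torus) (\<lambda>p. phase x (snd p))"
      by (rule continuous_on_compose2[OF continuous_on_phase[of UNIV] continuous_on_snd]) (auto intro: continuous_intros)
    show ?thesis unfolding case_prod_unfold by (intro continuous_intros s p Q_l1 g_l1)
  qed
  then show ?thesis
    unfolding flow_def torus_def by (rule integral_continuous_on_param)
qed

end

lemma integral_inverse_power_tail:
  fixes m U T :: real
  assumes U: "0 < U" and T: "U \<le> T"
  shows "((\<lambda>t. (t - m) powr (- 3 / 2)) has_integral (2 * U powr (- 1 / 2) - 2 * T powr (- 1 / 2))) {m + U..m + T}"
    and "((\<lambda>t. (m - t) powr (- 3 / 2)) has_integral (2 * U powr (- 1 / 2) - 2 * T powr (- 1 / 2))) {m - T..m - U}"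
proof -
  have d: "((\<lambda>t. - 2 * (t - m) powr (- 1 / 2)) has_vector_derivative (t - m) powr (- 3 / 2)) (at t within S)" if "m < t" for t S
  proof -
    have "((\<lambda>t. - 2 * (t - m) powr (- 1 / 2)) has_real_derivative (- 2 * ((- 1 / 2) * (t - m) powr (- 1 / 2 - 1)))) (at t within S)"
      using that by (auto intro!: derivative_eq_intros)
    then show ?thesis by (simp add: has_real_derivative_iff_has_vector_derivative)
  qed
  have "((\<lambda>t. (t - m) powr (- 3 / 2)) has_integral (- 2 * (m + T - m) powr (- 1 / 2) - - 2 * (m + U - m) powr (- 1 / 2))) {m + U..m + T}"
  proof (rule fundamental_theorem_of_calculus)
    fix t assume "t \<in> {m + U..m + T}"
    then show "((\<lambda>t. - 2 * (t - m) powr (- 1 / 2)) has_vector_derivative (t - m) powr (- 3 / 2)) (at t within {m + U..m + T})"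
      using U by (intro d) auto
  qed (use T in auto)
  then show "((\<lambda>t. (t - m) powr (- 3 / 2)) has_integral (2 * U powr (- 1 / 2) - 2 * T powr (- 1 / 2))) {m + U..m + T}"
    by simp
  have e: "((\<lambda>t. 2 * (m - t) powr (- 1 / 2)) has_vector_derivative (m - t) powr (- 3 / 2)) (at t within S)" if "t < m" for t S
  proof -
    have "((\<lambda>t. 2 * (m - t) powr (- 1 / 2)) has_real_derivative (2 * ((- 1 / 2) * (m - t) powr (- 1 / 2 - 1) * (- 1)))) (at t within S)"
      using that by (auto intro!: derivative_eq_intros)
    then show ?thesis by (simp add: has_real_derivative_iff_has_vector_derivative)
  qed
  have "((\<lambda>t. (m - t) powr (- 3 / 2)) has_integral (2 * (m - (m - U)) powr (- 1 / 2) - 2 * (m - (m - T)) powr (- 1 / 2))) {m - T..m - U}"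
  proof (rule fundamental_theorem_of_calculus)
    fix t assume "t \<in> {m - T..m - U}"
    then show "((\<lambda>t. 2 * (m - t) powr (- 1 / 2)) has_vector_derivative (m - t) powr (- 3 / 2)) (at t within {m - T..m - U})"
      using U by (intro e) auto
  qed (use T in auto)
  then show "((\<lambda>t. (m - t) powr (- 3 / 2)) has_integral (2 * U powr (- 1 / 2) - 2 * T powr (- 1 / 2))) {m - T..m - U}"
    by simp
qed

text \<open>The integral over all real times of the Gaussian that approximates the flow, with the
  covariance frozen at \<open>t0\<close>.\<close>

definition renewal_term :: "(int ^ 'd::finite \<Rightarrow> real) \<Rightarrow> real \<Rightarrow> real" where
  "renewal_term Q t0 = (2 * pi / t0) powr (real CARD('d) / 2) / sqrt (det (covar Q)) *
     sqrt (2 * pi * t0 / (drift Q \<bullet> (matrix_inv (covar Q) *v drift Q)))"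

text \<open>The pointwise error has order t0^(- d/2 - z/2 + \<delta>) and the window length 2
  t0^(1/2 + \<delta>); with z = 16 \<delta> the total is smaller than the main order by t0^(-6
  \<delta>). Extending the Gaussian to the whole line costs a relative t0^(-2 \<delta>).\<close>

lemma flow_window_integral:
  fixes M K z e0 :: real
  defines "d \<equiv> CARD('d::finite)" and "\<delta> \<equiv> z / 16"
  assumes M: "0 < M" and K: "0 < K" and z: "0 < z" "z \<le> 1" and e0: "0 < e0"
  shows "\<exists>C>0. \<forall>(Q :: int ^ 'd \<Rightarrow> real) g x t0. walk_kernel M K z Q g \<and> e0 \<le> norm (drift Q) \<and>
     rvec x = t0 *\<^sub>R drift Q \<and> 1 \<le> t0 \<and> t0 powr (1 / 2 + \<delta>) \<le> t0 / 2 \<longrightarrow>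
     norm (integral {t0 - t0 powr (1 / 2 + \<delta>)..t0 + t0 powr (1 / 2 + \<delta>)} (\<lambda>t. flow Q g t x)
       - fourier g 0 * complex_of_real (renewal_term Q t0)) \<le> C * t0 powr (1 / 2 - real d / 2 - \<delta>)"
proof -
  have \<delta>: "0 < \<delta>" "\<delta> \<le> 1 / 16" "z = 16 * \<delta>" using z by (auto simp: \<delta>_def)
  define c where "c = K / 2"
  have c: "0 < c" using K by (simp add: c_def)
  define A where "A = 8 * (2 * M * c powr (- z / 2) + 2 * M\<^sup>2 * c powr (- (2 + z) / 2) + M\<^sup>2 * c powr (- 1) + M * c powr (- 1)) * (2 * pi / c) powr (d / 2)"
  define q0 where "q0 = 2 * K * e0\<^sup>2 / M\<^sup>2"
  have q0: "0 < q0" using K e0 M by (simp add: q0_def)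
  define B where "B = M * ((pi / K) powr (d / 2) * (4 / q0 * sqrt (4 * pi / q0)))"
  have A: "0 < A" unfolding A_def using M c by (intro mult_pos_pos add_pos_pos) auto
  have B: "0 < B" unfolding B_def using M K q0 by (intro mult_pos_pos) auto
  have main: "norm (integral {t0 - t0 powr (1 / 2 + \<delta>)..t0 + t0 powr (1 / 2 + \<delta>)} (\<lambda>t. flow Q g t x)
       - fourier g 0 * complex_of_real (renewal_term Q t0)) \<le> (2 * A + B) * t0 powr (1 / 2 - real d / 2 - \<delta>)"
    if wk: "walk_kernel M K z Q g" and e: "e0 \<le> norm (drift Q)" and x: "rvec x = t0 *\<^sub>R drift Q"
      and t0: "1 \<le> t0" and Ut: "t0 powr (1 / 2 + \<delta>) \<le> t0 / 2" for Q g :: "int ^ 'd \<Rightarrow> real" and x t0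
  proof -
    interpret walk_kernel M K z Q g by (rule wk)
    define U where "U = t0 powr (1 / 2 + \<delta>)"
    have U: "0 < U" using t0 by (simp add: U_def)
    define q where "q = drift Q \<bullet> (matrix_inv (covar Q) *v drift Q)"
    define p0 where "p0 = (2 * pi / t0) powr (d / 2) / sqrt (det (covar Q))"
    have qq: "q0 \<le> q"
    proof -
      have "q0 \<le> 2 * K * (norm (drift Q))\<^sup>2 / M\<^sup>2"
        unfolding q0_def using e e0 K by (intro divide_right_mono mult_left_mono power_mono) auto
      then show ?thesis using inverse_covar_bounds(1)[of "drift Q"] by (simp add: q_def)
    qed
    then have q: "0 < q" using q0 by simp
    let ?S = "{t0 - U..t0 + U}"
    define a where "a = q / (2 * t0)"
    have a: "0 < a" using q t0 by (simp add: a_def)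
    let ?G = "\<lambda>t. p0 * exp (- (a * (t - t0)\<^sup>2))"
    have ct0: "K * t0 / 2 = c * t0" by (simp add: c_def)
    have pt: "norm (flow Q g t x - fourier g 0 * complex_of_real (?G t)) \<le> A * t0 powr (- d / 2 - z / 2 + \<delta>)" if t: "t \<in> ?S" for t
    proof -
      have tU: "\<bar>t - t0\<bar> \<le> U" using t by auto
      let ?E = "t0 powr (- z / 2 + \<delta>)"
      have pc: "(c * t0) powr s = c powr s * t0 powr s" for s by (rule powr_mult)
      have "norm (flow Q g t x - fourier g 0 * complex_of_real (?G t))
        \<le> 8 * (2 * M * (c * t0) powr (- z / 2) + M\<^sup>2 * (2 * t0) * (c * t0) powr (- (2 + z) / 2) + M\<^sup>2 * \<bar>t - t0\<bar> * (c * t0) powr (- 1) + M * (c * t0) powr (- 1))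
          * (2 * pi / (c * t0)) powr (d / 2)"
      proof -
        have "\<bar>t - t0\<bar> \<le> t0 / 2" using tU Ut by (simp add: U_def)
        from flow_window[OF x t0 this, unfolded ct0] show ?thesis
          by (simp add: p0_def a_def q_def d_def mult_ac)
      qed
      also have "\<dots> \<le> 8 * (2 * M * (c powr (- z / 2) * ?E) + 2 * M\<^sup>2 * (c powr (- (2 + z) / 2) * ?E) + M\<^sup>2 * (c powr (- 1) * ?E) + M * (c powr (- 1) * ?E))
          * ((2 * pi / c) powr (d / 2) * t0 powr (- d / 2))"
      proof -
        have "(c * t0) powr (- z / 2) \<le> c powr (- z / 2) * ?E"
          unfolding pc using \<delta> t0 by (intro mult_left_mono powr_mono) auto
        then have T1: "2 * M * (c * t0) powr (- z / 2) \<le> 2 * M * (c powr (- z / 2) * ?E)"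
          using M by (intro mult_left_mono) auto
        have "M\<^sup>2 * (2 * t0) * (c * t0) powr (- (2 + z) / 2) = 2 * M\<^sup>2 * (c powr (- (2 + z) / 2) * (t0 powr 1 * t0 powr (- (2 + z) / 2)))"
          unfolding pc using t0 by simp
        also have "t0 powr 1 * t0 powr (- (2 + z) / 2) = t0 powr (- z / 2)"
          unfolding powr_add[symmetric] by (rule arg_cong2[where f = "(powr)"]) (auto simp: field_simps)
        also have "2 * M\<^sup>2 * (c powr (- (2 + z) / 2) * t0 powr (- z / 2)) \<le> 2 * M\<^sup>2 * (c powr (- (2 + z) / 2) * ?E)"
          using \<delta> t0 by (intro mult_left_mono powr_mono) auto
        finally have T2: "M\<^sup>2 * (2 * t0) * (c * t0) powr (- (2 + z) / 2) \<le> 2 * M\<^sup>2 * (c powr (- (2 + z) / 2) * ?E)" .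
        have "\<bar>t - t0\<bar> * (c * t0) powr (- 1) \<le> U * (c * t0) powr (- 1)" using tU by (intro mult_right_mono) auto
        also have "\<dots> = c powr (- 1) * (t0 powr (1 / 2 + \<delta>) * t0 powr (- 1))" unfolding pc U_def by simp
        also have "t0 powr (1 / 2 + \<delta>) * t0 powr (- 1) = t0 powr (- 1 / 2 + \<delta>)"
          unfolding powr_add[symmetric] by (rule arg_cong2[where f = "(powr)"]) auto
        also have "c powr (- 1) * t0 powr (- 1 / 2 + \<delta>) \<le> c powr (- 1) * ?E"
          using z t0 by (intro mult_left_mono powr_mono) auto
        finally have "M\<^sup>2 * (\<bar>t - t0\<bar> * (c * t0) powr (- 1)) \<le> M\<^sup>2 * (c powr (- 1) * ?E)" by (intro mult_left_mono) auto
        then have T3: "M\<^sup>2 * \<bar>t - t0\<bar> * (c * t0) powr (- 1) \<le> M\<^sup>2 * (c powr (- 1) * ?E)" by (simp add: mult.assoc)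
        have "(c * t0) powr (- 1) \<le> c powr (- 1) * ?E"
          unfolding pc using \<delta> z t0 by (intro mult_left_mono powr_mono) auto
        then have T4: "M * (c * t0) powr (- 1) \<le> M * (c powr (- 1) * ?E)"
          using M by (intro mult_left_mono) auto
        have T5: "(2 * pi / (c * t0)) powr (d / 2) \<le> (2 * pi / c) powr (d / 2) * t0 powr (- d / 2)"
          using c t0 by (simp add: powr_divide powr_mult powr_minus_divide)
        have T6: "0 \<le> 8 * (2 * M * (c powr (- z / 2) * ?E) + 2 * M\<^sup>2 * (c powr (- (2 + z) / 2) * ?E) + M\<^sup>2 * (c powr (- 1) * ?E) + M * (c powr (- 1) * ?E))"
          using M by simp
        show ?thesis
          by (rule mult_mono[OF mult_left_mono[OF add_mono[OF add_mono[OF add_mono[OF T1 T2] T3] T4]] T5 T6]) auto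
      qed
      also have "\<dots> = A * (t0 powr (- d / 2) * ?E)" by (simp add: A_def algebra_simps)
      also have "t0 powr (- d / 2) * ?E = t0 powr (- d / 2 - z / 2 + \<delta>)"
        unfolding powr_add[symmetric] by (rule arg_cong2[where f = "(powr)"]) auto
      finally show ?thesis .
    qed
    have fi: "(\<lambda>t. flow Q g t x) integrable_on ?S" by (rule integrable_continuous_real[OF continuous_on_flow])
    have Gi: "(\<lambda>t. complex_of_real (?G t)) integrable_on ?S" by (intro integrable_continuous_real continuous_intros)
    have Gr: "(\<lambda>t. exp (- (a * (t - t0)\<^sup>2))) integrable_on ?S" by (intro integrable_continuous_real continuous_intros)
    have Gi': "(\<lambda>t. fourier g 0 * complex_of_real (?G t)) integrable_on ?S" by (intro integrable_continuous_real continuous_intros)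
    have 1: "norm (integral ?S (\<lambda>t. flow Q g t x) - integral ?S (\<lambda>t. fourier g 0 * complex_of_real (?G t))) \<le> 2 * A * t0 powr (1 / 2 - real d / 2 - \<delta>)"
    proof -
      have "norm (integral ?S (\<lambda>t. flow Q g t x - fourier g 0 * complex_of_real (?G t))) \<le> integral ?S (\<lambda>t. A * t0 powr (- d / 2 - z / 2 + \<delta>))"
        by (rule Henstock_Kurzweil_Integration.integral_norm_bound_integral[OF integrable_diff[OF fi Gi']]) (use pt in auto)
      also have "\<dots> = 2 * A * (t0 powr (1 / 2 + \<delta>) * t0 powr (- d / 2 - z / 2 + \<delta>))" using U by (simp add: U_def)
      also have "t0 powr (1 / 2 + \<delta>) * t0 powr (- d / 2 - z / 2 + \<delta>) = t0 powr (1 / 2 - d / 2 - 6 * \<delta>)"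
        unfolding powr_add[symmetric] by (rule arg_cong2[where f = "(powr)"]) (auto simp: \<delta>(3))
      also have "2 * A * t0 powr (1 / 2 - d / 2 - 6 * \<delta>) \<le> 2 * A * t0 powr (1 / 2 - d / 2 - \<delta>)"
        using \<delta> A t0 by (intro mult_left_mono powr_mono) auto
      finally have "norm (integral ?S (\<lambda>t. flow Q g t x - fourier g 0 * complex_of_real (?G t))) \<le> 2 * A * t0 powr (1 / 2 - d / 2 - \<delta>)" .
      then show ?thesis unfolding Henstock_Kurzweil_Integration.integral_diff[OF fi Gi'] .
    qed
    have I: "integral ?S (\<lambda>t. fourier g 0 * complex_of_real (?G t)) = fourier g 0 * complex_of_real (p0 * integral ?S (\<lambda>t. exp (- (a * (t - t0)\<^sup>2))))"
    proof -
      have "((\<lambda>t. fourier g 0 * complex_of_real (?G t)) has_integral fourier g 0 * complex_of_real (p0 * integral ?S (\<lambda>t. exp (- (a * (t - t0)\<^sup>2))))) ?S"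
        by (intro has_integral_mult_right has_integral_of_real integrable_integral Gr)
      then show ?thesis by (rule integral_unique)
    qed
    have p0: "0 \<le> p0" "p0 \<le> (pi / K) powr (d / 2) * t0 powr (- d / 2)"
    proof -
      have "p0 = (2 * pi) powr (d / 2) / sqrt (det (covar Q)) * t0 powr (- d / 2)"
        using t0 by (simp add: p0_def powr_divide powr_minus_divide)
      also have "\<dots> \<le> (pi / K) powr (d / 2) * t0 powr (- d / 2)"
        using gauss_zero_bounds(2) by (intro mult_right_mono) (auto simp: d_def)
      finally show "p0 \<le> (pi / K) powr (d / 2) * t0 powr (- d / 2)" .
      have "0 \<le> (2 * pi) powr (CARD('d) / 2) / sqrt (det (covar Q))"
        using gauss_zero_bounds(1) powr_ge_zero[of "2 * pi / M" "CARD('d) / 2"] by linarith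
      then show "0 \<le> p0"
        using t0 by (simp add: p0_def powr_divide d_def zero_le_divide_iff)
    qed
    have ren: "renewal_term Q t0 = p0 * sqrt (pi / a)"
      by (simp add: renewal_term_def p0_def a_def q_def d_def)
    have 2: "norm (integral ?S (\<lambda>t. fourier g 0 * complex_of_real (?G t)) - fourier g 0 * complex_of_real (renewal_term Q t0)) \<le> B * t0 powr (1 / 2 - real d / 2 - \<delta>)"
    proof -
      have "norm (integral ?S (\<lambda>t. fourier g 0 * complex_of_real (?G t)) - fourier g 0 * complex_of_real (renewal_term Q t0))
        = norm (fourier g 0) * (p0 * \<bar>integral ?S (\<lambda>t. exp (- (a * (t - t0)\<^sup>2))) - sqrt (pi / a)\<bar>)"
      proof -
        have "fourier g 0 * complex_of_real (p0 * integral ?S (\<lambda>t. exp (- (a * (t - t0)\<^sup>2)))) - fourier g 0 * complex_of_real (p0 * sqrt (pi / a))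
          = fourier g 0 * complex_of_real (p0 * (integral ?S (\<lambda>t. exp (- (a * (t - t0)\<^sup>2))) - sqrt (pi / a)))"
          by (simp add: algebra_simps)
        then show ?thesis
          unfolding I ren by (simp only: norm_mult norm_of_real abs_mult abs_of_nonneg[OF p0(1)])
      qed
      also have "\<dots> \<le> M * (((pi / K) powr (d / 2) * t0 powr (- d / 2)) * (2 / (a * U\<^sup>2) * sqrt (2 * pi / a)))"
        using M p0 by (intro mult_mono norm_fourier_g p0 gaussian_real_window[OF a U]) auto
      also have "\<dots> \<le> M * (((pi / K) powr (d / 2) * t0 powr (- d / 2)) * (4 / q0 * sqrt (4 * pi / q0) * t0 powr (1 / 2 - 2 * \<delta>)))"
      proof -
        have U2: "U\<^sup>2 = t0 * t0 powr (2 * \<delta>)"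
        proof -
          have "1 / 2 + \<delta> + (1 / 2 + \<delta>) = 1 + 2 * \<delta>" by simp
          then show ?thesis
            unfolding U_def power2_eq_square powr_add[symmetric] using t0 by (simp only: powr_add) simp
        qed
        have "a * U\<^sup>2 = q * t0 powr (2 * \<delta>) / 2" using t0 by (simp add: a_def U2)
        then have "2 / (a * U\<^sup>2) = 2 / (q * t0 powr (2 * \<delta>) / 2)" by (simp only:)
        also have "\<dots> = 4 / q * t0 powr (- 2 * \<delta>)" by (simp add: powr_minus_divide)
        also have "\<dots> \<le> 4 / q0 * t0 powr (- 2 * \<delta>)" using qq q0 by (intro mult_right_mono divide_left_mono) auto
        finally have x1: "2 / (a * U\<^sup>2) \<le> 4 / q0 * t0 powr (- 2 * \<delta>)" .
        have "sqrt (2 * pi / a) = sqrt (4 * pi / q) * sqrt t0" using t0 by (simp add: a_def flip: real_sqrt_mult)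
        also have "\<dots> \<le> sqrt (4 * pi / q0) * sqrt t0" using qq q0 t0 by (intro mult_right_mono real_sqrt_le_mono divide_left_mono) auto
        also have "sqrt t0 = t0 powr (1 / 2)" using t0 by (simp add: powr_half_sqrt)
        finally have x2: "sqrt (2 * pi / a) \<le> sqrt (4 * pi / q0) * t0 powr (1 / 2)" .
        have "2 / (a * U\<^sup>2) * sqrt (2 * pi / a) \<le> (4 / q0 * t0 powr (- 2 * \<delta>)) * (sqrt (4 * pi / q0) * t0 powr (1 / 2))"
          using a q0 U by (intro mult_mono x1 x2) auto
        also have "\<dots> = 4 / q0 * sqrt (4 * pi / q0) * (t0 powr (- 2 * \<delta>) * t0 powr (1 / 2))" by (simp only: mult_ac)
        also have "t0 powr (- 2 * \<delta>) * t0 powr (1 / 2) = t0 powr (1 / 2 - 2 * \<delta>)"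
          unfolding powr_add[symmetric] by (rule arg_cong2[where f = "(powr)"]) auto
        finally show ?thesis using M by (intro mult_left_mono) auto
      qed
      also have "\<dots> = B * (t0 powr (- d / 2) * t0 powr (1 / 2 - 2 * \<delta>))" by (simp add: B_def mult_ac)
      also have "t0 powr (- d / 2) * t0 powr (1 / 2 - 2 * \<delta>) = t0 powr (1 / 2 - d / 2 - 2 * \<delta>)"
        unfolding powr_add[symmetric] by (rule arg_cong2[where f = "(powr)"]) auto
      also have "B * t0 powr (1 / 2 - d / 2 - 2 * \<delta>) \<le> B * t0 powr (1 / 2 - d / 2 - \<delta>)"
        using \<delta> B t0 by (intro mult_left_mono powr_mono) auto
      finally show ?thesis .
    qed
    have "norm (integral ?S (\<lambda>t. flow Q g t x) - fourier g 0 * complex_of_real (renewal_term Q t0))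
      \<le> 2 * A * t0 powr (1 / 2 - real d / 2 - \<delta>) + B * t0 powr (1 / 2 - real d / 2 - \<delta>)"
      using norm_triangle_le[OF add_mono[OF 1 2]] by simp
    then show ?thesis by (simp add: U_def distrib_right)
  qed
  show ?thesis
    using main A B by (intro exI[of _ "2 * A + B"] conjI) auto
qed

text \<open>The main term has order t0^(1/2 - d/2), so the factor t0^(-\<delta>) in the bound makes
  the error relatively small. The upper limit \<open>T\<close> is free because the integral to
  infinity is taken as a limit afterwards.\<close>

lemma flow_integral:
  fixes M K z e0 :: real
  defines "d \<equiv> CARD('d::finite)" and "\<delta> \<equiv> z / 16"
  assumes M: "0 < M" and K: "0 < K" and z: "0 < z" "z \<le> 1" and e0: "0 < e0"
  shows "\<exists>C>0. \<exists>T0\<ge>1. \<forall>(Q :: int ^ 'd \<Rightarrow> real) g x t0 T. walk_kernel M K z Q g \<and> e0 \<le> norm (drift Q) \<and>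
     rvec x = t0 *\<^sub>R drift Q \<and> T0 \<le> t0 \<and> 2 * t0 \<le> T \<longrightarrow>
     norm (integral {0..T} (\<lambda>t. flow Q g t x) - fourier g 0 * complex_of_real (renewal_term Q t0))
       \<le> C * t0 powr (1 / 2 - real d / 2 - \<delta>)"
proof -
  have \<delta>: "0 < \<delta>" "\<delta> \<le> 1 / 16" "z = 16 * \<delta>" using z by (auto simp: \<delta>_def)
  obtain C1 T1 where C1: "0 < C1" and early: "\<forall>(Q :: int ^ 'd \<Rightarrow> real) g t x t0. walk_kernel M K z Q g \<and> e0 \<le> norm (drift Q) \<and>
     rvec x = t0 *\<^sub>R drift Q \<and> T1 \<le> t0 \<and> 0 < t \<and> t \<le> t0 / 2 \<longrightarrow>
     norm (flow Q g t x) \<le> C1 * (t0 powr (- real d / 2 - z / 2) * t powr (- 1 / 2))"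
    using flow_early[OF M K z e0, where 'd = 'd, folded d_def] by (elim exE conjE)
  obtain C2 T2 where C2: "0 < C2" and far: "\<forall>(Q :: int ^ 'd \<Rightarrow> real) g t x t0. walk_kernel M K z Q g \<and> e0 \<le> norm (drift Q) \<and>
     rvec x = t0 *\<^sub>R drift Q \<and> T2 \<le> t0 \<and> t0 / 2 \<le> t \<and> t0 powr (1 / 2 + \<delta>) \<le> \<bar>t - t0\<bar> \<longrightarrow>
     norm (flow Q g t x) \<le> C2 * (t0 powr (3 / 4 - real d / 2 - \<delta>) * \<bar>t - t0\<bar> powr (- 3 / 2))"
    using flow_far[OF M K z e0, where 'd = 'd, folded d_def \<delta>_def] by (elim exE conjE)
  obtain C3 where C3: "0 < C3" and window: "\<forall>(Q :: int ^ 'd \<Rightarrow> real) g x t0. walk_kernel M K z Q g \<and> e0 \<le> norm (drift Q) \<and>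
     rvec x = t0 *\<^sub>R drift Q \<and> 1 \<le> t0 \<and> t0 powr (1 / 2 + \<delta>) \<le> t0 / 2 \<longrightarrow>
     norm (integral {t0 - t0 powr (1 / 2 + \<delta>)..t0 + t0 powr (1 / 2 + \<delta>)} (\<lambda>t. flow Q g t x)
       - fourier g 0 * complex_of_real (renewal_term Q t0)) \<le> C3 * t0 powr (1 / 2 - real d / 2 - \<delta>)"
    using flow_window_integral[OF M K z e0, where 'd = 'd, folded d_def \<delta>_def] by (elim exE conjE)
  \<comment> \<open>The bound 2^4 makes t0^(1/4) \<ge> 2, and as 1/2 + \<delta> + 1/4 \<le> 1 the
    window then stays to the right of \<open>t0 / 2\<close>.\<close>
  define T0 where "T0 = max (max T1 T2) (2 powr 4)"
  define C where "C = 2 * C1 + 4 * C2 + C3"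
  have main: "norm (integral {0..T} (\<lambda>t. flow Q g t x) - fourier g 0 * complex_of_real (renewal_term Q t0))
       \<le> C * t0 powr (1 / 2 - real d / 2 - \<delta>)"
    if wk: "walk_kernel M K z Q g" and e: "e0 \<le> norm (drift Q)" and x: "rvec x = t0 *\<^sub>R drift Q"
      and Tt: "T0 \<le> t0" and T: "2 * t0 \<le> T" for Q g :: "int ^ 'd \<Rightarrow> real" and x t0 T
  proof -
    interpret walk_kernel M K z Q g by (rule wk)
    have t0: "1 \<le> t0" "T1 \<le> t0" "T2 \<le> t0" "2 powr 4 \<le> t0" using Tt by (auto simp: T0_def)
    define U where "U = t0 powr (1 / 2 + \<delta>)"
    let ?P = "t0 powr (1 / 2 - real d / 2 - \<delta>)"
    let ?f = "\<lambda>t. flow Q g t x"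
    have U0: "0 < U" using t0 by (simp add: U_def)
    have Ut: "U \<le> t0 / 2"
    proof -
      have "2 * U \<le> t0 powr (1 / 4) * U"
      proof (rule mult_right_mono)
        have "(2 powr 4) powr (1 / 4) \<le> t0 powr (1 / 4)" using t0 by (intro powr_mono2) auto
        then show "2 \<le> t0 powr (1 / 4)" by (simp add: powr_powr)
      qed (use U0 in auto)
      also have "\<dots> = t0 powr (3 / 4 + \<delta>)" unfolding U_def powr_add[symmetric] by (rule arg_cong2[where f = "(powr)"]) auto
      also have "\<dots> \<le> t0 powr 1" using t0 \<delta> by (intro powr_mono) auto
      finally show ?thesis using t0 by simp
    qed
    have int: "?f integrable_on {a..b}" for a b
      by (rule integrable_continuous_real[OF continuous_on_flow])
    have split: "integral {0..T} ?f = integral {0..t0 / 2} ?f + integral {t0 / 2..t0 - U} ?f + integral {t0 - U..t0 + U} ?f + integral {t0 + U..T} ?f"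
    proof -
      have a: "integral {0..t0 / 2} ?f + integral {t0 / 2..T} ?f = integral {0..T} ?f"
        by (rule Henstock_Kurzweil_Integration.integral_combine[OF _ _ int]) (use t0 T in auto)
      have b: "integral {t0 / 2..t0 - U} ?f + integral {t0 - U..T} ?f = integral {t0 / 2..T} ?f"
        by (rule Henstock_Kurzweil_Integration.integral_combine[OF _ _ int]) (use t0 T Ut U0 in auto)
      have c: "integral {t0 - U..t0 + U} ?f + integral {t0 + U..T} ?f = integral {t0 - U..T} ?f"
        by (rule Henstock_Kurzweil_Integration.integral_combine[OF _ _ int]) (use t0 T Ut U0 in auto)
      show ?thesis unfolding a[symmetric] b[symmetric] c[symmetric] by (simp only: add.assoc)
    qed
    have 1: "norm (integral {0..t0 / 2} ?f) \<le> 2 * C1 * ?P"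
    proof -
      let ?c = "C1 * t0 powr (- real d / 2 - z / 2)"
      have h: "((\<lambda>t. ?c * t powr (- 1 / 2)) has_integral ?c * ((t0 / 2) powr (- 1 / 2 + 1) / (- 1 / 2 + 1))) {0..t0 / 2}"
        by (intro has_integral_mult_right has_integral_powr_from_0) (use t0 in auto)
      \<comment> \<open>\<open>0 powr (- 1 / 2)\<close> is 0, so the early bound need not hold at
        \<open>t = 0\<close>; the integrand is changed at that single point.\<close>
      have sp: "integral {0..t0 / 2} (\<lambda>t. if t = 0 then 0 else ?f t) = integral {0..t0 / 2} ?f"
        by (rule integral_spike[of "{0}"]) auto
      have "norm (integral {0..t0 / 2} (\<lambda>t. if t = 0 then 0 else ?f t)) \<le> integral {0..t0 / 2} (\<lambda>t. ?c * t powr (- 1 / 2))"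
      proof (rule Henstock_Kurzweil_Integration.integral_norm_bound_integral)
        show "(\<lambda>t. if t = 0 then 0 else ?f t) integrable_on {0..t0 / 2}"
          by (rule integrable_spike[OF int[of 0 "t0 / 2"], of "{0}"]) auto
        show "(\<lambda>t. ?c * t powr (- 1 / 2)) integrable_on {0..t0 / 2}" using h by blast
        fix t assume "t \<in> {0..t0 / 2}"
        then show "norm (if t = 0 then 0 else ?f t) \<le> ?c * t powr (- 1 / 2)"
          using early[rule_format, of Q g x t0 t] wk e x t0 by (cases "t = 0") (auto simp: mult.assoc)
      qed
      also have "\<dots> = ?c * (2 * (t0 / 2) powr (1 / 2))" by (subst integral_unique[OF h]) simp
      also have "\<dots> \<le> ?c * (2 * t0 powr (1 / 2))" using t0 C1 by (intro mult_left_mono powr_mono2) auto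
      also have "\<dots> = 2 * C1 * (t0 powr (- real d / 2 - z / 2) * t0 powr (1 / 2))" by simp
      also have "\<dots> \<le> 2 * C1 * ?P"
        unfolding powr_add[symmetric] using C1 t0 z \<delta> by (intro mult_left_mono powr_mono) auto
      finally show ?thesis unfolding sp .
    qed
    have Uq: "2 * U powr (- 1 / 2) \<le> 2 * t0 powr (- 1 / 4)"
      unfolding U_def powr_powr using t0 \<delta> by (intro mult_left_mono powr_mono) auto
    let ?c = "C2 * t0 powr (3 / 4 - real d / 2 - \<delta>)"
    \<comment> \<open>Here 3/4 - 1/4 = 1/2: the tail of u^(-3/2) beyond the window gains the missing
      power of \<open>t0\<close>.\<close>
    have cP: "?c * (2 * t0 powr (- 1 / 4)) = 2 * C2 * ?P"
    proof -
      have "t0 powr (3 / 4 - real d / 2 - \<delta>) * t0 powr (- 1 / 4) = ?P"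
        unfolding powr_add[symmetric] by (rule arg_cong2[where f = "(powr)"]) auto
      then show ?thesis by simp
    qed
    have far': "norm (?f t) \<le> ?c * \<bar>t - t0\<bar> powr (- 3 / 2)" if "t0 / 2 \<le> t" "U \<le> \<bar>t - t0\<bar>" for t
      using far[rule_format, of Q g x t0 t] wk e x t0 that by (auto simp: U_def mult.assoc)
    have 2: "norm (integral {t0 / 2..t0 - U} ?f) \<le> 2 * C2 * ?P"
    proof -
      note h = has_integral_mult_right[OF integral_inverse_power_tail(2)[OF U0 Ut, of t0], of ?c]
      have eq: "{t0 - t0 / 2..t0 - U} = {t0 / 2..t0 - U}" by simp
      note h = h[unfolded eq]
      have "norm (integral {t0 / 2..t0 - U} ?f) \<le> integral {t0 / 2..t0 - U} (\<lambda>t. ?c * (t0 - t) powr (- 3 / 2))"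
      proof (rule Henstock_Kurzweil_Integration.integral_norm_bound_integral[OF int])
        show "(\<lambda>t. ?c * (t0 - t) powr (- 3 / 2)) integrable_on {t0 / 2..t0 - U}" using h by blast
        fix t assume "t \<in> {t0 / 2..t0 - U}"
        then show "norm (?f t) \<le> ?c * (t0 - t) powr (- 3 / 2)" using far'[of t] U0 by (simp add: abs_if)
      qed
      also have "\<dots> = ?c * (2 * U powr (- 1 / 2) - 2 * (t0 / 2) powr (- 1 / 2))" by (rule integral_unique[OF h])
      also have "\<dots> \<le> ?c * (2 * t0 powr (- 1 / 4))"
      proof (rule mult_left_mono)
        show "2 * U powr (- 1 / 2) - 2 * (t0 / 2) powr (- 1 / 2) \<le> 2 * t0 powr (- 1 / 4)"
          using Uq powr_ge_zero[of "t0 / 2" "- 1 / 2"] by linarith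
      qed (use C2 in auto)
      finally show ?thesis unfolding cP .
    qed
    have 4: "norm (integral {t0 + U..T} ?f) \<le> 2 * C2 * ?P"
    proof -
      have UT: "U \<le> T - t0" using Ut T t0 by simp
      note h = has_integral_mult_right[OF integral_inverse_power_tail(1)[OF U0 UT, of t0], of ?c]
      have eq: "{t0 + U..t0 + (T - t0)} = {t0 + U..T}" by simp
      note h = h[unfolded eq]
      have "norm (integral {t0 + U..T} ?f) \<le> integral {t0 + U..T} (\<lambda>t. ?c * (t - t0) powr (- 3 / 2))"
      proof (rule Henstock_Kurzweil_Integration.integral_norm_bound_integral[OF int])
        show "(\<lambda>t. ?c * (t - t0) powr (- 3 / 2)) integrable_on {t0 + U..T}" using h by blast
        fix t assume "t \<in> {t0 + U..T}"
        then show "norm (?f t) \<le> ?c * (t - t0) powr (- 3 / 2)" using far'[of t] U0 t0 by simp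
      qed
      also have "\<dots> = ?c * (2 * U powr (- 1 / 2) - 2 * (T - t0) powr (- 1 / 2))" by (rule integral_unique[OF h])
      also have "\<dots> \<le> ?c * (2 * t0 powr (- 1 / 4))"
      proof (rule mult_left_mono)
        show "2 * U powr (- 1 / 2) - 2 * (T - t0) powr (- 1 / 2) \<le> 2 * t0 powr (- 1 / 4)"
          using Uq powr_ge_zero[of "T - t0" "- 1 / 2"] by linarith
      qed (use C2 in auto)
      finally show ?thesis unfolding cP .
    qed
    have 3: "norm (integral {t0 - U..t0 + U} ?f - fourier g 0 * complex_of_real (renewal_term Q t0)) \<le> C3 * ?P"
      using window[rule_format, of Q g x t0] wk e x t0 Ut by (simp add: U_def)
    have "norm (integral {0..T} ?f - fourier g 0 * complex_of_real (renewal_term Q t0)) \<le> 2 * C1 * ?P + 2 * C2 * ?P + C3 * ?P + 2 * C2 * ?P"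
    proof -
      have eq: "integral {0..T} ?f - fourier g 0 * complex_of_real (renewal_term Q t0)
        = integral {0..t0 / 2} ?f + integral {t0 / 2..t0 - U} ?f
          + (integral {t0 - U..t0 + U} ?f - fourier g 0 * complex_of_real (renewal_term Q t0)) + integral {t0 + U..T} ?f"
        unfolding split by simp
      show ?thesis
        unfolding eq by (intro norm_triangle_le add_mono 1 2 3 4)
    qed
    then show ?thesis by (simp add: C_def algebra_simps)
  qed
  have "1 \<le> T0" by (simp add: T0_def)
  then show ?thesis
    using main C1 C2 C3 by (intro exI[of _ C] conjI exI[of _ T0]) (auto simp: C_def)
qed

section \<open>The renewal equation and its tilts\<close>

lemma flow_tilt:
  fixes J h :: "int ^ 'd::finite \<Rightarrow> real"
  assumes "in_lp 1 J" "in_lp 1 h" "in_lp 1 (tilt \<mu> J)" "in_lp 1 (tilt \<mu> h)"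
  shows "flow (tilt \<mu> J) (tilt \<mu> h) t x = of_real (exp (\<mu> \<bullet> rvec x)) * flow J h t x"
proof -
  have e: "flow Q g t x = of_real (exp (- t)) * integral torus (\<lambda>k. phase x k * fourier g k * exp (of_real t * fourier Q k))" for Q g :: "int ^ 'd \<Rightarrow> real"
  proof -
    have "exp (of_real t * (fourier Q k - 1)) = of_real (exp (- t)) * exp (of_real t * fourier Q k)" for k
      by (simp add: right_diff_distrib exp_diff exp_minus divide_inverse mult.commute flip: exp_of_real)
    then have "flow Q g t x = integral torus (\<lambda>k. of_real (exp (- t)) * (phase x k * fourier g k * exp (of_real t * fourier Q k)))"
      unfolding flow_def by (simp add: mult_ac)
    then show ?thesis by (simp only: integral_mult_right)
  qed
  show ?thesis
    unfolding e integral_exp_fourier_tilt[OF assms] by (simp only: mult_ac)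
qed

lemma fourier_renewal:
  fixes S J h :: "int ^ 'd::finite \<Rightarrow> real"
  assumes S: "in_lp 1 S" and J: "in_lp 1 J" and h: "in_lp 1 h"
    and eq: "\<And>x. S x = h x + conv J S x"
  shows "fourier h k = fourier S k * (1 - fourier J k)"
proof -
  have c: "in_lp 1 (conv J S)" by (rule in_lp_conv[OF J S])
  have "fourier S k = fourier h k + fourier (conv J S) k"
  proof -
    have "complex_of_real (S y) = complex_of_real (h y) + complex_of_real (conv J S y)" for y
      by (subst eq) simp
    then have "fourier S k = (\<Sum>\<^sub>\<infinity>y. complex_of_real (h y) * phase (- y) k + complex_of_real (conv J S y) * phase (- y) k)"
      unfolding fourier_eq by (simp only: distrib_right)
    also have "\<dots> = fourier h k + fourier (conv J S) k"
      unfolding fourier_eq by (intro infsum_add fourier_summable h c)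
    finally show ?thesis .
  qed
  then show ?thesis by (simp add: fourier_conv[OF J S] algebra_simps)
qed

text \<open>By \<open>fourier_renewal\<close> the integrand is the time derivative of the transform
  of \<open>S\<close> times a decaying exponential, so integrating in \<open>t\<close> inverts
  \<open>S\<close> and leaves a remainder. The gap \<open>\<kappa>\<close> makes it exponentially
  small.\<close>

lemma flow_integral_limit:
  fixes S J h :: "int ^ 'd::finite \<Rightarrow> real"
  assumes S: "in_lp 1 S" and J: "in_lp 1 J" and h: "in_lp 1 h"
    and eq: "\<And>x. S x = h x + conv J S x"
    and \<kappa>: "0 < \<kappa>" "\<And>k. k \<in> torus \<Longrightarrow> \<kappa> \<le> 1 - Re (fourier J k)"
  shows "((\<lambda>T. integral {0..T} (\<lambda>t. flow J h t x)) \<longlongrightarrow> complex_of_real ((2 * pi) ^ CARD('d) * S x)) at_top"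
proof -
  note hS = fourier_renewal[OF S J h eq]
  have I: "integral {0..T} (\<lambda>t. flow J h t x) = complex_of_real ((2 * pi) ^ CARD('d) * S x)
     - integral torus (\<lambda>k. phase x k * fourier S k * exp (of_real T * (fourier J k - 1)))" if T: "0 \<le> T" for T
  proof -
    let ?F = "\<lambda>t k. phase x k * fourier h k * exp (of_real t * (fourier J k - 1))"
    have cF: "continuous_on (cbox (0, \<chi> i. - pi) (T, \<chi> i. pi)) (\<lambda>(t, k). ?F t k)"
    proof -
      have s: "continuous_on A (\<lambda>p :: real \<times> (real ^ 'd). fourier f (snd p))" if "in_lp 1 f" for f :: "int ^ 'd \<Rightarrow> real" and A
        by (rule continuous_on_compose2[OF continuous_on_fourier[OF that, of UNIV] continuous_on_snd]) (auto intro: continuous_intros)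
      have p: "continuous_on A (\<lambda>p :: real \<times> (real ^ 'd). phase x (snd p))" for A
        by (rule continuous_on_compose2[OF continuous_on_phase[of UNIV] continuous_on_snd]) (auto intro: continuous_intros)
      show ?thesis unfolding case_prod_unfold by (intro continuous_intros s p J h)
    qed
    have inner: "integral {0..T} (\<lambda>t. ?F t k) = phase x k * fourier S k - phase x k * fourier S k * exp (of_real T * (fourier J k - 1))" for k
    proof (rule integral_unique)
      let ?G = "\<lambda>t :: real. - (phase x k * fourier S k * exp (of_real t * (fourier J k - 1)))"
      have "((\<lambda>t. ?F t k) has_integral ?G T - ?G 0) {0..T}"
      proof (rule fundamental_theorem_of_calculus[OF T])
        fix t :: real
        have "((\<lambda>z. - (phase x k * fourier S k * exp (z * (fourier J k - 1)))) has_field_derivative ?F t k) (at (of_real t))"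
          by (auto intro!: derivative_eq_intros simp: hS algebra_simps)
        then show "(?G has_vector_derivative ?F t k) (at t within {0..T})"
          by (rule has_vector_derivative_real_field)
      qed
      then show "((\<lambda>t. ?F t k) has_integral phase x k * fourier S k - phase x k * fourier S k * exp (of_real T * (fourier J k - 1))) {0..T}"
        by simp
    qed
    have "integral {0..T} (\<lambda>t. flow J h t x) = integral torus (\<lambda>k. integral {0..T} (\<lambda>t. ?F t k))"
      unfolding flow_def torus_def cbox_interval[symmetric] by (rule integral_swap_continuous[OF cF])
    also have "\<dots> = integral torus (\<lambda>k. phase x k * fourier S k - phase x k * fourier S k * exp (of_real T * (fourier J k - 1)))"
      by (simp only: inner)
    also have "\<dots> = integral torus (\<lambda>k. phase x k * fourier S k) - integral torus (\<lambda>k. phase x k * fourier S k * exp (of_real T * (fourier J k - 1)))"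
      unfolding torus_def
      by (intro Henstock_Kurzweil_Integration.integral_diff integrable_continuous continuous_intros S J)
    finally show ?thesis by (simp add: fourier_inversion[OF S])
  qed
  have bound: "norm (integral {0..T} (\<lambda>t. flow J h t x) - complex_of_real ((2 * pi) ^ CARD('d) * S x)) \<le> l1_norm S * (2 * pi) ^ CARD('d) * exp (- (\<kappa> * T))"
    if T: "0 \<le> T" for T
  proof -
    have "norm (integral torus (\<lambda>k. phase x k * fourier S k * exp (of_real T * (fourier J k - 1)))) \<le> integral torus (\<lambda>k :: real ^ 'd. l1_norm S * exp (- (\<kappa> * T)))"
      unfolding torus_def
    proof (rule Henstock_Kurzweil_Integration.integral_norm_bound_integral, unfold torus_def[symmetric])
      show "(\<lambda>k. phase x k * fourier S k * exp (of_real T * (fourier J k - 1))) integrable_on torus" "(\<lambda>k :: real ^ 'd. l1_norm S * exp (- (\<kappa> * T))) integrable_on torus"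
        unfolding torus_def by (intro integrable_continuous continuous_intros S J)+
      fix k :: "real ^ 'd" assume "k \<in> torus"
      from mult_left_mono[OF \<kappa>(2)[OF this] T] have "norm (exp (of_real T * (fourier J k - 1))) \<le> exp (- (\<kappa> * T))"
        by (simp add: norm_exp_eq_Re algebra_simps)
      then show "norm (phase x k * fourier S k * exp (of_real T * (fourier J k - 1))) \<le> l1_norm S * exp (- (\<kappa> * T))"
        unfolding norm_mult norm_phase mult_1_left by (intro mult_mono norm_fourier_le[OF S]) (auto intro: l1_norm_nonneg)
    qed
    also have "\<dots> = l1_norm S * (2 * pi) ^ CARD('d) * exp (- (\<kappa> * T))"
      by (simp add: torus_def content_cbox_cart interval_ne_empty_cart prod_constant mult_ac)
    finally show ?thesis unfolding I[OF T] by simp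
  qed
  have lim: "((\<lambda>T. l1_norm S * (2 * pi) ^ CARD('d) * exp (- (\<kappa> * T))) \<longlongrightarrow> l1_norm S * (2 * pi) ^ CARD('d) * 0) at_top"
  proof (intro tendsto_mult tendsto_const)
    have "filterlim (\<lambda>T. - (\<kappa> * T)) at_bot at_top"
      unfolding filterlim_uminus_at_top[symmetric] filterlim_uminus_at_bot
      using filterlim_tendsto_pos_mult_at_top[OF tendsto_const \<kappa>(1) filterlim_ident] by simp
    then show "((\<lambda>T. exp (- (\<kappa> * T))) \<longlongrightarrow> 0) at_top" by (rule filterlim_compose[OF exp_at_bot])
  qed
  show ?thesis
  proof (rule LIM_zero_cancel, rule Lim_null_comparison)
    show "\<forall>\<^sub>F T in at_top. norm (integral {0..T} (\<lambda>t. flow J h t x) - complex_of_real ((2 * pi) ^ CARD('d) * S x)) \<le> l1_norm S * (2 * pi) ^ CARD('d) * exp (- (\<kappa> * T))"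
      using eventually_ge_at_top[of 0] by eventually_elim (rule bound)
  qed (use lim in simp)
qed

section \<open>The domain of summable tilts: convexity and symmetries\<close>

lemma mem_Omega_iff:
  fixes S :: "int ^ 'd::finite \<Rightarrow> real"
  assumes S: "\<And>x. 0 \<le> S x"
  shows "\<mu> \<in> Omega S \<longleftrightarrow> in_lp 1 (tilt \<mu> S)"
proof -
  let ?f = "tilt \<mu> S"
  have f0: "0 \<le> ?f x" for x using S by (simp add: tilt_def)
  have se: "sum (\<lambda>x. ennreal (?f x)) F = ennreal (sum ?f F)" for F
    by (rule sum_ennreal) (rule f0)
  have su: "susc S \<mu> = (SUP F\<in>{F. finite F \<and> F \<subseteq> UNIV}. ennreal (sum ?f F))"
    unfolding susc_def se[symmetric] by (rule nonneg_infsum_complete) simp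
  have "susc S \<mu> < \<infinity> \<longleftrightarrow> ?f summable_on UNIV"
  proof
    assume fin: "susc S \<mu> < \<infinity>"
    show "?f summable_on UNIV"
    proof (rule nonneg_bdd_above_summable_on)
      show "bdd_above (sum ?f ` {F. F \<subseteq> UNIV \<and> finite F})"
      proof (rule bdd_aboveI2)
        fix F :: "(int ^ 'd) set" assume "F \<in> {F. F \<subseteq> UNIV \<and> finite F}"
        then have "F \<in> {F. finite F \<and> F \<subseteq> UNIV}" by blast
        then have "ennreal (sum ?f F) \<le> susc S \<mu>" unfolding su by (rule SUP_upper)
        also have "susc S \<mu> = ennreal (enn2real (susc S \<mu>))" using fin by (intro ennreal_enn2real[symmetric]) simp
        finally show "sum ?f F \<le> enn2real (susc S \<mu>)" using ennreal_le_iff[OF enn2real_nonneg] by blast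
      qed
    qed (use f0 in auto)
  next
    assume s: "?f summable_on UNIV"
    have "susc S \<mu> \<le> ennreal (infsum ?f UNIV)"
      unfolding su
    proof (rule SUP_least)
      fix F :: "(int ^ 'd) set" assume "F \<in> {F. finite F \<and> F \<subseteq> UNIV}"
      then have "sum ?f F \<le> infsum ?f UNIV" using f0 by (intro finite_sum_le_infsum[OF s]) auto
      then show "ennreal (sum ?f F) \<le> ennreal (infsum ?f UNIV)" by (rule ennreal_leI)
    qed
    also have "ennreal (infsum ?f UNIV) < \<infinity>" by simp
    finally show "susc S \<mu> < \<infinity>" .
  qed
  moreover have "(\<lambda>x. \<bar>?f x\<bar>) = ?f" using f0 by (intro ext abs_of_nonneg)
  ultimately show ?thesis unfolding Omega_def in_lp_1_iff mem_Collect_eq by (simp only:)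
qed

lemma convex_Omega:
  fixes S :: "int ^ 'd::finite \<Rightarrow> real"
  assumes S: "\<And>x. 0 \<le> S x"
  shows "convex (Omega S)"
proof (rule convexI)
  fix \<mu> \<nu> and u v :: real
  assume m: "\<mu> \<in> Omega S" "\<nu> \<in> Omega S" and uv: "0 \<le> u" "0 \<le> v" "u + v = 1"
  have s: "(\<lambda>x. u * tilt \<mu> S x + v * tilt \<nu> S x) summable_on UNIV"
    using m S by (intro summable_on_add summable_on_cmult_right) (auto simp: mem_Omega_iff in_lp_1_iff tilt_def)
  have "in_lp 1 (tilt (u *\<^sub>R \<mu> + v *\<^sub>R \<nu>) S)"
    unfolding in_lp_1_iff
  proof (rule summable_on_comparison_test[OF s])
    fix x
    have "exp ((u *\<^sub>R \<mu> + v *\<^sub>R \<nu>) \<bullet> rvec x) \<le> u * exp (\<mu> \<bullet> rvec x) + v * exp (\<nu> \<bullet> rvec x)"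
    proof -
      have u: "u = 1 - v" using uv by simp
      have "exp ((1 - v) *\<^sub>R (\<mu> \<bullet> rvec x) + v *\<^sub>R (\<nu> \<bullet> rvec x)) \<le> (1 - v) * exp (\<mu> \<bullet> rvec x) + v * exp (\<nu> \<bullet> rvec x)"
        by (rule convex_onD[OF exp_convex]) (use uv in auto)
      then show ?thesis unfolding u by (simp add: inner_add_left)
    qed
    then have "S x * exp ((u *\<^sub>R \<mu> + v *\<^sub>R \<nu>) \<bullet> rvec x) \<le> S x * (u * exp (\<mu> \<bullet> rvec x) + v * exp (\<nu> \<bullet> rvec x))"
      using S by (intro mult_left_mono)
    then show "\<bar>tilt (u *\<^sub>R \<mu> + v *\<^sub>R \<nu>) S x\<bar> \<le> u * tilt \<mu> S x + v * tilt \<nu> S x"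
      using S by (simp add: tilt_def abs_mult algebra_simps)
  qed auto
  then show "u *\<^sub>R \<mu> + v *\<^sub>R \<nu> \<in> Omega S" using S by (simp add: mem_Omega_iff)
qed

lemma Omega_image:
  fixes S :: "int ^ 'd::finite \<Rightarrow> real"
  assumes S: "\<And>x. 0 \<le> S x" and m: "\<mu> \<in> Omega S"
    and bij: "bij g" and gS: "\<And>x. S (g x) = S x" and gm: "\<And>x. \<mu> \<bullet> rvec (g x) = \<nu> \<bullet> rvec x"
  shows "\<nu> \<in> Omega S"
proof -
  have "(\<lambda>x. \<bar>tilt \<mu> S (g x)\<bar>) summable_on UNIV"
    using summable_on_reindex_bij_betw[OF bij, of "\<lambda>x. \<bar>tilt \<mu> S x\<bar>"] m S by (simp add: mem_Omega_iff in_lp_1_iff)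
  moreover have "tilt \<mu> S (g x) = tilt \<nu> S x" for x by (simp add: tilt_def gS gm)
  ultimately show ?thesis using S by (simp add: mem_Omega_iff in_lp_1_iff)
qed

lemma Omega_flip:
  fixes S :: "int ^ 'd::finite \<Rightarrow> real"
  assumes S: "\<And>x. 0 \<le> S x" and sym: "Zd_symmetric S" and m: "\<mu> \<in> Omega S"
  shows "(\<chi> j. if j = i then - (\<mu> $ j) else \<mu> $ j) \<in> Omega S"
proof (rule Omega_image[OF S m])
  let ?g = "\<lambda>x :: int ^ 'd. \<chi> j. if j = i then - (x $ j) else x $ j"
  show "bij ?g" by (rule o_bij[of ?g]) (auto simp: vec_eq_iff)
  show "S (?g x) = S x" for x using sym by (simp add: Zd_symmetric_def)
  show "\<mu> \<bullet> rvec (?g x) = (\<chi> j. if j = i then - (\<mu> $ j) else \<mu> $ j) \<bullet> rvec x" for x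
    by (simp add: inner_vec_def rvec_def if_distrib if_distribR cong: sum.cong) (rule sum.cong, auto)
qed

lemma Omega_permute:
  fixes S :: "int ^ 'd::finite \<Rightarrow> real"
  assumes S: "\<And>x. 0 \<le> S x" and sym: "Zd_symmetric S" and m: "\<mu> \<in> Omega S" and p: "bij p"
  shows "(\<chi> j. \<mu> $ inv p j) \<in> Omega S"
proof (rule Omega_image[OF S m])
  let ?g = "\<lambda>x :: int ^ 'd. \<chi> j. x $ p j"
  have pp: "p (inv p j) = j" "inv p (p j) = j" for j using p by (auto simp: bij_is_inj bij_is_surj surj_f_inv_f)
  show "bij ?g" by (rule o_bij[of "\<lambda>x. \<chi> j. x $ inv p j"]) (auto simp: vec_eq_iff pp)
  show "S (?g x) = S x" for x using sym p by (simp add: Zd_symmetric_def)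
  show "\<mu> \<bullet> rvec (?g x) = (\<chi> j. \<mu> $ inv p j) \<bullet> rvec x" for x
    using sum.reindex_bij_betw[OF p, of "\<lambda>j. \<mu> $ inv p j * real_of_int (x $ j)"] by (simp add: inner_vec_def rvec_def pp)
qed

text \<open>Averaging a tilt with its reflections removes coordinates one at a time, convexity keeps
  the average in the domain, and symmetry moves the surviving coordinate to any axis. This reduces
  every coordinate to the first axis, where \<open>mass\<close> is defined.\<close>

lemma Omega_coordinate:
  fixes S :: "int ^ 'd::finite \<Rightarrow> real"
  assumes S: "\<And>x. 0 \<le> S x" and sym: "Zd_symmetric S" and m: "\<mu> \<in> Omega S"
    and s: "s = 1 \<or> s = - 1"
  shows "axis j (s * \<bar>\<mu> $ i\<bar>) \<in> Omega S"
proof -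
  have zero: "(\<chi> l. if l \<in> A then 0 else \<mu> $ l) \<in> Omega S" if "finite A" for A
    using that
  proof (induction A rule: finite_induct)
    case (insert a A)
    let ?v = "\<chi> l. if l \<in> A then 0 else \<mu> $ l"
    have "(1 / 2) *\<^sub>R ?v + (1 / 2) *\<^sub>R (\<chi> j. if j = a then - (?v $ j) else ?v $ j) \<in> Omega S"
      by (rule convexD[OF convex_Omega[OF S] insert.IH Omega_flip[OF S sym insert.IH]]) auto
    moreover have "(1 / 2) *\<^sub>R ?v + (1 / 2) *\<^sub>R (\<chi> j. if j = a then - (?v $ j) else ?v $ j) = (\<chi> l. if l \<in> insert a A then 0 else \<mu> $ l)"
      by (auto simp: vec_eq_iff)
    ultimately show ?case by simp
  qed (use m in \<open>simp add: vec_nth_inverse\<close>)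
  have "(\<chi> l. if l \<in> - {i} then 0 else \<mu> $ l) = axis i (\<mu> $ i)" by (auto simp: vec_eq_iff axis_def)
  with zero[of "- {i}"] have 1: "axis i (\<mu> $ i) \<in> Omega S" by simp
  have "(\<chi> l. axis i (\<mu> $ i) $ inv (Transposition.transpose i j) l) = axis j (\<mu> $ i)"
    by (auto simp: vec_eq_iff axis_def Transposition.transpose_def)
  with Omega_permute[OF S sym 1, of "Transposition.transpose i j"] have 2: "axis j (\<mu> $ i) \<in> Omega S"
    by (simp add: bij_transpose)
  have "(\<chi> l. if l = j then - (axis j (\<mu> $ i) $ l) else axis j (\<mu> $ i) $ l) = axis j (- \<mu> $ i)"
    by (auto simp: vec_eq_iff axis_def)
  with Omega_flip[OF S sym 2, of j] have 3: "axis j (- \<mu> $ i) \<in> Omega S" by simp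
  from 2 3 s show ?thesis by (auto simp: abs_if)
qed

section \<open>From the class to the kernel locales\<close>

lemma lp_bounded_1_iff: "lp_bounded 1 f M \<longleftrightarrow> in_lp 1 f \<and> l1_norm f \<le> M"
proof -
  have "lp_norm 1 f = l1_norm f"
    using l1_norm_nonneg[of f] by (simp add: lp_norm_def l1_norm_def)
  then show ?thesis by (simp add: lp_bounded_def)
qed

text \<open>For p \<le> 2 the embedding of lp into l2 has norm one, so the constant \<open>M\<close>
  survives.\<close>

lemma lp_bounded_l2:
  assumes b: "lp_bounded p f M" and p: "0 < p" "p \<le> 2" and M: "0 < M"
  shows "(\<lambda>x. (f x)\<^sup>2) summable_on UNIV" "(\<Sum>\<^sub>\<infinity>x. (f x)\<^sup>2) \<le> M\<^sup>2"
proof -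
  let ?S = "\<Sum>\<^sub>\<infinity>x. \<bar>f x\<bar> powr p"
  have s: "(\<lambda>x. \<bar>f x\<bar> powr p) summable_on UNIV" and n: "?S powr (1 / p) \<le> M"
    using b by (auto simp: lp_bounded_def in_lp_def lp_norm_def)
  have S0: "0 \<le> ?S" by (rule infsum_nonneg) auto
  have "(?S powr (1 / p)) powr p \<le> M powr p" using n p by (intro powr_mono2) auto
  then have SM: "?S \<le> M powr p" using p S0 by (simp add: powr_powr)
  \<comment> \<open>A single summand is bounded by the whole sum; this sup bound then pays for the
    exponents between \<open>p\<close> and 2.\<close>
  have fM: "\<bar>f x\<bar> \<le> M" for x
  proof -
    have "(\<Sum>x\<in>{x}. \<bar>f x\<bar> powr p) \<le> ?S" by (rule finite_sum_le_infsum[OF s]) auto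
    then have "\<bar>f x\<bar> powr p \<le> M powr p" using SM by simp
    then show ?thesis using p M powr_less_mono2[of p M "\<bar>f x\<bar>"] by (auto simp: not_less[symmetric])
  qed
  have le: "norm ((f x)\<^sup>2) \<le> M powr (2 - p) * \<bar>f x\<bar> powr p" for x
  proof (cases "f x = 0")
    case False
    have "(f x)\<^sup>2 = \<bar>f x\<bar> powr 2" using False by (simp add: powr_numeral)
    also have "\<dots> = \<bar>f x\<bar> powr (2 - p) * \<bar>f x\<bar> powr p" by (simp flip: powr_add)
    also have "\<dots> \<le> M powr (2 - p) * \<bar>f x\<bar> powr p" using p fM by (intro mult_right_mono powr_mono2) auto
    finally show ?thesis by simp
  qed auto
  have s': "(\<lambda>x. M powr (2 - p) * \<bar>f x\<bar> powr p) summable_on UNIV" by (rule summable_on_cmult_right[OF s])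
  show "(\<lambda>x. (f x)\<^sup>2) summable_on UNIV" by (rule infsum_comparison(1)[OF le s'])
  have "norm (\<Sum>\<^sub>\<infinity>x. (f x)\<^sup>2) \<le> (\<Sum>\<^sub>\<infinity>x. M powr (2 - p) * \<bar>f x\<bar> powr p)" by (rule infsum_comparison(2)[OF le s'])
  then have "(\<Sum>\<^sub>\<infinity>x. (f x)\<^sup>2) \<le> M powr (2 - p) * ?S" by (simp add: infsum_cmult_right')
  also have "\<dots> \<le> M powr (2 - p) * M powr p" using SM by (intro mult_left_mono) auto
  also have "\<dots> = M\<^sup>2" using M by (simp add: powr_numeral flip: powr_add)
  finally show "(\<Sum>\<^sub>\<infinity>x. (f x)\<^sup>2) \<le> M\<^sup>2" .
qed

lemma l1_weight_mono:
  fixes f :: "int ^ 'd::finite \<Rightarrow> real"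
  assumes b: "lp_bounded 1 (\<lambda>y. norm (rvec y) powr q * f y) M" and p: "0 < p" "p \<le> q"
  shows "(\<lambda>y. norm (rvec y) powr p * \<bar>f y\<bar>) summable_on UNIV"
    "(\<Sum>\<^sub>\<infinity>y. norm (rvec y) powr p * \<bar>f y\<bar>) \<le> M"
proof -
  have s: "(\<lambda>y. norm (rvec y) powr q * \<bar>f y\<bar>) summable_on UNIV" "(\<Sum>\<^sub>\<infinity>y. norm (rvec y) powr q * \<bar>f y\<bar>) \<le> M"
    using b unfolding lp_bounded_1_iff by (simp_all add: in_lp_1_iff l1_norm_def abs_mult)
  have le: "norm (norm (rvec y) powr p * \<bar>f y\<bar>) \<le> norm (rvec y) powr q * \<bar>f y\<bar>" for y
    using norm_rvec_powr_mono[OF p, of y] by (simp add: abs_mult mult_right_mono)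
  show "(\<lambda>y. norm (rvec y) powr p * \<bar>f y\<bar>) summable_on UNIV" by (rule infsum_comparison(1)[OF le s(1)])
  have "norm (\<Sum>\<^sub>\<infinity>y. norm (rvec y) powr p * \<bar>f y\<bar>) \<le> (\<Sum>\<^sub>\<infinity>y. norm (rvec y) powr q * \<bar>f y\<bar>)"
    by (rule infsum_comparison(2)[OF le s(1)])
  then show "(\<Sum>\<^sub>\<infinity>y. norm (rvec y) powr p * \<bar>f y\<bar>) \<le> M" using s(2) by simp
qed

text \<open>Lowering the moment exponent is free on the lattice and brings \<open>z\<close> into the
  range where the Taylor bounds hold.\<close>

lemma kernel_moments_Q_class:
  fixes Q g :: "int ^ 'd::finite \<Rightarrow> real"
  assumes "(Q, g) \<in> Q_class M K \<zeta>" "0 < M" "0 < K" "0 < \<zeta>"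
  shows "kernel_moments M K (min \<zeta> 1) Q"
proof
  show "(\<lambda>y. norm (rvec y) powr (2 + min \<zeta> 1) * \<bar>Q y\<bar>) summable_on UNIV"
    "(\<Sum>\<^sub>\<infinity>y. norm (rvec y) powr (2 + min \<zeta> 1) * \<bar>Q y\<bar>) \<le> M"
    using assms by (auto simp: Q_class_def intro!: l1_weight_mono[of "2 + \<zeta>"])
qed (use assms in \<open>auto simp: Q_class_def lp_bounded_1_iff torus_iff\<close>)

lemma walk_kernel_Q_class:
  fixes Q g :: "int ^ 'd::finite \<Rightarrow> real"
  assumes Qg: "(Q, g) \<in> Q_class M K \<zeta>" and pos: "0 < M" "0 < K" "0 < \<zeta>" and mass: "(\<Sum>\<^sub>\<infinity>y. Q y) = 1"
  shows "walk_kernel M K (min \<zeta> 1) Q g"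
proof -
  let ?d = "CARD('d)"
  interpret kernel_moments M K "min \<zeta> 1" Q by (rule kernel_moments_Q_class[OF Qg pos])
  have d1: "1 \<le> ?d" by (simp add: Suc_le_eq)
  show ?thesis
  proof
    show "(\<lambda>y. norm (rvec y) powr (min \<zeta> 1) * \<bar>g y\<bar>) summable_on UNIV"
      "(\<Sum>\<^sub>\<infinity>y. norm (rvec y) powr (min \<zeta> 1) * \<bar>g y\<bar>) \<le> M"
      using Qg pos by (auto simp: Q_class_def intro!: l1_weight_mono[of \<zeta>])
    have "\<exists>p. 0 < p \<and> p \<le> 2 \<and> lp_bounded p (\<lambda>y. norm (rvec y) ^ max 2 (?d - 1) * g y) M"
    proof (cases "4 \<le> ?d")
      case True
      then have "max 2 (?d - 1) = ?d - 1" by simp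
      then show ?thesis using Qg True by (intro exI[of _ 2]) (auto simp: Q_class_def)
    next
      case False
      then have m: "max 2 (?d - 1) = 2" by simp
      \<comment> \<open>The exponent enters as a denominator in \<open>lp_norm\<close>, and for d =
        2 only \<zeta> > 0 keeps it positive.\<close>
      have "0 < p_exp ?d \<zeta>"
      proof (cases "?d = 1")
        case False
        then have "2 \<le> ?d" using d1 by linarith
        then have "0 < real ?d - 2 + min \<zeta> 2" using pos by linarith
        then show ?thesis by (simp add: p_exp_def)
      qed (simp add: p_exp_def)
      then show ?thesis using Qg unfolding m by (intro exI[of _ "min (p_exp ?d \<zeta>) 2"]) (auto simp: Q_class_def)
    qed
    then obtain p where p: "0 < p" "p \<le> 2" "lp_bounded p (\<lambda>y. norm (rvec y) ^ max 2 (?d - 1) * g y) M" by blast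
    show "(\<lambda>y. (norm (rvec y) ^ max 2 (?d - 1) * g y)\<^sup>2) summable_on UNIV"
      "(\<Sum>\<^sub>\<infinity>y. (norm (rvec y) ^ max 2 (?d - 1) * g y)\<^sup>2) \<le> M\<^sup>2"
      by (rule lp_bounded_l2[OF p(3,1,2) pos(1)])+
    assume d4: "4 \<le> ?d"
    have q: "lp_bounded (min (real ?d / 3) 2) (\<lambda>y. norm (rvec y) ^ (?d - 1) * Q y) M"
      using Qg d4 by (auto simp: Q_class_def)
    show "(\<lambda>y. (norm (rvec y) ^ (?d - 1) * Q y)\<^sup>2) summable_on UNIV"
      "(\<Sum>\<^sub>\<infinity>y. (norm (rvec y) ^ (?d - 1) * Q y)\<^sup>2) \<le> M\<^sup>2"
      using d4 by (intro lp_bounded_l2[OF q _ _ pos(1)]; simp)+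
  qed (use Qg mass in \<open>auto simp: Q_class_def lp_bounded_1_iff\<close>)
qed

locale oz =
  fixes i1 :: "'d::finite" and M K \<zeta> :: real and S J h :: "int ^ 'd \<Rightarrow> real"
  assumes pos: "0 < M" "0 < K" "0 < \<zeta>" and S_nonneg: "\<And>x. 0 \<le> S x"
    and A1: "assumption1 i1 S" and A2: "assumption2 M K \<zeta> S J h"
begin

abbreviation W where "W \<equiv> closure (Omega S)"

definition \<phi> :: "real ^ 'd \<Rightarrow> real" where "\<phi> \<mu> = (\<Sum>\<^sub>\<infinity>y. tilt \<mu> J y)"

lemma sym: "Zd_symmetric S" and open_Omega: "open (Omega S)" and zero_Omega: "0 \<in> Omega S"
  using A1 by (auto simp: assumption1_def)

lemma convex_W: "convex W" by (intro convex_closure convex_Omega S_nonneg)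

lemma Omega_W: "\<mu> \<in> Omega S \<Longrightarrow> \<mu> \<in> W" using closure_subset by blast

lemma Q_class_tilt: "\<mu> \<in> W \<Longrightarrow> (tilt \<mu> J, tilt \<mu> h) \<in> Q_class M K \<zeta>"
  and h_pos: "\<mu> \<in> W \<Longrightarrow> 0 < Re (fourier (tilt \<mu> h) 0)"
  using A2 by (auto simp: assumption2_def)

lemma moments: "\<mu> \<in> W \<Longrightarrow> kernel_moments M K (min \<zeta> 1) (tilt \<mu> J)"
  by (rule kernel_moments_Q_class[OF Q_class_tilt pos])

lemma h_l1: "\<mu> \<in> W \<Longrightarrow> in_lp 1 (tilt \<mu> h)" "\<mu> \<in> W \<Longrightarrow> l1_norm (tilt \<mu> h) \<le> M"
  using Q_class_tilt by (auto simp: Q_class_def lp_bounded_1_iff)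

lemma S_eq: "S x = h x + conv J S x"
  using A2 by (simp add: assumption2_def)

text \<open>The segment from the interior point 0 to a point of the closure stays in the interior
  short of its end. Boundary tilts are thus approached through tilts at which \<open>S\<close> is
  summable.\<close>

lemma interior_segment:
  assumes "\<mu> \<in> W" "0 \<le> s" "s < 1"
  shows "s *\<^sub>R \<mu> \<in> Omega S"
proof -
  have "0 \<in> interior (Omega S)" using zero_Omega open_Omega by (simp add: interior_open)
  then have "\<mu> - (1 - s) *\<^sub>R (\<mu> - 0) \<in> interior (Omega S)"
    using assms by (intro mem_interior_closure_convex_shrink[OF convex_Omega[OF S_nonneg]]) auto
  then show ?thesis using open_Omega by (simp add: interior_open algebra_simps)
qed

lemma axis_scale_le_Sup:
  assumes t: "t *\<^sub>R axis i1 1 \<in> Omega S"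
  shows "t \<le> Sup {t. 0 \<le> t \<and> susc S (t *\<^sub>R axis i1 1) < \<infinity>}"
proof -
  let ?T = "{t. 0 \<le> t \<and> susc S (t *\<^sub>R axis i1 1) < \<infinity>}"
  obtain \<mu>1 where \<mu>1: "0 < \<mu>1" "\<mu>1 *\<^sub>R axis i1 1 \<notin> Omega S" using A1 by (auto simp: assumption1_def)
  have bdd: "bdd_above ?T"
  proof (rule bdd_aboveI)
    \<comment> \<open>A larger \<open>t\<close> would put the excluded point on a segment inside the
      domain. Boundedness is what makes \<open>Sup\<close> a genuine supremum.\<close>
    fix t assume t: "t \<in> ?T"
    show "t \<le> \<mu>1"
    proof (rule ccontr)
      assume "\<not> t \<le> \<mu>1"
      then have "(\<mu>1 / t) *\<^sub>R (t *\<^sub>R axis i1 1) \<in> Omega S"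
        using t \<mu>1 by (intro interior_segment[of "t *\<^sub>R axis i1 1" "\<mu>1 / t"] Omega_W) (auto simp: Omega_def)
      moreover have "(\<mu>1 / t) *\<^sub>R (t *\<^sub>R axis i1 (1 :: real)) = \<mu>1 *\<^sub>R axis i1 1" using \<open>\<not> t \<le> \<mu>1\<close> \<mu>1 by simp
      ultimately show False using \<mu>1 by simp
    qed
  qed
  have zero: "0 \<in> ?T" using zero_Omega by (simp add: Omega_def)
  show "t \<le> Sup ?T"
  proof (cases "0 \<le> t")
    case True
    then show ?thesis using t by (intro cSup_upper bdd) (auto simp: Omega_def)
  next
    case False
    then show ?thesis using cSup_upper[OF zero bdd] by simp
  qed
qed

lemma Omega_coord_le_mass: "\<mu> \<in> Omega S \<Longrightarrow> \<bar>\<mu> $ i\<bar> \<le> mass i1 S"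
  using axis_scale_le_Sup[of "\<bar>\<mu> $ i\<bar>"] Omega_coordinate[OF S_nonneg sym, of \<mu> 1 i1 i]
  by (simp add: mass_def axis_def scaleR_vec_def if_distrib cong: if_cong)

lemma W_coord_le_mass: "\<mu> \<in> W \<Longrightarrow> \<bar>\<mu> $ i\<bar> \<le> mass i1 S"
proof -
  have "closed {\<mu> :: real ^ 'd. \<bar>\<mu> $ i\<bar> \<le> mass i1 S}"
    by (intro closed_Collect_le continuous_intros)
  moreover have "Omega S \<subseteq> {\<mu>. \<bar>\<mu> $ i\<bar> \<le> mass i1 S}" using Omega_coord_le_mass by blast
  ultimately have "W \<subseteq> {\<mu>. \<bar>\<mu> $ i\<bar> \<le> mass i1 S}" by (rule closure_minimal[rotated])
  then show "\<mu> \<in> W \<Longrightarrow> \<bar>\<mu> $ i\<bar> \<le> mass i1 S" by blast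
qed

lemma compact_W: "compact W"
proof -
  have "W \<subseteq> cbox (\<chi> i. - mass i1 S) (\<chi> i. mass i1 S)"
    using W_coord_le_mass by (auto simp: mem_box_cart abs_le_iff minus_le_iff)
  then have "bounded W" by (rule bounded_subset[OF bounded_cbox])
  then show ?thesis by (simp add: compact_eq_bounded_closed)
qed

lemma mass_pos: "0 < mass i1 S"
proof -
  obtain e where e: "0 < e" "ball 0 e \<subseteq> Omega S" using open_Omega zero_Omega by (meson open_contains_ball)
  have "(e / 2) *\<^sub>R axis i1 1 \<in> ball (0 :: real ^ 'd) e" using e by (simp add: dist_norm)
  then have "(e / 2) *\<^sub>R axis i1 1 \<in> Omega S" using e by blast
  from axis_scale_le_Sup[OF this] show ?thesis using e by (simp add: mass_def)
qed

text \<open>These points give the lower bound for the support function of the domain that makes all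
  later constants depend on the mass.\<close>

lemma axis_in_W:
  assumes s: "s = 1 \<or> s = - 1"
  shows "axis j (s * mass i1 S) \<in> W"
proof -
  have om: "axis j (s * t) \<in> Omega S" if t: "0 < t" "t < mass i1 S" for t
  proof -
    have ne: "{t. 0 \<le> t \<and> susc S (t *\<^sub>R axis i1 1) < \<infinity>} \<noteq> {}"
      using zero_Omega by (auto simp: Omega_def intro!: exI[of _ "0 :: real"])
    obtain t' where t': "0 \<le> t'" "susc S (t' *\<^sub>R axis i1 1) < \<infinity>" "t < t'"
      using less_cSupD[OF ne t(2)[unfolded mass_def]] by blast
    then have "(t / t') *\<^sub>R (t' *\<^sub>R axis i1 1) \<in> Omega S"
      using t by (intro interior_segment[of "t' *\<^sub>R axis i1 1" "t / t'"] Omega_W) (auto simp: Omega_def)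
    moreover have "(t / t') *\<^sub>R (t' *\<^sub>R axis i1 (1 :: real)) = axis i1 t" using t t' by (auto simp: vec_eq_iff axis_def)
    ultimately have "axis i1 t \<in> Omega S" by simp
    from Omega_coordinate[OF S_nonneg sym this s, of j i1] show ?thesis using t by simp
  qed
  have ax: "axis j r = r *\<^sub>R axis j 1" for r :: real by (simp add: vec_eq_iff axis_def)
  \<comment> \<open>The shift by two keeps the scaling factor strictly between 0 and 1 already for
    \<open>n = 0\<close>, as \<open>om\<close> demands.\<close>
  define f where "f n = axis j (s * (mass i1 S * (1 - inverse (real (Suc (Suc n))))))" for n
  have "f n \<in> W" for n
    unfolding f_def using mass_pos by (intro Omega_W om) (auto simp: field_simps intro!: add_pos_nonneg)
  moreover have "f \<longlonglongrightarrow> axis j (s * (mass i1 S * (1 - 0)))"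
  proof -
    have "(\<lambda>n. inverse (real (Suc (Suc n)))) \<longlonglongrightarrow> 0"
      by (rule LIMSEQ_Suc[OF LIMSEQ_inverse_real_of_nat])
    then show ?thesis unfolding f_def by (subst (1 2) ax) (intro tendsto_intros)
  qed
  ultimately show ?thesis using closed_sequentially[OF closed_closure, of f "Omega S"] by simp
qed

end

section \<open>Strong convexity and the maximiser\<close>

text \<open>The exponential at the intermediate point is bounded by the sum of its values at both
  ends. After multiplication by one tilt of the kernel, Taylor remainders are thereby controlled by
  moments of the two end tilts, which are finite even on the boundary of the domain.\<close>

lemma exp_taylor_between:
  fixes s :: real
  assumes "s \<noteq> 0" "0 < n"
  obtains t where "exp t \<le> 1 + exp s" "exp s = (\<Sum>m<n. s ^ m / fact m) + exp t / fact n * s ^ n"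
proof -
  have "\<exists>t. (if s < 0 then s < t \<and> t < 0 else 0 < t \<and> t < s) \<and>
    exp s = (\<Sum>m<n. exp 0 / fact m * (s - 0) ^ m) + exp t / fact n * (s - 0) ^ n"
    by (rule Taylor[where diff = "\<lambda>_. exp" and a = "min s 0" and b = "max s 0"]) (use assms in auto)
  then obtain t where t: "if s < 0 then s < t \<and> t < 0 else 0 < t \<and> t < s"
    "exp s = (\<Sum>m<n. exp 0 / fact m * (s - 0) ^ m) + exp t / fact n * (s - 0) ^ n" by blast
  have "exp t \<le> 1 + exp s"
  proof (cases "s < 0")
    case True
    then have "exp t \<le> 1" using t by simp
    then show ?thesis using exp_gt_zero[of s] by linarith
  next
    case False
    then have "exp t \<le> exp s" using t(1) by simp
    then show ?thesis by linarith
  qed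
  then show thesis using that t(2) by simp
qed

lemma exp_remainder_quadratic: "\<bar>exp s - 1 - s\<bar> \<le> s\<^sup>2 / 2 * (1 + exp s)" for s :: real
proof (cases "s = 0")
  case False
  obtain t where t: "exp t \<le> 1 + exp s" "exp s = (\<Sum>m<2. s ^ m / fact m) + exp t / fact 2 * s ^ 2"
    using exp_taylor_between[OF False, of 2] by auto
  have eq: "exp s - 1 - s = s\<^sup>2 / 2 * exp t" using t(2) by (simp add: numeral_2_eq_2)
  have "\<bar>exp s - 1 - s\<bar> = s\<^sup>2 / 2 * exp t" unfolding eq by simp
  also have "\<dots> \<le> s\<^sup>2 / 2 * (1 + exp s)" using t(1) by (intro mult_left_mono) auto
  finally show ?thesis .
qed simp

text \<open>For large \<bar>s\<bar> a first-order expansion is used, since the quadratic remainder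
  would demand a higher moment than available after multiplication by one more linear
  factor.\<close>

lemma exp_remainder_holder:
  fixes s z :: real
  assumes z: "0 < z" "z \<le> 1"
  shows "\<bar>exp s - 1 - s\<bar> \<le> 2 * \<bar>s\<bar> powr (1 + z) * (1 + exp s)"
proof -
  consider "s = 0" | "0 < \<bar>s\<bar>" "\<bar>s\<bar> \<le> 1" | "1 < \<bar>s\<bar>" by linarith
  then show ?thesis
  proof cases
    case 2
    have "s\<^sup>2 = \<bar>s\<bar> powr 2" using 2 by (simp add: powr_numeral)
    also have "\<dots> \<le> \<bar>s\<bar> powr (1 + z)" using 2 z by (intro powr_mono') auto
    finally have "s\<^sup>2 / 2 \<le> 2 * \<bar>s\<bar> powr (1 + z)" using powr_ge_zero[of "\<bar>s\<bar>" "1 + z"] by linarith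
    then have "s\<^sup>2 / 2 * (1 + exp s) \<le> 2 * \<bar>s\<bar> powr (1 + z) * (1 + exp s)"
      by (intro mult_right_mono add_nonneg_nonneg) auto
    then show ?thesis using exp_remainder_quadratic[of s] by linarith
  next
    case 3
    have "s \<noteq> 0" using 3 by auto
    then obtain t where t: "exp t \<le> 1 + exp s" "exp s = (\<Sum>m<1. s ^ m / fact m) + exp t / fact 1 * s ^ 1"
      by (rule exp_taylor_between[OF _ zero_less_one])
    have eq: "exp s - 1 = s * exp t" using t(2) by simp
    have "\<bar>exp s - 1\<bar> = \<bar>s\<bar> * exp t" unfolding eq by (simp add: abs_mult)
    also have "\<dots> \<le> \<bar>s\<bar> * (1 + exp s)" using t(1) by (intro mult_left_mono) auto
    finally have "\<bar>exp s - 1 - s\<bar> \<le> \<bar>s\<bar> * (1 + exp s) + \<bar>s\<bar> * 1" by linarith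
    also have "\<dots> \<le> \<bar>s\<bar> * (1 + exp s) + \<bar>s\<bar> * (1 + exp s)" by (intro add_left_mono mult_left_mono) auto
    also have "\<dots> = 2 * \<bar>s\<bar> powr 1 * (1 + exp s)" using 3 by simp
    also have "\<dots> \<le> 2 * \<bar>s\<bar> powr (1 + z) * (1 + exp s)"
      using 3 z by (intro mult_right_mono mult_left_mono powr_mono add_nonneg_nonneg) auto
    finally show ?thesis .
  qed simp
qed

lemma has_real_derivative_holder:
  fixes f :: "real \<Rightarrow> real"
  assumes z: "0 < z" and le: "\<And>y. y \<in> A \<Longrightarrow> \<bar>f y - f x - (y - x) * D\<bar> \<le> C * \<bar>y - x\<bar> powr (1 + z)"
  shows "(f has_real_derivative D) (at x within A)"
  unfolding has_field_derivative_iff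
proof (rule LIM_zero_cancel, rule Lim_null_comparison)
  show "\<forall>\<^sub>F y in at x within A. norm ((f y - f x) / (y - x) - D) \<le> C * \<bar>y - x\<bar> powr z"
    unfolding eventually_at_filter
  proof (intro always_eventually allI impI)
    fix y assume y: "y \<noteq> x" "y \<in> A"
    have "\<bar>(f y - f x) / (y - x) - D\<bar> * \<bar>y - x\<bar> = \<bar>f y - f x - (y - x) * D\<bar>"
    proof -
      have "((f y - f x) / (y - x) - D) * (y - x) = f y - f x - (y - x) * D" using y by (simp add: field_simps)
      then show ?thesis by (simp only: abs_mult[symmetric])
    qed
    also have "\<dots> \<le> C * \<bar>y - x\<bar> powr (1 + z)" by (rule le[OF y(2)])
    also have "\<dots> = (C * \<bar>y - x\<bar> powr z) * \<bar>y - x\<bar>" using y by (simp add: powr_add)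
    finally show "norm ((f y - f x) / (y - x) - D) \<le> C * \<bar>y - x\<bar> powr z" using y by simp
  qed
  have "((\<lambda>y. \<bar>y - x\<bar> powr z) \<longlongrightarrow> \<bar>x - x\<bar> powr z) (at x within A)"
  proof (rule tendsto_powr')
    show "((\<lambda>y. \<bar>y - x\<bar>) \<longlongrightarrow> \<bar>x - x\<bar>) (at x within A)" by (intro tendsto_intros)
    show "\<bar>x - x\<bar> \<noteq> 0 \<or> 0 < z \<and> (\<forall>\<^sub>F y in at x within A. 0 \<le> \<bar>y - x\<bar>)"
      using z by (intro disjI2 conjI always_eventually allI abs_ge_zero)
  qed (rule tendsto_const)
  then have "((\<lambda>y. C * \<bar>y - x\<bar> powr z) \<longlongrightarrow> C * \<bar>x - x\<bar> powr z) (at x within A)" by (rule tendsto_mult_left)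
  then show "((\<lambda>y. C * \<bar>y - x\<bar> powr z) \<longlongrightarrow> 0) (at x within A)" using z by simp
qed

lemma has_real_derivative_nonneg_le:
  fixes F :: "real \<Rightarrow> real"
  assumes ab: "a \<le> b" and d: "\<And>x. x \<in> {a..b} \<Longrightarrow> (F has_real_derivative F' x) (at x within {a..b})"
    and nn: "\<And>x. x \<in> {a..b} \<Longrightarrow> 0 \<le> F' x"
  shows "F a \<le> F b"
proof -
  have "\<exists>x\<in>{a..b}. F b - F a = F' x * (b - a)"
    using mvt_very_simple[OF ab, of F "\<lambda>x. (*) (F' x)"] d by (simp add: has_field_derivative_def)
  then obtain x where "x \<in> {a..b}" "F b - F a = F' x * (b - a)" by blast
  moreover have "0 \<le> F' x * (b - a)" using nn[OF \<open>x \<in> {a..b}\<close>] ab by simp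
  ultimately show ?thesis by simp
qed

text \<open>Derivatives are taken within the closed interval because the segment may end on the
  boundary, beyond which the tilted sums need not converge.\<close>

lemma second_derivative_lower_bound:
  fixes G :: "real \<Rightarrow> real"
  assumes dG: "\<And>x. x \<in> {0..1} \<Longrightarrow> (G has_real_derivative G' x) (at x within {0..1})"
    and dG': "\<And>x. x \<in> {0..1} \<Longrightarrow> (G' has_real_derivative G'' x) (at x within {0..1})"
    and c: "\<And>x. x \<in> {0..1} \<Longrightarrow> 2 * c \<le> G'' x"
  shows "G 0 + G' 0 + c \<le> G 1"
proof -
  have G': "G' 0 + 2 * c * t \<le> G' t" if t: "t \<in> {0..1}" for t
  proof -
    have d: "((\<lambda>x. G' x - 2 * c * x) has_real_derivative G'' x - 2 * c * 1) (at x within {0..t})" if x: "x \<in> {0..t}" for x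
    proof -
      have "(G' has_real_derivative G'' x) (at x within {0..t})"
        by (rule has_field_derivative_subset[OF dG']) (use x t in auto)
      then show ?thesis by (intro DERIV_diff DERIV_cmult DERIV_ident)
    qed
    have "G' 0 - 2 * c * 0 \<le> G' t - 2 * c * t"
      by (rule has_real_derivative_nonneg_le[OF _ d]) (use t c in auto)
    then show ?thesis by simp
  qed
  have d: "((\<lambda>x. G x - G' 0 * x - c * x\<^sup>2) has_real_derivative G' x - G' 0 * 1 - c * (2 * x)) (at x within {0..1})"
    if x: "x \<in> {0..1}" for x
  proof -
    have "((\<lambda>x :: real. x\<^sup>2) has_real_derivative 2 * x) (at x within {0..1})"
      using DERIV_power[OF DERIV_ident, of 2 x "{0..1}"] by simp
    then show ?thesis by (intro DERIV_diff DERIV_cmult DERIV_ident dG x)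
  qed
  have n: "0 \<le> G' x - G' 0 * 1 - c * (2 * x)" if "x \<in> {0..1}" for x
    using G'[OF that] by (simp add: algebra_simps)
  have "G 0 - G' 0 * 0 - c * 0\<^sup>2 \<le> G 1 - G' 0 * 1 - c * 1\<^sup>2"
    by (rule has_real_derivative_nonneg_le[OF _ d n]) auto
  then show ?thesis by simp
qed

context oz
begin

lemma \<phi>_summable: "\<mu> \<in> W \<Longrightarrow> (tilt \<mu> J has_sum \<phi> \<mu>) UNIV"
  unfolding \<phi>_def using kernel_moments.Q_summable[OF moments] by (rule has_sum_infsum)

lemma tilt_shift: "tilt b J y = tilt a J y * exp ((b - a) \<bullet> rvec y)"
  by (simp add: tilt_def inner_diff_left flip: exp_add)

lemma moment_bound:
  assumes \<mu>: "\<mu> \<in> W" and p: "p = 2 \<or> p = 2 + min \<zeta> 1"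
  shows "(\<lambda>y. norm (rvec y) powr p * \<bar>tilt \<mu> J y\<bar>) summable_on UNIV" "(\<Sum>\<^sub>\<infinity>y. norm (rvec y) powr p * \<bar>tilt \<mu> J y\<bar>) \<le> M"
proof -
  have "lp_bounded 1 (\<lambda>y. norm (rvec y) powr (2 + \<zeta>) * tilt \<mu> J y) M"
    using Q_class_tilt[OF \<mu>] by (auto simp: Q_class_def)
  from l1_weight_mono[OF this, of p] p pos
  show "(\<lambda>y. norm (rvec y) powr p * \<bar>tilt \<mu> J y\<bar>) summable_on UNIV" "(\<Sum>\<^sub>\<infinity>y. norm (rvec y) powr p * \<bar>tilt \<mu> J y\<bar>) \<le> M"
    by auto
qed

lemma two_point_sum:
  assumes ab: "a \<in> W" "b \<in> W" and p: "p = 2 \<or> p = 2 + min \<zeta> 1" and c: "0 \<le> c"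
    and F: "(F has_sum s) UNIV"
    and le: "\<And>y. \<bar>F y\<bar> \<le> c * (norm (rvec y) powr p * \<bar>tilt a J y\<bar> + norm (rvec y) powr p * \<bar>tilt b J y\<bar>)"
  shows "\<bar>s\<bar> \<le> c * (2 * M)"
proof -
  note m = moment_bound[OF ab(1) p] moment_bound[OF ab(2) p]
  have s: "(\<lambda>y. c * (norm (rvec y) powr p * \<bar>tilt a J y\<bar> + norm (rvec y) powr p * \<bar>tilt b J y\<bar>)) summable_on UNIV"
    by (intro summable_on_cmult_right summable_on_add m)
  have "norm (infsum F UNIV) \<le> (\<Sum>\<^sub>\<infinity>y. c * (norm (rvec y) powr p * \<bar>tilt a J y\<bar> + norm (rvec y) powr p * \<bar>tilt b J y\<bar>))"
    by (rule infsum_comparison(2)[OF _ s]) (use le in simp)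
  also have "\<dots> = c * ((\<Sum>\<^sub>\<infinity>y. norm (rvec y) powr p * \<bar>tilt a J y\<bar>) + (\<Sum>\<^sub>\<infinity>y. norm (rvec y) powr p * \<bar>tilt b J y\<bar>))"
    by (simp add: infsum_cmult_right' infsum_add m)
  also have "\<dots> \<le> c * (2 * M)" using m c by (intro mult_left_mono) auto
  finally show ?thesis by (simp add: infsumI[OF F])
qed

lemma \<phi>_taylor:
  assumes ab: "a \<in> W" "b \<in> W"
  shows "\<bar>\<phi> b - \<phi> a - (b - a) \<bullet> drift (tilt a J)\<bar> \<le> M * (norm (b - a))\<^sup>2"
proof -
  let ?s = "\<lambda>y. (b - a) \<bullet> rvec y"
  have F: "((\<lambda>y. tilt b J y - tilt a J y - ?s y * tilt a J y) has_sum (\<phi> b - \<phi> a - (b - a) \<bullet> drift (tilt a J))) UNIV"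
    by (intro has_sum_diff \<phi>_summable ab kernel_moments.inner_drift[OF moments])
  have "\<bar>tilt b J y - tilt a J y - ?s y * tilt a J y\<bar> \<le> (norm (b - a))\<^sup>2 / 2 * (norm (rvec y) powr 2 * \<bar>tilt a J y\<bar> + norm (rvec y) powr 2 * \<bar>tilt b J y\<bar>)" for y
  proof -
    have "tilt b J y - tilt a J y - ?s y * tilt a J y = tilt a J y * (exp (?s y) - 1 - ?s y)"
      by (simp add: tilt_shift[of b y a] algebra_simps)
    then have "\<bar>tilt b J y - tilt a J y - ?s y * tilt a J y\<bar> = \<bar>tilt a J y\<bar> * \<bar>exp (?s y) - 1 - ?s y\<bar>" by (simp add: abs_mult)
    also have "\<dots> \<le> \<bar>tilt a J y\<bar> * ((?s y)\<^sup>2 / 2 * (1 + exp (?s y)))" by (intro mult_left_mono exp_remainder_quadratic) auto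
    also have "\<dots> \<le> \<bar>tilt a J y\<bar> * ((norm (b - a) * norm (rvec y))\<^sup>2 / 2 * (1 + exp (?s y)))"
    proof (intro mult_left_mono mult_right_mono divide_right_mono)
      show "(?s y)\<^sup>2 \<le> (norm (b - a) * norm (rvec y))\<^sup>2"
        using power_mono[OF Cauchy_Schwarz_ineq2[of "b - a" "rvec y"], of 2] by simp
    qed (auto intro: add_nonneg_nonneg)
    also have "\<dots> = (norm (b - a))\<^sup>2 / 2 * ((norm (rvec y))\<^sup>2 * \<bar>tilt a J y\<bar> + (norm (rvec y))\<^sup>2 * (\<bar>tilt a J y\<bar> * exp (?s y)))"
      by (simp add: power_mult_distrib algebra_simps)
    also have "\<bar>tilt a J y\<bar> * exp (?s y) = \<bar>tilt b J y\<bar>" by (simp add: tilt_shift[of b y a] abs_mult)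
    also have "(norm (rvec y))\<^sup>2 = norm (rvec y) powr 2" using powr_numeral[of "norm (rvec y)" "num.Bit0 num.One"] by (cases "norm (rvec y) = 0") auto
    finally show ?thesis .
  qed
  from two_point_sum[OF ab _ _ F this] show ?thesis by (simp add: mult.commute)
qed

text \<open>Along a segment the drift has the covariance as its derivative. The extra linear factor
  raises the remainder from order 1 + z to the moment of order 2 + z.\<close>

lemma drift_holder:
  assumes ab: "a \<in> W" "b \<in> W" and r: "b - a = r *\<^sub>R \<delta>"
  shows "\<bar>\<delta> \<bullet> drift (tilt b J) - \<delta> \<bullet> drift (tilt a J) - r * (\<delta> \<bullet> (covar (tilt a J) *v \<delta>))\<bar>
    \<le> 4 * M * norm \<delta> powr (2 + min \<zeta> 1) * \<bar>r\<bar> powr (1 + min \<zeta> 1)"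
proof -
  let ?z = "min \<zeta> 1"
  have z: "0 < ?z" "?z \<le> 1" using pos by auto
  let ?d = "\<lambda>y. \<delta> \<bullet> rvec y"
  have F: "((\<lambda>y. ?d y * tilt b J y - ?d y * tilt a J y - r * ((?d y)\<^sup>2 * tilt a J y)) has_sum
     (\<delta> \<bullet> drift (tilt b J) - \<delta> \<bullet> drift (tilt a J) - r * (\<delta> \<bullet> (covar (tilt a J) *v \<delta>)))) UNIV"
    by (intro has_sum_diff has_sum_cmult_right kernel_moments.inner_drift[OF moments] kernel_moments.inner_covar[OF moments] ab)
  have "\<bar>?d y * tilt b J y - ?d y * tilt a J y - r * ((?d y)\<^sup>2 * tilt a J y)\<bar>
    \<le> (2 * norm \<delta> powr (2 + ?z) * \<bar>r\<bar> powr (1 + ?z)) * (norm (rvec y) powr (2 + ?z) * \<bar>tilt a J y\<bar> + norm (rvec y) powr (2 + ?z) * \<bar>tilt b J y\<bar>)" for y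
  proof -
    have s: "(b - a) \<bullet> rvec y = r * ?d y" by (simp add: r)
    have tb: "tilt b J y = tilt a J y * exp (r * ?d y)" using tilt_shift[of b y a] by (simp only: s)
    have dn: "\<bar>?d y\<bar> \<le> norm \<delta> * norm (rvec y)" by (rule Cauchy_Schwarz_ineq2)
    have "?d y * tilt b J y - ?d y * tilt a J y - r * ((?d y)\<^sup>2 * tilt a J y) = tilt a J y * (?d y * (exp (r * ?d y) - 1 - r * ?d y))"
      by (simp add: tb power2_eq_square algebra_simps)
    then have "\<bar>?d y * tilt b J y - ?d y * tilt a J y - r * ((?d y)\<^sup>2 * tilt a J y)\<bar> = \<bar>tilt a J y\<bar> * (\<bar>?d y\<bar> * \<bar>exp (r * ?d y) - 1 - r * ?d y\<bar>)"
      by (simp add: abs_mult)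
    also have "\<dots> \<le> \<bar>tilt a J y\<bar> * (\<bar>?d y\<bar> * (2 * \<bar>r * ?d y\<bar> powr (1 + ?z) * (1 + exp (r * ?d y))))"
      by (intro mult_left_mono exp_remainder_holder z) auto
    also have "\<bar>?d y\<bar> * (2 * \<bar>r * ?d y\<bar> powr (1 + ?z) * (1 + exp (r * ?d y))) = 2 * \<bar>r\<bar> powr (1 + ?z) * \<bar>?d y\<bar> powr (2 + ?z) * (1 + exp (r * ?d y))"
      using powr_add[of "\<bar>?d y\<bar>" 1 "1 + ?z"] by (simp add: abs_mult powr_mult)
    also have "\<bar>tilt a J y\<bar> * (2 * \<bar>r\<bar> powr (1 + ?z) * \<bar>?d y\<bar> powr (2 + ?z) * (1 + exp (r * ?d y)))
      \<le> \<bar>tilt a J y\<bar> * (2 * \<bar>r\<bar> powr (1 + ?z) * (norm \<delta> * norm (rvec y)) powr (2 + ?z) * (1 + exp (r * ?d y)))"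
      using dn z by (intro mult_left_mono mult_right_mono powr_mono2 add_nonneg_nonneg) auto
    also have "\<dots> = (2 * norm \<delta> powr (2 + ?z) * \<bar>r\<bar> powr (1 + ?z)) * (norm (rvec y) powr (2 + ?z) * \<bar>tilt a J y\<bar> + norm (rvec y) powr (2 + ?z) * (\<bar>tilt a J y\<bar> * exp (r * ?d y)))"
      by (simp add: powr_mult algebra_simps)
    also have "\<bar>tilt a J y\<bar> * exp (r * ?d y) = \<bar>tilt b J y\<bar>" by (simp add: tb abs_mult)
    finally show ?thesis .
  qed
  from two_point_sum[OF ab _ _ F this] show ?thesis by (simp add: mult_ac)
qed

text \<open>On the segment the second derivative of \<open>\<phi>\<close> is the covariance form of
  the current tilt, and the infrared bound makes it at least \<open>2 * K\<close> times the squared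
  length, uniformly in the tilt.\<close>

lemma \<phi>_strongly_convex:
  assumes ab: "a \<in> W" "b \<in> W"
  shows "\<phi> a + (b - a) \<bullet> drift (tilt a J) + K * (norm (b - a))\<^sup>2 \<le> \<phi> b"
proof -
  let ?z = "min \<zeta> 1"
  have z: "0 < ?z" "?z \<le> 1" using pos by auto
  define \<delta> where "\<delta> = b - a"
  define p where "p t = a + t *\<^sub>R \<delta>" for t
  define G where "G t = \<phi> (p t)" for t
  define G' where "G' t = \<delta> \<bullet> drift (tilt (p t) J)" for t
  define G'' where "G'' t = \<delta> \<bullet> (covar (tilt (p t) J) *v \<delta>)" for t
  have pW: "p t \<in> W" if "t \<in> {0..1}" for t
  proof -
    have "p t = (1 - t) *\<^sub>R a + t *\<^sub>R b" by (simp add: p_def \<delta>_def algebra_simps)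
    then show ?thesis using convexD_alt[OF convex_W ab, of t] that by simp
  qed
  have pd: "p y - p x = (y - x) *\<^sub>R \<delta>" for x y by (simp add: p_def algebra_simps)
  have dG: "(G has_real_derivative G' x) (at x within {0..1})" if x: "x \<in> {0..1}" for x
  proof (rule has_real_derivative_holder[of 1])
    fix y :: real assume y: "y \<in> {0..1}"
    show "\<bar>G y - G x - (y - x) * G' x\<bar> \<le> (M * (norm \<delta>)\<^sup>2) * \<bar>y - x\<bar> powr (1 + 1)"
      using \<phi>_taylor[OF pW[OF x] pW[OF y], unfolded pd] powr_numeral[of "\<bar>y - x\<bar>" "num.Bit0 num.One"]
      by (cases "y = x") (simp_all add: G_def G'_def power_mult_distrib mult_ac)
  qed simp
  have dG': "(G' has_real_derivative G'' x) (at x within {0..1})" if x: "x \<in> {0..1}" for x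
    by (rule has_real_derivative_holder[OF z(1)])
       (use drift_holder[OF pW[OF x] pW pd] in \<open>simp add: G'_def G''_def\<close>)
  have G''2: "2 * (K * (norm \<delta>)\<^sup>2) \<le> G'' x" if "x \<in> {0..1}" for x
    using kernel_moments.covar_lower[OF moments[OF pW[OF that]], of \<delta>] by (simp add: G''_def)
  have "p 0 = a" "p 1 = b" by (simp_all add: p_def \<delta>_def)
  with second_derivative_lower_bound[OF dG dG' G''2] show ?thesis by (simp add: G_def G'_def \<delta>_def)
qed

section \<open>Mass of the tilted kernel on the boundary, and the maximiser\<close>

lemma Omega_iff: "\<mu> \<in> Omega S \<longleftrightarrow> in_lp 1 (tilt \<mu> S)"
  by (rule mem_Omega_iff) (rule S_nonneg)

lemma Omega_iff_summable: "\<mu> \<in> Omega S \<longleftrightarrow> tilt \<mu> S summable_on UNIV"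
proof -
  have "(\<lambda>x. \<bar>tilt \<mu> S x\<bar>) = tilt \<mu> S" by (simp add: fun_eq_iff tilt_def S_nonneg)
  then show ?thesis by (simp add: Omega_iff in_lp_1_iff)
qed

lemma J_l1: "\<mu> \<in> W \<Longrightarrow> in_lp 1 (tilt \<mu> J)"
  using Q_class_tilt by (auto simp: Q_class_def lp_bounded_1_iff)

lemma \<phi>_fourier: "fourier (tilt \<mu> J) 0 = complex_of_real (\<phi> \<mu>)"
  unfolding \<phi>_def by (rule fourier_0)

lemma infsum_tilt_S:
  assumes \<mu>: "\<mu> \<in> Omega S"
  shows "(1 - \<phi> \<mu>) * (\<Sum>\<^sub>\<infinity>x. tilt \<mu> S x) = Re (fourier (tilt \<mu> h) 0)"
proof -
  have S: "in_lp 1 (tilt \<mu> S)" using \<mu> by (simp add: Omega_iff)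
  have "S = (\<lambda>x. h x + conv J S x)" using S_eq by blast
  then have "tilt \<mu> S x = tilt \<mu> h x + tilt \<mu> (conv J S) x" for x
    using fun_cong[of S "\<lambda>x. h x + conv J S x" x] by (simp add: tilt_def distrib_right)
  then have "tilt \<mu> S x = tilt \<mu> h x + conv (tilt \<mu> J) (tilt \<mu> S) x" for x by (simp add: tilt_conv)
  from fourier_renewal[OF S J_l1[OF Omega_W[OF \<mu>]] h_l1(1)[OF Omega_W[OF \<mu>]] this, of 0]
  have "fourier (tilt \<mu> h) 0 = complex_of_real ((1 - \<phi> \<mu>) * (\<Sum>\<^sub>\<infinity>x. tilt \<mu> S x))"
    unfolding fourier_0 \<phi>_def by (simp add: mult.commute)
  then show ?thesis by simp
qed

lemma h_le: "\<mu> \<in> W \<Longrightarrow> Re (fourier (tilt \<mu> h) 0) \<le> M"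
  using norm_fourier_le[OF h_l1(1), of \<mu> 0] h_l1(2)[of \<mu>] complex_Re_le_cmod[of "fourier (tilt \<mu> h) 0"] by linarith

lemma \<phi>_less_1:
  assumes \<mu>: "\<mu> \<in> Omega S"
  shows "\<phi> \<mu> < 1"
proof -
  have "0 < (1 - \<phi> \<mu>) * (\<Sum>\<^sub>\<infinity>x. tilt \<mu> S x)"
    unfolding infsum_tilt_S[OF \<mu>] by (rule h_pos[OF Omega_W[OF \<mu>]])
  moreover have "0 \<le> (\<Sum>\<^sub>\<infinity>x. tilt \<mu> S x)" by (rule infsum_nonneg) (simp add: tilt_def S_nonneg)
  ultimately show ?thesis by (simp add: zero_less_mult_iff)
qed

lemma tendsto_\<phi>:
  assumes f: "\<And>n. f n \<in> W" "f \<longlonglongrightarrow> a" and a: "a \<in> W"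
  shows "(\<lambda>n. \<phi> (f n)) \<longlonglongrightarrow> \<phi> a"
proof -
  let ?L = "\<lambda>n. \<phi> a + (f n - a) \<bullet> drift (tilt a J)"
  have "?L \<longlonglongrightarrow> \<phi> a + (a - a) \<bullet> drift (tilt a J)"
    by (intro tendsto_add tendsto_const tendsto_inner tendsto_diff f(2))
  then have L: "?L \<longlonglongrightarrow> \<phi> a" by simp
  have "(\<lambda>n. M * (norm (f n - a))\<^sup>2) \<longlonglongrightarrow> M * (norm (a - a))\<^sup>2"
    by (intro tendsto_mult tendsto_power tendsto_norm tendsto_const tendsto_diff f(2))
  then have z: "(\<lambda>n. M * (norm (f n - a))\<^sup>2) \<longlonglongrightarrow> 0" by simp
  have "norm (\<phi> (f n) - ?L n) \<le> M * (norm (f n - a))\<^sup>2" for n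
    using \<phi>_taylor[OF a f(1)[of n]] by (simp only: real_norm_def diff_diff_eq)
  then have "(\<lambda>n. \<phi> (f n) - ?L n) \<longlonglongrightarrow> 0"
    by (intro Lim_null_comparison[OF _ z] always_eventually allI)
  then show ?thesis by (rule Lim_transform[OF L])
qed

text \<open>Approach \<open>\<mu>\<close> along the segment from 0. If \<open>\<phi> \<mu>\<close>
  were below 1, the sums of the tilted \<open>S\<close> would stay bounded by about M / (1 -
  \<phi>), and their finite partial sums would pass to the limit, placing \<open>\<mu>\<close> in
  the domain.\<close>

lemma \<phi>_eq_1:
  assumes \<mu>: "\<mu> \<in> W" "\<mu> \<notin> Omega S"
  shows "\<phi> \<mu> = 1"
proof -
  define s where "s n = 1 - inverse (real (Suc n))" for n
  have s01: "0 \<le> s n" "s n < 1" for n by (simp_all add: s_def field_simps)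
  have sl: "s \<longlonglongrightarrow> 1" using tendsto_diff[OF tendsto_const LIMSEQ_inverse_real_of_nat, of 1] by (simp add: s_def[abs_def])
  have om: "s n *\<^sub>R \<mu> \<in> Omega S" for n by (rule interior_segment[OF \<mu>(1) s01])
  have pl: "(\<lambda>n. s n *\<^sub>R \<mu>) \<longlonglongrightarrow> \<mu>" using tendsto_scaleR[OF sl tendsto_const, of \<mu>] by simp
  have \<phi>l: "(\<lambda>n. \<phi> (s n *\<^sub>R \<mu>)) \<longlonglongrightarrow> \<phi> \<mu>" by (rule tendsto_\<phi>[OF Omega_W[OF om] pl \<mu>(1)])
  have le: "\<phi> \<mu> \<le> 1" by (rule LIMSEQ_le_const2[OF \<phi>l]) (use \<phi>_less_1[OF om] in \<open>blast intro: less_imp_le\<close>)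
  have "\<not> \<phi> \<mu> < 1"
  proof
    assume lt: "\<phi> \<mu> < 1"
    have "sum (tilt \<mu> S) F \<le> M / (1 - \<phi> \<mu>)" if F: "finite F" for F
    proof (rule LIMSEQ_le)
      show "(\<lambda>n. M / (1 - \<phi> (s n *\<^sub>R \<mu>))) \<longlonglongrightarrow> M / (1 - \<phi> \<mu>)"
        by (intro tendsto_divide tendsto_const tendsto_diff \<phi>l) (use lt in simp)
      show "(\<lambda>n. sum (tilt (s n *\<^sub>R \<mu>) S) F) \<longlonglongrightarrow> sum (tilt \<mu> S) F"
        unfolding tilt_def by (intro tendsto_sum tendsto_mult tendsto_const tendsto_exp tendsto_inner pl)
      have "sum (tilt (s n *\<^sub>R \<mu>) S) F \<le> M / (1 - \<phi> (s n *\<^sub>R \<mu>))" for n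
      proof -
        have "tilt (s n *\<^sub>R \<mu>) S summable_on UNIV" using om Omega_iff_summable by blast
        then have "sum (tilt (s n *\<^sub>R \<mu>) S) F \<le> (\<Sum>\<^sub>\<infinity>x. tilt (s n *\<^sub>R \<mu>) S x)"
          by (rule finite_sum_le_infsum) (use F in \<open>auto simp: tilt_def S_nonneg\<close>)
        also have "\<dots> = Re (fourier (tilt (s n *\<^sub>R \<mu>) h) 0) / (1 - \<phi> (s n *\<^sub>R \<mu>))"
          using infsum_tilt_S[OF om[of n]] \<phi>_less_1[OF om[of n]] by (simp add: field_simps)
        also have "\<dots> \<le> M / (1 - \<phi> (s n *\<^sub>R \<mu>))"
          using h_le[OF Omega_W[OF om[of n]]] \<phi>_less_1[OF om[of n]] by (intro divide_right_mono) auto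
        finally show ?thesis .
      qed
      then show "\<exists>N. \<forall>n\<ge>N. sum (tilt (s n *\<^sub>R \<mu>) S) F \<le> M / (1 - \<phi> (s n *\<^sub>R \<mu>))" by blast
    qed
    then have "tilt \<mu> S summable_on UNIV"
      by (intro nonneg_bdd_above_summable_on bdd_aboveI2) (auto simp: tilt_def S_nonneg)
    then show False using \<mu>(2) Omega_iff_summable by blast
  qed
  then show ?thesis using le by simp
qed

lemma not_maximal_Omega:
  assumes "u \<noteq> 0" "\<mu> \<in> Omega S"
  obtains \<nu> where "\<nu> \<in> W" "\<mu> \<bullet> u < \<nu> \<bullet> u"
proof -
  obtain e where e: "0 < e" "ball \<mu> e \<subseteq> Omega S" using assms(2) open_Omega open_contains_ball by blast
  show thesis
  proof (rule that)
    have "\<mu> + (e / 2 / norm u) *\<^sub>R u \<in> ball \<mu> e" using e assms(1) by (simp add: dist_norm)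
    then show "\<mu> + (e / 2 / norm u) *\<^sub>R u \<in> W" using e(2) Omega_W by blast
    have "0 < e / 2 / norm u * (u \<bullet> u)" using e assms(1) by simp
    then show "\<mu> \<bullet> u < (\<mu> + (e / 2 / norm u) *\<^sub>R u) \<bullet> u" by (simp add: inner_add_left)
  qed
qed

text \<open>Compactness gives a maximiser, openness of the domain expels it to the boundary, and
  strong convexity leaves room for only one.\<close>

lemma mu_max:
  assumes u: "u \<noteq> 0"
  shows "mu_max S u \<in> W" "\<nu> \<in> W \<Longrightarrow> \<nu> \<bullet> u \<le> mu_max S u \<bullet> u" "mu_max S u \<notin> Omega S"
proof -
  let ?P = "is_arg_max (\<lambda>\<nu>. \<nu> \<bullet> u) (\<lambda>\<nu>. \<nu> \<in> W)"
  have P: "?P \<nu> \<longleftrightarrow> \<nu> \<in> W \<and> (\<forall>\<xi>\<in>W. \<xi> \<bullet> u \<le> \<nu> \<bullet> u)" for \<nu>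
    by (simp only: is_arg_max_linorder Ball_def)
  have ne: "W \<noteq> {}" using zero_Omega by (auto simp: closure_eq_empty)
  have "continuous_on W (\<lambda>\<nu>. \<nu> \<bullet> u)"
    by (rule continuous_on_inner[OF continuous_on_id continuous_on_const])
  from continuous_attains_sup[OF compact_W ne this]
  obtain \<mu> where "\<mu> \<in> W" "\<forall>\<xi>\<in>W. \<xi> \<bullet> u \<le> \<mu> \<bullet> u" ..
  then have \<mu>: "?P \<mu>" using P[of \<mu>] by simp
  have out: "\<nu> \<notin> Omega S" if "?P \<nu>" for \<nu>
  proof
    assume "\<nu> \<in> Omega S"
    then obtain \<xi> where "\<xi> \<in> W" "\<nu> \<bullet> u < \<xi> \<bullet> u" by (rule not_maximal_Omega[OF u])
    moreover have "\<xi> \<bullet> u \<le> \<nu> \<bullet> u" using that \<open>\<xi> \<in> W\<close> unfolding P by blast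
    ultimately show False by linarith
  qed
  have "\<nu> = \<mu>" if \<nu>: "?P \<nu>" for \<nu>
  proof (rule ccontr)
    assume "\<nu> \<noteq> \<mu>"
    have W: "\<mu> \<in> W" "\<nu> \<in> W" using \<mu> \<nu> unfolding P by blast+
    have "\<mu> \<bullet> u \<le> \<nu> \<bullet> u" "\<nu> \<bullet> u \<le> \<mu> \<bullet> u" using \<mu> \<nu> W unfolding P by blast+
    then have eq: "\<nu> \<bullet> u = \<mu> \<bullet> u" by linarith
    \<comment> \<open>The midpoint of two maximisers is again a maximiser, so all three points have
      mass 1. Adding the two strong convexity inequalities based at the midpoint cancels the linear
      terms and contradicts this.\<close>
    define p where "p = (1 / 2) *\<^sub>R \<mu> + (1 / 2) *\<^sub>R \<nu>"
    have pW: "p \<in> W" unfolding p_def by (rule convexD[OF convex_W W]) auto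
    have "p \<bullet> u = \<mu> \<bullet> u" by (simp add: p_def inner_add_left eq)
    then have "?P p" using \<mu> pW unfolding P by simp
    then have "\<phi> p = 1" by (intro \<phi>_eq_1 pW out)
    note 1 = this \<phi>_eq_1[OF W(1) out[OF \<mu>]] \<phi>_eq_1[OF W(2) out[OF \<nu>]]
    have mid: "\<mu> - p = (1 / 2) *\<^sub>R (\<mu> - \<nu>)" "\<nu> - p = - ((1 / 2) *\<^sub>R (\<mu> - \<nu>))"
      by (simp_all add: p_def vec_eq_iff field_simps)
    have "0 < K * (norm ((1 / 2) *\<^sub>R (\<mu> - \<nu>)))\<^sup>2" using \<open>\<nu> \<noteq> \<mu>\<close> pos by simp
    moreover note \<phi>_strongly_convex[OF pW W(1), unfolded 1 mid] \<phi>_strongly_convex[OF pW W(2), unfolded 1 mid]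
    ultimately show False by (simp only: norm_minus_cancel inner_minus_left)
  qed
  with \<mu> have "mu_max S u = \<mu>" unfolding mu_max_def by (rule the_equality)
  then show "mu_max S u \<in> W" "\<nu> \<in> W \<Longrightarrow> \<nu> \<bullet> u \<le> mu_max S u \<bullet> u" "mu_max S u \<notin> Omega S"
    using \<mu> out[OF \<mu>] unfolding P by auto
qed

text \<open>Comparison with the points of length \<open>mass\<close> on the axes bounds the maximum
  below by \<open>mass\<close> times each \<bar>u $ j\<bar>; summing over \<open>j\<close> uses that
  the l1 norm of a unit vector is at least 1.\<close>

lemma inner_mu_max_ge:
  assumes u: "norm u = 1"
  shows "mass i1 S / CARD('d) \<le> mu_max S u \<bullet> u"
proof -
  have u0: "u \<noteq> 0" using u by auto
  have "mass i1 S * \<bar>u $ j\<bar> \<le> mu_max S u \<bullet> u" for j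
  proof -
    define s :: real where "s = (if 0 \<le> u $ j then 1 else - 1)"
    have "axis j (s * mass i1 S) \<bullet> u \<le> mu_max S u \<bullet> u"
      by (intro mu_max(2)[OF u0] axis_in_W) (auto simp: s_def)
    then show ?thesis by (auto simp: inner_axis' s_def abs_if)
  qed
  then have "(\<Sum>j\<in>UNIV. mass i1 S * \<bar>u $ j\<bar>) \<le> (\<Sum>j\<in>(UNIV :: 'd set). mu_max S u \<bullet> u)" by (intro sum_mono)
  moreover have "mass i1 S * 1 \<le> mass i1 S * (\<Sum>j\<in>UNIV. \<bar>u $ j\<bar>)"
    using norm_le_l1_cart[of u] u mass_pos by (intro mult_left_mono) auto
  ultimately show ?thesis by (simp add: sum_distrib_left divide_le_eq mult.commute)
qed

text \<open>Strong convexity based at the maximiser and evaluated at 0, where \<open>\<phi>\<close>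
  is below its boundary value 1.\<close>

lemma drift_mu_max_lower:
  assumes u: "u \<noteq> 0"
  shows "K * (norm (mu_max S u))\<^sup>2 \<le> mu_max S u \<bullet> drift (tilt (mu_max S u) J)"
  using \<phi>_strongly_convex[OF mu_max(1)[OF u] Omega_W[OF zero_Omega]] \<phi>_eq_1[OF mu_max(1,3)[OF u]] \<phi>_less_1[OF zero_Omega]
  by simp

text \<open>The source of the uniform lower bound \<open>e0\<close> on the speed of the walk, and
  the place where the mass enters the constants.\<close>

lemma norm_drift_mu_max_ge:
  assumes u: "norm u = 1"
  shows "K * (mass i1 S / CARD('d)) \<le> norm (drift (tilt (mu_max S u) J))"
proof -
  let ?\<mu> = "mu_max S u"
  have u0: "u \<noteq> 0" using u by auto
  have n: "mass i1 S / CARD('d) \<le> norm ?\<mu>"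
    using inner_mu_max_ge[OF u] norm_cauchy_schwarz[of ?\<mu> u] u by simp
  have "0 < mass i1 S / CARD('d)" using mass_pos by simp
  then have n0: "0 < norm ?\<mu>" using n by linarith
  have "K * (norm ?\<mu>)\<^sup>2 \<le> norm ?\<mu> * norm (drift (tilt ?\<mu> J))"
    using drift_mu_max_lower[OF u0] norm_cauchy_schwarz[of ?\<mu> "drift (tilt ?\<mu> J)"] by linarith
  then have "norm ?\<mu> * (K * norm ?\<mu>) \<le> norm ?\<mu> * norm (drift (tilt ?\<mu> J))" by (simp add: power2_eq_square mult_ac)
  then have "K * norm ?\<mu> \<le> norm (drift (tilt ?\<mu> J))" using n0 mult_le_cancel_left_pos by blast
  moreover have "K * (mass i1 S / CARD('d)) \<le> K * norm ?\<mu>" using n pos by (intro mult_left_mono) auto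
  ultimately show ?thesis by linarith
qed

text \<open>A Lagrange condition for a function known only on the closure of the domain. If the
  drift were not along \<open>u\<close>, some direction would increase the objective while
  decreasing \<open>\<phi>\<close> to first order. The path in this direction starts slightly
  inside, at \<open>(1 - s) *\<^sub>R \<mu>\<close>, to be sure that it begins in the
  domain.\<close>

lemma drift_mu_max:
  assumes u: "norm u = 1"
  shows "drift (tilt (mu_max S u) J) = norm (drift (tilt (mu_max S u) J)) *\<^sub>R u"
proof (rule ccontr)
  define \<mu> where "\<mu> = mu_max S u"
  define \<eta> where "\<eta> = drift (tilt \<mu> J)"
  define e where "e = norm \<eta>"
  assume "drift (tilt (mu_max S u) J) \<noteq> norm (drift (tilt (mu_max S u) J)) *\<^sub>R u"
  then have neq: "\<eta> \<noteq> e *\<^sub>R u" by (simp add: \<mu>_def \<eta>_def e_def)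
  have u0: "u \<noteq> 0" using u by auto
  note mu = mu_max[OF u0, folded \<mu>_def]
  have "0 < K * (mass i1 S / CARD('d))" using pos mass_pos by simp
  then have e0: "0 < e" using norm_drift_mu_max_ge[OF u] unfolding e_def \<eta>_def \<mu>_def by linarith
  \<comment> \<open>The difference of the unit vectors along \<open>u\<close> and along the drift:
    for distinct unit vectors it has a positive inner product with the first and a negative one with
    the second.\<close>
  define w where "w = u - (1 / e) *\<^sub>R \<eta>"
  define c where "c = 1 - (u \<bullet> \<eta>) / e"
  have w0: "w \<noteq> 0"
  proof
    assume "w = 0"
    then have "e *\<^sub>R w = 0" by simp
    then show False using neq e0 by (simp add: w_def scaleR_diff_right)
  qed
  have uu: "u \<bullet> u = 1" using u by (simp add: norm_eq_sqrt_inner)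
  have ee: "\<eta> \<bullet> \<eta> = e\<^sup>2" by (simp add: e_def power2_norm_eq_inner)
  have wu: "w \<bullet> u = c" unfolding w_def c_def inner_diff_left inner_scaleR_left uu inner_commute[of \<eta> u] by simp
  have we: "w \<bullet> \<eta> = - e * c" using e0 by (simp add: w_def c_def inner_diff_left ee field_simps power2_eq_square)
  have "w \<bullet> w = 2 * c"
  proof -
    have "w \<bullet> w = w \<bullet> u - (1 / e) * (w \<bullet> \<eta>)" by (subst (2) w_def) (simp add: inner_diff_right)
    then show ?thesis using e0 by (simp add: wu we)
  qed
  moreover have "0 < w \<bullet> w" using w0 by simp
  ultimately have c0: "0 < c" by linarith
  define m where "m = \<mu> \<bullet> u"
  have "0 < mass i1 S / CARD('d)" using mass_pos by simp
  then have m0: "0 < m" using inner_mu_max_ge[OF u] unfolding m_def \<mu>_def by linarith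
  then have \<mu>0: "\<mu> \<noteq> 0" by (auto simp: m_def)
  \<comment> \<open>Up to the factor \<open>s\<close>, this bounds the distance from
    \<open>\<mu>\<close> to any point of the path.\<close>
  define B where "B = norm \<mu> + 2 * m / c * norm w"
  have B0: "0 < B" unfolding B_def using \<mu>0 m0 c0 by (intro add_pos_nonneg) auto
  \<comment> \<open>Small enough for the first-order gain s K \<bar>\<mu>\<bar>^2 to exceed the
    quadratic error M (s B)^2 by a factor of two.\<close>
  define s where "s = min (1 / 2) (K * (norm \<mu>)\<^sup>2 / (2 * M * B\<^sup>2))"
  have s: "0 < s" "s < 1" "s \<le> K * (norm \<mu>)\<^sup>2 / (2 * M * B\<^sup>2)"
  proof -
    have "0 < K * (norm \<mu>)\<^sup>2 / (2 * M * B\<^sup>2)" using pos \<mu>0 B0 by simp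
    then show "0 < s" by (simp add: s_def)
    have "s \<le> 1 / 2" by (simp only: s_def min.cobounded1)
    then show "s < 1" by simp
  qed (simp only: s_def min.cobounded2)
  \<comment> \<open>The factor 2 first makes up for the retreat by \<open>s\<close> and then pushes
    the objective above its maximum.\<close>
  define r1 where "r1 = 2 * s * m / c"
  have r1: "0 \<le> r1" "r1 * c = 2 * s * m" using s m0 c0 by (simp_all add: r1_def)
  define p where "p r = (1 - s) *\<^sub>R \<mu> + r *\<^sub>R w" for r
  \<comment> \<open>The last parameter at which the path is in the closure. Were that point
    interior, it would have to be the end of the path, contradicting maximality; otherwise it has
    mass 1, contradicting the first-order decrease.\<close>
  define T where "T = {0..r1} \<inter> p -` W"
  have "compact T" unfolding T_def
    by (intro compact_Int_closed continuous_closed_vimage compact_Icc) (auto simp: p_def[abs_def] intro!: continuous_intros)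
  moreover have "0 \<in> T"
    using Omega_W[OF interior_segment[OF mu(1), of "1 - s"]] s r1 by (simp add: T_def p_def)
  ultimately obtain r where r: "r \<in> T" "\<And>r'. r' \<in> T \<Longrightarrow> r' \<le> r" using compact_attains_sup[of T] by blast
  have rW: "p r \<in> W" "0 \<le> r" "r \<le> r1" using r(1) by (auto simp: T_def)
  show False
  proof (cases "p r \<in> Omega S")
    case True
    then obtain \<epsilon> where \<epsilon>: "0 < \<epsilon>" "ball (p r) \<epsilon> \<subseteq> Omega S" using open_Omega open_contains_ball by blast
    define r' where "r' = min r1 (r + \<epsilon> / (2 * norm w))"
    have r': "r \<le> r'" "r' - r \<le> \<epsilon> / (2 * norm w)" "r' \<le> r1" using rW \<epsilon> by (auto simp: r'_def)
    have "(r' - r) * norm w \<le> \<epsilon> / (2 * norm w) * norm w" using r' by (intro mult_right_mono) auto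
    moreover have "dist (p r) (p r') = (r' - r) * norm w"
    proof -
      have "p r' - p r = (r' - r) *\<^sub>R w" by (simp add: p_def algebra_simps)
      then show ?thesis using r' by (simp add: dist_norm norm_minus_commute[of "p r"])
    qed
    ultimately have "p r' \<in> ball (p r) \<epsilon>" using \<epsilon> w0 by simp
    then have "r' \<in> T" using \<epsilon> r' rW Omega_W by (auto simp: T_def)
    then have "r' \<le> r" by (rule r(2))
    moreover have "0 < \<epsilon> / (2 * norm w)" using \<epsilon> w0 by simp
    ultimately have "r = r1" using rW by (auto simp: r'_def min_def split: if_splits)
    have "p r \<bullet> u = (1 - s) * m + r1 * c" by (simp add: p_def inner_add_left m_def wu \<open>r = r1\<close>)
    also have "\<dots> = m + s * m" unfolding r1(2) by (simp add: algebra_simps)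
    finally have "m < p r \<bullet> u" using s m0 by simp
    then show False using mu(2)[OF rW(1)] by (simp add: m_def)
  next
    case False
    have 1: "\<phi> (p r) = 1" "\<phi> \<mu> = 1" by (rule \<phi>_eq_1 rW(1) False mu(1,3))+
    have d: "p r - \<mu> = r *\<^sub>R w - s *\<^sub>R \<mu>" by (simp add: p_def algebra_simps)
    have "norm (p r - \<mu>) \<le> r * norm w + s * norm \<mu>"
      unfolding d using norm_triangle_ineq4[of "r *\<^sub>R w" "s *\<^sub>R \<mu>"] rW s by simp
    also have "\<dots> \<le> r1 * norm w + s * norm \<mu>" using rW by (intro add_mono mult_right_mono) auto
    also have "\<dots> = s * B" by (simp add: r1_def B_def algebra_simps)
    finally have nb: "(norm (p r - \<mu>))\<^sup>2 \<le> (s * B)\<^sup>2" by (intro power_mono) auto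
    have "K * (norm \<mu>)\<^sup>2 \<le> \<mu> \<bullet> \<eta>" using drift_mu_max_lower[OF u0] by (simp add: \<mu>_def \<eta>_def)
    then have "s * (K * (norm \<mu>)\<^sup>2) \<le> s * (\<mu> \<bullet> \<eta>)" using s by (intro mult_left_mono) auto
    moreover have "0 \<le> r * (e * c)" using rW e0 c0 by simp
    moreover have "(p r - \<mu>) \<bullet> \<eta> = - (r * (e * c)) - s * (\<mu> \<bullet> \<eta>)"
      unfolding d by (simp add: inner_diff_left we)
    moreover have "\<bar>\<phi> (p r) - \<phi> \<mu> - (p r - \<mu>) \<bullet> \<eta>\<bar> \<le> M * (norm (p r - \<mu>))\<^sup>2"
      unfolding \<eta>_def by (rule \<phi>_taylor[OF mu(1) rW(1)])
    ultimately have "s * (K * (norm \<mu>)\<^sup>2) \<le> M * (norm (p r - \<mu>))\<^sup>2" unfolding 1 by linarith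
    also have "\<dots> \<le> M * (s * B)\<^sup>2" using nb pos by (intro mult_left_mono) auto
    also have "\<dots> = s * (s * (M * B\<^sup>2))" by (simp add: power_mult_distrib power2_eq_square)
    finally have "K * (norm \<mu>)\<^sup>2 \<le> s * (M * B\<^sup>2)" using s by simp
    moreover have "s * (2 * M * B\<^sup>2) \<le> K * (norm \<mu>)\<^sup>2" using s(3) pos B0 by (simp add: le_divide_eq)
    moreover have "0 < K * (norm \<mu>)\<^sup>2" using pos \<mu>0 by simp
    ultimately show False by linarith
  qed
qed

end

section \<open>The asymptotics\<close>

text \<open>Taking logarithms turns the identity between products of powers into a linear
  one.\<close>

lemma prefactor_identity:
  fixes D q e n d :: real
  assumes "0 < D" "0 < q" "0 < e" "0 < n"
  shows "(2 * pi / (n / e)) powr (d / 2) / sqrt D * sqrt (2 * pi * (n / e) / (e\<^sup>2 * q)) =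
    (2 * pi) powr d * (1 / ((2 * pi) powr ((d - 1) / 2) * sqrt D) * (1 / q powr (1 / 2)) *
      (e powr ((d - 3) / 2) / n powr ((d - 1) / 2)))" (is "?L = ?R")
proof -
  define p where "p = 2 * pi"
  have p: "0 < p" by (simp add: p_def)
  have l: "ln ?L = (d / 2) * (ln p - (ln n - ln e)) - ln D / 2 + (ln p + (ln n - ln e) - (2 * ln e + ln q)) / 2"
    using assms p unfolding p_def[symmetric] by (simp add: ln_mult ln_div ln_powr ln_sqrt ln_realpow algebra_simps add_divide_distrib diff_divide_distrib)
  have r: "ln ?R = d * ln p + (- ((d - 1) / 2 * ln p + ln D / 2) - ln q / 2 + ((d - 3) / 2 * ln e - (d - 1) / 2 * ln n))"
    using assms p unfolding p_def[symmetric] by (simp add: ln_mult ln_div ln_powr ln_sqrt)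
  have "ln ?L = ln ?R" unfolding l r by (simp add: field_simps)
  moreover have "0 < ?L" "0 < ?R" using assms by simp_all
  ultimately show ?thesis by (simp only: ln_inj_iff)
qed

context walk_kernel
begin

lemma det_covar_pos: "0 < det (covar Q)"
proof -
  have "0 < (2 * pi / M) powr (CARD('d) / 2)" using M by simp
  then have "0 < (2 * pi) powr (CARD('d) / 2) / sqrt (det (covar Q))" using gauss_zero_bounds(1) by linarith
  then show ?thesis by (simp add: zero_less_divide_iff)
qed

lemma inverse_covar_pos: "v \<noteq> 0 \<Longrightarrow> 0 < v \<bullet> (matrix_inv (covar Q) *v v)"
  using inverse_covar_bounds(1)[of v] M K by (smt (verit) divide_pos_pos zero_less_norm_iff zero_less_power mult_pos_pos)

lemma renewal_term_eq:
  assumes u: "norm u = 1" and e: "drift Q = e *\<^sub>R u" "0 < e" and n: "0 < n"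
  shows "renewal_term Q (n / e) = (2 * pi) ^ CARD('d) *
    (1 / ((2 * pi) powr ((real CARD('d) - 1) / 2) * sqrt (det (covar Q))) * (1 / (u \<bullet> (matrix_inv (covar Q) *v u)) powr (1 / 2)) *
      (e powr ((real CARD('d) - 3) / 2) / n powr ((real CARD('d) - 1) / 2)))"
proof -
  have "u \<noteq> 0" using u by auto
  have q: "drift Q \<bullet> (matrix_inv (covar Q) *v drift Q) = e\<^sup>2 * (u \<bullet> (matrix_inv (covar Q) *v u))"
    by (simp add: e(1) matrix_vector_mult_scaleR power2_eq_square)
  have "(2 * pi) ^ CARD('d) = (2 * pi) powr CARD('d)" by (simp add: powr_realpow)
  then show ?thesis
    unfolding renewal_term_def q using prefactor_identity[OF det_covar_pos inverse_covar_pos[OF \<open>u \<noteq> 0\<close>] e(2) n] by (simp only:)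
qed

text \<open>A lower bound uniform in the kernel, needed to convert the absolute error of the time
  integral into a relative one.\<close>

lemma renewal_term_lower:
  assumes t0: "0 < t0" and Q0: "drift Q \<noteq> 0"
  shows "(2 * pi / M) powr (CARD('d) / 2) * (sqrt (4 * pi * K) / M) * t0 powr (1 / 2 - real CARD('d) / 2) \<le> renewal_term Q t0"
proof -
  let ?d = "real CARD('d)" and ?q = "drift Q \<bullet> (matrix_inv (covar Q) *v drift Q)"
  have q: "0 < ?q" by (rule inverse_covar_pos[OF Q0])
  have "?q \<le> (norm (drift Q))\<^sup>2 / (2 * K)" by (rule inverse_covar_bounds(2))
  also have "\<dots> \<le> M\<^sup>2 / (2 * K)" using norm_drift K by (intro divide_right_mono power_mono) auto
  finally have q2: "?q \<le> M\<^sup>2 / (2 * K)" .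
  have "sqrt (4 * pi * K) / M * t0 powr (1 / 2) = sqrt (2 * pi * t0 / (M\<^sup>2 / (2 * K)))"
    using t0 M K by (simp add: real_sqrt_mult real_sqrt_divide powr_half_sqrt field_simps)
  also have "\<dots> \<le> sqrt (2 * pi * t0 / ?q)"
    using q q2 t0 M K by (intro real_sqrt_le_mono divide_left_mono) auto
  finally have a: "sqrt (4 * pi * K) / M * t0 powr (1 / 2) \<le> sqrt (2 * pi * t0 / ?q)" .
  have "(2 * pi / M) powr (?d / 2) * (sqrt (4 * pi * K) / M) * t0 powr (1 / 2 - ?d / 2)
    = ((2 * pi / M) powr (?d / 2) * t0 powr (- ?d / 2)) * (sqrt (4 * pi * K) / M * t0 powr (1 / 2))"
    by (simp add: powr_diff powr_minus_divide mult.commute mult.left_commute)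
  also have "\<dots> \<le> ((2 * pi) powr (?d / 2) / sqrt (det (covar Q)) * t0 powr (- ?d / 2)) * sqrt (2 * pi * t0 / ?q)"
    using a gauss_zero_bounds(1) M K det_covar_pos by (intro mult_mono mult_right_mono) auto
  also have "\<dots> = renewal_term Q t0"
    using t0 by (simp add: renewal_term_def powr_divide powr_minus_divide)
  finally show ?thesis .
qed

end

context oz
begin

text \<open>Convergence is proved for the untilted kernel, which has the gap
  \<open>1 - \<phi> 0\<close>, and is then multiplied by the constant factor relating the two flows.
  At a boundary tilt itself there is no gap.\<close>

lemma tilted_flow_limit:
  assumes \<mu>: "\<mu> \<in> W"
  shows "((\<lambda>T. integral {0..T} (\<lambda>t. flow (tilt \<mu> J) (tilt \<mu> h) t x))
    \<longlongrightarrow> complex_of_real ((2 * pi) ^ CARD('d) * (S x * exp (\<mu> \<bullet> rvec x)))) at_top"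
proof -
  note l1 = Omega_iff[of 0, unfolded tilt_0, THEN iffD1, OF zero_Omega] J_l1[OF Omega_W[OF zero_Omega], unfolded tilt_0]
    h_l1(1)[OF Omega_W[OF zero_Omega], unfolded tilt_0]
  have \<kappa>: "1 - \<phi> 0 \<le> 1 - Re (fourier J k)" if "k \<in> torus" for k
  proof -
    have "K * (norm k)\<^sup>2 \<le> Re (fourier J 0 - fourier J k)"
      using Q_class_tilt[OF Omega_W[OF zero_Omega]] that by (simp add: Q_class_def torus_iff)
    moreover have "0 \<le> K * (norm k)\<^sup>2" using pos by simp
    moreover have "Re (fourier J 0) = \<phi> 0" using \<phi>_fourier[of 0] by simp
    ultimately show ?thesis by simp
  qed
  have "0 < 1 - \<phi> 0" using \<phi>_less_1[OF zero_Omega] by simp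
  from flow_integral_limit[OF l1 S_eq this \<kappa>]
  have "((\<lambda>T. integral {0..T} (\<lambda>t. flow J h t x)) \<longlongrightarrow> complex_of_real ((2 * pi) ^ CARD('d) * S x)) at_top" .
  from tendsto_mult_left[OF this, of "complex_of_real (exp (\<mu> \<bullet> rvec x))"]
  have "((\<lambda>T. integral {0..T} (\<lambda>t. complex_of_real (exp (\<mu> \<bullet> rvec x)) * flow J h t x))
    \<longlongrightarrow> complex_of_real (exp (\<mu> \<bullet> rvec x)) * complex_of_real ((2 * pi) ^ CARD('d) * S x)) at_top"
    by (simp only: integral_mult_right)
  moreover have "complex_of_real (exp (\<mu> \<bullet> rvec x)) * complex_of_real ((2 * pi) ^ CARD('d) * S x)
      = complex_of_real ((2 * pi) ^ CARD('d) * (S x * exp (\<mu> \<bullet> rvec x)))" by simp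
  ultimately show ?thesis
    unfolding flow_tilt[OF l1(2,3) J_l1[OF \<mu>] h_l1(1)[OF \<mu>]] by (simp only:)
qed

lemma walk_kernel_mu_max:
  assumes u: "u \<noteq> 0"
  shows "walk_kernel M K (min \<zeta> 1) (tilt (mu_max S u) J) (tilt (mu_max S u) h)"
  using walk_kernel_Q_class[OF Q_class_tilt[OF mu_max(1)[OF u]] pos] \<phi>_eq_1[OF mu_max(1,3)[OF u]]
  by (simp add: \<phi>_def)

end

theorem corollary1p8:
  fixes i1 :: "'d::finite" and M K \<zeta> m :: real
  assumes "M > 0" and "K > 0" and "\<zeta> > 0"
  shows "\<forall>\<epsilon>>0. \<exists>R. \<forall>(S :: int ^ 'd \<Rightarrow> real) J h.
    (\<forall>x. 0 \<le> S x) \<and> assumption1 i1 S \<and> assumption2 M K \<zeta> S J h \<and> mass i1 S = m \<longrightarrow>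
    (\<forall>x. x \<noteq> 0 \<and> norm (rvec x) \<ge> R \<longrightarrow>
      (let d = real CARD('d);
           u = sgn (rvec x);
           \<mu> = mu_max S u;
           \<eta> = eta S J u;
           \<Lambda> = Lambda S J u
       in \<exists>r. \<bar>r\<bar> \<le> \<epsilon> \<and>
         S x = 1 / ((2 * pi) powr ((d - 1) / 2) * sqrt (det \<Lambda>))
             * (1 / (u \<bullet> (matrix_inv \<Lambda> *v u)) powr (1 / 2))
             * (norm \<eta> powr ((d - 3) / 2) / norm (rvec x) powr ((d - 1) / 2))
             * exp (- m * S_norm i1 S (rvec x))
             * (Re (fourier (tilt \<mu> h) 0) + r)))"
proof (cases "0 < m")
  case False
  \<comment> \<open>Assumption 1 forces a positive mass, so for \<open>m \<le> 0\<close> nothing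
    satisfies the hypotheses.\<close>
  have "\<not> ((\<forall>x. 0 \<le> S x) \<and> assumption1 i1 S \<and> assumption2 M K \<zeta> S J h \<and> mass i1 S = m)" for S J h
  proof
    assume a: "(\<forall>x. 0 \<le> S x) \<and> assumption1 i1 S \<and> assumption2 M K \<zeta> S J h \<and> mass i1 S = m"
    then interpret oz i1 M K \<zeta> S J h by unfold_locales (use assms in auto)
    show False using mass_pos False a by simp
  qed
  then show ?thesis by blast
next
  case m: True
  let ?d = "real CARD('d)"
  define z where "z = min \<zeta> 1"
  have z: "0 < z" "z \<le> 1" using assms by (auto simp: z_def)
  define e0 where "e0 = K * (m / ?d)"
  have e0: "0 < e0" using assms m by (simp add: e0_def)
  obtain C T0 where C: "0 < C" "1 \<le> T0" and flow: "\<And>(Q :: int ^ 'd \<Rightarrow> real) g x t0 T.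
      walk_kernel M K z Q g \<Longrightarrow> e0 \<le> norm (drift Q) \<Longrightarrow> rvec x = t0 *\<^sub>R drift Q \<Longrightarrow> T0 \<le> t0 \<Longrightarrow> 2 * t0 \<le> T \<Longrightarrow>
      norm (integral {0..T} (\<lambda>t. flow Q g t x) - fourier g 0 * complex_of_real (renewal_term Q t0))
        \<le> C * t0 powr (1 / 2 - ?d / 2 - z / 16)"
    using flow_integral[OF assms(1,2) z e0] by blast
  define c where "c = (2 * pi / M) powr (?d / 2) * (sqrt (4 * pi * K) / M)"
  have c: "0 < c" using assms by (simp add: c_def)
  show ?thesis
  proof (intro allI impI)
    fix \<epsilon> :: real assume \<epsilon>: "0 < \<epsilon>"
    \<comment> \<open>Beyond this time the relative error (C / c) t0^(- z/16) is at most
      \<epsilon>.\<close>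
    define T1 where "T1 = (C / (c * \<epsilon>)) powr (16 / z)"
    show "\<exists>R. \<forall>(S :: int ^ 'd \<Rightarrow> real) J h.
      (\<forall>x. 0 \<le> S x) \<and> assumption1 i1 S \<and> assumption2 M K \<zeta> S J h \<and> mass i1 S = m \<longrightarrow>
      (\<forall>x. x \<noteq> 0 \<and> norm (rvec x) \<ge> R \<longrightarrow>
        (let d = ?d;
             u = sgn (rvec x);
             \<mu> = mu_max S u;
             \<eta> = eta S J u;
             \<Lambda> = Lambda S J u
         in \<exists>r. \<bar>r\<bar> \<le> \<epsilon> \<and>
           S x = 1 / ((2 * pi) powr ((d - 1) / 2) * sqrt (det \<Lambda>))
               * (1 / (u \<bullet> (matrix_inv \<Lambda> *v u)) powr (1 / 2))
               * (norm \<eta> powr ((d - 3) / 2) / norm (rvec x) powr ((d - 1) / 2))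
               * exp (- m * S_norm i1 S (rvec x))
               * (Re (fourier (tilt \<mu> h) 0) + r)))"
    \<comment> \<open>The drift has length at most \<open>M\<close>, so
      \<open>norm (rvec x) \<ge> M * T\<close> guarantees a typical time t0 \<ge> T.\<close>
    proof (intro exI[of _ "M * max T0 T1"] allI impI)
      fix S J h :: "int ^ 'd \<Rightarrow> real" and x :: "int ^ 'd"
      assume a: "(\<forall>x. 0 \<le> S x) \<and> assumption1 i1 S \<and> assumption2 M K \<zeta> S J h \<and> mass i1 S = m"
        and x: "x \<noteq> 0 \<and> M * max T0 T1 \<le> norm (rvec x)"
      interpret oz i1 M K \<zeta> S J h by unfold_locales (use assms a in auto)
      have mass: "mass i1 S = m" using a by simp
      define u where "u = sgn (rvec x)"
      define \<mu> where "\<mu> = mu_max S u"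
      define Q where "Q = tilt \<mu> J"
      define g where "g = tilt \<mu> h"
      define n where "n = norm (rvec x)"
      define e where "e = norm (drift Q)"
      define t0 where "t0 = n / e"
      have "rvec x \<noteq> 0" using x by (simp add: rvec_def vec_eq_iff)
      then have n: "0 < n" and u: "norm u = 1" and xu: "rvec x = n *\<^sub>R u"
        by (simp_all add: n_def u_def norm_sgn sgn_div_norm)
      have u0: "u \<noteq> 0" using u by auto
      interpret wk: walk_kernel M K z Q g
        unfolding z_def Q_def g_def \<mu>_def by (rule walk_kernel_mu_max[OF u0])
      have e: "e0 \<le> e" using norm_drift_mu_max_ge[OF u] by (simp add: e0_def e_def Q_def \<mu>_def mass)
      then have e_pos: "0 < e" using e0 by linarith
      have dr: "drift Q = e *\<^sub>R u" unfolding e_def Q_def \<mu>_def by (rule drift_mu_max[OF u])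
      have t0: "max T0 T1 \<le> t0"
      proof -
        have "max T0 T1 * e \<le> max T0 T1 * M" using C wk.norm_drift by (intro mult_left_mono) (auto simp: e_def)
        also have "\<dots> \<le> n" using x by (simp add: n_def mult.commute)
        finally show ?thesis using e_pos by (simp add: t0_def le_divide_eq)
      qed
      then have t0_pos: "0 < t0" using C by linarith
      define N where "N = (2 * pi) ^ CARD('d)"
      have N: "0 < N" by (simp add: N_def)
      define Y where "Y = S x * exp (\<mu> \<bullet> rvec x)"
      define H where "H = Re (fourier g 0)"
      have H: "fourier g 0 = complex_of_real H" by (simp add: H_def fourier_0)
      define rt where "rt = renewal_term Q t0"
      define pf where "pf = 1 / ((2 * pi) powr ((?d - 1) / 2) * sqrt (det (covar Q))) *
        (1 / (u \<bullet> (matrix_inv (covar Q) *v u)) powr (1 / 2)) * (e powr ((?d - 3) / 2) / n powr ((?d - 1) / 2))"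
      have rt: "rt = N * pf" unfolding rt_def t0_def N_def pf_def by (rule wk.renewal_term_eq[OF u dr e_pos n])
      have "norm (complex_of_real (N * Y) - fourier g 0 * complex_of_real rt) \<le> C * t0 powr (1 / 2 - ?d / 2 - z / 16)"
      proof (rule tendsto_upperbound)
        have "((\<lambda>T. integral {0..T} (\<lambda>t. flow Q g t x)) \<longlongrightarrow> complex_of_real (N * Y)) at_top"
          unfolding Q_def g_def N_def Y_def \<mu>_def by (rule tilted_flow_limit[OF mu_max(1)[OF u0]])
        then show "((\<lambda>T. norm (integral {0..T} (\<lambda>t. flow Q g t x) - fourier g 0 * complex_of_real rt))
          \<longlongrightarrow> norm (complex_of_real (N * Y) - fourier g 0 * complex_of_real rt)) at_top"
          by (intro tendsto_norm tendsto_diff tendsto_const)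
        have tx: "rvec x = t0 *\<^sub>R drift Q" using e_pos by (simp add: dr t0_def xu)
        show "\<forall>\<^sub>F T in at_top. norm (integral {0..T} (\<lambda>t. flow Q g t x) - fourier g 0 * complex_of_real rt)
          \<le> C * t0 powr (1 / 2 - ?d / 2 - z / 16)"
          unfolding rt_def
          by (rule eventually_mono[OF eventually_ge_at_top[of "2 * t0"]], rule flow[OF wk.walk_kernel_axioms _ tx])
             (use e t0 in \<open>auto simp: e_def\<close>)
      qed simp
      then have err: "\<bar>N * Y - H * rt\<bar> \<le> C * t0 powr (1 / 2 - ?d / 2 - z / 16)"
        unfolding H by (simp only: of_real_mult[symmetric] of_real_diff[symmetric] norm_of_real)
      have "drift Q \<noteq> 0" using e_pos by (auto simp: e_def)
      from wk.renewal_term_lower[OF t0_pos this]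
      have low: "c * t0 powr (1 / 2 - ?d / 2) \<le> rt" by (simp add: c_def rt_def)
      have "0 < c * t0 powr (1 / 2 - ?d / 2)" using c t0_pos by simp
      then have rt_pos: "0 < rt" using low by linarith
      then have pf: "0 < pf" using rt N by (simp add: zero_less_mult_iff)
      have small: "C * t0 powr (- (z / 16)) \<le> c * \<epsilon>"
      proof -
        have "C / (c * \<epsilon>) = T1 powr (z / 16)" using C c \<epsilon> z by (simp add: T1_def powr_powr)
        also have "\<dots> \<le> t0 powr (z / 16)" using t0 z by (intro powr_mono2) (auto simp: T1_def)
        finally show ?thesis using c \<epsilon> t0_pos by (simp add: powr_minus_divide field_simps)
      qed
      have "\<bar>N * Y - H * rt\<bar> \<le> (C * t0 powr (- (z / 16))) * t0 powr (1 / 2 - ?d / 2)"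
        using err powr_add[of t0 "- (z / 16)" "1 / 2 - ?d / 2"] by (simp add: mult.assoc add.commute)
      also have "\<dots> \<le> (c * \<epsilon>) * t0 powr (1 / 2 - ?d / 2)" using small by (intro mult_right_mono) auto
      also have "\<dots> \<le> \<epsilon> * rt" using mult_left_mono[OF low, of \<epsilon>] \<epsilon> by (simp add: mult_ac)
      finally have "\<bar>N * Y - H * rt\<bar> \<le> \<epsilon> * rt" .
      \<comment> \<open>The Fourier normalisation (2 pi)^d cancels, since it multiplies both
        \<open>Y\<close> and the prefactor; the required \<open>r\<close> is simply the defect
        \<open>Y / pf - H\<close>.\<close>
      moreover have "Y / pf - H = (N * Y - H * rt) / rt" using pf N by (simp add: rt diff_divide_distrib)
      ultimately have r: "\<bar>Y / pf - H\<bar> \<le> \<epsilon>" using rt_pos by (simp add: abs_divide divide_le_eq)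
      have ex: "exp (- m * S_norm i1 S (rvec x)) = exp (- (\<mu> \<bullet> rvec x))"
        using \<open>rvec x \<noteq> 0\<close> m by (simp add: S_norm_def mass \<mu>_def u_def)
      have "S x = pf * exp (- m * S_norm i1 S (rvec x)) * (H + (Y / pf - H))"
        unfolding ex using pf by (simp add: Y_def exp_minus)
      moreover have "eta S J u = drift Q" "Lambda S J u = covar Q"
        by (simp_all add: eta_def drift_def Lambda_def covar_def Q_def \<mu>_def)
      ultimately show "let d = ?d;
             u = sgn (rvec x);
             \<mu> = mu_max S u;
             \<eta> = eta S J u;
             \<Lambda> = Lambda S J u
         in \<exists>r. \<bar>r\<bar> \<le> \<epsilon> \<and>
           S x = 1 / ((2 * pi) powr ((d - 1) / 2) * sqrt (det \<Lambda>))
               * (1 / (u \<bullet> (matrix_inv \<Lambda> *v u)) powr (1 / 2))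
               * (norm \<eta> powr ((d - 3) / 2) / norm (rvec x) powr ((d - 1) / 2))
               * exp (- m * S_norm i1 S (rvec x))
               * (Re (fourier (tilt \<mu> h) 0) + r)"
        unfolding Let_def u_def[symmetric] \<mu>_def[symmetric] g_def[symmetric] n_def[symmetric] H_def[symmetric]
        using r by (intro exI[of _ "Y / pf - H"] conjI) (simp_all only: e_def[symmetric] pf_def[symmetric])
    qed
  qed
qed

end
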